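(* Pro-etale geometric morphisms are discrete opfibrations in $\mathbf{GTop}$.
   Context: $\mathbf{GTop}$ is the 2-category of Grothendieck topoi, geometric morphisms and geometric transformations (a 2-cell $f\Rightarrow g$ is a natural transformation $f^*\Rightarrow g^*$); $\mathbf{GTop}/\mathcal{E}$ is the pseudoslice (1-cells are triangles commuting up to a specified invertible 2-cell). For $E\in\mathcal{E}$, $\pi_E:\mathcal{E}/E\to\mathcal{E}$ is the geometric morphism with inverse image $D\mapsto(E\times D\to E)$. A geometric morphism with codomain $\mathcal{E}$ is pro-etale if it is equivalent in $\mathbf{GTop}/\mathcal{E}$ to a bilimit $\operatorname{bilim}_{i\in I}\pi_{E_i}$ for some small cofiltered category $I$ and some functor $I\to\mathcal{E}$, $i\mapsto E_i$. In a 2-category $\mathcal{K}$, a 1-cell $f:C\to D$ is an opfibration if for every object $B$ the functor $\mathcal{K}[B,f]:\mathcal{K}[B,C]\to\mathcal{K}[B,D]$ is an opfibration in $\mathbf{Cat}$ (understood up to isomorphism, i.e. opcartesian lifts are lifts up to coherent invertible 2-cells). Such an opfibration is discrete if $f$ is a discrete object of the pseudoslice $\mathcal{K}/D$, i.e. for every object $g$ of $\mathcal{K}/D$ the category $\mathcal{K}/D[g,f]$ is equivalent to a discrete category (a set). *)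

theory Defs
  imports "HOL-Library.FuncSet"
begin

unbundle cardinal_syntax

section \<open>Size\<close>

text \<open>
  HOL has no universes. Small sets are measured against a type \<open>'u\<close> whose cardinality is a strongly
  inaccessible cardinal \<open>\<kappa>\<close>: \<open>'u\<close> plays the role of the class of all sets \<open>V\<^sub>\<kappa>\<close> (which has
  cardinality \<open>\<kappa>\<close>), subsets of \<open>'u\<close> are classes, and a set is small iff it has fewer than \<open>\<kappa>\<close>
  elements. The objects (and the arrows) of a locally small category are a class, so a possibly
  large category is a \<open>('u,'u) cat\<close> in the sense below.
\<close>

definition inaccessible :: "'u itself \<Rightarrow> bool" where
  "inaccessible _ \<longleftrightarrow>
     natLeq <o |UNIV :: 'u set| \<and>
     (\<forall>A :: 'u set. |A| <o |UNIV :: 'u set| \<longrightarrow> |Pow A| <o |UNIV :: 'u set| ) \<and>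
     regularCard |UNIV :: 'u set|"

definition small :: "'u set \<Rightarrow> bool" where
  "small A \<longleftrightarrow> |A| <o |UNIV :: 'u set|"


section \<open>Categories\<close>

record ('o, 'a) cat =
  Ob :: "'o set"
  Ar :: "'a set"
  src :: "'a \<Rightarrow> 'o"
  tgt :: "'a \<Rightarrow> 'o"
  idn :: "'o \<Rightarrow> 'a"
  cmp :: "'a \<Rightarrow> 'a \<Rightarrow> 'a"  (infixl "\<cdot>\<index>" 70)

definition hom :: "('o,'a) cat \<Rightarrow> 'o \<Rightarrow> 'o \<Rightarrow> 'a set" where
  "hom C x y = {f \<in> Ar C. src C f = x \<and> tgt C f = y}"

locale category =
  fixes C :: "('o,'a) cat"
  assumes src_Ob: "f \<in> Ar C \<Longrightarrow> src C f \<in> Ob C"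
    and tgt_Ob: "f \<in> Ar C \<Longrightarrow> tgt C f \<in> Ob C"
    and idn_hom: "x \<in> Ob C \<Longrightarrow> idn C x \<in> hom C x x"
    and cmp_hom: "f \<in> hom C x y \<Longrightarrow> g \<in> hom C y z \<Longrightarrow> g \<cdot>\<^bsub>C\<^esub> f \<in> hom C x z"
    and idn_left: "f \<in> hom C x y \<Longrightarrow> idn C y \<cdot>\<^bsub>C\<^esub> f = f"
    and idn_right: "f \<in> hom C x y \<Longrightarrow> f \<cdot>\<^bsub>C\<^esub> idn C x = f"
    and cmp_assoc: "f \<in> hom C w x \<Longrightarrow> g \<in> hom C x y \<Longrightarrow> h \<in> hom C y z \<Longrightarrow>
      (h \<cdot>\<^bsub>C\<^esub> g) \<cdot>\<^bsub>C\<^esub> f = h \<cdot>\<^bsub>C\<^esub> (g \<cdot>\<^bsub>C\<^esub> f)"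

definition is_iso :: "('o,'a) cat \<Rightarrow> 'a \<Rightarrow> bool" where
  "is_iso C f \<longleftrightarrow> f \<in> Ar C \<and>
     (\<exists>g \<in> hom C (tgt C f) (src C f).
        g \<cdot>\<^bsub>C\<^esub> f = idn C (src C f) \<and> f \<cdot>\<^bsub>C\<^esub> g = idn C (tgt C f))"

definition small_category :: "('u,'u) cat \<Rightarrow> bool" where
  "small_category C \<longleftrightarrow> category C \<and> small (Ob C) \<and> small (Ar C)"

definition finite_category :: "('o,'a) cat \<Rightarrow> bool" where
  "finite_category C \<longleftrightarrow> category C \<and> finite (Ob C) \<and> finite (Ar C)"

definition discrete_cat :: "'o set \<Rightarrow> ('o,'o) cat" where
  "discrete_cat S = \<lparr>Ob = S, Ar = S, src = id, tgt = id, idn = id, cmp = (\<lambda>g f. f)\<rparr>"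

definition cofiltered :: "('o,'a) cat \<Rightarrow> bool" where
  "cofiltered I \<longleftrightarrow> Ob I \<noteq> {} \<and>
     (\<forall>i \<in> Ob I. \<forall>j \<in> Ob I. \<exists>k \<in> Ob I. hom I k i \<noteq> {} \<and> hom I k j \<noteq> {}) \<and>
     (\<forall>i \<in> Ob I. \<forall>j \<in> Ob I. \<forall>u \<in> hom I i j. \<forall>v \<in> hom I i j.
        \<exists>k \<in> Ob I. \<exists>w \<in> hom I k i. u \<cdot>\<^bsub>I\<^esub> w = v \<cdot>\<^bsub>I\<^esub> w)"


subsection \<open>Functors and natural transformations\<close>

text \<open>
  Functors and transformations are extensional functions, so that equality is the intended one
  and composition of functors is strictly associative and unital.
\<close>

record ('o,'a,'p,'b) ftr =
  fob :: "'o \<Rightarrow> 'p"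
  far :: "'a \<Rightarrow> 'b"

definition is_functor :: "('o,'a) cat \<Rightarrow> ('p,'b) cat \<Rightarrow> ('o,'a,'p,'b) ftr \<Rightarrow> bool" where
  "is_functor C D F \<longleftrightarrow>
     fob F \<in> Ob C \<rightarrow>\<^sub>E Ob D \<and>
     far F \<in> extensional (Ar C) \<and>
     (\<forall>f \<in> Ar C. far F f \<in> hom D (fob F (src C f)) (fob F (tgt C f))) \<and>
     (\<forall>x \<in> Ob C. far F (idn C x) = idn D (fob F x)) \<and>
     (\<forall>f \<in> Ar C. \<forall>g \<in> Ar C. tgt C f = src C g \<longrightarrow>
        far F (g \<cdot>\<^bsub>C\<^esub> f) = far F g \<cdot>\<^bsub>D\<^esub> far F f)"

definition id_ftr :: "('o,'a) cat \<Rightarrow> ('o,'a,'o,'a) ftr" where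
  "id_ftr C = \<lparr>fob = (\<lambda>x \<in> Ob C. x), far = (\<lambda>f \<in> Ar C. f)\<rparr>"

definition cmp_ftr ::
  "('o,'a) cat \<Rightarrow> ('p,'b,'q,'c) ftr \<Rightarrow> ('o,'a,'p,'b) ftr \<Rightarrow> ('o,'a,'q,'c) ftr" where
  "cmp_ftr C G F =
     \<lparr>fob = compose (Ob C) (fob G) (fob F), far = compose (Ar C) (far G) (far F)\<rparr>"

definition nat_trans ::
  "('o,'a) cat \<Rightarrow> ('p,'b) cat \<Rightarrow> ('o,'a,'p,'b) ftr \<Rightarrow> ('o,'a,'p,'b) ftr \<Rightarrow> ('o \<Rightarrow> 'b) \<Rightarrow> bool" where
  "nat_trans C D F G \<eta> \<longleftrightarrow>
     \<eta> \<in> extensional (Ob C) \<and>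
     (\<forall>x \<in> Ob C. \<eta> x \<in> hom D (fob F x) (fob G x)) \<and>
     (\<forall>f \<in> Ar C. \<eta> (tgt C f) \<cdot>\<^bsub>D\<^esub> far F f = far G f \<cdot>\<^bsub>D\<^esub> \<eta> (src C f))"

definition nat_iso ::
  "('o,'a) cat \<Rightarrow> ('p,'b) cat \<Rightarrow> ('o,'a,'p,'b) ftr \<Rightarrow> ('o,'a,'p,'b) ftr \<Rightarrow> ('o \<Rightarrow> 'b) \<Rightarrow> bool" where
  "nat_iso C D F G \<eta> \<longleftrightarrow> nat_trans C D F G \<eta> \<and> (\<forall>x \<in> Ob C. is_iso D (\<eta> x))"

definition is_equivalence :: "('o,'a) cat \<Rightarrow> ('p,'b) cat \<Rightarrow> ('o,'a,'p,'b) ftr \<Rightarrow> bool" where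
  "is_equivalence C D F \<longleftrightarrow> is_functor C D F \<and>
     (\<exists>G. is_functor D C G \<and>
        (\<exists>\<eta>. nat_iso C C (id_ftr C) (cmp_ftr C G F) \<eta>) \<and>
        (\<exists>\<epsilon>. nat_iso D D (cmp_ftr D F G) (id_ftr D) \<epsilon>))"

definition equivalent_cats :: "('o,'a) cat \<Rightarrow> ('p,'b) cat \<Rightarrow> bool" where
  "equivalent_cats C D \<longleftrightarrow> (\<exists>F. is_equivalence C D F)"

text \<open>
  Taking the set \<open>S\<close> inside the type of objects is no restriction: a category equivalent to a discrete
  one is equivalent to the discrete category on a set of representatives of its isomorphism classes.
\<close>

definition equivalent_to_discrete :: "('o,'a) cat \<Rightarrow> bool" where
  "equivalent_to_discrete C \<longleftrightarrow> (\<exists>S :: 'o set. equivalent_cats C (discrete_cat S))"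


subsection \<open>Opfibrations of categories, up to isomorphism\<close>

definition opcartesian ::
  "('o,'a) cat \<Rightarrow> ('p,'b) cat \<Rightarrow> ('o,'a,'p,'b) ftr \<Rightarrow> 'a \<Rightarrow> bool" where
  "opcartesian E B P \<chi> \<longleftrightarrow> \<chi> \<in> Ar E \<and>
     (\<forall>\<psi> \<in> Ar E. src E \<psi> = src E \<chi> \<longrightarrow>
       (\<forall>\<gamma> \<in> hom B (fob P (tgt E \<chi>)) (fob P (tgt E \<psi>)). \<gamma> \<cdot>\<^bsub>B\<^esub> far P \<chi> = far P \<psi> \<longrightarrow>
         (\<exists>!\<omega>. \<omega> \<in> hom E (tgt E \<chi>) (tgt E \<psi>) \<and> far P \<omega> = \<gamma> \<and> \<omega> \<cdot>\<^bsub>E\<^esub> \<chi> = \<psi>)))"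

definition cat_opfibration :: "('o,'a) cat \<Rightarrow> ('p,'b) cat \<Rightarrow> ('o,'a,'p,'b) ftr \<Rightarrow> bool" where
  "cat_opfibration E B P \<longleftrightarrow> is_functor E B P \<and>
     (\<forall>e \<in> Ob E. \<forall>\<alpha> \<in> Ar B. src B \<alpha> = fob P e \<longrightarrow>
       (\<exists>\<chi> \<theta>. opcartesian E B P \<chi> \<and> src E \<chi> = e \<and>
          \<theta> \<in> hom B (tgt B \<alpha>) (fob P (tgt E \<chi>)) \<and> is_iso B \<theta> \<and> far P \<chi> = \<theta> \<cdot>\<^bsub>B\<^esub> \<alpha>))"


subsection \<open>Limits\<close>

definition is_cone ::
  "('i,'j) cat \<Rightarrow> ('o,'a) cat \<Rightarrow> ('i,'j,'o,'a) ftr \<Rightarrow> 'o \<Rightarrow> ('i \<Rightarrow> 'a) \<Rightarrow> bool" where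
  "is_cone J C D L c \<longleftrightarrow> L \<in> Ob C \<and> (\<forall>j \<in> Ob J. c j \<in> hom C L (fob D j)) \<and>
     (\<forall>u \<in> Ar J. far D u \<cdot>\<^bsub>C\<^esub> c (src J u) = c (tgt J u))"

definition is_limit ::
  "('i,'j) cat \<Rightarrow> ('o,'a) cat \<Rightarrow> ('i,'j,'o,'a) ftr \<Rightarrow> 'o \<Rightarrow> ('i \<Rightarrow> 'a) \<Rightarrow> bool" where
  "is_limit J C D L c \<longleftrightarrow> is_cone J C D L c \<and>
     (\<forall>M d. is_cone J C D M d \<longrightarrow> (\<exists>!h. h \<in> hom C M L \<and> (\<forall>j \<in> Ob J. c j \<cdot>\<^bsub>C\<^esub> h = d j)))"

text \<open>Every finite category is isomorphic to one with objects and arrows in \<open>nat\<close>.\<close>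

definition left_exact :: "('o,'a) cat \<Rightarrow> ('p,'b) cat \<Rightarrow> ('o,'a,'p,'b) ftr \<Rightarrow> bool" where
  "left_exact C D F \<longleftrightarrow>
     (\<forall>(J :: (nat,nat) cat) G L c. finite_category J \<and> is_functor J C G \<and> is_limit J C G L c \<longrightarrow>
        is_limit J D (cmp_ftr J F G) (fob F L) (\<lambda>j. far F (c j)))"

definition is_product :: "('o,'a) cat \<Rightarrow> 'o \<Rightarrow> 'o \<Rightarrow> 'a \<Rightarrow> 'a \<Rightarrow> bool" where
  "is_product C X Y p q \<longleftrightarrow>
     p \<in> Ar C \<and> q \<in> Ar C \<and> src C p = src C q \<and> tgt C p = X \<and> tgt C q = Y \<and>
     (\<forall>p' \<in> Ar C. \<forall>q' \<in> Ar C. src C p' = src C q' \<and> tgt C p' = X \<and> tgt C q' = Y \<longrightarrow>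
       (\<exists>!k. k \<in> hom C (src C p') (src C p) \<and> p \<cdot>\<^bsub>C\<^esub> k = p' \<and> q \<cdot>\<^bsub>C\<^esub> k = q'))"

definition is_pullback :: "('o,'a) cat \<Rightarrow> 'a \<Rightarrow> 'a \<Rightarrow> 'a \<Rightarrow> 'a \<Rightarrow> bool" where
  "is_pullback C f g p q \<longleftrightarrow>
     f \<in> Ar C \<and> g \<in> Ar C \<and> p \<in> Ar C \<and> q \<in> Ar C \<and> tgt C f = tgt C g \<and>
     src C p = src C q \<and> tgt C p = src C f \<and> tgt C q = src C g \<and>
     f \<cdot>\<^bsub>C\<^esub> p = g \<cdot>\<^bsub>C\<^esub> q \<and>
     (\<forall>p' \<in> Ar C. \<forall>q' \<in> Ar C.
       src C p' = src C q' \<and> tgt C p' = src C f \<and> tgt C q' = src C g \<and>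
       f \<cdot>\<^bsub>C\<^esub> p' = g \<cdot>\<^bsub>C\<^esub> q' \<longrightarrow>
       (\<exists>!k. k \<in> hom C (src C p') (src C p) \<and> p \<cdot>\<^bsub>C\<^esub> k = p' \<and> q \<cdot>\<^bsub>C\<^esub> k = q'))"


section \<open>2-categories\<close>

record ('o,'m,'c) twocat =
  Obj :: "'o set"
  Hom :: "'o \<Rightarrow> 'o \<Rightarrow> ('m,'c) cat"
  id1 :: "'o \<Rightarrow> 'm"
  cmp1 :: "'o \<Rightarrow> 'o \<Rightarrow> 'o \<Rightarrow> 'm \<Rightarrow> 'm \<Rightarrow> 'm"
  cmp2 :: "'o \<Rightarrow> 'o \<Rightarrow> 'o \<Rightarrow> 'c \<Rightarrow> 'c \<Rightarrow> 'c"

text \<open>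
  \<open>cmp1 K A B C g f\<close> is \<open>g \<circ> f : A \<rightarrow> B \<rightarrow> C\<close>, and \<open>cmp2\<close> is the horizontal composition of 2-cells in the
  same order; vertical composition is the composition of \<open>Hom K A B\<close>.
\<close>

locale two_category =
  fixes K :: "('o,'m,'c) twocat"
  assumes Hom_category: "A \<in> Obj K \<Longrightarrow> B \<in> Obj K \<Longrightarrow> category (Hom K A B)"
    and id1_Hom: "A \<in> Obj K \<Longrightarrow> id1 K A \<in> Ob (Hom K A A)"
    and cmp1_Hom: "\<lbrakk>A \<in> Obj K; B \<in> Obj K; C \<in> Obj K; f \<in> Ob (Hom K A B); g \<in> Ob (Hom K B C)\<rbrakk>
      \<Longrightarrow> cmp1 K A B C g f \<in> Ob (Hom K A C)"
    and cmp2_Hom: "\<lbrakk>A \<in> Obj K; B \<in> Obj K; C \<in> Obj K;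
        \<sigma> \<in> hom (Hom K A B) f f'; \<tau> \<in> hom (Hom K B C) g g'\<rbrakk>
      \<Longrightarrow> cmp2 K A B C \<tau> \<sigma> \<in> hom (Hom K A C) (cmp1 K A B C g f) (cmp1 K A B C g' f')"
    and cmp2_idn: "\<lbrakk>A \<in> Obj K; B \<in> Obj K; C \<in> Obj K; f \<in> Ob (Hom K A B); g \<in> Ob (Hom K B C)\<rbrakk>
      \<Longrightarrow> cmp2 K A B C (idn (Hom K B C) g) (idn (Hom K A B) f)
          = idn (Hom K A C) (cmp1 K A B C g f)"
    and interchange: "\<lbrakk>A \<in> Obj K; B \<in> Obj K; C \<in> Obj K;
        \<sigma> \<in> hom (Hom K A B) f f'; \<sigma>' \<in> hom (Hom K A B) f' f'';
        \<tau> \<in> hom (Hom K B C) g g'; \<tau>' \<in> hom (Hom K B C) g' g''\<rbrakk>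
      \<Longrightarrow> cmp2 K A B C (\<tau>' \<cdot>\<^bsub>Hom K B C\<^esub> \<tau>) (\<sigma>' \<cdot>\<^bsub>Hom K A B\<^esub> \<sigma>)
          = cmp2 K A B C \<tau>' \<sigma>' \<cdot>\<^bsub>Hom K A C\<^esub> cmp2 K A B C \<tau> \<sigma>"
    and cmp1_id_left: "\<lbrakk>A \<in> Obj K; B \<in> Obj K; f \<in> Ob (Hom K A B)\<rbrakk>
      \<Longrightarrow> cmp1 K A B B (id1 K B) f = f"
    and cmp1_id_right: "\<lbrakk>A \<in> Obj K; B \<in> Obj K; f \<in> Ob (Hom K A B)\<rbrakk>
      \<Longrightarrow> cmp1 K A A B f (id1 K A) = f"
    and cmp1_assoc: "\<lbrakk>A \<in> Obj K; B \<in> Obj K; C \<in> Obj K; D \<in> Obj K;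
        f \<in> Ob (Hom K A B); g \<in> Ob (Hom K B C); h \<in> Ob (Hom K C D)\<rbrakk>
      \<Longrightarrow> cmp1 K A B D (cmp1 K B C D h g) f = cmp1 K A C D h (cmp1 K A B C g f)"
    and cmp2_id_left: "\<lbrakk>A \<in> Obj K; B \<in> Obj K; \<sigma> \<in> Ar (Hom K A B)\<rbrakk>
      \<Longrightarrow> cmp2 K A B B (idn (Hom K B B) (id1 K B)) \<sigma> = \<sigma>"
    and cmp2_id_right: "\<lbrakk>A \<in> Obj K; B \<in> Obj K; \<sigma> \<in> Ar (Hom K A B)\<rbrakk>
      \<Longrightarrow> cmp2 K A A B \<sigma> (idn (Hom K A A) (id1 K A)) = \<sigma>"
    and cmp2_assoc: "\<lbrakk>A \<in> Obj K; B \<in> Obj K; C \<in> Obj K; D \<in> Obj K;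
        \<rho> \<in> Ar (Hom K A B); \<sigma> \<in> Ar (Hom K B C); \<tau> \<in> Ar (Hom K C D)\<rbrakk>
      \<Longrightarrow> cmp2 K A B D (cmp2 K B C D \<tau> \<sigma>) \<rho> = cmp2 K A C D \<tau> (cmp2 K A B C \<sigma> \<rho>)"

definition lwhisker :: "('o,'m,'c) twocat \<Rightarrow> 'o \<Rightarrow> 'o \<Rightarrow> 'o \<Rightarrow> 'm \<Rightarrow> 'c \<Rightarrow> 'c" where
  "lwhisker K A B C g \<sigma> = cmp2 K A B C (idn (Hom K B C) g) \<sigma>"

definition rwhisker :: "('o,'m,'c) twocat \<Rightarrow> 'o \<Rightarrow> 'o \<Rightarrow> 'o \<Rightarrow> 'c \<Rightarrow> 'm \<Rightarrow> 'c" where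
  "rwhisker K A B C \<tau> f = cmp2 K A B C \<tau> (idn (Hom K A B) f)"

definition equivalent_objs :: "('o,'m,'c) twocat \<Rightarrow> 'o \<Rightarrow> 'o \<Rightarrow> bool" where
  "equivalent_objs K A B \<longleftrightarrow>
     (\<exists>f \<in> Ob (Hom K A B). \<exists>g \<in> Ob (Hom K B A).
       (\<exists>\<eta> \<in> hom (Hom K A A) (id1 K A) (cmp1 K A B A g f). is_iso (Hom K A A) \<eta>) \<and>
       (\<exists>\<epsilon> \<in> hom (Hom K B B) (cmp1 K B A B f g) (id1 K B). is_iso (Hom K B B) \<epsilon>))"


subsection \<open>The pseudoslice\<close>

definition slice_Hom ::
  "('o,'m,'c) twocat \<Rightarrow> 'o \<Rightarrow> 'o \<times> 'm \<Rightarrow> 'o \<times> 'm \<Rightarrow> ('m \<times> 'c, ('m \<times> 'c) \<times> ('m \<times> 'c) \<times> 'c) cat" where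
  "slice_Hom K D = (\<lambda>(A,f) (B,g).
     let T = {(h,\<alpha>). h \<in> Ob (Hom K A B) \<and>
                     \<alpha> \<in> hom (Hom K A D) f (cmp1 K A B D g h) \<and> is_iso (Hom K A D) \<alpha>}
     in \<lparr>Ob = T,
         Ar = {((h,\<alpha>),(k,\<beta>),\<sigma>). (h,\<alpha>) \<in> T \<and> (k,\<beta>) \<in> T \<and> \<sigma> \<in> hom (Hom K A B) h k \<and>
                 lwhisker K A B D g \<sigma> \<cdot>\<^bsub>Hom K A D\<^esub> \<alpha> = \<beta>},
         src = (\<lambda>(x,y,\<sigma>). x),
         tgt = (\<lambda>(x,y,\<sigma>). y),
         idn = (\<lambda>x. (x, x, idn (Hom K A B) (fst x))),
         cmp = (\<lambda>(y,z,\<tau>) (x,y',\<sigma>). (x, z, \<tau> \<cdot>\<^bsub>Hom K A B\<^esub> \<sigma>))\<rparr>)"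

definition slice_cmp1 ::
  "('o,'m,'c) twocat \<Rightarrow> 'o \<Rightarrow> 'o \<times> 'm \<Rightarrow> 'o \<times> 'm \<Rightarrow> 'o \<times> 'm \<Rightarrow> 'm \<times> 'c \<Rightarrow> 'm \<times> 'c \<Rightarrow> 'm \<times> 'c" where
  "slice_cmp1 K D = (\<lambda>(A,f) (B,g) (C,e) (k,\<beta>) (h,\<alpha>).
     (cmp1 K A B C k h, rwhisker K A B D \<beta> h \<cdot>\<^bsub>Hom K A D\<^esub> \<alpha>))"

definition pseudoslice ::
  "('o,'m,'c) twocat \<Rightarrow> 'o \<Rightarrow> ('o \<times> 'm, 'm \<times> 'c, ('m \<times> 'c) \<times> ('m \<times> 'c) \<times> 'c) twocat" where
  "pseudoslice K D =
     \<lparr>Obj = {(A,f). A \<in> Obj K \<and> f \<in> Ob (Hom K A D)},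
      Hom = slice_Hom K D,
      id1 = (\<lambda>(A,f). (id1 K A, idn (Hom K A D) f)),
      cmp1 = slice_cmp1 K D,
      cmp2 = (\<lambda>X Y Z (y,y',\<tau>) (x,x',\<sigma>).
        (slice_cmp1 K D X Y Z y x, slice_cmp1 K D X Y Z y' x',
         cmp2 K (fst X) (fst Y) (fst Z) \<tau> \<sigma>))\<rparr>"


subsection \<open>Discrete opfibrations in a 2-category\<close>

definition postcompose ::
  "('o,'m,'c) twocat \<Rightarrow> 'o \<Rightarrow> 'o \<Rightarrow> 'o \<Rightarrow> 'm \<Rightarrow> ('m,'c,'m,'c) ftr" where
  "postcompose K B C D f =
     \<lparr>fob = (\<lambda>h \<in> Ob (Hom K B C). cmp1 K B C D f h),
      far = (\<lambda>\<sigma> \<in> Ar (Hom K B C). lwhisker K B C D f \<sigma>)\<rparr>"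

definition opfibration :: "('o,'m,'c) twocat \<Rightarrow> 'o \<Rightarrow> 'o \<Rightarrow> 'm \<Rightarrow> bool" where
  "opfibration K C D f \<longleftrightarrow>
     (\<forall>B \<in> Obj K. cat_opfibration (Hom K B C) (Hom K B D) (postcompose K B C D f))"

definition discrete_object :: "('o,'m,'c) twocat \<Rightarrow> 'o \<Rightarrow> bool" where
  "discrete_object K X \<longleftrightarrow> (\<forall>G \<in> Obj K. equivalent_to_discrete (Hom K G X))"

definition discrete_opfibration :: "('o,'m,'c) twocat \<Rightarrow> 'o \<Rightarrow> 'o \<Rightarrow> 'm \<Rightarrow> bool" where
  "discrete_opfibration K C D f \<longleftrightarrow>
     opfibration K C D f \<and> discrete_object (pseudoslice K D) (C, f)"


subsection \<open>Bilimits\<close>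

record ('i,'j,'o,'m,'c) psftr =
  pob :: "'i \<Rightarrow> 'o"
  par :: "'j \<Rightarrow> 'm"
  pcmp :: "'j \<Rightarrow> 'j \<Rightarrow> 'c"
  pidn :: "'i \<Rightarrow> 'c"

text \<open>
  The comparison 2-cells are \<open>pcmp F v u : F v \<circ> F u \<Rightarrow> F (v \<cdot> u)\<close> and \<open>pidn F i : id \<Rightarrow> F id\<close>.
\<close>

definition pseudofunctor ::
  "('i,'j) cat \<Rightarrow> ('o,'m,'c) twocat \<Rightarrow> ('i,'j,'o,'m,'c) psftr \<Rightarrow> bool" where
  "pseudofunctor I K F \<longleftrightarrow>
     (\<forall>i \<in> Ob I. pob F i \<in> Obj K) \<and>
     (\<forall>i \<in> Ob I. \<forall>j \<in> Ob I. \<forall>u \<in> hom I i j. par F u \<in> Ob (Hom K (pob F i) (pob F j))) \<and>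
     (\<forall>i \<in> Ob I. \<forall>j \<in> Ob I. \<forall>k \<in> Ob I. \<forall>u \<in> hom I i j. \<forall>v \<in> hom I j k.
        pcmp F v u \<in> hom (Hom K (pob F i) (pob F k))
          (cmp1 K (pob F i) (pob F j) (pob F k) (par F v) (par F u)) (par F (v \<cdot>\<^bsub>I\<^esub> u)) \<and>
        is_iso (Hom K (pob F i) (pob F k)) (pcmp F v u)) \<and>
     (\<forall>i \<in> Ob I.
        pidn F i \<in> hom (Hom K (pob F i) (pob F i)) (id1 K (pob F i)) (par F (idn I i)) \<and>
        is_iso (Hom K (pob F i) (pob F i)) (pidn F i)) \<and>
     (\<forall>i \<in> Ob I. \<forall>j \<in> Ob I. \<forall>k \<in> Ob I. \<forall>l \<in> Ob I.
        \<forall>u \<in> hom I i j. \<forall>v \<in> hom I j k. \<forall>w \<in> hom I k l.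
        pcmp F w (v \<cdot>\<^bsub>I\<^esub> u) \<cdot>\<^bsub>Hom K (pob F i) (pob F l)\<^esub>
          lwhisker K (pob F i) (pob F k) (pob F l) (par F w) (pcmp F v u)
        = pcmp F (w \<cdot>\<^bsub>I\<^esub> v) u \<cdot>\<^bsub>Hom K (pob F i) (pob F l)\<^esub>
          rwhisker K (pob F i) (pob F j) (pob F l) (pcmp F w v) (par F u)) \<and>
     (\<forall>i \<in> Ob I. \<forall>j \<in> Ob I. \<forall>u \<in> hom I i j.
        pcmp F (idn I j) u \<cdot>\<^bsub>Hom K (pob F i) (pob F j)\<^esub>
          rwhisker K (pob F i) (pob F j) (pob F j) (pidn F j) (par F u)
          = idn (Hom K (pob F i) (pob F j)) (par F u) \<and>
        pcmp F u (idn I i) \<cdot>\<^bsub>Hom K (pob F i) (pob F j)\<^esub>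
          lwhisker K (pob F i) (pob F i) (pob F j) (par F u) (pidn F i)
          = idn (Hom K (pob F i) (pob F j)) (par F u))"

text \<open>
  A pseudocone \<open>(l, n)\<close> with vertex \<open>B\<close> consists of 1-cells \<open>l i : B \<rightarrow> F i\<close> and invertible 2-cells
  \<open>n u : F u \<circ> l i \<Rightarrow> l j\<close> for \<open>u : i \<rightarrow> j\<close>.
\<close>

definition pseudocone ::
  "('i,'j) cat \<Rightarrow> ('o,'m,'c) twocat \<Rightarrow> ('i,'j,'o,'m,'c) psftr \<Rightarrow> 'o \<Rightarrow>
   ('i \<Rightarrow> 'm) \<times> ('j \<Rightarrow> 'c) \<Rightarrow> bool" where
  "pseudocone I K F B = (\<lambda>(l, n).
     l \<in> extensional (Ob I) \<and> n \<in> extensional (Ar I) \<and>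
     (\<forall>i \<in> Ob I. l i \<in> Ob (Hom K B (pob F i))) \<and>
     (\<forall>i \<in> Ob I. \<forall>j \<in> Ob I. \<forall>u \<in> hom I i j.
        n u \<in> hom (Hom K B (pob F j)) (cmp1 K B (pob F i) (pob F j) (par F u) (l i)) (l j) \<and>
        is_iso (Hom K B (pob F j)) (n u)) \<and>
     (\<forall>i \<in> Ob I. \<forall>j \<in> Ob I. \<forall>k \<in> Ob I. \<forall>u \<in> hom I i j. \<forall>v \<in> hom I j k.
        n (v \<cdot>\<^bsub>I\<^esub> u) \<cdot>\<^bsub>Hom K B (pob F k)\<^esub>
          rwhisker K B (pob F i) (pob F k) (pcmp F v u) (l i)
        = n v \<cdot>\<^bsub>Hom K B (pob F k)\<^esub>
          lwhisker K B (pob F j) (pob F k) (par F v) (n u)) \<and>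
     (\<forall>i \<in> Ob I.
        n (idn I i) \<cdot>\<^bsub>Hom K B (pob F i)\<^esub>
          rwhisker K B (pob F i) (pob F i) (pidn F i) (l i)
        = idn (Hom K B (pob F i)) (l i)))"

definition pseudocones ::
  "('i,'j) cat \<Rightarrow> ('o,'m,'c) twocat \<Rightarrow> ('i,'j,'o,'m,'c) psftr \<Rightarrow> 'o \<Rightarrow>
   (('i \<Rightarrow> 'm) \<times> ('j \<Rightarrow> 'c),
    (('i \<Rightarrow> 'm) \<times> ('j \<Rightarrow> 'c)) \<times> (('i \<Rightarrow> 'm) \<times> ('j \<Rightarrow> 'c)) \<times> ('i \<Rightarrow> 'c)) cat" where
  "pseudocones I K F B =
     \<lparr>Ob = {x. pseudocone I K F B x},
      Ar = {(x, y, m). pseudocone I K F B x \<and> pseudocone I K F B y \<and> m \<in> extensional (Ob I) \<and>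
              (\<forall>i \<in> Ob I. m i \<in> hom (Hom K B (pob F i)) (fst x i) (fst y i)) \<and>
              (\<forall>i \<in> Ob I. \<forall>j \<in> Ob I. \<forall>u \<in> hom I i j.
                 snd y u \<cdot>\<^bsub>Hom K B (pob F j)\<^esub>
                   lwhisker K B (pob F i) (pob F j) (par F u) (m i)
                 = m j \<cdot>\<^bsub>Hom K B (pob F j)\<^esub> snd x u)},
      src = (\<lambda>(x,y,m). x),
      tgt = (\<lambda>(x,y,m). y),
      idn = (\<lambda>x. (x, x, \<lambda>i \<in> Ob I. idn (Hom K B (pob F i)) (fst x i))),
      cmp = (\<lambda>(y,z,m') (x,y',m). (x, z, \<lambda>i \<in> Ob I. m' i \<cdot>\<^bsub>Hom K B (pob F i)\<^esub> m i))\<rparr>"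

definition precompose_cone ::
  "('i,'j) cat \<Rightarrow> ('o,'m,'c) twocat \<Rightarrow> ('i,'j,'o,'m,'c) psftr \<Rightarrow> 'o \<Rightarrow> ('i \<Rightarrow> 'm) \<times> ('j \<Rightarrow> 'c) \<Rightarrow> 'o \<Rightarrow>
   'm \<Rightarrow> ('i \<Rightarrow> 'm) \<times> ('j \<Rightarrow> 'c)" where
  "precompose_cone I K F L = (\<lambda>(l, n) B h.
     (\<lambda>i \<in> Ob I. cmp1 K B L (pob F i) (l i) h,
      \<lambda>u \<in> Ar I. rwhisker K B L (pob F (tgt I u)) (n u) h))"

definition cone_ftr ::
  "('i,'j) cat \<Rightarrow> ('o,'m,'c) twocat \<Rightarrow> ('i,'j,'o,'m,'c) psftr \<Rightarrow> 'o \<Rightarrow> ('i \<Rightarrow> 'm) \<times> ('j \<Rightarrow> 'c) \<Rightarrow> 'o \<Rightarrow>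
   ('m, 'c, ('i \<Rightarrow> 'm) \<times> ('j \<Rightarrow> 'c),
    (('i \<Rightarrow> 'm) \<times> ('j \<Rightarrow> 'c)) \<times> (('i \<Rightarrow> 'm) \<times> ('j \<Rightarrow> 'c)) \<times> ('i \<Rightarrow> 'c)) ftr" where
  "cone_ftr I K F L c B =
     \<lparr>fob = (\<lambda>h \<in> Ob (Hom K B L). precompose_cone I K F L c B h),
      far = (\<lambda>\<sigma> \<in> Ar (Hom K B L).
        (precompose_cone I K F L c B (src (Hom K B L) \<sigma>),
         precompose_cone I K F L c B (tgt (Hom K B L) \<sigma>),
         \<lambda>i \<in> Ob I. lwhisker K B L (pob F i) (fst c i) \<sigma>))\<rparr>"

definition is_bilimit ::
  "('i,'j) cat \<Rightarrow> ('o,'m,'c) twocat \<Rightarrow> ('i,'j,'o,'m,'c) psftr \<Rightarrow> 'o \<Rightarrow> ('i \<Rightarrow> 'm) \<times> ('j \<Rightarrow> 'c) \<Rightarrow> bool" where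
  "is_bilimit I K F L c \<longleftrightarrow> L \<in> Obj K \<and> pseudocone I K F L c \<and>
     (\<forall>B \<in> Obj K. is_equivalence (Hom K B L) (pseudocones I K F B) (cone_ftr I K F L c B))"


section \<open>Grothendieck topoi\<close>

definition sieve :: "('u,'u) cat \<Rightarrow> 'u \<Rightarrow> 'u set \<Rightarrow> bool" where
  "sieve C c S \<longleftrightarrow> S \<subseteq> {f \<in> Ar C. tgt C f = c} \<and>
     (\<forall>f \<in> S. \<forall>g \<in> Ar C. tgt C g = src C f \<longrightarrow> f \<cdot>\<^bsub>C\<^esub> g \<in> S)"

definition pull_sieve :: "('u,'u) cat \<Rightarrow> 'u \<Rightarrow> 'u set \<Rightarrow> 'u set" where
  "pull_sieve C h S = {g \<in> Ar C. tgt C g = src C h \<and> h \<cdot>\<^bsub>C\<^esub> g \<in> S}"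

definition grothendieck_topology :: "('u,'u) cat \<Rightarrow> ('u \<Rightarrow> 'u set set) \<Rightarrow> bool" where
  "grothendieck_topology C J \<longleftrightarrow>
     (\<forall>c \<in> Ob C. \<forall>S \<in> J c. sieve C c S) \<and>
     (\<forall>c \<in> Ob C. {f \<in> Ar C. tgt C f = c} \<in> J c) \<and>
     (\<forall>h \<in> Ar C. \<forall>S \<in> J (tgt C h). pull_sieve C h S \<in> J (src C h)) \<and>
     (\<forall>c \<in> Ob C. \<forall>S \<in> J c. \<forall>R. sieve C c R \<and> (\<forall>h \<in> S. pull_sieve C h R \<in> J (src C h)) \<longrightarrow> R \<in> J c)"

record 'u psh =
  sec :: "'u \<Rightarrow> 'u set"
  res :: "'u \<Rightarrow> 'u \<Rightarrow> 'u"

definition presheaf :: "('u,'u) cat \<Rightarrow> 'u psh \<Rightarrow> bool" where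
  "presheaf C P \<longleftrightarrow>
     sec P \<in> extensional (Ob C) \<and> res P \<in> extensional (Ar C) \<and>
     (\<forall>c \<in> Ob C. small (sec P c)) \<and>
     (\<forall>f \<in> Ar C. res P f \<in> sec P (tgt C f) \<rightarrow>\<^sub>E sec P (src C f)) \<and>
     (\<forall>c \<in> Ob C. \<forall>a \<in> sec P c. res P (idn C c) a = a) \<and>
     (\<forall>f \<in> Ar C. \<forall>g \<in> Ar C. tgt C g = src C f \<longrightarrow>
        (\<forall>a \<in> sec P (tgt C f). res P (f \<cdot>\<^bsub>C\<^esub> g) a = res P g (res P f a)))"

definition sheaf :: "('u,'u) cat \<Rightarrow> ('u \<Rightarrow> 'u set set) \<Rightarrow> 'u psh \<Rightarrow> bool" where
  "sheaf C J P \<longleftrightarrow> presheaf C P \<and>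
     (\<forall>c \<in> Ob C. \<forall>S \<in> J c. \<forall>x.
        (\<forall>f \<in> S. x f \<in> sec P (src C f)) \<and>
        (\<forall>f \<in> S. \<forall>g \<in> Ar C. tgt C g = src C f \<longrightarrow> x (f \<cdot>\<^bsub>C\<^esub> g) = res P g (x f)) \<longrightarrow>
        (\<exists>!a. a \<in> sec P c \<and> (\<forall>f \<in> S. res P f a = x f)))"

definition Sh :: "('u,'u) cat \<Rightarrow> ('u \<Rightarrow> 'u set set) \<Rightarrow>
    ('u psh, 'u psh \<times> 'u psh \<times> ('u \<Rightarrow> 'u \<Rightarrow> 'u)) cat" where
  "Sh C J =
     \<lparr>Ob = {P. sheaf C J P},
      Ar = {(P, Q, \<eta>). sheaf C J P \<and> sheaf C J Q \<and> \<eta> \<in> extensional (Ob C) \<and>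
              (\<forall>c \<in> Ob C. \<eta> c \<in> sec P c \<rightarrow>\<^sub>E sec Q c) \<and>
              (\<forall>f \<in> Ar C. \<forall>a \<in> sec P (tgt C f).
                 \<eta> (src C f) (res P f a) = res Q f (\<eta> (tgt C f) a))},
      src = (\<lambda>(P,Q,\<eta>). P),
      tgt = (\<lambda>(P,Q,\<eta>). Q),
      idn = (\<lambda>P. (P, P, \<lambda>c \<in> Ob C. \<lambda>a \<in> sec P c. a)),
      cmp = (\<lambda>(Q,R,\<theta>) (P,Q',\<eta>). (P, R, \<lambda>c \<in> Ob C. compose (sec P c) (\<theta> c) (\<eta> c)))\<rparr>"

definition grothendieck_topos :: "('u,'u) cat \<Rightarrow> bool" where
  "grothendieck_topos E \<longleftrightarrow> category E \<and> (\<forall>x \<in> Ob E. \<forall>y \<in> Ob E. small (hom E x y)) \<and>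
     (\<exists>(C :: ('u,'u) cat) J. small_category C \<and> grothendieck_topology C J \<and> equivalent_cats E (Sh C J))"


subsection \<open>The 2-category of Grothendieck topoi\<close>

record 'u geom =
  inv_im :: "('u,'u,'u,'u) ftr"
  dir_im :: "('u,'u,'u,'u) ftr"
  adj_unit :: "'u \<Rightarrow> 'u"
  adj_counit :: "'u \<Rightarrow> 'u"

definition geometric_morphism :: "('u,'u) cat \<Rightarrow> ('u,'u) cat \<Rightarrow> 'u geom \<Rightarrow> bool" where
  "geometric_morphism E F f \<longleftrightarrow>
     is_functor F E (inv_im f) \<and> is_functor E F (dir_im f) \<and>
     nat_trans F F (id_ftr F) (cmp_ftr F (dir_im f) (inv_im f)) (adj_unit f) \<and>
     nat_trans E E (cmp_ftr E (inv_im f) (dir_im f)) (id_ftr E) (adj_counit f) \<and>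
     (\<forall>x \<in> Ob F. adj_counit f (fob (inv_im f) x) \<cdot>\<^bsub>E\<^esub> far (inv_im f) (adj_unit f x)
        = idn E (fob (inv_im f) x)) \<and>
     (\<forall>y \<in> Ob E. far (dir_im f) (adj_counit f y) \<cdot>\<^bsub>F\<^esub> adj_unit f (fob (dir_im f) y)
        = idn F (fob (dir_im f) y)) \<and>
     left_exact F E (inv_im f)"

definition id_geom :: "('u,'u) cat \<Rightarrow> 'u geom" where
  "id_geom E = \<lparr>inv_im = id_ftr E, dir_im = id_ftr E,
     adj_unit = (\<lambda>x \<in> Ob E. idn E x), adj_counit = (\<lambda>x \<in> Ob E. idn E x)\<rparr>"

definition cmp_geom ::
  "('u,'u) cat \<Rightarrow> ('u,'u) cat \<Rightarrow> ('u,'u) cat \<Rightarrow> 'u geom \<Rightarrow> 'u geom \<Rightarrow> 'u geom" where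
  "cmp_geom A B C g f =
     \<lparr>inv_im = cmp_ftr C (inv_im f) (inv_im g),
      dir_im = cmp_ftr A (dir_im g) (dir_im f),
      adj_unit = (\<lambda>c \<in> Ob C.
        far (dir_im g) (adj_unit f (fob (inv_im g) c)) \<cdot>\<^bsub>C\<^esub> adj_unit g c),
      adj_counit = (\<lambda>a \<in> Ob A.
        adj_counit f a \<cdot>\<^bsub>A\<^esub> far (inv_im f) (adj_counit g (fob (dir_im f) a)))\<rparr>"

definition gtop :: "(('u,'u) cat, 'u geom, 'u geom \<times> 'u geom \<times> ('u \<Rightarrow> 'u)) twocat" where
  "gtop =
     \<lparr>Obj = {E. grothendieck_topos E},
      Hom = (\<lambda>E F.
        \<lparr>Ob = {f. geometric_morphism E F f},
         Ar = {(f, g, \<sigma>). geometric_morphism E F f \<and> geometric_morphism E F g \<and>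
                 nat_trans F E (inv_im f) (inv_im g) \<sigma>},
         src = (\<lambda>(f,g,\<sigma>). f),
         tgt = (\<lambda>(f,g,\<sigma>). g),
         idn = (\<lambda>f. (f, f, \<lambda>x \<in> Ob F. idn E (fob (inv_im f) x))),
         cmp = (\<lambda>(g,h,\<tau>) (f,g',\<sigma>). (f, h, \<lambda>x \<in> Ob F. \<tau> x \<cdot>\<^bsub>E\<^esub> \<sigma> x))\<rparr>),
      id1 = id_geom,
      cmp1 = cmp_geom,
      cmp2 = (\<lambda>A B C (g,g',\<tau>) (f,f',\<sigma>).
        (cmp_geom A B C g f, cmp_geom A B C g' f',
         \<lambda>c \<in> Ob C. \<sigma> (fob (inv_im g') c) \<cdot>\<^bsub>A\<^esub> far (inv_im f) (\<tau> c)))\<rparr>"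


section \<open>Pro-etale geometric morphisms\<close>

text \<open>
  An injection of \<open>'u \<times> 'u\<close> into \<open>'u\<close> (which exists since \<open>'u\<close> is infinite) makes the slice
  category again a \<open>('u,'u) cat\<close>. The arrow \<open>g : x \<rightarrow> y\<close> of the slice over \<open>X\<close>, where \<open>x = y \<cdot> g\<close>, is the
  code of the pair \<open>(g, y)\<close>.
\<close>

definition pair_code :: "'u \<times> 'u \<Rightarrow> 'u" where
  "pair_code = (SOME e. inj e)"

definition pair_decode :: "'u \<Rightarrow> 'u \<times> 'u" where
  "pair_decode = inv pair_code"

definition slice :: "('u,'u) cat \<Rightarrow> 'u \<Rightarrow> ('u,'u) cat" where
  "slice E X =
     \<lparr>Ob = {x \<in> Ar E. tgt E x = X},
      Ar = {pair_code (g, y) | g y. g \<in> Ar E \<and> y \<in> Ar E \<and> tgt E g = src E y \<and> tgt E y = X},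
      src = (\<lambda>a. snd (pair_decode a) \<cdot>\<^bsub>E\<^esub> fst (pair_decode a)),
      tgt = (\<lambda>a. snd (pair_decode a)),
      idn = (\<lambda>x. pair_code (idn E (src E x), x)),
      cmp = (\<lambda>b a. pair_code (fst (pair_decode b) \<cdot>\<^bsub>E\<^esub> fst (pair_decode a), snd (pair_decode b)))\<rparr>"

definition slice_arrow :: "'u \<Rightarrow> 'u" where
  "slice_arrow a = fst (pair_decode a)"

text \<open>
  \<open>is_etale E X p q\<close>: the geometric morphism \<open>p : E/X \<rightarrow> E\<close> is \<open>\<pi>\<^sub>X\<close>, that is, its inverse image is
  \<open>D \<mapsto> (X \<times> D \<rightarrow> X)\<close> for a choice of products with second projections \<open>q D : X \<times> D \<rightarrow> D\<close>.
\<close>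

definition is_etale :: "('u,'u) cat \<Rightarrow> 'u \<Rightarrow> 'u geom \<Rightarrow> ('u \<Rightarrow> 'u) \<Rightarrow> bool" where
  "is_etale E X p q \<longleftrightarrow> geometric_morphism (slice E X) E p \<and>
     (\<forall>D \<in> Ob E. is_product E X D (fob (inv_im p) D) (q D)) \<and>
     (\<forall>h \<in> Ar E. q (tgt E h) \<cdot>\<^bsub>E\<^esub> slice_arrow (far (inv_im p) h) = h \<cdot>\<^bsub>E\<^esub> q (src E h))"

text \<open>
  For \<open>u : X \<rightarrow> Y\<close> in \<open>E\<close>, the 1-cell \<open>(t, \<alpha>) : \<pi>\<^sub>X \<rightarrow> \<pi>\<^sub>Y\<close> of \<open>GTop/E\<close> is the one induced by \<open>u\<close>: the inverse
  image of \<open>t : E/X \<rightarrow> E/Y\<close> is pullback along \<open>u\<close>, with projections \<open>r b : u\<^sup>* b \<rightarrow> b\<close>, and \<open>\<alpha>\<close> is the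
  canonical isomorphism \<open>X \<times> D \<rightarrow> u\<^sup>* (Y \<times> D)\<close>.
\<close>

definition is_etale_transition ::
  "('u,'u) cat \<Rightarrow> 'u \<Rightarrow> 'u geom \<Rightarrow> ('u \<Rightarrow> 'u) \<Rightarrow> 'u \<Rightarrow> 'u geom \<Rightarrow> ('u \<Rightarrow> 'u) \<Rightarrow> 'u \<Rightarrow>
   'u geom \<times> 'u geom \<times> 'u geom \<times> ('u \<Rightarrow> 'u) \<Rightarrow> bool" where
  "is_etale_transition E X pX qX Y pY qY u = (\<lambda>(t, a, b, \<alpha>).
     (t, a, b, \<alpha>) \<in> Ob (Hom (pseudoslice gtop E) (slice E X, pX) (slice E Y, pY)) \<and>
     (\<exists>r.
       (\<forall>y \<in> Ob (slice E Y). is_pullback E u y (fob (inv_im t) y) (r y)) \<and>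
       (\<forall>h \<in> Ar (slice E Y).
          r (tgt (slice E Y) h) \<cdot>\<^bsub>E\<^esub> slice_arrow (far (inv_im t) h)
          = slice_arrow h \<cdot>\<^bsub>E\<^esub> r (src (slice E Y) h)) \<and>
       (\<forall>D \<in> Ob E. (qY D \<cdot>\<^bsub>E\<^esub> r (fob (inv_im pY) D)) \<cdot>\<^bsub>E\<^esub> slice_arrow (\<alpha> D) = qX D)))"

text \<open>
  \<open>F\<close> is the composite of \<open>D : I \<rightarrow> E\<close> with the pseudofunctor \<open>E \<rightarrow> GTop/E\<close>, \<open>X \<mapsto> \<pi>\<^sub>X\<close>. Its comparison
  2-cells need no description: parallel 1-cells between objects \<open>\<pi>\<^sub>X\<close> and \<open>\<pi>\<^sub>Y\<close> of \<open>GTop/E\<close> have at most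
  one 2-cell between them.
\<close>

definition etale_diagram ::
  "('u,'u) cat \<Rightarrow> ('u,'u) cat \<Rightarrow> ('u,'u,'u,'u) ftr \<Rightarrow>
   ('u, 'u, ('u,'u) cat \<times> 'u geom, 'u geom \<times> 'u geom \<times> 'u geom \<times> ('u \<Rightarrow> 'u),
    ('u geom \<times> 'u geom \<times> 'u geom \<times> ('u \<Rightarrow> 'u)) \<times> ('u geom \<times> 'u geom \<times> 'u geom \<times> ('u \<Rightarrow> 'u)) \<times>
      'u geom \<times> 'u geom \<times> ('u \<Rightarrow> 'u)) psftr \<Rightarrow> bool" where
  "etale_diagram E I D F \<longleftrightarrow> pseudofunctor I (pseudoslice gtop E) F \<and>
     (\<exists>p q.
       (\<forall>i \<in> Ob I. pob F i = (slice E (fob D i), p i) \<and> is_etale E (fob D i) (p i) (q i)) \<and>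
       (\<forall>i \<in> Ob I. \<forall>j \<in> Ob I. \<forall>u \<in> hom I i j.
          is_etale_transition E (fob D i) (p i) (q i) (fob D j) (p j) (q j) (far D u) (par F u)))"

definition pro_etale :: "('u,'u) cat \<Rightarrow> ('u,'u) cat \<Rightarrow> 'u geom \<Rightarrow> bool" where
  "pro_etale C E f \<longleftrightarrow>
     (\<exists>(I :: ('u,'u) cat) D F L c.
        small_category I \<and> cofiltered I \<and> is_functor I E D \<and> etale_diagram E I D F \<and>
        is_bilimit I (pseudoslice gtop E) F L c \<and>
        equivalent_objs (pseudoslice gtop E) (C, f) L)"


section \<open>The 2-category laws\<close>

lemma hom_iff: "f \<in> hom C x y \<longleftrightarrow> f \<in> Ar C \<and> src C f = x \<and> tgt C f = y"
  by (auto simp: hom_def)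

lemma hom_Ob: "category C \<Longrightarrow> f \<in> hom C x y \<Longrightarrow> x \<in> Ob C \<and> y \<in> Ob C"
  by (auto simp: hom_iff category.src_Ob category.tgt_Ob)

lemma functor_Ob: "is_functor C D F \<Longrightarrow> x \<in> Ob C \<Longrightarrow> fob F x \<in> Ob D"
  by (auto simp: is_functor_def)

lemma functor_hom: "is_functor C D F \<Longrightarrow> f \<in> hom C x y \<Longrightarrow> far F f \<in> hom D (fob F x) (fob F y)"
  by (auto simp: is_functor_def hom_def)

lemma functor_idn: "is_functor C D F \<Longrightarrow> x \<in> Ob C \<Longrightarrow> far F (idn C x) = idn D (fob F x)"
  by (auto simp: is_functor_def)

lemma functor_cmp: "is_functor C D F \<Longrightarrow> f \<in> hom C x y \<Longrightarrow> g \<in> hom C y z \<Longrightarrow>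
   far F (g \<cdot>\<^bsub>C\<^esub> f) = far F g \<cdot>\<^bsub>D\<^esub> far F f"
  by (auto simp: is_functor_def hom_def)

lemma functor_ext: "is_functor C D F \<Longrightarrow> fob F \<in> extensional (Ob C) \<and> far F \<in> extensional (Ar C)"
  by (auto simp: is_functor_def PiE_def)

lemma functorI:
  assumes "category C" "fob F \<in> extensional (Ob C)" "far F \<in> extensional (Ar C)"
    "\<And>x. x \<in> Ob C \<Longrightarrow> fob F x \<in> Ob D"
    "\<And>f x y. f \<in> hom C x y \<Longrightarrow> far F f \<in> hom D (fob F x) (fob F y)"
    "\<And>x. x \<in> Ob C \<Longrightarrow> far F (idn C x) = idn D (fob F x)"
    "\<And>f g x y z. f \<in> hom C x y \<Longrightarrow> g \<in> hom C y z \<Longrightarrow> far F (g \<cdot>\<^bsub>C\<^esub> f) = far F g \<cdot>\<^bsub>D\<^esub> far F f"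
  shows "is_functor C D F"
  using assms unfolding is_functor_def PiE_def hom_def by auto

lemma functor_eq: "is_functor C D F \<Longrightarrow> is_functor C D G \<Longrightarrow> (\<And>x. x \<in> Ob C \<Longrightarrow> fob F x = fob G x) \<Longrightarrow>
  (\<And>f. f \<in> Ar C \<Longrightarrow> far F f = far G f) \<Longrightarrow> F = (G :: (_,_,_,_) ftr)"
  by (cases F; cases G) (auto simp: is_functor_def PiE_def intro: extensionalityI)

lemma id_functor: "category C \<Longrightarrow> is_functor C C (id_ftr C)"
  by (rule functorI) (auto simp: id_ftr_def hom_iff category.idn_hom category.cmp_hom
     intro: category.src_Ob category.tgt_Ob dest: category.idn_hom category.cmp_hom[unfolded hom_iff])

lemma cmp_fob: "x \<in> Ob C \<Longrightarrow> fob (cmp_ftr C G F) x = fob G (fob F x)"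
  by (simp add: cmp_ftr_def compose_def)
lemma cmp_far: "x \<in> Ar C \<Longrightarrow> far (cmp_ftr C G F) x = far G (far F x)"
  by (simp add: cmp_ftr_def compose_def)
lemma cmp_far_hom: "f \<in> hom C x y \<Longrightarrow> far (cmp_ftr C G F) f = far G (far F f)"
  by (simp add: cmp_far hom_iff)

lemma cmp_functor: assumes "category C" "is_functor C D F" "is_functor D E G"
  shows "is_functor C E (cmp_ftr C G F)"
proof (rule functorI)
  show "fob (cmp_ftr C G F) \<in> extensional (Ob C)" "far (cmp_ftr C G F) \<in> extensional (Ar C)"
    by (auto simp: cmp_ftr_def)
next
  fix f g x y z assume h: "f \<in> hom C x y" "g \<in> hom C y z"
  then have "g \<cdot>\<^bsub>C\<^esub> f \<in> hom C x z" using assms by (auto intro: category.cmp_hom)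
  then show "far (cmp_ftr C G F) (g \<cdot>\<^bsub>C\<^esub> f) = far (cmp_ftr C G F) g \<cdot>\<^bsub>E\<^esub> far (cmp_ftr C G F) f"
    using h assms by (simp add: cmp_far_hom functor_cmp[OF assms(2)] functor_cmp[OF assms(3) functor_hom[OF assms(2)] functor_hom[OF assms(2)]])
next
  fix f x y assume h: "f \<in> hom C x y"
  then show "far (cmp_ftr C G F) f \<in> hom E (fob (cmp_ftr C G F) x) (fob (cmp_ftr C G F) y)"
    using hom_Ob[OF assms(1) h] functor_hom[OF assms(3) functor_hom[OF assms(2) h]]
    by (simp add: cmp_far_hom[OF h] cmp_fob)
next
  fix x assume x: "x \<in> Ob C"
  show "far (cmp_ftr C G F) (idn C x) = idn E (fob (cmp_ftr C G F) x)"
    using category.idn_hom[OF assms(1) x] x assms functor_Ob[OF assms(2) x]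
    by (simp add: cmp_far_hom cmp_fob functor_idn)
qed (use assms in \<open>auto simp: cmp_fob functor_Ob\<close>)

lemma cmp_ftr_assoc:
  assumes "category A" "is_functor A B F" 
  shows "cmp_ftr A (cmp_ftr B H G) F = cmp_ftr A H (cmp_ftr A G F)"
  using assms functor_Ob[OF assms(2)] functor_hom[OF assms(2)]
  by (auto simp: cmp_ftr_def compose_def restrict_def hom_iff fun_eq_iff)

lemma cmp_id_left: "category C \<Longrightarrow> is_functor C D F \<Longrightarrow> cmp_ftr C (id_ftr D) F = F"
  using functor_Ob[of C D F] functor_hom[of C D F] functor_ext[of C D F]
  by (cases F) (auto simp: cmp_ftr_def id_ftr_def compose_def restrict_def hom_iff fun_eq_iff extensional_def)
lemma cmp_id_right: "is_functor C D F \<Longrightarrow> cmp_ftr C F (id_ftr C) = F"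
  using functor_ext[of C D F]
  by (cases F) (auto simp: cmp_ftr_def id_ftr_def compose_def restrict_def hom_iff fun_eq_iff extensional_def)

lemma nt_hom: "nat_trans C D F G \<eta> \<Longrightarrow> x \<in> Ob C \<Longrightarrow> \<eta> x \<in> hom D (fob F x) (fob G x)"
  by (simp add: nat_trans_def)
lemma nt_nat: "nat_trans C D F G \<eta> \<Longrightarrow> f \<in> hom C x y \<Longrightarrow> \<eta> y \<cdot>\<^bsub>D\<^esub> far F f = far G f \<cdot>\<^bsub>D\<^esub> \<eta> x"
  by (auto simp: nat_trans_def hom_iff)

lemma ntI: "\<eta> \<in> extensional (Ob C) \<Longrightarrow> (\<And>x. x \<in> Ob C \<Longrightarrow> \<eta> x \<in> hom D (fob F x) (fob G x)) \<Longrightarrow>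
  (\<And>f x y. f \<in> hom C x y \<Longrightarrow> \<eta> y \<cdot>\<^bsub>D\<^esub> far F f = far G f \<cdot>\<^bsub>D\<^esub> \<eta> x) \<Longrightarrow> nat_trans C D F G \<eta>"
  by (auto simp: nat_trans_def hom_iff)

lemma nt_id: assumes "category C" "category D" "is_functor C D F"
  shows "nat_trans C D F F (\<lambda>x \<in> Ob C. idn D (fob F x))"
proof (rule ntI)
  fix f x y assume h: "f \<in> hom C x y"
  show "(\<lambda>x \<in> Ob C. idn D (fob F x)) y \<cdot>\<^bsub>D\<^esub> far F f = far F f \<cdot>\<^bsub>D\<^esub> (\<lambda>x \<in> Ob C. idn D (fob F x)) x"
    using hom_Ob[OF assms(1) h] functor_hom[OF assms(3) h] assms(2)
    by (simp add: category.idn_left category.idn_right)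
qed (use assms in \<open>auto simp: category.idn_hom functor_Ob\<close>)

lemma nt_vcomp: assumes "category C" "category D" "is_functor C D F" "is_functor C D G" "is_functor C D H"
   "nat_trans C D F G \<sigma>" "nat_trans C D G H \<tau>"
  shows "nat_trans C D F H (\<lambda>x \<in> Ob C. \<tau> x \<cdot>\<^bsub>D\<^esub> \<sigma> x)"
proof (rule ntI)
  fix f x y assume h: "f \<in> hom C x y"
  note xy = hom_Ob[OF assms(1) h]
  interpret D: category D by fact
  note t = nt_hom[OF assms(6)] nt_hom[OF assms(7)] functor_hom[OF assms(3) h] functor_hom[OF assms(4) h] functor_hom[OF assms(5) h]
  have "(\<tau> y \<cdot>\<^bsub>D\<^esub> \<sigma> y) \<cdot>\<^bsub>D\<^esub> far F f = \<tau> y \<cdot>\<^bsub>D\<^esub> (\<sigma> y \<cdot>\<^bsub>D\<^esub> far F f)"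
    using t xy by (meson D.cmp_assoc)
  also have "\<dots> = \<tau> y \<cdot>\<^bsub>D\<^esub> (far G f \<cdot>\<^bsub>D\<^esub> \<sigma> x)" by (simp add: nt_nat[OF assms(6) h])
  also have "\<dots> = (\<tau> y \<cdot>\<^bsub>D\<^esub> far G f) \<cdot>\<^bsub>D\<^esub> \<sigma> x" using t xy by (metis D.cmp_assoc)
  also have "\<dots> = (far H f \<cdot>\<^bsub>D\<^esub> \<tau> x) \<cdot>\<^bsub>D\<^esub> \<sigma> x" by (simp add: nt_nat[OF assms(7) h])
  also have "\<dots> = far H f \<cdot>\<^bsub>D\<^esub> (\<tau> x \<cdot>\<^bsub>D\<^esub> \<sigma> x)" using t xy by (meson D.cmp_assoc)
  finally show "(\<lambda>x \<in> Ob C. \<tau> x \<cdot>\<^bsub>D\<^esub> \<sigma> x) y \<cdot>\<^bsub>D\<^esub> far F f = far H f \<cdot>\<^bsub>D\<^esub> (\<lambda>x \<in> Ob C. \<tau> x \<cdot>\<^bsub>D\<^esub> \<sigma> x) x"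
    using xy by simp
next
  fix x assume "x \<in> Ob C"
  then show "(\<lambda>x \<in> Ob C. \<tau> x \<cdot>\<^bsub>D\<^esub> \<sigma> x) x \<in> hom D (fob F x) (fob H x)"
    using category.cmp_hom[OF assms(2) nt_hom[OF assms(6)] nt_hom[OF assms(7)]] by auto
qed auto

lemma left_exact_cmp: assumes "category C" "is_functor C D F" "left_exact C D F" "left_exact D E G"
  shows "left_exact C E (cmp_ftr C G F)"
  unfolding left_exact_def
proof (intro allI impI, elim conjE)
  fix J :: "(nat,nat) cat" and H L c
  assume a: "finite_category J" "is_functor J C H" "is_limit J C H L c"
  then have J: "category J" by (simp add: finite_category_def)
  have 1: "is_limit J D (cmp_ftr J F H) (fob F L) (\<lambda>j. far F (c j))" using a assms by (auto simp: left_exact_def)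
  have "is_functor J D (cmp_ftr J F H)" using J a assms by (auto intro: cmp_functor)
  then have 2: "is_limit J E (cmp_ftr J G (cmp_ftr J F H)) (fob G (fob F L)) (\<lambda>j. far G (far F (c j)))"
    using 1 a assms by (auto simp: left_exact_def)
  have L: "L \<in> Ob C" "\<And>j. j \<in> Ob J \<Longrightarrow> c j \<in> Ar C" using a by (auto simp: is_limit_def is_cone_def hom_iff)
  have c: "j \<in> Ob J \<Longrightarrow> far (cmp_ftr C G F) (c j) = far G (far F (c j))" for j by (simp add: L cmp_far)
  show "is_limit J E (cmp_ftr J (cmp_ftr C G F) H) (fob (cmp_ftr C G F) L) (\<lambda>j. far (cmp_ftr C G F) (c j))"
    using 2 J L c unfolding cmp_ftr_assoc[OF J a(2)] cmp_fob[OF L(1)]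
    unfolding is_limit_def is_cone_def
    by (auto simp: category.src_Ob[OF J] category.tgt_Ob[OF J])
qed

lemma left_exact_id: assumes "category C" shows "left_exact C C (id_ftr C)"
  unfolding left_exact_def
proof (intro allI impI, elim conjE)
  fix J :: "(nat,nat) cat" and H L c
  assume a: "finite_category J" "is_functor J C H" "is_limit J C H L c"
  then have J: "category J" by (simp add: finite_category_def)
  have L: "L \<in> Ob C" "\<And>j. j \<in> Ob J \<Longrightarrow> c j \<in> Ar C" using a by (auto simp: is_limit_def is_cone_def hom_iff)
  have c: "j \<in> Ob J \<Longrightarrow> far (id_ftr C) (c j) = c j" for j by (simp add: L id_ftr_def)
  have d: "fob (id_ftr C) L = L" by (simp add: L id_ftr_def)
  show "is_limit J C (cmp_ftr J (id_ftr C) H) (fob (id_ftr C) L) (\<lambda>j. far (id_ftr C) (c j))"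
    using a(3) unfolding cmp_id_left[OF J a(2)] d is_limit_def is_cone_def
    by (auto simp: c category.src_Ob[OF J] category.tgt_Ob[OF J])
qed

lemma inj_pair_code:
  assumes "infinite (UNIV :: 'u set)"
  shows "inj (pair_code :: 'u \<times> 'u \<Rightarrow> 'u)"
proof -
  have "|UNIV \<times> UNIV :: ('u \<times> 'u) set| \<le>o |UNIV :: 'u set|"
    using card_of_Times_same_infinite[OF assms] ordIso_imp_ordLeq by blast
  then have "\<exists>e :: 'u \<times> 'u \<Rightarrow> 'u. inj e"
    unfolding card_of_ordLeq[symmetric] by auto
  then show ?thesis unfolding pair_code_def by (rule someI_ex)
qed

lemma category_slice:
  assumes E: "category E" and inf: "infinite (UNIV :: 'u set)"
  shows "category (slice (E :: ('u,'u) cat) X)"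
proof -
  interpret E: category E by (rule E)
  have [simp]: "pair_decode (pair_code z) = z" for z :: "'u \<times> 'u"
    unfolding pair_decode_def using inj_pair_code[OF inf] by (simp add: inv_f_f)
  have H: "a \<in> hom (slice E X) x y \<longleftrightarrow>
     (\<exists>g. a = pair_code (g, y) \<and> g \<in> hom E (src E x) (src E y) \<and> x \<in> hom E (src E x) X \<and>
          y \<in> hom E (src E y) X \<and> y \<cdot>\<^bsub>E\<^esub> g = x)" for a x y
  proof
    assume "a \<in> hom (slice E X) x y"
    then obtain g where g: "a = pair_code (g, y)" "g \<in> Ar E" "y \<in> Ar E" "tgt E g = src E y" "tgt E y = X"
      "y \<cdot>\<^bsub>E\<^esub> g = x" unfolding hom_iff slice_def by auto
    have "x \<in> hom E (src E g) X" using E.cmp_hom[of g "src E g" "src E y" y X] g by (auto simp: hom_iff)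
    then show "\<exists>g. a = pair_code (g, y) \<and> g \<in> hom E (src E x) (src E y) \<and> x \<in> hom E (src E x) X \<and>
          y \<in> hom E (src E y) X \<and> y \<cdot>\<^bsub>E\<^esub> g = x" using g by (auto simp: hom_iff)
  qed (auto simp: hom_iff slice_def)
  have cmp: "pair_code (h, z) \<cdot>\<^bsub>slice E X\<^esub> pair_code (g, y) = pair_code (h \<cdot>\<^bsub>E\<^esub> g, z)" for g h y z
    by (simp add: slice_def)
  have idn: "idn (slice E X) x = pair_code (idn E (src E x), x)" for x by (simp add: slice_def)
  show ?thesis
  proof (rule category.intro)
    fix f g h w x y z
    { assume "f \<in> Ar (slice E X)"
      then have "f \<in> hom (slice E X) (src (slice E X) f) (tgt (slice E X) f)" by (simp add: hom_iff)
      then show "src (slice E X) f \<in> Ob (slice E X)" "tgt (slice E X) f \<in> Ob (slice E X)"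
        unfolding H by (auto simp: slice_def hom_iff) }
    { assume "x \<in> Ob (slice E X)"
      then have x: "x \<in> hom E (src E x) X" by (simp add: slice_def hom_iff)
      then show "idn (slice E X) x \<in> hom (slice E X) x x"
        unfolding H idn using E.idn_hom hom_Ob[OF E x] E.idn_right[OF x] by blast }
    { assume f: "f \<in> hom (slice E X) x y"
      then show "idn (slice E X) y \<cdot>\<^bsub>slice E X\<^esub> f = f" "f \<cdot>\<^bsub>slice E X\<^esub> idn (slice E X) x = f"
        unfolding H idn by (auto simp: cmp E.idn_left E.idn_right)
      assume g: "g \<in> hom (slice E X) y z"
      then show "g \<cdot>\<^bsub>slice E X\<^esub> f \<in> hom (slice E X) x z"
        using f unfolding H by (auto simp: cmp E.cmp_assoc intro: E.cmp_hom)
      assume h: "h \<in> hom (slice E X) z w"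
      show "(h \<cdot>\<^bsub>slice E X\<^esub> g) \<cdot>\<^bsub>slice E X\<^esub> f = h \<cdot>\<^bsub>slice E X\<^esub> (g \<cdot>\<^bsub>slice E X\<^esub> f)"
        using f g h unfolding H by (elim exE conjE, hypsubst, simp only: cmp) (metis E.cmp_assoc) }
  qed
qed

lemma isoI: "f \<in> hom C x y \<Longrightarrow> g \<in> hom C y x \<Longrightarrow> g \<cdot>\<^bsub>C\<^esub> f = idn C x \<Longrightarrow> f \<cdot>\<^bsub>C\<^esub> g = idn C y \<Longrightarrow> is_iso C f"
  by (auto simp: is_iso_def hom_iff)

lemma isoE: assumes "is_iso C f" "f \<in> hom C x y"
  obtains g where "g \<in> hom C y x" "g \<cdot>\<^bsub>C\<^esub> f = idn C x" "f \<cdot>\<^bsub>C\<^esub> g = idn C y"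
  using assms by (auto simp: is_iso_def hom_iff)

lemma iso_idn: "category C \<Longrightarrow> x \<in> Ob C \<Longrightarrow> is_iso C (idn C x)"
  using isoI[of "idn C x" C x x "idn C x"] category.idn_hom[of C x] category.idn_left[of C "idn C x" x x] by auto

lemma iso_cmp: assumes C: "category C" and "is_iso C f" "is_iso C g" and f: "f \<in> hom C x y" and g: "g \<in> hom C y z"
  shows "is_iso C (g \<cdot>\<^bsub>C\<^esub> f)"
proof -
  interpret category C by fact
  obtain f' where f': "f' \<in> hom C y x" "f' \<cdot>\<^bsub>C\<^esub> f = idn C x" "f \<cdot>\<^bsub>C\<^esub> f' = idn C y" using assms isoE by metis
  obtain g' where g': "g' \<in> hom C z y" "g' \<cdot>\<^bsub>C\<^esub> g = idn C y" "g \<cdot>\<^bsub>C\<^esub> g' = idn C z" using assms isoE by metis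
  have "(f' \<cdot>\<^bsub>C\<^esub> g') \<cdot>\<^bsub>C\<^esub> (g \<cdot>\<^bsub>C\<^esub> f) = f' \<cdot>\<^bsub>C\<^esub> (g' \<cdot>\<^bsub>C\<^esub> (g \<cdot>\<^bsub>C\<^esub> f))"
    using cmp_assoc[OF cmp_hom[OF f g] g'(1) f'(1)] .
  also have "\<dots> = f' \<cdot>\<^bsub>C\<^esub> f" by (simp add: cmp_assoc[OF f g g'(1), symmetric] g' idn_left[OF f])
  finally have 1: "(f' \<cdot>\<^bsub>C\<^esub> g') \<cdot>\<^bsub>C\<^esub> (g \<cdot>\<^bsub>C\<^esub> f) = idn C x" by (simp add: f')
  have "(g \<cdot>\<^bsub>C\<^esub> f) \<cdot>\<^bsub>C\<^esub> (f' \<cdot>\<^bsub>C\<^esub> g') = g \<cdot>\<^bsub>C\<^esub> (f \<cdot>\<^bsub>C\<^esub> (f' \<cdot>\<^bsub>C\<^esub> g'))"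
    using cmp_assoc[OF cmp_hom[OF g'(1) f'(1)] f g] .
  also have "\<dots> = g \<cdot>\<^bsub>C\<^esub> g'" by (simp add: cmp_assoc[OF g'(1) f'(1) f, symmetric] f' idn_left[OF g'(1)])
  finally have 2: "(g \<cdot>\<^bsub>C\<^esub> f) \<cdot>\<^bsub>C\<^esub> (f' \<cdot>\<^bsub>C\<^esub> g') = idn C z" by (simp add: g')
  show ?thesis by (rule isoI[OF cmp_hom[OF f g] cmp_hom[OF g'(1) f'(1)] 1 2])
qed

context two_category
begin

lemma idH: "A \<in> Obj K \<Longrightarrow> B \<in> Obj K \<Longrightarrow> f \<in> Ob (Hom K A B) \<Longrightarrow> idn (Hom K A B) f \<in> hom (Hom K A B) f f"
  using category.idn_hom[OF Hom_category] by auto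

lemma homOb: "A \<in> Obj K \<Longrightarrow> B \<in> Obj K \<Longrightarrow> s \<in> hom (Hom K A B) f g \<Longrightarrow> f \<in> Ob (Hom K A B) \<and> g \<in> Ob (Hom K A B)"
  using category.src_Ob[OF Hom_category] category.tgt_Ob[OF Hom_category] by (auto simp: hom_iff)

lemma lw_hom: "\<lbrakk>A \<in> Obj K; B \<in> Obj K; C \<in> Obj K; g \<in> Ob (Hom K B C); s \<in> hom (Hom K A B) f f'\<rbrakk> \<Longrightarrow>
  lwhisker K A B C g s \<in> hom (Hom K A C) (cmp1 K A B C g f) (cmp1 K A B C g f')"
  unfolding lwhisker_def by (intro cmp2_Hom idH)
lemma rw_hom: "\<lbrakk>A \<in> Obj K; B \<in> Obj K; C \<in> Obj K; f \<in> Ob (Hom K A B); t \<in> hom (Hom K B C) g g'\<rbrakk> \<Longrightarrow>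
  rwhisker K A B C t f \<in> hom (Hom K A C) (cmp1 K A B C g f) (cmp1 K A B C g' f)"
  unfolding rwhisker_def by (intro cmp2_Hom idH)

lemma lw_cmp: "\<lbrakk>A \<in> Obj K; B \<in> Obj K; C \<in> Obj K; g \<in> Ob (Hom K B C); s \<in> hom (Hom K A B) f f'; s' \<in> hom (Hom K A B) f' f''\<rbrakk> \<Longrightarrow>
  lwhisker K A B C g (s' \<cdot>\<^bsub>Hom K A B\<^esub> s) = lwhisker K A B C g s' \<cdot>\<^bsub>Hom K A C\<^esub> lwhisker K A B C g s"
  unfolding lwhisker_def using interchange[of A B C s f f' s' f'' "idn (Hom K B C) g" g g "idn (Hom K B C) g" g]
   idH[of B C g] category.idn_left[OF Hom_category[of B C] idH[of B C g]] by auto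
lemma rw_cmp: "\<lbrakk>A \<in> Obj K; B \<in> Obj K; C \<in> Obj K; f \<in> Ob (Hom K A B); t \<in> hom (Hom K B C) g g'; t' \<in> hom (Hom K B C) g' g''\<rbrakk> \<Longrightarrow>
  rwhisker K A B C (t' \<cdot>\<^bsub>Hom K B C\<^esub> t) f = rwhisker K A B C t' f \<cdot>\<^bsub>Hom K A C\<^esub> rwhisker K A B C t f"
  unfolding rwhisker_def using interchange[of A B C "idn (Hom K A B) f" f f "idn (Hom K A B) f" f t g g' t' g'']
   idH[of A B f] category.idn_left[OF Hom_category[of A B] idH[of A B f]] by auto

lemma rw_iso: assumes o: "A \<in> Obj K" "B \<in> Obj K" "C \<in> Obj K" "f \<in> Ob (Hom K A B)" and t: "t \<in> hom (Hom K B C) g g'" "is_iso (Hom K B C) t"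
  shows "is_iso (Hom K A C) (rwhisker K A B C t f)"
proof -
  obtain t' where t': "t' \<in> hom (Hom K B C) g' g" "t' \<cdot>\<^bsub>Hom K B C\<^esub> t = idn (Hom K B C) g" "t \<cdot>\<^bsub>Hom K B C\<^esub> t' = idn (Hom K B C) g'"
    using isoE[OF t(2,1)] .
  have g: "g \<in> Ob (Hom K B C)" "g' \<in> Ob (Hom K B C)" using homOb o t by auto
  show ?thesis by (rule isoI[OF rw_hom[OF o t(1)] rw_hom[OF o t'(1)]])
    (simp_all add: rw_cmp[OF o t(1) t'(1), symmetric] rw_cmp[OF o t'(1) t(1), symmetric] t', 
     simp_all add: rwhisker_def cmp2_idn o g)
qed

lemma hcomp_eq: assumes o: "A \<in> Obj K" "B \<in> Obj K" "C \<in> Obj K" and s: "s \<in> hom (Hom K A B) f f'" and t: "t \<in> hom (Hom K B C) g g'"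
  shows "cmp2 K A B C t s = rwhisker K A B C t f' \<cdot>\<^bsub>Hom K A C\<^esub> lwhisker K A B C g s"
    "cmp2 K A B C t s = lwhisker K A B C g' s \<cdot>\<^bsub>Hom K A C\<^esub> rwhisker K A B C t f"
proof -
  note f = homOb[OF o(1,2) s] and g = homOb[OF o(2,3) t]
  note c1 = Hom_category[OF o(1,2)] and c2 = Hom_category[OF o(2,3)]
  show "cmp2 K A B C t s = rwhisker K A B C t f' \<cdot>\<^bsub>Hom K A C\<^esub> lwhisker K A B C g s"
    unfolding rwhisker_def lwhisker_def
    using interchange[OF o s idH[OF o(1,2) conjunct2[OF f]] idH[OF o(2,3) conjunct1[OF g]] t]
    by (simp add: category.idn_left[OF c1 s] category.idn_right[OF c2 t])
  show "cmp2 K A B C t s = lwhisker K A B C g' s \<cdot>\<^bsub>Hom K A C\<^esub> rwhisker K A B C t f"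
    unfolding rwhisker_def lwhisker_def
    using interchange[OF o idH[OF o(1,2) conjunct1[OF f]] s t idH[OF o(2,3) conjunct2[OF g]]]
    by (simp add: category.idn_right[OF c1 s] category.idn_left[OF c2 t])
qed

abbreviation "PS D \<equiv> pseudoslice K D"

lemma PS_Obj: "(A,f) \<in> Obj (PS D) \<longleftrightarrow> A \<in> Obj K \<and> f \<in> Ob (Hom K A D)" by (simp add: pseudoslice_def)
lemma PS_Ob: "(h,\<alpha>) \<in> Ob (Hom (PS D) (A,f) (B,g)) \<longleftrightarrow> h \<in> Ob (Hom K A B) \<and>
                     \<alpha> \<in> hom (Hom K A D) f (cmp1 K A B D g h) \<and> is_iso (Hom K A D) \<alpha>" 
  by (simp add: pseudoslice_def slice_Hom_def Let_def)
lemma PS_hom: "s \<in> hom (Hom (PS D) (A,f) (B,g)) x y \<longleftrightarrow> (\<exists>\<sigma>. s = (x,y,\<sigma>) \<and> x \<in> Ob (Hom (PS D) (A,f) (B,g)) \<and> y \<in> Ob (Hom (PS D) (A,f) (B,g)) \<and>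
    \<sigma> \<in> hom (Hom K A B) (fst x) (fst y) \<and> lwhisker K A B D g \<sigma> \<cdot>\<^bsub>Hom K A D\<^esub> snd x = snd y)"
  by (cases s; cases x; cases y) (auto simp: pseudoslice_def slice_Hom_def Let_def hom_def)
lemma PS_sel: "idn (Hom (PS D) (A,f) (B,g)) x = (x, x, idn (Hom K A B) (fst x))"
  "(y,z,\<tau>) \<cdot>\<^bsub>Hom (PS D) (A,f) (B,g)\<^esub> (x,y',\<sigma>) = (x, z, \<tau> \<cdot>\<^bsub>Hom K A B\<^esub> \<sigma>)"
  "cmp1 (PS D) (A,f) (B,g) (C,e) (k,\<beta>) (h,\<alpha>) = (cmp1 K A B C k h, rwhisker K A B D \<beta> h \<cdot>\<^bsub>Hom K A D\<^esub> \<alpha>)"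
  "id1 (PS D) (A,f) = (id1 K A, idn (Hom K A D) f)"
  "cmp2 (PS D) (A,f) (B,g) (C,e) (y,y',\<tau>) (x,x',\<sigma>) = (cmp1 (PS D) (A,f) (B,g) (C,e) y x, cmp1 (PS D) (A,f) (B,g) (C,e) y' x', cmp2 K A B C \<tau> \<sigma>)"
  by (auto simp: pseudoslice_def slice_Hom_def Let_def slice_cmp1_def)

lemma PS_Ar: "s \<in> Ar (Hom (PS D) (A,f) (B,g)) \<Longrightarrow> \<exists>x y. s \<in> hom (Hom (PS D) (A,f) (B,g)) x y" by (auto simp: hom_def)

lemma PS_Hom_category: assumes o: "A \<in> Obj K" "B \<in> Obj K" "D \<in> Obj K" and f: "f \<in> Ob (Hom K A D)" and g: "g \<in> Ob (Hom K B D)"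
  shows "category (Hom (PS D) (A,f) (B,g))"
proof (rule category.intro)
  interpret AB: category "Hom K A B" using Hom_category o by auto
  interpret AD: category "Hom K A D" using Hom_category o by auto
  fix x y z w s t r
  { assume "s \<in> Ar (Hom (PS D) (A,f) (B,g))" then obtain x y where "s \<in> hom (Hom (PS D) (A,f) (B,g)) x y" using PS_Ar by blast
    then show "src (Hom (PS D) (A,f) (B,g)) s \<in> Ob (Hom (PS D) (A,f) (B,g))" "tgt (Hom (PS D) (A,f) (B,g)) s \<in> Ob (Hom (PS D) (A,f) (B,g))"
      by (auto simp: PS_hom) (auto simp: pseudoslice_def slice_Hom_def Let_def) }
  { assume x: "x \<in> Ob (Hom (PS D) (A,f) (B,g))"
    obtain h \<alpha> where e: "x = (h,\<alpha>)" by (cases x)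
    have h: "h \<in> Ob (Hom K A B)" and a: "\<alpha> \<in> hom (Hom K A D) f (cmp1 K A B D g h)" using x unfolding e PS_Ob by auto
    show "idn (Hom (PS D) (A,f) (B,g)) x \<in> hom (Hom (PS D) (A,f) (B,g)) x x"
      using x h AD.idn_left[OF a] by (auto simp: PS_hom PS_sel e AB.idn_hom lwhisker_def cmp2_idn o g) }
  { assume "s \<in> hom (Hom (PS D) (A,f) (B,g)) x y" 
    then obtain \<sigma> where s: "s = (x,y,\<sigma>)" "x \<in> Ob (Hom (PS D) (A,f) (B,g))" "y \<in> Ob (Hom (PS D) (A,f) (B,g))"
      "\<sigma> \<in> hom (Hom K A B) (fst x) (fst y)" "lwhisker K A B D g \<sigma> \<cdot>\<^bsub>Hom K A D\<^esub> snd x = snd y" by (auto simp: PS_hom)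
    show "idn (Hom (PS D) (A,f) (B,g)) y \<cdot>\<^bsub>Hom (PS D) (A,f) (B,g)\<^esub> s = s" "s \<cdot>\<^bsub>Hom (PS D) (A,f) (B,g)\<^esub> idn (Hom (PS D) (A,f) (B,g)) x = s"
      by (auto simp: s(1) PS_sel AB.idn_left[OF s(4)] AB.idn_right[OF s(4)])
    assume "t \<in> hom (Hom (PS D) (A,f) (B,g)) y z" 
    then obtain \<tau> where t: "t = (y,z,\<tau>)" "z \<in> Ob (Hom (PS D) (A,f) (B,g))"
      "\<tau> \<in> hom (Hom K A B) (fst y) (fst z)" "lwhisker K A B D g \<tau> \<cdot>\<^bsub>Hom K A D\<^esub> snd y = snd z" by (auto simp: PS_hom)
    have x: "snd x \<in> hom (Hom K A D) f (cmp1 K A B D g (fst x))" using s(2) by (cases x) (auto simp: PS_Ob)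
    have "lwhisker K A B D g (\<tau> \<cdot>\<^bsub>Hom K A B\<^esub> \<sigma>) \<cdot>\<^bsub>Hom K A D\<^esub> snd x = snd z"
      by (simp add: lw_cmp[OF o g s(4) t(3)] AD.cmp_assoc[OF x lw_hom[OF o g s(4)] lw_hom[OF o g t(3)]] s(5) t(4))
    then show "t \<cdot>\<^bsub>Hom (PS D) (A,f) (B,g)\<^esub> s \<in> hom (Hom (PS D) (A,f) (B,g)) x z"
      using s t AB.cmp_hom by (auto simp: PS_hom PS_sel)
    assume "r \<in> hom (Hom (PS D) (A,f) (B,g)) z w"
    then obtain \<rho> where r: "r = (z,w,\<rho>)" "\<rho> \<in> hom (Hom K A B) (fst z) (fst w)" by (auto simp: PS_hom)
    show "(r \<cdot>\<^bsub>Hom (PS D) (A,f) (B,g)\<^esub> t) \<cdot>\<^bsub>Hom (PS D) (A,f) (B,g)\<^esub> s = r \<cdot>\<^bsub>Hom (PS D) (A,f) (B,g)\<^esub> (t \<cdot>\<^bsub>Hom (PS D) (A,f) (B,g)\<^esub> s)"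
      unfolding s(1) t(1) r(1) PS_sel AB.cmp_assoc[OF s(4) t(3) r(2)] .. }
qed

proposition two_category_pseudoslice: assumes D: "D \<in> Obj K" shows "two_category (PS D)"
proof (rule two_category.intro)
  fix X Y Z W and h k l s t r and h' h'' k' k'' s' t'
  obtain A B C E :: 'o and f g e d :: 'm where XYZ: "X = (A,f)" "Y = (B,g)" "Z = (C,e)" "W = (E,d)" by (metis surj_pair)
  assume "X \<in> Obj (PS D)" then have A: "A \<in> Obj K" and f: "f \<in> Ob (Hom K A D)" by (auto simp: XYZ PS_Obj)
  interpret AD: category "Hom K A D" using Hom_category A D by auto
  interpret AA: category "Hom K A A" using Hom_category A D by auto
  have cid: "cmp1 K A A D f (id1 K A) = f" by (rule cmp1_id_right[OF A D f])
  show "id1 (PS D) X \<in> Ob (Hom (PS D) X X)"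
    unfolding XYZ PS_sel PS_Ob cid using id1_Hom[OF A] AD.idn_hom[OF f] iso_idn[OF AD.category_axioms f] by auto
  assume "Y \<in> Obj (PS D)" then have B: "B \<in> Obj K" and g: "g \<in> Ob (Hom K B D)" by (auto simp: XYZ PS_Obj)
  interpret AB: category "Hom K A B" using Hom_category A B by auto
  interpret BB: category "Hom K B B" using Hom_category A B by auto
  interpret BD: category "Hom K B D" using Hom_category D B by auto
  show "category (Hom (PS D) X Y)" unfolding XYZ by (rule PS_Hom_category[OF A B D f g])
  have cl: "cmp1 (PS D) X Y Y (id1 (PS D) Y) x = x" "cmp1 (PS D) X X Y x (id1 (PS D) X) = x" if "x \<in> Ob (Hom (PS D) X Y)" for x
  proof -
    obtain h \<alpha> where e: "x = (h,\<alpha>)" by (cases x)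
    have h: "h \<in> Ob (Hom K A B)" and a: "\<alpha> \<in> hom (Hom K A D) f (cmp1 K A B D g h)" using that unfolding e XYZ PS_Ob by auto
    show "cmp1 (PS D) X Y Y (id1 (PS D) Y) x = x" "cmp1 (PS D) X X Y x (id1 (PS D) X) = x"
      unfolding XYZ e PS_sel using a AD.idn_left[OF a] AD.idn_right[OF a] cmp2_id_right[OF A D]
      by (auto simp: rwhisker_def cmp1_id_left cmp1_id_right A B h cmp2_idn D g hom_iff)
  qed
  { assume "h \<in> Ob (Hom (PS D) X Y)" then show "cmp1 (PS D) X Y Y (id1 (PS D) Y) h = h" "cmp1 (PS D) X X Y h (id1 (PS D) X) = h" using cl by auto }
  { assume "s \<in> Ar (Hom (PS D) X Y)"
    then obtain x y \<sigma> where s: "s = (x,y,\<sigma>)" "x \<in> Ob (Hom (PS D) X Y)" "y \<in> Ob (Hom (PS D) X Y)"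
      "\<sigma> \<in> Ar (Hom K A B)" by (metis PS_Ar PS_hom XYZ hom_iff)
    show "cmp2 (PS D) X Y Y (idn (Hom (PS D) Y Y) (id1 (PS D) Y)) s = s" 
      using cl[OF s(2)] cl[OF s(3)] cmp2_id_left[OF A B s(4)] unfolding XYZ s(1) PS_sel by simp
    show "cmp2 (PS D) X X Y s (idn (Hom (PS D) X X) (id1 (PS D) X)) = s" 
      using cl[OF s(2)] cl[OF s(3)] cmp2_id_right[OF A B s(4)] unfolding XYZ s(1) PS_sel by simp }
  assume "Z \<in> Obj (PS D)" then have C: "C \<in> Obj K" and e: "e \<in> Ob (Hom K C D)" by (auto simp: XYZ PS_Obj)
  interpret AC: category "Hom K A C" using Hom_category A C by auto
  interpret BC: category "Hom K B C" using Hom_category B C by auto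
  have cmpOb: "cmp1 (PS D) X Y Z y x \<in> Ob (Hom (PS D) X Z)" and cmpH: "fst (cmp1 (PS D) X Y Z y x) = cmp1 K A B C (fst y) (fst x)"
     if "x \<in> Ob (Hom (PS D) X Y)" "y \<in> Ob (Hom (PS D) Y Z)" for x y
  proof -
    obtain h \<alpha> k \<beta> where ee: "x = (h,\<alpha>)" "y = (k,\<beta>)" by (cases x; cases y)
    have h: "h \<in> Ob (Hom K A B)" and a: "\<alpha> \<in> hom (Hom K A D) f (cmp1 K A B D g h)" "is_iso (Hom K A D) \<alpha>"
     and k: "k \<in> Ob (Hom K B C)" and b: "\<beta> \<in> hom (Hom K B D) g (cmp1 K B C D e k)" "is_iso (Hom K B D) \<beta>"
      using that unfolding ee XYZ PS_Ob by auto
    note w = rw_hom[OF A B D h b(1), unfolded cmp1_assoc[OF A B C D h k e]]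
    show "cmp1 (PS D) X Y Z y x \<in> Ob (Hom (PS D) X Z)"
      unfolding XYZ ee PS_sel PS_Ob using AD.cmp_hom[OF a(1) w] iso_cmp[OF AD.category_axioms a(2) rw_iso[OF A B D h b] a(1) w] cmp1_Hom[OF A B C h k] by auto
    show "fst (cmp1 (PS D) X Y Z y x) = cmp1 K A B C (fst y) (fst x)" unfolding ee XYZ PS_sel by simp
  qed
  { assume "h \<in> Ob (Hom (PS D) X Y)" "k \<in> Ob (Hom (PS D) Y Z)" 
    note hk = this
    then show "cmp1 (PS D) X Y Z k h \<in> Ob (Hom (PS D) X Z)" using cmpOb by auto
    have "fst h \<in> Ob (Hom K A B)" "fst k \<in> Ob (Hom K B C)" using hk by (cases h; cases k; auto simp: XYZ PS_Ob)+
    then show "cmp2 (PS D) X Y Z (idn (Hom (PS D) Y Z) k) (idn (Hom (PS D) X Y) h) = idn (Hom (PS D) X Z) (cmp1 (PS D) X Y Z k h)"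
      using cmpH[OF hk] cmp2_idn[OF A B C] unfolding XYZ PS_sel by auto }
  { assume "s \<in> hom (Hom (PS D) X Y) h h'" "t \<in> hom (Hom (PS D) Y Z) k k'"
    then obtain \<sigma> \<tau> where s: "s = (h,h',\<sigma>)" "h \<in> Ob (Hom (PS D) X Y)" "h' \<in> Ob (Hom (PS D) X Y)" "\<sigma> \<in> hom (Hom K A B) (fst h) (fst h')"
        "lwhisker K A B D g \<sigma> \<cdot>\<^bsub>Hom K A D\<^esub> snd h = snd h'"
      and t: "t = (k,k',\<tau>)" "k \<in> Ob (Hom (PS D) Y Z)" "k' \<in> Ob (Hom (PS D) Y Z)" "\<tau> \<in> hom (Hom K B C) (fst k) (fst k')"
        "lwhisker K B C D e \<tau> \<cdot>\<^bsub>Hom K B D\<^esub> snd k = snd k'"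
      by (auto simp: PS_hom XYZ)
    obtain H a H' a' k0 b k0' b' where ee: "h = (H,a)" "h' = (H',a')" "k = (k0,b)" "k' = (k0',b')" by (cases h; cases h'; cases k; cases k')
    have h: "H \<in> Ob (Hom K A B)" "a \<in> hom (Hom K A D) f (cmp1 K A B D g H)" and h': "H' \<in> Ob (Hom K A B)" "a' \<in> hom (Hom K A D) f (cmp1 K A B D g H')"
      and k: "k0 \<in> Ob (Hom K B C)" "b \<in> hom (Hom K B D) g (cmp1 K B C D e k0)" and k': "k0' \<in> Ob (Hom K B C)" "b' \<in> hom (Hom K B D) g (cmp1 K B C D e k0')"
      using s(2,3) t(2,3) unfolding ee XYZ PS_Ob by auto
    note ss = s(4,5)[unfolded ee fst_conv snd_conv] and tt = t(4,5)[unfolded ee fst_conv snd_conv]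
    note et = lw_hom[OF B C D e tt(1)]
    have "lwhisker K A C D e (cmp2 K A B C \<tau> \<sigma>) = cmp2 K A B D (lwhisker K B C D e \<tau>) \<sigma>"
      unfolding lwhisker_def by (rule cmp2_assoc[OF A B C D, symmetric]) (use ss tt AD.category_axioms idH[OF C D e] in \<open>auto simp: hom_iff\<close>)
    also have "\<dots> = rwhisker K A B D (lwhisker K B C D e \<tau>) H' \<cdot>\<^bsub>Hom K A D\<^esub> lwhisker K A B D (cmp1 K B C D e k0) \<sigma>"
      by (rule hcomp_eq(1)[OF A B D ss(1) et])
    finally have 1: "lwhisker K A C D e (cmp2 K A B C \<tau> \<sigma>) = rwhisker K A B D (lwhisker K B C D e \<tau>) H' \<cdot>\<^bsub>Hom K A D\<^esub> lwhisker K A B D (cmp1 K B C D e k0) \<sigma>" .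
    have 2: "lwhisker K A B D (cmp1 K B C D e k0) \<sigma> \<cdot>\<^bsub>Hom K A D\<^esub> rwhisker K A B D b H = rwhisker K A B D b H' \<cdot>\<^bsub>Hom K A D\<^esub> lwhisker K A B D g \<sigma>"
      using hcomp_eq[OF A B D ss(1) k(2)] by simp
    note ek = cmp1_Hom[OF B C D k(1) e]
    note w1 = rw_hom[OF A B D h'(1) et] and w2 = lw_hom[OF A B D ek ss(1)] and w3 = rw_hom[OF A B D h(1) k(2)] and w4 = rw_hom[OF A B D h'(1) k(2)] and w5 = lw_hom[OF A B D g ss(1)]
    have key: "lwhisker K A C D e (cmp2 K A B C \<tau> \<sigma>) \<cdot>\<^bsub>Hom K A D\<^esub> (rwhisker K A B D b H \<cdot>\<^bsub>Hom K A D\<^esub> a) = rwhisker K A B D b' H' \<cdot>\<^bsub>Hom K A D\<^esub> a'"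
      unfolding 1 tt(2)[symmetric] ss(2)[symmetric] rw_cmp[OF A B D h'(1) k(2) et]
      by (metis 2 AD.cmp_assoc[OF AD.cmp_hom[OF h(2) w3] w2 w1] AD.cmp_assoc[OF h(2) w3 w2] AD.cmp_assoc[OF h(2) w5 w4]
          AD.cmp_assoc[OF AD.cmp_hom[OF h(2) w5] w4 w1])
    show "cmp2 (PS D) X Y Z t s \<in> hom (Hom (PS D) X Z) (cmp1 (PS D) X Y Z k h) (cmp1 (PS D) X Y Z k' h')"
      using cmpOb[OF s(2) t(2)] cmpOb[OF s(3) t(3)] cmp2_Hom[OF A B C ss(1) tt(1)] key
      unfolding s(1) t(1) XYZ ee PS_sel PS_hom by auto
    assume "s' \<in> hom (Hom (PS D) X Y) h' h''" "t' \<in> hom (Hom (PS D) Y Z) k' k''"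
    then obtain \<sigma>' \<tau>' where "s' = (h',h'',\<sigma>')" "\<sigma>' \<in> hom (Hom K A B) (fst h') (fst h'')"
      "t' = (k',k'',\<tau>')" "\<tau>' \<in> hom (Hom K B C) (fst k') (fst k'')" by (auto simp: PS_hom XYZ)
    then show "cmp2 (PS D) X Y Z (t' \<cdot>\<^bsub>Hom (PS D) Y Z\<^esub> t) (s' \<cdot>\<^bsub>Hom (PS D) X Y\<^esub> s) = cmp2 (PS D) X Y Z t' s' \<cdot>\<^bsub>Hom (PS D) X Z\<^esub> cmp2 (PS D) X Y Z t s"
      using interchange[OF A B C s(4) _ t(4)] by (simp add: XYZ PS_sel s(1) t(1)) }
  assume "W \<in> Obj (PS D)" then have E: "E \<in> Obj K" and d: "d \<in> Ob (Hom K E D)" by (auto simp: XYZ PS_Obj)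
  have assoc: "cmp1 (PS D) X Y W (cmp1 (PS D) Y Z W z y) x = cmp1 (PS D) X Z W z (cmp1 (PS D) X Y Z y x)"
     if "x \<in> Ob (Hom (PS D) X Y)" "y \<in> Ob (Hom (PS D) Y Z)" "z \<in> Ob (Hom (PS D) Z W)" for x y z
  proof -
    obtain h a k b l c where ee: "x = (h,a)" "y = (k,b)" "z = (l,c)" by (cases x; cases y; cases z)
    have h: "h \<in> Ob (Hom K A B)" and a: "a \<in> hom (Hom K A D) f (cmp1 K A B D g h)" 
     and k: "k \<in> Ob (Hom K B C)" and b: "b \<in> hom (Hom K B D) g (cmp1 K B C D e k)" 
     and l: "l \<in> Ob (Hom K C E)" and c: "c \<in> hom (Hom K C D) e (cmp1 K C E D d l)" 
      using that unfolding ee XYZ PS_Ob by auto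
    note w1 = rw_hom[OF B C D k c]
    have q: "rwhisker K A B D (rwhisker K B C D c k) h = rwhisker K A C D c (cmp1 K A B C k h)"
      unfolding rwhisker_def cmp2_idn[OF A B C h k, symmetric]
      by (rule cmp2_assoc[OF A B C D]) (use idH[OF A B h] idH[OF B C k] c in \<open>auto simp: hom_iff\<close>)
    show ?thesis unfolding ee XYZ PS_sel cmp1_assoc[OF A B C E h k l] rw_cmp[OF A B D h b w1] q[symmetric]
      using AD.cmp_assoc[OF a rw_hom[OF A B D h b] rw_hom[OF A B D h w1]] by simp
  qed
  { assume "h \<in> Ob (Hom (PS D) X Y)" "k \<in> Ob (Hom (PS D) Y Z)" "l \<in> Ob (Hom (PS D) Z W)"
    then show "cmp1 (PS D) X Y W (cmp1 (PS D) Y Z W l k) h = cmp1 (PS D) X Z W l (cmp1 (PS D) X Y Z k h)" using assoc by auto }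
  { assume "s \<in> Ar (Hom (PS D) X Y)" "t \<in> Ar (Hom (PS D) Y Z)" "r \<in> Ar (Hom (PS D) Z W)"
    then obtain x x' y y' z z' \<sigma> \<tau> \<rho> where "s = (x,x',\<sigma>)" "x \<in> Ob (Hom (PS D) X Y)" "x' \<in> Ob (Hom (PS D) X Y)" "\<sigma> \<in> Ar (Hom K A B)"
      "t = (y,y',\<tau>)" "y \<in> Ob (Hom (PS D) Y Z)" "y' \<in> Ob (Hom (PS D) Y Z)" "\<tau> \<in> Ar (Hom K B C)"
      "r = (z,z',\<rho>)" "z \<in> Ob (Hom (PS D) Z W)" "z' \<in> Ob (Hom (PS D) Z W)" "\<rho> \<in> Ar (Hom K C E)" by (metis PS_Ar PS_hom XYZ hom_iff)
    then show "cmp2 (PS D) X Y W (cmp2 (PS D) Y Z W r t) s = cmp2 (PS D) X Z W r (cmp2 (PS D) X Y Z t s)"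
      using assoc cmp2_assoc[OF A B C E] by (simp add: XYZ PS_sel) }
qed

end

lemma id_geom: assumes "category E" shows "geometric_morphism E E (id_geom E)"
proof -
  note i = id_functor[OF assms]
  have e: "cmp_ftr E (id_ftr E) (id_ftr E) = id_ftr E" using cmp_id_right[OF i] .
  have n: "nat_trans E E (id_ftr E) (id_ftr E) (\<lambda>x\<in>Ob E. idn E x)"
    using nt_id[OF assms assms i] by (simp add: id_ftr_def cong: restrict_cong)
  have x: "x \<in> Ob E \<Longrightarrow> idn E x \<in> Ar E \<and> idn E x \<cdot>\<^bsub>E\<^esub> idn E x = idn E x" for x
    using category.idn_hom[OF assms] category.idn_left[OF assms category.idn_hom[OF assms]] by (auto simp: hom_iff)
  show ?thesis using i n x left_exact_id[OF assms] unfolding geometric_morphism_def id_geom_def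
    by (simp add: e) (simp add: id_ftr_def)
qed

lemma geom_dest: assumes "geometric_morphism E F f"
  shows "is_functor F E (inv_im f)" "is_functor E F (dir_im f)"
     "nat_trans F F (id_ftr F) (cmp_ftr F (dir_im f) (inv_im f)) (adj_unit f)"
     "nat_trans E E (cmp_ftr E (inv_im f) (dir_im f)) (id_ftr E) (adj_counit f)"
     "\<And>x. x \<in> Ob F \<Longrightarrow> adj_counit f (fob (inv_im f) x) \<cdot>\<^bsub>E\<^esub> far (inv_im f) (adj_unit f x)
        = idn E (fob (inv_im f) x)"
     "\<And>y. y \<in> Ob E \<Longrightarrow> far (dir_im f) (adj_counit f y) \<cdot>\<^bsub>F\<^esub> adj_unit f (fob (dir_im f) y)
        = idn F (fob (dir_im f) y)"
     "left_exact F E (inv_im f)"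
  using assms unfolding geometric_morphism_def by auto

lemma unit_hom: "geometric_morphism E F f \<Longrightarrow> x \<in> Ob F \<Longrightarrow> adj_unit f x \<in> hom F x (fob (dir_im f) (fob (inv_im f) x))"
  using nt_hom[OF geom_dest(3), of E F f x] by (simp add: cmp_fob id_ftr_def)
lemma counit_hom: "geometric_morphism E F f \<Longrightarrow> x \<in> Ob E \<Longrightarrow> adj_counit f x \<in> hom E (fob (inv_im f) (fob (dir_im f) x)) x"
  using nt_hom[OF geom_dest(4), of E F f x] by (simp add: cmp_fob id_ftr_def)
lemma unit_nat: "geometric_morphism E F f \<Longrightarrow> h \<in> hom F x y \<Longrightarrow> adj_unit f y \<cdot>\<^bsub>F\<^esub> h = far (dir_im f) (far (inv_im f) h) \<cdot>\<^bsub>F\<^esub> adj_unit f x"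
  using nt_nat[OF geom_dest(3), of E F f h x y] by (simp add: cmp_far id_ftr_def hom_iff)
lemma counit_nat: "geometric_morphism E F f \<Longrightarrow> h \<in> hom E x y \<Longrightarrow> adj_counit f y \<cdot>\<^bsub>E\<^esub> far (inv_im f) (far (dir_im f) h) = h \<cdot>\<^bsub>E\<^esub> adj_counit f x"
  using nt_nat[OF geom_dest(4), of E F f h x y] by (simp add: cmp_far id_ftr_def hom_iff)

lemma cmp_geom:
  assumes cats: "category A" "category B" "category C"
    and f: "geometric_morphism A B f" and g: "geometric_morphism B C g"
  shows "geometric_morphism A C (cmp_geom A B C g f)"
proof -
  interpret A: category A by fact
  interpret B: category B by fact
  interpret C: category C by fact
  let ?fi = "inv_im f" and ?fd = "dir_im f" and ?gi = "inv_im g" and ?gd = "dir_im g"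
  note F = geom_dest[OF f] and G = geom_dest[OF g]
  have inv: "is_functor C A (cmp_ftr C ?fi ?gi)" by (rule cmp_functor[OF cats(3) G(1) F(1)])
  have dir: "is_functor A C (cmp_ftr A ?gd ?fd)" by (rule cmp_functor[OF cats(1) F(2) G(2)])
  note gi = functor_hom[OF G(1)] functor_Ob[OF G(1)]
  note gd = functor_hom[OF G(2)] functor_Ob[OF G(2)]
  note fi = functor_hom[OF F(1)] functor_Ob[OF F(1)]
  note fd = functor_hom[OF F(2)] functor_Ob[OF F(2)]
  note uf = unit_hom[OF f] and ug = unit_hom[OF g] and cf = counit_hom[OF f] and cg = counit_hom[OF g]
  have un: "nat_trans C C (id_ftr C) (cmp_ftr C (cmp_ftr A ?gd ?fd) (cmp_ftr C ?fi ?gi))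
     (\<lambda>c \<in> Ob C. far ?gd (adj_unit f (fob ?gi c)) \<cdot>\<^bsub>C\<^esub> adj_unit g c)"
  proof (rule ntI)
    fix x assume x: "x \<in> Ob C"
    then show "(\<lambda>c \<in> Ob C. far ?gd (adj_unit f (fob ?gi c)) \<cdot>\<^bsub>C\<^esub> adj_unit g c) x \<in>
      hom C (fob (id_ftr C) x) (fob (cmp_ftr C (cmp_ftr A ?gd ?fd) (cmp_ftr C ?fi ?gi)) x)"
      using C.cmp_hom[OF ug[OF x] gd(1)[OF uf[OF gi(2)[OF x]]]] gi fi by (simp add: cmp_fob id_ftr_def)
  next
    fix h x y assume h: "h \<in> hom C x y"
    then have xy: "x \<in> Ob C" "y \<in> Ob C" using hom_Ob[OF cats(3) h] by auto
    have gih: "far ?gi h \<in> hom B (fob ?gi x) (fob ?gi y)" using gi h by auto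
    have "(far ?gd (adj_unit f (fob ?gi y)) \<cdot>\<^bsub>C\<^esub> adj_unit g y) \<cdot>\<^bsub>C\<^esub> h
      = far ?gd (adj_unit f (fob ?gi y)) \<cdot>\<^bsub>C\<^esub> (adj_unit g y \<cdot>\<^bsub>C\<^esub> h)"
      by (rule C.cmp_assoc[OF h ug[OF xy(2)] gd(1)[OF uf[OF gi(2)[OF xy(2)]]]])
    also have "\<dots> = far ?gd (adj_unit f (fob ?gi y)) \<cdot>\<^bsub>C\<^esub> (far ?gd (far ?gi h) \<cdot>\<^bsub>C\<^esub> adj_unit g x)"
      by (simp add: unit_nat[OF g h])
    also have "\<dots> = (far ?gd (adj_unit f (fob ?gi y)) \<cdot>\<^bsub>C\<^esub> far ?gd (far ?gi h)) \<cdot>\<^bsub>C\<^esub> adj_unit g x"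
      by (rule C.cmp_assoc[OF ug[OF xy(1)] gd(1)[OF gih] gd(1)[OF uf[OF gi(2)[OF xy(2)]]], symmetric])
    also have "\<dots> = far ?gd (adj_unit f (fob ?gi y) \<cdot>\<^bsub>B\<^esub> far ?gi h) \<cdot>\<^bsub>C\<^esub> adj_unit g x"
      by (simp add: functor_cmp[OF G(2) gih uf[OF gi(2)[OF xy(2)]]])
    also have "\<dots> = far ?gd (far ?fd (far ?fi (far ?gi h)) \<cdot>\<^bsub>B\<^esub> adj_unit f (fob ?gi x)) \<cdot>\<^bsub>C\<^esub> adj_unit g x"
      by (simp add: unit_nat[OF f gih])
    also have "\<dots> = (far ?gd (far ?fd (far ?fi (far ?gi h))) \<cdot>\<^bsub>C\<^esub> far ?gd (adj_unit f (fob ?gi x))) \<cdot>\<^bsub>C\<^esub> adj_unit g x"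
      by (simp add: functor_cmp[OF G(2) uf[OF gi(2)[OF xy(1)]] fd(1)[OF fi(1)[OF gih]]])
    also have "\<dots> = far ?gd (far ?fd (far ?fi (far ?gi h))) \<cdot>\<^bsub>C\<^esub> (far ?gd (adj_unit f (fob ?gi x)) \<cdot>\<^bsub>C\<^esub> adj_unit g x)"
      by (rule C.cmp_assoc[OF ug[OF xy(1)] gd(1)[OF uf[OF gi(2)[OF xy(1)]]] gd(1)[OF fd(1)[OF fi(1)[OF gih]]]])
    finally show "(\<lambda>c \<in> Ob C. far ?gd (adj_unit f (fob ?gi c)) \<cdot>\<^bsub>C\<^esub> adj_unit g c) y \<cdot>\<^bsub>C\<^esub> far (id_ftr C) h
      = far (cmp_ftr C (cmp_ftr A ?gd ?fd) (cmp_ftr C ?fi ?gi)) h \<cdot>\<^bsub>C\<^esub> (\<lambda>c \<in> Ob C. far ?gd (adj_unit f (fob ?gi c)) \<cdot>\<^bsub>C\<^esub> adj_unit g c) x"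
      using xy h fi(1)[OF gih] by (simp add: id_ftr_def cmp_far hom_iff)
  qed auto
  have cn: "nat_trans A A (cmp_ftr A (cmp_ftr C ?fi ?gi) (cmp_ftr A ?gd ?fd)) (id_ftr A)
     (\<lambda>a \<in> Ob A. adj_counit f a \<cdot>\<^bsub>A\<^esub> far ?fi (adj_counit g (fob ?fd a)))"
  proof (rule ntI)
    fix x assume x: "x \<in> Ob A"
    then show "(\<lambda>a \<in> Ob A. adj_counit f a \<cdot>\<^bsub>A\<^esub> far ?fi (adj_counit g (fob ?fd a))) x \<in>
      hom A (fob (cmp_ftr A (cmp_ftr C ?fi ?gi) (cmp_ftr A ?gd ?fd)) x) (fob (id_ftr A) x)"
      using A.cmp_hom[OF fi(1)[OF cg[OF fd(2)[OF x]]] cf[OF x]] gd fd by (simp add: cmp_fob id_ftr_def)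
  next
    fix h x y assume h: "h \<in> hom A x y"
    then have xy: "x \<in> Ob A" "y \<in> Ob A" using hom_Ob[OF cats(1) h] by auto
    have fdh: "far ?fd h \<in> hom B (fob ?fd x) (fob ?fd y)" using fd h by auto
    note gg = gi(1)[OF gd(1)[OF fdh]]
    have "(adj_counit f y \<cdot>\<^bsub>A\<^esub> far ?fi (adj_counit g (fob ?fd y))) \<cdot>\<^bsub>A\<^esub> far ?fi (far ?gi (far ?gd (far ?fd h)))
      = adj_counit f y \<cdot>\<^bsub>A\<^esub> (far ?fi (adj_counit g (fob ?fd y)) \<cdot>\<^bsub>A\<^esub> far ?fi (far ?gi (far ?gd (far ?fd h))))"
      by (rule A.cmp_assoc[OF fi(1)[OF gg] fi(1)[OF cg[OF fd(2)[OF xy(2)]]] cf[OF xy(2)]])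
    also have "\<dots> = adj_counit f y \<cdot>\<^bsub>A\<^esub> far ?fi (adj_counit g (fob ?fd y) \<cdot>\<^bsub>B\<^esub> far ?gi (far ?gd (far ?fd h)))"
      by (simp add: functor_cmp[OF F(1) gg cg[OF fd(2)[OF xy(2)]]])
    also have "\<dots> = adj_counit f y \<cdot>\<^bsub>A\<^esub> far ?fi (far ?fd h \<cdot>\<^bsub>B\<^esub> adj_counit g (fob ?fd x))"
      by (simp add: counit_nat[OF g fdh])
    also have "\<dots> = adj_counit f y \<cdot>\<^bsub>A\<^esub> (far ?fi (far ?fd h) \<cdot>\<^bsub>A\<^esub> far ?fi (adj_counit g (fob ?fd x)))"
      by (simp add: functor_cmp[OF F(1) cg[OF fd(2)[OF xy(1)]] fdh])
    also have "\<dots> = (adj_counit f y \<cdot>\<^bsub>A\<^esub> far ?fi (far ?fd h)) \<cdot>\<^bsub>A\<^esub> far ?fi (adj_counit g (fob ?fd x))"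
      by (rule A.cmp_assoc[OF fi(1)[OF cg[OF fd(2)[OF xy(1)]]] fi(1)[OF fdh] cf[OF xy(2)], symmetric])
    also have "\<dots> = (h \<cdot>\<^bsub>A\<^esub> adj_counit f x) \<cdot>\<^bsub>A\<^esub> far ?fi (adj_counit g (fob ?fd x))"
      by (simp add: counit_nat[OF f h])
    also have "\<dots> = h \<cdot>\<^bsub>A\<^esub> (adj_counit f x \<cdot>\<^bsub>A\<^esub> far ?fi (adj_counit g (fob ?fd x)))"
      by (rule A.cmp_assoc[OF fi(1)[OF cg[OF fd(2)[OF xy(1)]]] cf[OF xy(1)] h])
    finally show "(\<lambda>a \<in> Ob A. adj_counit f a \<cdot>\<^bsub>A\<^esub> far ?fi (adj_counit g (fob ?fd a))) y \<cdot>\<^bsub>A\<^esub>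
         far (cmp_ftr A (cmp_ftr C ?fi ?gi) (cmp_ftr A ?gd ?fd)) h
       = far (id_ftr A) h \<cdot>\<^bsub>A\<^esub> (\<lambda>a \<in> Ob A. adj_counit f a \<cdot>\<^bsub>A\<^esub> far ?fi (adj_counit g (fob ?fd a))) x"
      using xy h gd(1)[OF fdh] by (simp add: id_ftr_def cmp_far hom_iff)
  qed auto
  have tri1: "(adj_counit f (fob ?fi (fob ?gi x)) \<cdot>\<^bsub>A\<^esub> far ?fi (adj_counit g (fob ?fd (fob ?fi (fob ?gi x)))))
      \<cdot>\<^bsub>A\<^esub> far ?fi (far ?gi (far ?gd (adj_unit f (fob ?gi x)) \<cdot>\<^bsub>C\<^esub> adj_unit g x)) = idn A (fob ?fi (fob ?gi x))"
    if x: "x \<in> Ob C" for x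
  proof -
    let ?y = "fob ?gi x" let ?u = "adj_unit f ?y" let ?z = "fob ?fi ?y" let ?w = "fob ?fd ?z"
    have y: "?y \<in> Ob B" and z: "?z \<in> Ob A" and w: "?w \<in> Ob B" using x gi fi fd by auto
    note u = uf[OF y] and v = ug[OF x]
    note gdu = gd(1)[OF u] and giu = gi(1)[OF gd(1)[OF u]] and giv = gi(1)[OF v] and c = cg[OF w] and c' = cg[OF y]
    have "adj_counit g ?w \<cdot>\<^bsub>B\<^esub> far ?gi (far ?gd ?u \<cdot>\<^bsub>C\<^esub> adj_unit g x)
      = adj_counit g ?w \<cdot>\<^bsub>B\<^esub> (far ?gi (far ?gd ?u) \<cdot>\<^bsub>B\<^esub> far ?gi (adj_unit g x))"
      by (simp add: functor_cmp[OF G(1) v gdu])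
    also have "\<dots> = (adj_counit g ?w \<cdot>\<^bsub>B\<^esub> far ?gi (far ?gd ?u)) \<cdot>\<^bsub>B\<^esub> far ?gi (adj_unit g x)"
      by (rule B.cmp_assoc[OF giv giu c, symmetric])
    also have "\<dots> = (?u \<cdot>\<^bsub>B\<^esub> adj_counit g ?y) \<cdot>\<^bsub>B\<^esub> far ?gi (adj_unit g x)" by (simp add: counit_nat[OF g u])
    also have "\<dots> = ?u \<cdot>\<^bsub>B\<^esub> (adj_counit g ?y \<cdot>\<^bsub>B\<^esub> far ?gi (adj_unit g x))" by (rule B.cmp_assoc[OF giv c' u])
    also have "\<dots> = ?u" by (simp add: G(5)[OF x] B.idn_right[OF u])
    finally have e: "adj_counit g ?w \<cdot>\<^bsub>B\<^esub> far ?gi (far ?gd ?u \<cdot>\<^bsub>C\<^esub> adj_unit g x) = ?u" .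
    note k = gi(1)[OF C.cmp_hom[OF v gdu]]
    have "(adj_counit f ?z \<cdot>\<^bsub>A\<^esub> far ?fi (adj_counit g ?w)) \<cdot>\<^bsub>A\<^esub> far ?fi (far ?gi (far ?gd ?u \<cdot>\<^bsub>C\<^esub> adj_unit g x))
      = adj_counit f ?z \<cdot>\<^bsub>A\<^esub> (far ?fi (adj_counit g ?w) \<cdot>\<^bsub>A\<^esub> far ?fi (far ?gi (far ?gd ?u \<cdot>\<^bsub>C\<^esub> adj_unit g x)))"
      by (rule A.cmp_assoc[OF fi(1)[OF k] fi(1)[OF c] cf[OF z]])
    also have "\<dots> = adj_counit f ?z \<cdot>\<^bsub>A\<^esub> far ?fi ?u" by (simp add: functor_cmp[OF F(1) k c, symmetric] e)
    also have "\<dots> = idn A ?z" by (rule F(5)[OF y])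
    finally show ?thesis .
  qed
  have tri2: "far ?gd (far ?fd (adj_counit f y \<cdot>\<^bsub>A\<^esub> far ?fi (adj_counit g (fob ?fd y)))) \<cdot>\<^bsub>C\<^esub>
      (far ?gd (adj_unit f (fob ?gi (fob ?gd (fob ?fd y)))) \<cdot>\<^bsub>C\<^esub> adj_unit g (fob ?gd (fob ?fd y))) = idn C (fob ?gd (fob ?fd y))"
    if y0: "y \<in> Ob A" for y
  proof -
    let ?z = "fob ?fd y" let ?x = "fob ?gd ?z" let ?w = "fob ?gi ?x" let ?c = "adj_counit g ?z"
    have z: "?z \<in> Ob B" and x: "?x \<in> Ob C" and w: "?w \<in> Ob B" using y0 gi gd fi fd by auto
    note c = cg[OF z] and v = ug[OF x] and u = uf[OF w] and d = cf[OF y0]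
    note fic = fi(1)[OF c] and fdc = fd(1)[OF fi(1)[OF c]]
    have "far ?fd (adj_counit f y \<cdot>\<^bsub>A\<^esub> far ?fi ?c) \<cdot>\<^bsub>B\<^esub> adj_unit f ?w
      = (far ?fd (adj_counit f y) \<cdot>\<^bsub>B\<^esub> far ?fd (far ?fi ?c)) \<cdot>\<^bsub>B\<^esub> adj_unit f ?w"
      by (simp add: functor_cmp[OF F(2) fic d])
    also have "\<dots> = far ?fd (adj_counit f y) \<cdot>\<^bsub>B\<^esub> (far ?fd (far ?fi ?c) \<cdot>\<^bsub>B\<^esub> adj_unit f ?w)"
      by (rule B.cmp_assoc[OF u fdc fd(1)[OF d]])
    also have "\<dots> = far ?fd (adj_counit f y) \<cdot>\<^bsub>B\<^esub> (adj_unit f ?z \<cdot>\<^bsub>B\<^esub> ?c)" by (simp add: unit_nat[OF f c])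
    also have "\<dots> = (far ?fd (adj_counit f y) \<cdot>\<^bsub>B\<^esub> adj_unit f ?z) \<cdot>\<^bsub>B\<^esub> ?c"
      by (rule B.cmp_assoc[OF c uf[OF z] fd(1)[OF d], symmetric])
    also have "\<dots> = ?c" by (simp add: F(6)[OF y0] B.idn_left[OF c])
    finally have e: "far ?fd (adj_counit f y \<cdot>\<^bsub>A\<^esub> far ?fi ?c) \<cdot>\<^bsub>B\<^esub> adj_unit f ?w = ?c" .
    note k = fd(1)[OF A.cmp_hom[OF fic d]]
    have "far ?gd (far ?fd (adj_counit f y \<cdot>\<^bsub>A\<^esub> far ?fi ?c)) \<cdot>\<^bsub>C\<^esub> (far ?gd (adj_unit f ?w) \<cdot>\<^bsub>C\<^esub> adj_unit g ?x)
      = (far ?gd (far ?fd (adj_counit f y \<cdot>\<^bsub>A\<^esub> far ?fi ?c)) \<cdot>\<^bsub>C\<^esub> far ?gd (adj_unit f ?w)) \<cdot>\<^bsub>C\<^esub> adj_unit g ?x"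
      by (rule C.cmp_assoc[OF v gd(1)[OF u] gd(1)[OF k], symmetric])
    also have "\<dots> = far ?gd ?c \<cdot>\<^bsub>C\<^esub> adj_unit g ?x" by (simp add: functor_cmp[OF G(2) u k, symmetric] e)
    also have "\<dots> = idn C ?x" by (rule G(6)[OF z])
    finally show ?thesis .
  qed
  have q1: "far ?gd (adj_unit f (fob ?gi x)) \<cdot>\<^bsub>C\<^esub> adj_unit g x \<in> Ar C" if "x \<in> Ob C" for x
    using C.cmp_hom[OF ug[OF that] gd(1)[OF uf[OF gi(2)[OF that]]]] by (simp add: hom_iff)
  have q2: "adj_counit f a \<cdot>\<^bsub>A\<^esub> far ?fi (adj_counit g (fob ?fd a)) \<in> Ar A" if "a \<in> Ob A" for a
    using A.cmp_hom[OF fi(1)[OF cg[OF fd(2)[OF that]]] cf[OF that]] by (simp add: hom_iff)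
  show ?thesis unfolding geometric_morphism_def cmp_geom_def
    using inv dir un cn tri1 tri2 left_exact_cmp[OF cats(3) G(1) G(7) F(7)]
    by (simp add: cmp_fob cmp_far q1 q2 gi fi gd fd)
qed

lemma cmp_geom_id_left: assumes "category A" "category B" "geometric_morphism A B f"
  shows "cmp_geom A B B (id_geom B) f = f"
proof -
  note F = geom_dest[OF assms(3)]
  have e: "adj_unit f \<in> extensional (Ob B)" "adj_counit f \<in> extensional (Ob A)" using F by (auto simp: nat_trans_def)
  have 1: "(\<lambda>c\<in>Ob B. far (id_ftr B) (adj_unit f (fob (id_ftr B) c)) \<cdot>\<^bsub>B\<^esub> (\<lambda>x\<in>Ob B. idn B x) c) = adj_unit f"
    by (rule extensionalityI[OF _ e(1)]) (use unit_hom[OF assms(3)] category.idn_right[OF assms(2) unit_hom[OF assms(3)]] in \<open>auto simp: id_ftr_def hom_iff\<close>)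
  have 2: "(\<lambda>a\<in>Ob A. adj_counit f a \<cdot>\<^bsub>A\<^esub> far (inv_im f) ((\<lambda>x\<in>Ob B. idn B x) (fob (dir_im f) a))) = adj_counit f"
    by (rule extensionalityI[OF _ e(2)])
      (use counit_hom[OF assms(3)] category.idn_right[OF assms(1)] functor_Ob[OF F(2)] functor_idn[OF F(1)] in \<open>auto\<close>)
  show ?thesis unfolding cmp_geom_def id_geom_def
    by (cases f) (use 1 2 cmp_id_right[OF F(1)] cmp_id_left[OF assms(1) F(2)] in simp)
qed

lemma cmp_geom_id_right: assumes "category A" "category B" "geometric_morphism A B f"
  shows "cmp_geom A A B f (id_geom A) = f"
proof -
  note F = geom_dest[OF assms(3)]
  have e: "adj_unit f \<in> extensional (Ob B)" "adj_counit f \<in> extensional (Ob A)" using F by (auto simp: nat_trans_def)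
  have 1: "(\<lambda>c\<in>Ob B. far (dir_im f) ((\<lambda>x\<in>Ob A. idn A x) (fob (inv_im f) c)) \<cdot>\<^bsub>B\<^esub> adj_unit f c) = adj_unit f"
    by (rule extensionalityI[OF _ e(1)])
      (use unit_hom[OF assms(3)] category.idn_left[OF assms(2)] functor_Ob[OF F(1)] functor_idn[OF F(2)] in \<open>auto\<close>)
  have 2: "(\<lambda>a\<in>Ob A. (\<lambda>x\<in>Ob A. idn A x) a \<cdot>\<^bsub>A\<^esub> far (id_ftr A) (adj_counit f (fob (id_ftr A) a))) = adj_counit f"
    by (rule extensionalityI[OF _ e(2)])
      (use counit_hom[OF assms(3)] category.idn_left[OF assms(1) counit_hom[OF assms(3)]] in \<open>auto simp: id_ftr_def hom_iff\<close>)
  show ?thesis unfolding cmp_geom_def id_geom_def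
    by (cases f) (use 1 2 cmp_id_right[OF F(2)] cmp_id_left[OF assms(2) F(1)] in simp)
qed

lemma cmp_geom_assoc: assumes "category A" "category B" "category C" "category D"
  "geometric_morphism A B f" "geometric_morphism B C g" "geometric_morphism C D h"
  shows "cmp_geom A B D (cmp_geom B C D h g) f = cmp_geom A C D h (cmp_geom A B C g f)"
proof -
  note F = geom_dest[OF assms(5)] and G = geom_dest[OF assms(6)] and H = geom_dest[OF assms(7)]
  have "cmp_ftr D (inv_im f) (cmp_ftr D (inv_im g) (inv_im h)) = cmp_ftr D (cmp_ftr C (inv_im f) (inv_im g)) (inv_im h)"
    by (rule cmp_ftr_assoc[OF assms(4) H(1), symmetric])
  moreover have "cmp_ftr A (cmp_ftr B (dir_im h) (dir_im g)) (dir_im f) = cmp_ftr A (dir_im h) (cmp_ftr A (dir_im g) (dir_im f))"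
    by (rule cmp_ftr_assoc[OF assms(1) F(2)])
  moreover have "far (cmp_ftr B (dir_im h) (dir_im g)) (adj_unit f (fob (cmp_ftr D (inv_im g) (inv_im h)) d)) \<cdot>\<^bsub>D\<^esub>
      (far (dir_im h) (adj_unit g (fob (inv_im h) d)) \<cdot>\<^bsub>D\<^esub> adj_unit h d)
    = far (dir_im h) (far (dir_im g) (adj_unit f (fob (inv_im g) (fob (inv_im h) d))) \<cdot>\<^bsub>C\<^esub> adj_unit g (fob (inv_im h) d)) \<cdot>\<^bsub>D\<^esub> adj_unit h d"
    if d: "d \<in> Ob D" for d
  proof -
    have c: "fob (inv_im h) d \<in> Ob C" using functor_Ob[OF H(1) d] .
    have b: "fob (inv_im g) (fob (inv_im h) d) \<in> Ob B" using functor_Ob[OF G(1) c] .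
    note u = unit_hom[OF assms(5) b] and v = unit_hom[OF assms(6) c] and w = unit_hom[OF assms(7) d]
    note gu = functor_hom[OF G(2) u]
    show ?thesis
      using category.cmp_assoc[OF assms(4) w functor_hom[OF H(2) v] functor_hom[OF H(2) gu]] u d
      by (simp add: cmp_fob cmp_far_hom functor_cmp[OF H(2) v gu])
  qed
  moreover have "adj_counit f a \<cdot>\<^bsub>A\<^esub> far (inv_im f) (adj_counit g (fob (dir_im f) a) \<cdot>\<^bsub>B\<^esub> far (inv_im g) (adj_counit h (fob (dir_im g) (fob (dir_im f) a))))
    = (adj_counit f a \<cdot>\<^bsub>A\<^esub> far (inv_im f) (adj_counit g (fob (dir_im f) a))) \<cdot>\<^bsub>A\<^esub> far (cmp_ftr C (inv_im f) (inv_im g)) (adj_counit h (fob (cmp_ftr A (dir_im g) (dir_im f)) a))"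
    if a: "a \<in> Ob A" for a
  proof -
    have b: "fob (dir_im f) a \<in> Ob B" using functor_Ob[OF F(2) a] .
    have c: "fob (dir_im g) (fob (dir_im f) a) \<in> Ob C" using functor_Ob[OF G(2) b] .
    note u = counit_hom[OF assms(5) a] and v = counit_hom[OF assms(6) b] and w = counit_hom[OF assms(7) c]
    note gw = functor_hom[OF G(1) w]
    show ?thesis
      using category.cmp_assoc[OF assms(1) functor_hom[OF F(1) gw] functor_hom[OF F(1) v] u] w a
      by (simp add: cmp_fob cmp_far_hom functor_cmp[OF F(1) gw v])
  qed
  ultimately show ?thesis unfolding cmp_geom_def
    using functor_Ob[OF F(2)] functor_Ob[OF H(1)] by (auto simp: restrict_def fun_eq_iff)
qed

lemma hom_gtop: "s \<in> hom (Hom gtop E F) f g \<longleftrightarrow>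
   (\<exists>\<sigma>. s = (f,g,\<sigma>) \<and> geometric_morphism E F f \<and> geometric_morphism E F g \<and> nat_trans F E (inv_im f) (inv_im g) \<sigma>)"
  by (auto simp: hom_def gtop_def)

lemma nt_eq: "nat_trans C D F G s \<Longrightarrow> t \<in> extensional (Ob C) \<Longrightarrow> (\<And>x. x \<in> Ob C \<Longrightarrow> t x = s x) \<Longrightarrow> t = s"
  by (rule extensionalityI) (auto simp: nat_trans_def)

lemma Hom_gtop_category: assumes "category E" "category F" shows "category (Hom gtop E F)"
proof
  fix f g h s t assume "s \<in> hom (Hom gtop E F) f g" "t \<in> hom (Hom gtop E F) g h"
  then show "t \<cdot>\<^bsub>Hom gtop E F\<^esub> s \<in> hom (Hom gtop E F) f h"
    using nt_vcomp[OF assms(2,1), where F="inv_im f" and G="inv_im g" and H="inv_im h"]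
    by (auto simp: hom_gtop dest: geom_dest(1)) (auto simp: gtop_def dest: geom_dest(1))
next
  fix f assume "f \<in> Ob (Hom gtop E F)"
  then show "idn (Hom gtop E F) f \<in> hom (Hom gtop E F) f f"
    by (auto simp: hom_gtop) (auto simp: gtop_def intro!: nt_id[OF assms(2,1)] geom_dest(1))
next
  fix f g s assume "s \<in> hom (Hom gtop E F) f g" 
  then show "idn (Hom gtop E F) g \<cdot>\<^bsub>Hom gtop E F\<^esub> s = s"  
    by (auto simp: hom_gtop) (auto simp: gtop_def intro!: nt_eq category.idn_left[OF assms(1)] dest: nt_hom)
next
  fix f g s assume "s \<in> hom (Hom gtop E F) f g" 
  then show "s \<cdot>\<^bsub>Hom gtop E F\<^esub> idn (Hom gtop E F) f = s"  
    by (auto simp: hom_gtop) (auto simp: gtop_def intro!: nt_eq category.idn_right[OF assms(1)] dest: nt_hom)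
next
  fix f g h k s t r assume "s \<in> hom (Hom gtop E F) f g" "t \<in> hom (Hom gtop E F) g h" "r \<in> hom (Hom gtop E F) h k"
  then show "(r \<cdot>\<^bsub>Hom gtop E F\<^esub> t) \<cdot>\<^bsub>Hom gtop E F\<^esub> s = r \<cdot>\<^bsub>Hom gtop E F\<^esub> (t \<cdot>\<^bsub>Hom gtop E F\<^esub> s)"
    by (auto simp: hom_gtop) (auto simp: gtop_def restrict_def fun_eq_iff intro!: category.cmp_assoc[OF assms(1)] dest: nt_hom)
qed (auto simp: gtop_def)

lemma gtop_sel:
  "Obj gtop = {E. grothendieck_topos E}" "id1 gtop = id_geom" "cmp1 gtop = cmp_geom"
  "cmp2 gtop A B C (g,g',\<tau>) (f,f',\<sigma>) = (cmp_geom A B C g f, cmp_geom A B C g' f',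
         \<lambda>c \<in> Ob C. \<sigma> (fob (inv_im g') c) \<cdot>\<^bsub>A\<^esub> far (inv_im f) (\<tau> c))"
  "Ob (Hom gtop E F) = {f. geometric_morphism E F f}"
  "idn (Hom gtop E F) f = (f, f, \<lambda>x \<in> Ob F. idn E (fob (inv_im f) x))"
  "(g1,h,\<tau>) \<cdot>\<^bsub>Hom gtop E F\<^esub> (f,g2,\<sigma>) = (f, h, \<lambda>x \<in> Ob F. \<tau> x \<cdot>\<^bsub>E\<^esub> \<sigma> x)"
  by (auto simp: gtop_def)

lemma Ar_gtop: "s \<in> Ar (Hom gtop E F) \<Longrightarrow> \<exists>f g. s \<in> hom (Hom gtop E F) f g" by (auto simp: hom_def)

lemma inv_cmp_geom: "inv_im (cmp_geom A B C g f) = cmp_ftr C (inv_im f) (inv_im g)" by (simp add: cmp_geom_def)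

lemma hcomp_nt:
  assumes cats: "category A" "category B" "category C"
   and "geometric_morphism A B f" "geometric_morphism A B f'" "geometric_morphism B C g" "geometric_morphism B C g'"
   and s: "nat_trans B A (inv_im f) (inv_im f') \<sigma>" and t: "nat_trans C B (inv_im g) (inv_im g') \<tau>"
  shows "nat_trans C A (cmp_ftr C (inv_im f) (inv_im g)) (cmp_ftr C (inv_im f') (inv_im g'))
     (\<lambda>c \<in> Ob C. \<sigma> (fob (inv_im g') c) \<cdot>\<^bsub>A\<^esub> far (inv_im f) (\<tau> c))"
proof (rule ntI)
  note F = geom_dest(1)[OF assms(4)] and F' = geom_dest(1)[OF assms(5)] and G = geom_dest(1)[OF assms(6)] and G' = geom_dest(1)[OF assms(7)]
  interpret A: category A by fact
  {fix x assume x: "x \<in> Ob C"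
  show "(\<lambda>c \<in> Ob C. \<sigma> (fob (inv_im g') c) \<cdot>\<^bsub>A\<^esub> far (inv_im f) (\<tau> c)) x \<in> hom A (fob (cmp_ftr C (inv_im f) (inv_im g)) x) (fob (cmp_ftr C (inv_im f') (inv_im g')) x)"
    using A.cmp_hom[OF functor_hom[OF F nt_hom[OF t x]] nt_hom[OF s functor_Ob[OF G' x]]] x by (simp add: cmp_fob) }
  fix h x y assume h: "h \<in> hom C x y"
  have x: "x \<in> Ob C" and y: "y \<in> Ob C" using hom_Ob[OF cats(3) h] by auto
  note tx = nt_hom[OF t x] and ty = nt_hom[OF t y] and gh = functor_hom[OF G h] and gh' = functor_hom[OF G' h]
  note sx = nt_hom[OF s functor_Ob[OF G' x]] and sy = nt_hom[OF s functor_Ob[OF G' y]]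
  have "(\<sigma> (fob (inv_im g') y) \<cdot>\<^bsub>A\<^esub> far (inv_im f) (\<tau> y)) \<cdot>\<^bsub>A\<^esub> far (inv_im f) (far (inv_im g) h)
    = \<sigma> (fob (inv_im g') y) \<cdot>\<^bsub>A\<^esub> (far (inv_im f) (\<tau> y) \<cdot>\<^bsub>A\<^esub> far (inv_im f) (far (inv_im g) h))"
    by (rule A.cmp_assoc[OF functor_hom[OF F gh] functor_hom[OF F ty] sy])
  also have "\<dots> = \<sigma> (fob (inv_im g') y) \<cdot>\<^bsub>A\<^esub> (far (inv_im f) (far (inv_im g') h) \<cdot>\<^bsub>A\<^esub> far (inv_im f) (\<tau> x))"
    by (simp add: functor_cmp[OF F gh ty, symmetric] functor_cmp[OF F tx gh', symmetric] nt_nat[OF t h])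
  also have "\<dots> = (\<sigma> (fob (inv_im g') y) \<cdot>\<^bsub>A\<^esub> far (inv_im f) (far (inv_im g') h)) \<cdot>\<^bsub>A\<^esub> far (inv_im f) (\<tau> x)"
    by (rule A.cmp_assoc[OF functor_hom[OF F tx] functor_hom[OF F gh'] sy, symmetric])
  also have "\<dots> = (far (inv_im f') (far (inv_im g') h) \<cdot>\<^bsub>A\<^esub> \<sigma> (fob (inv_im g') x)) \<cdot>\<^bsub>A\<^esub> far (inv_im f) (\<tau> x)"
    by (simp add: nt_nat[OF s gh'])
  also have "\<dots> = far (inv_im f') (far (inv_im g') h) \<cdot>\<^bsub>A\<^esub> (\<sigma> (fob (inv_im g') x) \<cdot>\<^bsub>A\<^esub> far (inv_im f) (\<tau> x))"
    by (rule A.cmp_assoc[OF functor_hom[OF F tx] sx functor_hom[OF F' gh']])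
  finally show "(\<lambda>c \<in> Ob C. \<sigma> (fob (inv_im g') c) \<cdot>\<^bsub>A\<^esub> far (inv_im f) (\<tau> c)) y \<cdot>\<^bsub>A\<^esub> far (cmp_ftr C (inv_im f) (inv_im g)) h
    = far (cmp_ftr C (inv_im f') (inv_im g')) h \<cdot>\<^bsub>A\<^esub> (\<lambda>c \<in> Ob C. \<sigma> (fob (inv_im g') c) \<cdot>\<^bsub>A\<^esub> far (inv_im f) (\<tau> c)) x"
    using x y h by (simp add: cmp_far_hom)
qed auto

proposition two_category_gtop: "two_category (gtop :: (('u,'u) cat, _, _) twocat)"
proof (rule two_category.intro)
  have cat: "A \<in> Obj gtop \<Longrightarrow> category A" for A :: "('u,'u) cat" by (simp add: gtop_sel grothendieck_topos_def)
  fix A B C D :: "('u,'u) cat" and f g h and f' f'' g' g'' and \<sigma> \<tau> \<rho> \<sigma>' \<tau>'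
  assume A: "A \<in> Obj gtop" note cA = cat[OF A]
  show "id1 gtop A \<in> Ob (Hom gtop A A)" using id_geom[OF cA] by (simp add: gtop_sel)
  assume B: "B \<in> Obj gtop" note cB = cat[OF B]
  show "category (Hom gtop A B)" using Hom_gtop_category cA cB by auto
  { assume f: "f \<in> Ob (Hom gtop A B)"
    then show "cmp1 gtop A B B (id1 gtop B) f = f" "cmp1 gtop A A B f (id1 gtop A) = f"
      using cmp_geom_id_left cmp_geom_id_right cA cB by (auto simp: gtop_sel) }
  { assume "\<sigma> \<in> Ar (Hom gtop A B)"
    then obtain f f' s where s: "\<sigma> = (f,f',s)" "geometric_morphism A B f" "geometric_morphism A B f'" "nat_trans B A (inv_im f) (inv_im f') s"
      using Ar_gtop hom_gtop by meson
    show "cmp2 gtop A B B (idn (Hom gtop B B) (id1 gtop B)) \<sigma> = \<sigma>" 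
      unfolding s(1) gtop_sel cmp_geom_id_left[OF cA cB s(2)] cmp_geom_id_left[OF cA cB s(3)]
      using nt_hom[OF s(4)] functor_idn[OF geom_dest(1)[OF s(2)]] category.idn_right[OF cA nt_hom[OF s(4)]]
      by (auto intro!: nt_eq[OF s(4)] simp: id_geom_def id_ftr_def)
    show "cmp2 gtop A A B \<sigma> (idn (Hom gtop A A) (id1 gtop A)) = \<sigma>" 
      unfolding s(1) gtop_sel cmp_geom_id_right[OF cA cB s(2)] cmp_geom_id_right[OF cA cB s(3)]
      using nt_hom[OF s(4)] functor_Ob[OF geom_dest(1)[OF s(3)]] category.idn_left[OF cA nt_hom[OF s(4)]]
      by (auto intro!: nt_eq[OF s(4)] simp: id_geom_def id_ftr_def hom_iff) }
  assume C: "C \<in> Obj gtop" note cC = cat[OF C]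
  { assume "f \<in> Ob (Hom gtop A B)" "g \<in> Ob (Hom gtop B C)"
    then have f: "geometric_morphism A B f" and g: "geometric_morphism B C g" by (auto simp: gtop_sel)
    then show "cmp1 gtop A B C g f \<in> Ob (Hom gtop A C)" using cmp_geom[OF cA cB cC] by (simp add: gtop_sel)
    show "cmp2 gtop A B C (idn (Hom gtop B C) g) (idn (Hom gtop A B) f) = idn (Hom gtop A C) (cmp1 gtop A B C g f)"
      using functor_Ob[OF geom_dest(1)[OF g]] functor_Ob[OF geom_dest(1)[OF f]] functor_idn[OF geom_dest(1)[OF f]] category.idn_left[OF cA category.idn_hom[OF cA]]
      by (auto simp: gtop_sel inv_cmp_geom cmp_fob restrict_def fun_eq_iff) }
  { assume "\<sigma> \<in> hom (Hom gtop A B) f f'" "\<tau> \<in> hom (Hom gtop B C) g g'"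
    then obtain s t where st: "\<sigma> = (f,f',s)" "\<tau> = (g,g',t)" and fg: "geometric_morphism A B f" "geometric_morphism A B f'" "geometric_morphism B C g" "geometric_morphism B C g'"
     and n: "nat_trans B A (inv_im f) (inv_im f') s" "nat_trans C B (inv_im g) (inv_im g') t" by (auto simp: hom_gtop)
    show "cmp2 gtop A B C \<tau> \<sigma> \<in> hom (Hom gtop A C) (cmp1 gtop A B C g f) (cmp1 gtop A B C g' f')"
      unfolding st gtop_sel hom_gtop using hcomp_nt[OF cA cB cC fg n] fg cmp_geom[OF cA cB cC]
      by (auto simp: inv_cmp_geom)
    assume "\<sigma>' \<in> hom (Hom gtop A B) f' f''" "\<tau>' \<in> hom (Hom gtop B C) g' g''"
    then obtain s' t' where st': "\<sigma>' = (f',f'',s')" "\<tau>' = (g',g'',t')" and fg': "geometric_morphism A B f''" "geometric_morphism B C g''"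
     and n': "nat_trans B A (inv_im f') (inv_im f'') s'" "nat_trans C B (inv_im g') (inv_im g'') t'" by (auto simp: hom_gtop)
    note F = geom_dest(1)[OF fg(1)] and F' = geom_dest(1)[OF fg(2)] and F'' = geom_dest(1)[OF fg'(1)]
      and G = geom_dest(1)[OF fg(3)] and G' = geom_dest(1)[OF fg(4)] and G'' = geom_dest(1)[OF fg'(2)]
    have "(s' (fob (inv_im g'') x) \<cdot>\<^bsub>A\<^esub> s (fob (inv_im g'') x)) \<cdot>\<^bsub>A\<^esub> far (inv_im f) (t' x \<cdot>\<^bsub>B\<^esub> t x)
      = (s' (fob (inv_im g'') x) \<cdot>\<^bsub>A\<^esub> far (inv_im f') (t' x)) \<cdot>\<^bsub>A\<^esub> (s (fob (inv_im g') x) \<cdot>\<^bsub>A\<^esub> far (inv_im f) (t x))"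
      if x: "x \<in> Ob C" for x
    proof -
      interpret A: category A by (rule cA)
      note t = nt_hom[OF n(2) x] and t' = nt_hom[OF n'(2) x]
      note s = nt_hom[OF n(1) functor_Ob[OF G'' x]] and s' = nt_hom[OF n'(1) functor_Ob[OF G'' x]] and s0 = nt_hom[OF n(1) functor_Ob[OF G' x]]
      note ft = functor_hom[OF F t] and ft' = functor_hom[OF F t'] and ft'' = functor_hom[OF F' t']
      have e: "s (fob (inv_im g'') x) \<cdot>\<^bsub>A\<^esub> far (inv_im f) (t' x) = far (inv_im f') (t' x) \<cdot>\<^bsub>A\<^esub> s (fob (inv_im g') x)"
        by (rule nt_nat[OF n(1) t'])
      show ?thesis
        unfolding functor_cmp[OF F t t'] A.cmp_assoc[OF A.cmp_hom[OF ft ft'] s s'] A.cmp_assoc[OF ft ft' s, symmetric] e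
          A.cmp_assoc[OF ft s0 ft''] A.cmp_assoc[OF A.cmp_hom[OF ft s0] ft'' s'] ..
    qed
    then show "cmp2 gtop A B C (\<tau>' \<cdot>\<^bsub>Hom gtop B C\<^esub> \<tau>) (\<sigma>' \<cdot>\<^bsub>Hom gtop A B\<^esub> \<sigma>)
          = cmp2 gtop A B C \<tau>' \<sigma>' \<cdot>\<^bsub>Hom gtop A C\<^esub> cmp2 gtop A B C \<tau> \<sigma>"
      unfolding st st' gtop_sel using functor_Ob[OF G''] by (auto simp: restrict_def fun_eq_iff) }
  assume D: "D \<in> Obj gtop" note cD = cat[OF D]
  { assume "f \<in> Ob (Hom gtop A B)" "g \<in> Ob (Hom gtop B C)" "h \<in> Ob (Hom gtop C D)"
    then show "cmp1 gtop A B D (cmp1 gtop B C D h g) f = cmp1 gtop A C D h (cmp1 gtop A B C g f)"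
      using cmp_geom_assoc[OF cA cB cC cD] by (simp add: gtop_sel) }
  { assume "\<rho> \<in> Ar (Hom gtop A B)" "\<sigma> \<in> Ar (Hom gtop B C)" "\<tau> \<in> Ar (Hom gtop C D)"
    then obtain f f' g g' h h' r s t where e: "\<rho> = (f,f',r)" "\<sigma> = (g,g',s)" "\<tau> = (h,h',t)"
      and F: "geometric_morphism A B f" "geometric_morphism A B f'" and G: "geometric_morphism B C g" "geometric_morphism B C g'"
      and H: "geometric_morphism C D h" "geometric_morphism C D h'" 
      and r: "nat_trans B A (inv_im f) (inv_im f') r" and s: "nat_trans C B (inv_im g) (inv_im g') s" 
      and t: "nat_trans D C (inv_im h) (inv_im h') t" by (metis Ar_gtop hom_gtop)
    have "r (fob (inv_im g') (fob (inv_im h') x)) \<cdot>\<^bsub>A\<^esub> far (inv_im f) (s (fob (inv_im h') x) \<cdot>\<^bsub>B\<^esub> far (inv_im g) (t x))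
      = (r (fob (inv_im g') (fob (inv_im h') x)) \<cdot>\<^bsub>A\<^esub> far (inv_im f) (s (fob (inv_im h') x))) \<cdot>\<^bsub>A\<^esub> far (inv_im f) (far (inv_im g) (t x))"
      if x: "x \<in> Ob D" for x
    proof -
      note hx = functor_Ob[OF geom_dest(1)[OF H(2)] x]
      note tx = functor_hom[OF geom_dest(1)[OF G(1)] nt_hom[OF t x]]
      note sx = nt_hom[OF s hx]
      note rx = nt_hom[OF r functor_Ob[OF geom_dest(1)[OF G(2)] hx]]
      note FF = geom_dest(1)[OF F(1)]
      show ?thesis
        by (simp add: functor_cmp[OF FF tx sx] category.cmp_assoc[OF cA functor_hom[OF FF tx] functor_hom[OF FF sx] rx])
    qed
    then show "cmp2 gtop A B D (cmp2 gtop B C D \<tau> \<sigma>) \<rho> = cmp2 gtop A C D \<tau> (cmp2 gtop A B C \<sigma> \<rho>)"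
      unfolding e gtop_sel cmp_geom_assoc[OF cA cB cC cD F(1) G(1) H(1)] cmp_geom_assoc[OF cA cB cC cD F(2) G(2) H(2)]
      using functor_Ob[OF geom_dest(1)[OF H(2)]] nt_hom[OF t]
      by (auto simp: restrict_def fun_eq_iff inv_cmp_geom cmp_fob cmp_far_hom[OF nt_hom[OF t]]) }
qed

end

theory Submission
  imports Defs
begin

text \<open>
  A 1-cell over \<open>E\<close> from \<open>a : T \<rightarrow> E\<close> to \<open>E/X\<close> is determined, up to a unique isomorphism, by its generic section
  \<open>1 \<rightarrow> a\<^sup>* X\<close>, and every section \<open>s\<close> occurs: pulling back along \<open>s\<close> is left exact on \<open>E/X\<close> and has a right adjoint,
  obtained from the dependent product along \<open>s\<close>, which is computed on sheaves. In particular \<open>E/X\<close> is essentially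
  discrete in \<open>GTop/E\<close>.

  The category \<open>T\<close> of arrows of a topos \<open>B\<close> is again a topos, and it is the tensor of \<open>B\<close> with the category
  \<open>0 \<rightarrow> 1\<close> in \<open>GTop\<close>. The terminal object of \<open>T\<close> is an invertible arrow, so a section of an object of \<open>T\<close> is
  determined by its domain component, which is arbitrary. Hence restriction along the inclusion \<open>i0 : B \<rightarrow> T\<close> at \<open>0\<close> is an
  equivalence from the 1-cells \<open>T \<rightarrow> E/X\<close> to the 1-cells \<open>B \<rightarrow> E/X\<close> over \<open>E\<close>.

  Both properties pass to bilimits in \<open>GTop/E\<close> and along equivalences, so \<open>f\<close> inherits them. A 2-cell \<open>f \<circ> e \<Rightarrow> g\<close> of
  1-cells \<open>B \<rightarrow> E\<close> amounts to a 1-cell \<open>T \<rightarrow> E\<close> whose restriction along \<open>i0\<close> lifts to \<open>C\<close>; orthogonality lifts all of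
  it, and uniqueness of lifts makes every 2-cell between 1-cells \<open>B \<rightarrow> C\<close> opcartesian.
\<close>

text \<open>Bilimits and pseudoslices carry coherence conditions for 2-cells. These become automatic
  once the hom-categories into an object are groupoids with trivial automorphisms: parallel 2-cells
  are equal, so the mere existence of a 2-cell is all the information there is. Hence orthogonality
  is phrased with nonempty hom-sets, and pseudocones are put together from arbitrarily chosen
  components.

  A second obstacle is that a Grothendieck topos is only known to be equivalent to sheaves on some
  site. Pullbacks, terminal and initial objects and the dependent product along a global element are
  therefore built from sections of sheaves, and an arrow category is recognised as a topos through
  the product of the site with a two-element order. Adjoints are handled one couniversal arrow at a
  time and assembled into a geometric morphism at the end.

  A 2-cell is a transformation of inverse images, so the end 0 of the tensor is the one whose
  inverse image takes an arrow to its domain.\<close>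

context category
begin

lemma cmp_Ar [simp]: "f \<in> Ar C \<Longrightarrow> g \<in> Ar C \<Longrightarrow> tgt C f = src C g \<Longrightarrow> g \<cdot>\<^bsub>C\<^esub> f \<in> Ar C"
  and src_cmp [simp]: "f \<in> Ar C \<Longrightarrow> g \<in> Ar C \<Longrightarrow> tgt C f = src C g \<Longrightarrow> src C (g \<cdot>\<^bsub>C\<^esub> f) = src C f"
  and tgt_cmp [simp]: "f \<in> Ar C \<Longrightarrow> g \<in> Ar C \<Longrightarrow> tgt C f = src C g \<Longrightarrow> tgt C (g \<cdot>\<^bsub>C\<^esub> f) = tgt C g"
  using cmp_hom[of f "src C f" "tgt C f" g "tgt C g"] by (auto simp: hom_iff)

lemma idn_Ar [simp]: "x \<in> Ob C \<Longrightarrow> idn C x \<in> Ar C"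
  and src_idn [simp]: "x \<in> Ob C \<Longrightarrow> src C (idn C x) = x"
  and tgt_idn [simp]: "x \<in> Ob C \<Longrightarrow> tgt C (idn C x) = x"
  using idn_hom[of x] by (auto simp: hom_iff)

lemma idn_cmp [simp]: "f \<in> Ar C \<Longrightarrow> tgt C f = y \<Longrightarrow> idn C y \<cdot>\<^bsub>C\<^esub> f = f"
  and cmp_idn [simp]: "f \<in> Ar C \<Longrightarrow> src C f = x \<Longrightarrow> f \<cdot>\<^bsub>C\<^esub> idn C x = f"
  using idn_left[of f "src C f" y] idn_right[of f x "tgt C f"] by (auto simp: hom_iff)

lemma assoc: "f \<in> Ar C \<Longrightarrow> g \<in> Ar C \<Longrightarrow> h \<in> Ar C \<Longrightarrow> tgt C f = src C g \<Longrightarrow> tgt C g = src C h \<Longrightarrow>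
    (h \<cdot>\<^bsub>C\<^esub> g) \<cdot>\<^bsub>C\<^esub> f = h \<cdot>\<^bsub>C\<^esub> (g \<cdot>\<^bsub>C\<^esub> f)"
  using cmp_assoc[of f "src C f" "tgt C f" g "tgt C g" h "tgt C h"] by (auto simp: hom_iff)

text \<open>Composites are kept nested to the right by \<open>assoc\<close>. An equation for a
  composite of two arrows then has to be applied in front of a further arrow \<open>x\<close>, and
  this is the form that does it.\<close>

lemma reassoc:
  assumes "g \<cdot>\<^bsub>C\<^esub> f = k" "f \<in> Ar C" "g \<in> Ar C" "tgt C f = src C g" "x \<in> Ar C" "tgt C x = src C f"
  shows "g \<cdot>\<^bsub>C\<^esub> (f \<cdot>\<^bsub>C\<^esub> x) = k \<cdot>\<^bsub>C\<^esub> x"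
  using assms assoc[of x f g] by simp

declare src_Ob [simp] tgt_Ob [simp]

lemma hom_ObD: "f \<in> hom C x y \<Longrightarrow> x \<in> Ob C \<and> y \<in> Ob C"
  by (auto simp: hom_iff)

lemma iso_mono:
  assumes "is_iso C i" "f \<in> Ar C" "g \<in> Ar C" "tgt C f = src C i" "tgt C g = src C i" "i \<cdot>\<^bsub>C\<^esub> f = i \<cdot>\<^bsub>C\<^esub> g"
  shows "f = g"
proof -
  obtain j where j: "j \<in> hom C (tgt C i) (src C i)" "j \<cdot>\<^bsub>C\<^esub> i = idn C (src C i)" and i: "i \<in> Ar C"
    using assms(1) by (auto simp: is_iso_def)
  have "(j \<cdot>\<^bsub>C\<^esub> i) \<cdot>\<^bsub>C\<^esub> f = (j \<cdot>\<^bsub>C\<^esub> i) \<cdot>\<^bsub>C\<^esub> g"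
    using j(1) i assms(2-) by (simp add: hom_iff assoc)
  then show ?thesis using assms i unfolding j(2) by simp
qed

lemma iso_epi:
  assumes "is_iso C i" "f \<in> Ar C" "g \<in> Ar C" "src C f = tgt C i" "src C g = tgt C i" "f \<cdot>\<^bsub>C\<^esub> i = g \<cdot>\<^bsub>C\<^esub> i"
  shows "f = g"
proof -
  obtain j where j: "j \<in> hom C (tgt C i) (src C i)" "i \<cdot>\<^bsub>C\<^esub> j = idn C (tgt C i)" and i: "i \<in> Ar C"
    using assms(1) by (auto simp: is_iso_def)
  have "f \<cdot>\<^bsub>C\<^esub> (i \<cdot>\<^bsub>C\<^esub> j) = g \<cdot>\<^bsub>C\<^esub> (i \<cdot>\<^bsub>C\<^esub> j)"
    using j(1) i assms(2-) by (simp add: hom_iff assoc[symmetric])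
  then show ?thesis using assms i unfolding j(2) by simp
qed

lemma iso_inverse: "is_iso C i \<Longrightarrow> i \<in> hom C x y \<Longrightarrow>
    \<exists>j \<in> hom C y x. j \<cdot>\<^bsub>C\<^esub> i = idn C x \<and> i \<cdot>\<^bsub>C\<^esub> j = idn C y \<and> is_iso C j"
  by (metis isoE isoI)

end

section \<open>Functors and equivalences of categories\<close>

locale ftor = C: category C + D: category D
  for C :: "('o,'a) cat" and D :: "('p,'b) cat" +
  fixes F :: "('o,'a,'p,'b) ftr"
  assumes F: "is_functor C D F"
begin

lemma fob_Ob [simp]: "x \<in> Ob C \<Longrightarrow> fob F x \<in> Ob D"
  using functor_Ob[OF F] .

lemma far_Ar [simp]: "f \<in> Ar C \<Longrightarrow> far F f \<in> Ar D"
  and src_far [simp]: "f \<in> Ar C \<Longrightarrow> src D (far F f) = fob F (src C f)"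
  and tgt_far [simp]: "f \<in> Ar C \<Longrightarrow> tgt D (far F f) = fob F (tgt C f)"
  using functor_hom[OF F, of f "src C f" "tgt C f"] by (auto simp: hom_iff)

lemma far_idn [simp]: "x \<in> Ob C \<Longrightarrow> far F (idn C x) = idn D (fob F x)"
  using functor_idn[OF F] .

lemma far_cmp: "f \<in> Ar C \<Longrightarrow> g \<in> Ar C \<Longrightarrow> tgt C f = src C g \<Longrightarrow> far F (g \<cdot>\<^bsub>C\<^esub> f) = far F g \<cdot>\<^bsub>D\<^esub> far F f"
  using functor_cmp[OF F, of f "src C f" "tgt C f" g "tgt C g"] by (auto simp: hom_iff)

lemma far_iso: assumes "is_iso C i" shows "is_iso D (far F i)"
proof -
  obtain j where j: "j \<in> hom C (tgt C i) (src C i)" "j \<cdot>\<^bsub>C\<^esub> i = idn C (src C i)" "i \<cdot>\<^bsub>C\<^esub> j = idn C (tgt C i)"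
    and i: "i \<in> Ar C" using assms by (auto simp: is_iso_def)
  then show ?thesis
    using far_cmp[of i j] far_cmp[of j i]
    by (intro isoI[of "far F i" D "fob F (src C i)" "fob F (tgt C i)" "far F j"]) (auto simp: hom_iff)
qed

lemma natD:
  assumes "nat_trans C D F G \<eta>"
  shows "f \<in> Ar C \<Longrightarrow> \<eta> (tgt C f) \<cdot>\<^bsub>D\<^esub> far F f = far G f \<cdot>\<^bsub>D\<^esub> \<eta> (src C f)"
    and "x \<in> Ob C \<Longrightarrow> \<eta> x \<in> Ar D" "x \<in> Ob C \<Longrightarrow> src D (\<eta> x) = fob F x" "x \<in> Ob C \<Longrightarrow> tgt D (\<eta> x) = fob G x"
  using assms by (auto simp: nat_trans_def hom_iff)

end

lemma ftorI: "category C \<Longrightarrow> category D \<Longrightarrow> is_functor C D F \<Longrightarrow> ftor C D F"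
  by (simp add: ftor.intro ftor_axioms.intro)

lemma id_ftr_sel [simp]:
  "x \<in> Ob C \<Longrightarrow> fob (id_ftr C) x = x" "f \<in> Ar C \<Longrightarrow> far (id_ftr C) f = f"
  by (auto simp: id_ftr_def)

definition fully_faithful :: "('o,'a) cat \<Rightarrow> ('p,'b) cat \<Rightarrow> ('o,'a,'p,'b) ftr \<Rightarrow> bool" where
  "fully_faithful C D F \<longleftrightarrow>
     (\<forall>x \<in> Ob C. \<forall>y \<in> Ob C. bij_betw (far F) (hom C x y) (hom D (fob F x) (fob F y)))"

definition ess_surj :: "('o,'a) cat \<Rightarrow> ('p,'b) cat \<Rightarrow> ('o,'a,'p,'b) ftr \<Rightarrow> bool" where
  "ess_surj C D F \<longleftrightarrow> (\<forall>d \<in> Ob D. \<exists>c \<in> Ob C. \<exists>i \<in> hom D (fob F c) d. is_iso D i)"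

lemma fully_faithful_full:
  assumes "fully_faithful C D F" "x \<in> Ob C" "y \<in> Ob C" "k \<in> hom D (fob F x) (fob F y)"
  obtains f where "f \<in> hom C x y" "far F f = k"
  using assms unfolding fully_faithful_def bij_betw_def by (metis imageE)

lemma fully_faithful_eq:
  assumes "fully_faithful C D F" "x \<in> Ob C" "y \<in> Ob C" "f \<in> hom C x y" "g \<in> hom C x y" "far F f = far F g"
  shows "f = g"
  using assms unfolding fully_faithful_def bij_betw_def inj_on_def by metis

lemma faithful_of_nat_iso:
  assumes "category C" "is_functor C D F" "is_functor D C G"
    and \<eta>: "nat_iso C C (id_ftr C) (cmp_ftr C G F) \<eta>"
    and f: "f \<in> hom C x y" and g: "g \<in> hom C x y" and e: "far F f = far F g"
  shows "f = g"
proof -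
  interpret category C by fact
  have "\<eta> y \<cdot>\<^bsub>C\<^esub> f = far G (far F f) \<cdot>\<^bsub>C\<^esub> \<eta> x"
    using \<eta> f by (auto simp: nat_iso_def nat_trans_def hom_iff cmp_far)
  also have "\<dots> = \<eta> y \<cdot>\<^bsub>C\<^esub> g"
    unfolding e using \<eta> g by (auto simp: nat_iso_def nat_trans_def hom_iff cmp_far)
  finally have "\<eta> y \<cdot>\<^bsub>C\<^esub> f = \<eta> y \<cdot>\<^bsub>C\<^esub> g" .
  moreover have "is_iso C (\<eta> y)" "\<eta> y \<in> hom C y (fob G (fob F y))"
    using \<eta> f by (auto simp: nat_iso_def nat_trans_def hom_iff cmp_fob)
  ultimately show ?thesis using iso_mono[of "\<eta> y" f g] f g by (auto simp: hom_iff)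
qed

text \<open>Here the transformation runs in the direction of a counit. It is applied to
  \<open>\<epsilon>\<close> to see that a quasi-inverse is faithful.\<close>

lemma faithful_of_nat_iso':
  assumes "category C" "is_functor C D F" "is_functor D C G"
    and \<eta>: "nat_iso C C (cmp_ftr C G F) (id_ftr C) \<eta>"
    and f: "f \<in> hom C x y" and g: "g \<in> hom C x y" and e: "far F f = far F g"
  shows "f = g"
proof -
  interpret category C by fact
  have "f \<cdot>\<^bsub>C\<^esub> \<eta> x = \<eta> y \<cdot>\<^bsub>C\<^esub> far G (far F f)"
    using \<eta> f by (auto simp: nat_iso_def nat_trans_def hom_iff cmp_far)
  also have "\<dots> = g \<cdot>\<^bsub>C\<^esub> \<eta> x"
    unfolding e using \<eta> g by (auto simp: nat_iso_def nat_trans_def hom_iff cmp_far)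
  finally have "f \<cdot>\<^bsub>C\<^esub> \<eta> x = g \<cdot>\<^bsub>C\<^esub> \<eta> x" .
  moreover have "is_iso C (\<eta> x)" "\<eta> x \<in> hom C (fob G (fob F x)) x"
    using \<eta> f by (auto simp: nat_iso_def nat_trans_def hom_iff cmp_fob)
  ultimately show ?thesis using iso_epi[of "\<eta> x" f g] f g by (auto simp: hom_iff)
qed

lemma equivalence_faithful:
  assumes "category C" "is_equivalence C D F" "f \<in> hom C x y" "g \<in> hom C x y" "far F f = far F g"
  shows "f = g"
  using assms faithful_of_nat_iso[OF assms(1) _ _ _ assms(3-5)] unfolding is_equivalence_def by blast

lemma equivalence_hom_nonempty:
  assumes "category C" "is_equivalence C D F" "x \<in> Ob C" "y \<in> Ob C" "hom D (fob F x) (fob F y) \<noteq> {}"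
  shows "hom C x y \<noteq> {}"
proof -
  interpret category C by fact
  obtain G \<eta> where G: "is_functor D C G" and \<eta>: "nat_iso C C (id_ftr C) (cmp_ftr C G F) \<eta>"
    using assms(2) unfolding is_equivalence_def by blast
  obtain k where k: "k \<in> hom D (fob F x) (fob F y)" using assms(5) by blast
  note Gk = functor_hom[OF G k]
  have ex: "\<eta> x \<in> hom C x (fob G (fob F x))" and ey: "\<eta> y \<in> hom C y (fob G (fob F y))" "is_iso C (\<eta> y)"
    using \<eta> assms by (auto simp: nat_iso_def nat_trans_def cmp_fob)
  obtain j where j: "j \<in> hom C (fob G (fob F y)) y" using ey isoE by metis
  show ?thesis using cmp_hom[OF cmp_hom[OF ex Gk] j] by blast
qed

lemma equivalence_ess_surj: "is_equivalence C D F \<Longrightarrow> ess_surj C D F"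
  unfolding is_equivalence_def ess_surj_def nat_iso_def nat_trans_def
  by (metis functor_Ob cmp_fob id_ftr_sel(1))

text \<open>For fullness, conjugating \<open>G k\<close> with the unit gives an arrow
  \<open>f\<close> of \<open>C\<close>. The arrows \<open>F f\<close> and \<open>k\<close> have the
  same image under \<open>G\<close>, and \<open>G\<close> is faithful because of the counit.\<close>

lemma equivalence_fully_faithful:
  assumes "category C" "category D" "is_equivalence C D F"
  shows "fully_faithful C D F"
  unfolding fully_faithful_def bij_betw_def
proof (intro ballI conjI)
  fix x y assume x: "x \<in> Ob C" and y: "y \<in> Ob C"
  interpret C: category C by fact
  interpret D: category D by fact
  obtain G \<eta> \<epsilon> where F: "is_functor C D F" and G: "is_functor D C G"
    and \<eta>: "nat_iso C C (id_ftr C) (cmp_ftr C G F) \<eta>" and \<epsilon>: "nat_iso D D (cmp_ftr D F G) (id_ftr D) \<epsilon>"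
    using assms(3) unfolding is_equivalence_def by blast
  show "inj_on (far F) (hom C x y)"
    by (rule inj_onI) (rule equivalence_faithful[OF assms(1,3)])
  show "far F ` hom C x y = hom D (fob F x) (fob F y)"
  proof (intro equalityI subsetI)
    fix k assume k: "k \<in> hom D (fob F x) (fob F y)"
    note Gk = functor_hom[OF G k]
    have ex: "\<eta> x \<in> hom C x (fob G (fob F x))" and ey: "\<eta> y \<in> hom C y (fob G (fob F y))" "is_iso C (\<eta> y)"
      and ix: "is_iso C (\<eta> x)"
      using \<eta> x y by (auto simp: nat_iso_def nat_trans_def cmp_fob)
    obtain j where j: "j \<in> hom C (fob G (fob F y)) y" "\<eta> y \<cdot>\<^bsub>C\<^esub> j = idn C (fob G (fob F y))"
      using ey isoE by metis
    define f where "f = j \<cdot>\<^bsub>C\<^esub> (far G k \<cdot>\<^bsub>C\<^esub> \<eta> x)"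
    have f: "f \<in> hom C x y" unfolding f_def using ex Gk j C.cmp_hom by metis
    have "far G (far F f) \<cdot>\<^bsub>C\<^esub> \<eta> x = \<eta> y \<cdot>\<^bsub>C\<^esub> f"
      using \<eta> f by (auto simp: nat_iso_def nat_trans_def hom_iff cmp_far)
    also have "\<dots> = far G k \<cdot>\<^bsub>C\<^esub> \<eta> x"
      unfolding f_def using j ex Gk ey C.hom_ObD[OF Gk] by (simp add: C.assoc[symmetric] hom_iff)
    finally have "far G (far F f) = far G k"
      using C.iso_epi[OF ix] functor_hom[OF G functor_hom[OF F f]] Gk ex by (auto simp: hom_iff)
    then have "far F f = k"
      by (rule faithful_of_nat_iso'[OF assms(2) G F \<epsilon> functor_hom[OF F f] k])
    then show "k \<in> far F ` hom C x y" using f by blast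
  qed (auto dest: functor_hom[OF F])
qed

lemma fully_faithful_iso:
  assumes "ftor C D F" "fully_faithful C D F" "f \<in> hom C x y" "is_iso D (far F f)"
  shows "is_iso C f"
proof -
  interpret ftor C D F by fact
  have xy: "x \<in> Ob C" "y \<in> Ob C" using assms(3) by (auto simp: hom_iff)
  obtain j where j: "j \<in> hom D (fob F y) (fob F x)" "j \<cdot>\<^bsub>D\<^esub> far F f = idn D (fob F x)" "far F f \<cdot>\<^bsub>D\<^esub> j = idn D (fob F y)"
    using isoE[OF assms(4) functor_hom[OF F assms(3)]] .
  obtain g where g: "g \<in> hom C y x" "far F g = j" using fully_faithful_full[OF assms(2) xy(2,1) j(1)] .
  have "g \<cdot>\<^bsub>C\<^esub> f = idn C x" "f \<cdot>\<^bsub>C\<^esub> g = idn C y"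
    by (rule fully_faithful_eq[OF assms(2)]; use g assms(3) j xy in \<open>auto simp: hom_iff far_cmp\<close>)+
  then show ?thesis using isoI[OF assms(3) g(1)] by blast
qed

text \<open>Preimages of objects and arrows are chosen. Since \<open>F\<close> is faithful,
  \<open>eqI\<close> moves every equation about the quasi-inverse to \<open>D\<close>, where the
  chosen isomorphisms \<open>i\<close> and \<open>j\<close> cancel.\<close>

lemma equivalenceI:
  assumes "ftor C D F" and ff: "fully_faithful C D F" and "ess_surj C D F"
  shows "is_equivalence C D F"
proof -
  interpret ftor C D F by fact
  obtain g i where g: "\<And>d. d \<in> Ob D \<Longrightarrow> g d \<in> Ob C" and i: "\<And>d. d \<in> Ob D \<Longrightarrow> i d \<in> hom D (fob F (g d)) d"
      "\<And>d. d \<in> Ob D \<Longrightarrow> is_iso D (i d)"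
    using assms(3) unfolding ess_surj_def by metis
  have "\<forall>d. \<exists>j. d \<in> Ob D \<longrightarrow> j \<in> hom D d (fob F (g d)) \<and> j \<cdot>\<^bsub>D\<^esub> i d = idn D (fob F (g d)) \<and> i d \<cdot>\<^bsub>D\<^esub> j = idn D d"
    using i isoE by metis
  then obtain j where j: "\<And>d. d \<in> Ob D \<Longrightarrow> j d \<in> hom D d (fob F (g d)) \<and> j d \<cdot>\<^bsub>D\<^esub> i d = idn D (fob F (g d)) \<and> i d \<cdot>\<^bsub>D\<^esub> j d = idn D d"
    by metis
  have "\<forall>x y k. \<exists>f. x \<in> Ob C \<and> y \<in> Ob C \<and> k \<in> hom D (fob F x) (fob F y) \<longrightarrow> f \<in> hom C x y \<and> far F f = k"
    using fully_faithful_full[OF ff] by metis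
  then obtain l where l: "\<And>x y k. x \<in> Ob C \<Longrightarrow> y \<in> Ob C \<Longrightarrow> k \<in> hom D (fob F x) (fob F y) \<Longrightarrow> l x y k \<in> hom C x y \<and> far F (l x y k) = k"
    by metis
  note [simp] = g i(1)[unfolded hom_iff, THEN conjunct1] i(1)[unfolded hom_iff, THEN conjunct2, THEN conjunct1]
     i(1)[unfolded hom_iff, THEN conjunct2, THEN conjunct2]
     j[unfolded hom_iff, THEN conjunct1, THEN conjunct1] j[unfolded hom_iff, THEN conjunct1, THEN conjunct2, THEN conjunct1]
     j[unfolded hom_iff, THEN conjunct1, THEN conjunct2, THEN conjunct2]
     j[THEN conjunct2, THEN conjunct1] j[THEN conjunct2, THEN conjunct2]
  define G where "G = \<lparr>fob = (\<lambda>d \<in> Ob D. g d),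
    far = (\<lambda>k \<in> Ar D. l (g (src D k)) (g (tgt D k)) (j (tgt D k) \<cdot>\<^bsub>D\<^esub> (k \<cdot>\<^bsub>D\<^esub> i (src D k))))\<rparr>"
  have Gob: "fob G d = g d" if "d \<in> Ob D" for d using that by (simp add: G_def)
  have Gar: "far G k \<in> Ar C" "src C (far G k) = g (src D k)" "tgt C (far G k) = g (tgt D k)"
     "far F (far G k) = j (tgt D k) \<cdot>\<^bsub>D\<^esub> (k \<cdot>\<^bsub>D\<^esub> i (src D k))" if "k \<in> Ar D" for k
    using that l[of "g (src D k)" "g (tgt D k)" "j (tgt D k) \<cdot>\<^bsub>D\<^esub> (k \<cdot>\<^bsub>D\<^esub> i (src D k))"]
    by (simp_all add: G_def hom_iff)
  note [simp] = Gob Gar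
  have eqI: "f = f'" if "f \<in> Ar C" "f' \<in> Ar C" "src C f = src C f'" "tgt C f = tgt C f'" "far F f = far F f'" for f f'
    using fully_faithful_eq[OF ff, of "src C f" "tgt C f" f f'] that by (auto simp: hom_iff)
  have ji: "j d \<cdot>\<^bsub>D\<^esub> (i d \<cdot>\<^bsub>D\<^esub> k) = k" if "d \<in> Ob D" "k \<in> Ar D" "tgt D k = fob F (g d)" for d k
    using D.reassoc[of "j d" "i d" _ k] that by simp
  have ij: "i d \<cdot>\<^bsub>D\<^esub> (j d \<cdot>\<^bsub>D\<^esub> k) = k" if "d \<in> Ob D" "k \<in> Ar D" "tgt D k = d" for d k
    using D.reassoc[of "i d" "j d" _ k] that by simp
  have G: "is_functor D C G"
  proof (rule functorI[OF D.category_axioms])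
    fix x assume "x \<in> Ob D"
    then show "far G (idn D x) = idn C (fob G x)" by (intro eqI) simp_all
  next
    fix f h x y z assume "f \<in> hom D x y" "h \<in> hom D y z"
    then show "far G (h \<cdot>\<^bsub>D\<^esub> f) = far G h \<cdot>\<^bsub>C\<^esub> far G f"
      by (intro eqI) (auto simp: hom_iff far_cmp D.assoc ij)
  qed (auto simp: hom_iff, auto simp: G_def)
  define \<eta> where "\<eta> = (\<lambda>x \<in> Ob C. l x (g (fob F x)) (j (fob F x)))"
  have \<eta>: "\<eta> x \<in> Ar C" "src C (\<eta> x) = x" "tgt C (\<eta> x) = g (fob F x)" "far F (\<eta> x) = j (fob F x)" if "x \<in> Ob C" for x
    using that l[of x "g (fob F x)" "j (fob F x)"] by (auto simp: \<eta>_def hom_iff)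
  have "nat_iso C C (id_ftr C) (cmp_ftr C G F) \<eta>"
    unfolding nat_iso_def nat_trans_def
  proof (intro conjI ballI)
    fix f assume "f \<in> Ar C"
    then show "\<eta> (tgt C f) \<cdot>\<^bsub>C\<^esub> far (id_ftr C) f = far (cmp_ftr C G F) f \<cdot>\<^bsub>C\<^esub> \<eta> (src C f)"
      by (intro eqI) (auto simp: \<eta> cmp_far far_cmp D.assoc)
  next
    fix x assume x: "x \<in> Ob C"
    have "is_iso D (far F (\<eta> x))"
      using x by (intro isoI[of _ D "fob F x" "fob F (g (fob F x))" "i (fob F x)"]) (auto simp: \<eta> hom_iff)
    then show "is_iso C (\<eta> x)"
      using x fully_faithful_iso[OF assms(1) ff, of "\<eta> x" x "g (fob F x)"] by (simp add: \<eta> hom_iff)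
  qed (auto simp: \<eta> hom_iff cmp_fob, auto simp: \<eta>_def)
  moreover have "nat_iso D D (cmp_ftr D F G) (id_ftr D) (\<lambda>d \<in> Ob D. i d)"
    unfolding nat_iso_def nat_trans_def using i by (auto simp: cmp_fob cmp_far hom_iff ij)
  ultimately show ?thesis unfolding is_equivalence_def using F G by blast
qed

subsection \<open>Essentially discrete categories\<close>

text \<open>For a category this means being a groupoid with trivial automorphism groups.\<close>

definition setoidal :: "('o,'a) cat \<Rightarrow> bool" where
  "setoidal C \<longleftrightarrow> (\<forall>x y f g. f \<in> hom C x y \<longrightarrow> g \<in> hom C x y \<longrightarrow> f = g) \<and>
     (\<forall>x y. hom C x y \<noteq> {} \<longrightarrow> hom C y x \<noteq> {})"

lemma setoidalD:
  "setoidal C \<Longrightarrow> f \<in> hom C x y \<Longrightarrow> g \<in> hom C x y \<Longrightarrow> f = g"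
  "setoidal C \<Longrightarrow> hom C x y \<noteq> {} \<Longrightarrow> hom C y x \<noteq> {}"
  unfolding setoidal_def by blast+

lemma setoidal_iso:
  assumes "category C" "setoidal C" "f \<in> hom C x y"
  shows "is_iso C f"
proof -
  interpret category C by fact
  obtain g where g: "g \<in> hom C y x" using setoidalD(2)[OF assms(2)] assms(3) by blast
  have "x \<in> Ob C" "y \<in> Ob C" using assms(3) by (auto simp: hom_iff)
  then show ?thesis
    using setoidalD(1)[OF assms(2) cmp_hom[OF assms(3) g]] setoidalD(1)[OF assms(2) cmp_hom[OF g assms(3)]]
    by (intro isoI[OF assms(3) g]) (auto intro: idn_hom)
qed

lemma category_discrete: "category (discrete_cat S)"
  by unfold_locales (auto simp: discrete_cat_def hom_def)

text \<open>The representative of \<open>x\<close> is picked from the predicate of being reachable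
  from \<open>x\<close>. Objects joined by an arrow have the very same predicate, hence the same
  representative, so \<open>rep\<close> is constant on isomorphism classes and \<open>S\<close>
  stays inside the type of objects.\<close>

lemma setoidal_discrete:
  fixes C :: "('o,'a) cat"
  assumes "category C" and st: "setoidal C"
  shows "equivalent_to_discrete C"
proof -
  interpret category C by fact
  define rep where "rep x = (SOME y. hom C x y \<noteq> {})" for x
  have rep: "hom C x (rep x) \<noteq> {}" if "x \<in> Ob C" for x
    unfolding rep_def by (rule someI[of "\<lambda>y. hom C x y \<noteq> {}" x]) (use idn_hom[OF that] in auto)
  have tr: "hom C x z \<noteq> {}" if "hom C x y \<noteq> {}" "hom C y z \<noteq> {}" for x y z
    using that cmp_hom by blast
  have "hom C x z \<noteq> {} \<longleftrightarrow> hom C y z \<noteq> {}" if "hom C x y \<noteq> {}" for x y z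
    using that tr setoidalD(2)[OF st] by blast
  then have eqv: "hom C x z \<noteq> {} \<longleftrightarrow> hom C y z \<noteq> {}" if "hom C x y \<noteq> {}" for x y z using that .
  then have "(\<lambda>z. hom C x z \<noteq> {}) = (\<lambda>z. hom C y z \<noteq> {})" if "hom C x y \<noteq> {}" for x y
    using that eqv by (intro ext) blast
  then have rep_eq: "rep x = rep y" if "hom C x y \<noteq> {}" for x y
    using that unfolding rep_def by metis
  have rep_tgt: "rep (src C f) = rep (tgt C f)" if "f \<in> Ar C" for f
    using that by (intro rep_eq) (auto simp: hom_def)
  define S where "S = rep ` Ob C"
  define F :: "('o,'a,'o,'o) ftr" where "F = \<lparr>fob = (\<lambda>x \<in> Ob C. rep x), far = (\<lambda>f \<in> Ar C. rep (src C f))\<rparr>"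
  have FF: "is_functor C (discrete_cat S) F"
    by (rule functorI[OF category_axioms])
      (auto simp: F_def discrete_cat_def S_def hom_iff rep_tgt)
  have "ftor C (discrete_cat S) F" by (intro ftorI FF category_discrete category_axioms)
  moreover have "fully_faithful C (discrete_cat S) F"
    unfolding fully_faithful_def bij_betw_def
  proof (intro ballI conjI inj_onI equalityI subsetI)
    fix x y f g assume "f \<in> hom C x y" "g \<in> hom C x y" then show "f = g" using setoidalD(1)[OF st] by blast
  next
    fix x y k assume xy: "x \<in> Ob C" "y \<in> Ob C" and k: "k \<in> hom (discrete_cat S) (fob F x) (fob F y)"
    then have e: "rep x = rep y" "k = rep x" by (auto simp: F_def discrete_cat_def hom_def)
    have "hom C x y \<noteq> {}" using rep[OF xy(1)] rep[OF xy(2)] setoidalD(2)[OF st] tr unfolding e by blast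
    then obtain f where "f \<in> hom C x y" by blast
    then show "k \<in> far F ` hom C x y" using e by (intro image_eqI[of _ _ f]) (auto simp: F_def hom_iff)
  qed (auto dest: functor_hom[OF FF])
  moreover have "ess_surj C (discrete_cat S) F"
    unfolding ess_surj_def
  proof
    fix d assume "d \<in> Ob (discrete_cat S)"
    then obtain c where "c \<in> Ob C" "d = rep c" by (auto simp: discrete_cat_def S_def)
    then show "\<exists>c\<in>Ob C. \<exists>i\<in>hom (discrete_cat S) (fob F c) d. is_iso (discrete_cat S) i"
      by (intro bexI[of _ c] bexI[of _ d]) (auto simp: F_def discrete_cat_def hom_def is_iso_def S_def)
  qed
  ultimately show ?thesis
    unfolding equivalent_to_discrete_def equivalent_cats_def using equivalenceI by blast
qed

subsection \<open>Geometric morphisms from couniversal arrows\<close>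

text \<open>\<open>R\<close> is the value at \<open>d\<close> of a right adjoint of
  \<open>F\<close>, and \<open>e\<close> is the counit there. Speaking of single objects allows
  adjoints to be built and transported without having a direct image functor at hand.\<close>

definition couniversal :: "('o,'a) cat \<Rightarrow> ('p,'b) cat \<Rightarrow> ('o,'a,'p,'b) ftr \<Rightarrow> 'p \<Rightarrow> 'o \<Rightarrow> 'b \<Rightarrow> bool" where
  "couniversal C D F d R e \<longleftrightarrow> R \<in> Ob C \<and> e \<in> hom D (fob F R) d \<and>
     (\<forall>x \<in> Ob C. \<forall>m \<in> hom D (fob F x) d. \<exists>!k. k \<in> hom C x R \<and> e \<cdot>\<^bsub>D\<^esub> far F k = m)"

lemma geom_couniversal:
  assumes "category E" "category D" and g: "geometric_morphism E D f" and b: "b \<in> Ob E"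
  shows "couniversal D E (inv_im f) b (fob (dir_im f) b) (adj_counit f b)"
proof -
  interpret I: ftor D E "inv_im f" using assms geom_dest(1) by (intro ftorI) auto
  interpret J: ftor E D "dir_im f" using assms geom_dest(2) by (intro ftorI) auto
  note c = counit_hom[OF g, unfolded hom_iff] and u = unit_hom[OF g, unfolded hom_iff]
  show ?thesis unfolding couniversal_def
  proof (intro conjI ballI)
    fix x m assume x: "x \<in> Ob D" and m: "m \<in> hom E (fob (inv_im f) x) b"
    show "\<exists>!k. k \<in> hom D x (fob (dir_im f) b) \<and> adj_counit f b \<cdot>\<^bsub>E\<^esub> far (inv_im f) k = m"
    proof (rule ex1I[of _ "far (dir_im f) m \<cdot>\<^bsub>D\<^esub> adj_unit f x"], intro conjI)
      show "far (dir_im f) m \<cdot>\<^bsub>D\<^esub> adj_unit f x \<in> hom D x (fob (dir_im f) b)"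
        using m u[OF x] x by (auto simp: hom_iff)
      have "adj_counit f b \<cdot>\<^bsub>E\<^esub> far (inv_im f) (far (dir_im f) m) = m \<cdot>\<^bsub>E\<^esub> adj_counit f (fob (inv_im f) x)"
        using counit_nat[OF g m] .
      from I.D.reassoc[OF this, of "far (inv_im f) (adj_unit f x)"]
      show "adj_counit f b \<cdot>\<^bsub>E\<^esub> far (inv_im f) (far (dir_im f) m \<cdot>\<^bsub>D\<^esub> adj_unit f x) = m"
        using m u[OF x] x b c geom_dest(5)[OF g x] by (auto simp: hom_iff I.far_cmp I.D.assoc)
    next
      fix k assume k: "k \<in> hom D x (fob (dir_im f) b) \<and> adj_counit f b \<cdot>\<^bsub>E\<^esub> far (inv_im f) k = m"
      have "far (dir_im f) (adj_counit f b) \<cdot>\<^bsub>D\<^esub> (adj_unit f (fob (dir_im f) b) \<cdot>\<^bsub>D\<^esub> k) = k"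
        using I.C.reassoc[OF geom_dest(6)[OF g b], of k] k c[OF b] u[of "fob (dir_im f) b"] b by (auto simp: hom_iff)
      then show "k = far (dir_im f) m \<cdot>\<^bsub>D\<^esub> adj_unit f x"
        using k c[OF b] u x b unit_nat[OF g, of k x "fob (dir_im f) b"]
        by (auto simp: hom_iff J.far_cmp I.C.assoc)
    qed
  qed (use b counit_hom[OF g] in auto)
qed

text \<open>Transposition \<open>tr\<close> gives both the direct image on arrows and the unit. The
  laws that compare two arrows into some \<open>R b\<close> follow from \<open>uniq\<close> after
  composing with the counit; the others are the defining equation of \<open>tr\<close>.\<close>

lemma geom_of_couniversal:
  assumes "ftor D E \<phi>" and lex: "left_exact D E \<phi>"
    and cu: "\<And>b. b \<in> Ob E \<Longrightarrow> \<exists>R e. couniversal D E \<phi> b R e"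
  shows "\<exists>f. geometric_morphism E D f \<and> inv_im f = \<phi>"
proof -
  interpret ftor D E \<phi> by fact
  obtain R e where Re: "\<And>b. b \<in> Ob E \<Longrightarrow> couniversal D E \<phi> b (R b) (e b)" using cu by metis
  have [simp]: "R b \<in> Ob D" "e b \<in> Ar E" "src E (e b) = fob \<phi> (R b)" "tgt E (e b) = b" if "b \<in> Ob E" for b
    using Re[OF that] by (auto simp: couniversal_def hom_iff)
  define tr where "tr x b m = (THE k. k \<in> hom D x (R b) \<and> e b \<cdot>\<^bsub>E\<^esub> far \<phi> k = m)" for x b m
  have tr: "tr x b m \<in> Ar D" "src D (tr x b m) = x" "tgt D (tr x b m) = R b" "e b \<cdot>\<^bsub>E\<^esub> far \<phi> (tr x b m) = m"
    if "x \<in> Ob D" "b \<in> Ob E" "m \<in> Ar E" "src E m = fob \<phi> x" "tgt E m = b" for x b m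
  proof -
    have "\<exists>!k. k \<in> hom D x (R b) \<and> e b \<cdot>\<^bsub>E\<^esub> far \<phi> k = m" using Re[OF that(2)] that by (auto simp: couniversal_def hom_iff)
    from theI'[OF this]
    show "tr x b m \<in> Ar D" "src D (tr x b m) = x" "tgt D (tr x b m) = R b" "e b \<cdot>\<^bsub>E\<^esub> far \<phi> (tr x b m) = m"
      unfolding tr_def by (auto simp: hom_iff)
  qed
  have uniq: "k = k'" if "b \<in> Ob E" "k \<in> Ar D" "k' \<in> Ar D" "src D k = src D k'" "tgt D k = R b" "tgt D k' = R b"
      "e b \<cdot>\<^bsub>E\<^esub> far \<phi> k = e b \<cdot>\<^bsub>E\<^esub> far \<phi> k'" for b k k'
  proof -
    have "e b \<cdot>\<^bsub>E\<^esub> far \<phi> k' \<in> hom E (fob \<phi> (src D k')) b" using that by (simp add: hom_iff)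
    then have "\<exists>!l. l \<in> hom D (src D k') (R b) \<and> e b \<cdot>\<^bsub>E\<^esub> far \<phi> l = e b \<cdot>\<^bsub>E\<^esub> far \<phi> k'"
      using Re[OF that(1)] that unfolding couniversal_def by auto
    then show ?thesis using that by (auto simp: hom_iff)
  qed
  have trE: "e b \<cdot>\<^bsub>E\<^esub> (far \<phi> (tr x b m) \<cdot>\<^bsub>E\<^esub> n) = m \<cdot>\<^bsub>E\<^esub> n"
    if "x \<in> Ob D" "b \<in> Ob E" "m \<in> Ar E" "src E m = fob \<phi> x" "tgt E m = b" "n \<in> Ar E" "tgt E n = fob \<phi> x" for x b m n
    using that tr by (intro D.reassoc) auto
  define f where "f = \<lparr>inv_im = \<phi>, dir_im = \<lparr>fob = (\<lambda>b \<in> Ob E. R b),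
      far = (\<lambda>m \<in> Ar E. tr (R (src E m)) (tgt E m) (m \<cdot>\<^bsub>E\<^esub> e (src E m)))\<rparr>,
      adj_unit = (\<lambda>x \<in> Ob D. tr x (fob \<phi> x) (idn E (fob \<phi> x))), adj_counit = (\<lambda>b \<in> Ob E. e b)\<rparr>"
  have dob: "fob (dir_im f) b = R b" if "b \<in> Ob E" for b using that by (simp add: f_def)
  have dar: "far (dir_im f) m = tr (R (src E m)) (tgt E m) (m \<cdot>\<^bsub>E\<^esub> e (src E m))" if "m \<in> Ar E" for m
    using that by (simp add: f_def)
  have un: "adj_unit f x = tr x (fob \<phi> x) (idn E (fob \<phi> x))" if "x \<in> Ob D" for x using that by (simp add: f_def)
  have co: "adj_counit f b = e b" if "b \<in> Ob E" for b using that by (simp add: f_def)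
  have inv: "inv_im f = \<phi>" by (simp add: f_def)
  have dir: "is_functor E D (dir_im f)"
  proof (rule functorI[OF D.category_axioms])
    fix x assume "x \<in> Ob E"
    then show "far (dir_im f) (idn E x) = idn D (fob (dir_im f) x)"
      by - (rule uniq[of x], simp_all add: dar dob tr)
  next
    fix m n x y z assume "m \<in> hom E x y" "n \<in> hom E y z"
    then show "far (dir_im f) (n \<cdot>\<^bsub>E\<^esub> m) = far (dir_im f) n \<cdot>\<^bsub>D\<^esub> far (dir_im f) m"
      by - (rule uniq[of z], auto simp: dar tr trE far_cmp hom_iff D.assoc)
  qed (auto simp: dob dar tr hom_iff, auto simp: f_def)
  have 1: "nat_trans D D (id_ftr D) (cmp_ftr D (dir_im f) \<phi>) (adj_unit f)"
  proof (rule ntI)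
    fix h x y assume "h \<in> hom D x y"
    then show "adj_unit f y \<cdot>\<^bsub>D\<^esub> far (id_ftr D) h = far (cmp_ftr D (dir_im f) \<phi>) h \<cdot>\<^bsub>D\<^esub> adj_unit f x"
      by - (rule uniq[of "fob \<phi> y"], auto simp: dar un tr trE far_cmp hom_iff D.assoc cmp_far)
  qed (auto simp: un tr hom_iff cmp_fob dob, auto simp: f_def)
  have 2: "nat_trans E E (cmp_ftr E \<phi> (dir_im f)) (id_ftr E) (adj_counit f)"
    by (rule ntI) (auto simp: co dar dob tr hom_iff cmp_far cmp_fob, auto simp: f_def)
  have 3: "adj_counit f (fob \<phi> x) \<cdot>\<^bsub>E\<^esub> far \<phi> (adj_unit f x) = idn E (fob \<phi> x)" if "x \<in> Ob D" for x
    using that by (simp add: co un tr)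
  have 4: "far (dir_im f) (adj_counit f y) \<cdot>\<^bsub>D\<^esub> adj_unit f (fob (dir_im f) y) = idn D (fob (dir_im f) y)"
    if "y \<in> Ob E" for y
    using that by - (rule uniq[of y], auto simp: co un dar dob tr trE far_cmp D.assoc)
  have "geometric_morphism E D f"
    unfolding geometric_morphism_def inv using F dir 1 2 3 4 lex by blast
  then show ?thesis using inv by blast
qed

section \<open>Essentially discrete objects, orthogonality and tensors in a 2-category\<close>

definition locally_setoidal :: "('o,'m,'c) twocat \<Rightarrow> 'o \<Rightarrow> bool" where
  "locally_setoidal K X \<longleftrightarrow> (\<forall>G \<in> Obj K. setoidal (Hom K G X))"

text \<open>
  When the hom-categories into \<open>X\<close> are essentially discrete, this says that precomposition with
  \<open>j : B \<rightarrow> T\<close> is an equivalence between the categories of 1-cells \<open>T \<rightarrow> X\<close> and \<open>B \<rightarrow> X\<close>.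
\<close>

definition orthogonal :: "('o,'m,'c) twocat \<Rightarrow> 'o \<Rightarrow> 'o \<Rightarrow> 'm \<Rightarrow> 'o \<Rightarrow> bool" where
  "orthogonal K B T j X \<longleftrightarrow>
     (\<forall>x \<in> Ob (Hom K B X). \<exists>y \<in> Ob (Hom K T X). hom (Hom K B X) (cmp1 K B T X y j) x \<noteq> {}) \<and>
     (\<forall>y \<in> Ob (Hom K T X). \<forall>y' \<in> Ob (Hom K T X).
        hom (Hom K B X) (cmp1 K B T X y j) (cmp1 K B T X y' j) \<noteq> {} \<longrightarrow> hom (Hom K T X) y y' \<noteq> {})"

text \<open>\<open>T\<close> is the tensor of \<open>B\<close> with the arrow category, \<open>\<tau> : i0 \<Rightarrow> i1\<close> being the universal 2-cell.\<close>

definition arrow_tensor :: "('o,'m,'c) twocat \<Rightarrow> 'o \<Rightarrow> 'o \<Rightarrow> 'm \<Rightarrow> 'm \<Rightarrow> 'c \<Rightarrow> bool" where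
  "arrow_tensor K B T i0 i1 \<tau> \<longleftrightarrow>
     T \<in> Obj K \<and> i0 \<in> Ob (Hom K B T) \<and> i1 \<in> Ob (Hom K B T) \<and> \<tau> \<in> hom (Hom K B T) i0 i1 \<and>
     (\<forall>D \<in> Obj K. \<forall>g g' \<alpha>. \<alpha> \<in> hom (Hom K B D) g g' \<longrightarrow>
        (\<exists>a \<in> Ob (Hom K T D). \<exists>\<kappa>0 \<in> hom (Hom K B D) g (cmp1 K B T D a i0).
         \<exists>\<kappa>1 \<in> hom (Hom K B D) g' (cmp1 K B T D a i1).
           is_iso (Hom K B D) \<kappa>0 \<and> is_iso (Hom K B D) \<kappa>1 \<and>
           lwhisker K B T D a \<tau> \<cdot>\<^bsub>Hom K B D\<^esub> \<kappa>0 = \<kappa>1 \<cdot>\<^bsub>Hom K B D\<^esub> \<alpha>)) \<and>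
     (\<forall>D \<in> Obj K. \<forall>a \<in> Ob (Hom K T D). \<forall>b \<in> Ob (Hom K T D).
        \<forall>\<sigma>0 \<in> hom (Hom K B D) (cmp1 K B T D a i0) (cmp1 K B T D b i0).
        \<forall>\<sigma>1 \<in> hom (Hom K B D) (cmp1 K B T D a i1) (cmp1 K B T D b i1).
          lwhisker K B T D b \<tau> \<cdot>\<^bsub>Hom K B D\<^esub> \<sigma>0 = \<sigma>1 \<cdot>\<^bsub>Hom K B D\<^esub> lwhisker K B T D a \<tau> \<longrightarrow>
          (\<exists>!\<sigma>. \<sigma> \<in> hom (Hom K T D) a b \<and> rwhisker K B T D \<sigma> i0 = \<sigma>0 \<and> rwhisker K B T D \<sigma> i1 = \<sigma>1))"

context two_category
begin

lemma lw_lw: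
  assumes "A \<in> Obj K" "B \<in> Obj K" "C \<in> Obj K" "D \<in> Obj K" "s \<in> Ar (Hom K A B)" "g \<in> Ob (Hom K B C)" "h \<in> Ob (Hom K C D)"
  shows "lwhisker K A C D h (lwhisker K A B C g s) = lwhisker K A B D (cmp1 K B C D h g) s"
  unfolding lwhisker_def cmp2_idn[OF assms(2-4,6,7), symmetric]
  by (rule cmp2_assoc[OF assms(1-5), symmetric]) (use idH assms in \<open>auto simp: hom_iff\<close>)

lemma lw_rw:
  assumes "A \<in> Obj K" "B \<in> Obj K" "C \<in> Obj K" "D \<in> Obj K" "f \<in> Ob (Hom K A B)" "t \<in> Ar (Hom K B C)" "h \<in> Ob (Hom K C D)"
  shows "rwhisker K A B D (lwhisker K B C D h t) f = lwhisker K A C D h (rwhisker K A B C t f)"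
  unfolding rwhisker_def lwhisker_def
  by (rule cmp2_assoc[OF assms(1-4)]) (use idH assms in \<open>auto simp: hom_iff\<close>)

lemma lw_idn: "A \<in> Obj K \<Longrightarrow> B \<in> Obj K \<Longrightarrow> C \<in> Obj K \<Longrightarrow> f \<in> Ob (Hom K A B) \<Longrightarrow> g \<in> Ob (Hom K B C) \<Longrightarrow>
   lwhisker K A B C g (idn (Hom K A B) f) = idn (Hom K A C) (cmp1 K A B C g f)"
  by (simp add: lwhisker_def cmp2_idn)

lemma whisker_swap:
  assumes o: "A \<in> Obj K" "B \<in> Obj K" "C \<in> Obj K" and "s \<in> hom (Hom K A B) f f'" "t \<in> hom (Hom K B C) g g'"
  shows "lwhisker K A B C g' s \<cdot>\<^bsub>Hom K A C\<^esub> rwhisker K A B C t f =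
    rwhisker K A B C t f' \<cdot>\<^bsub>Hom K A C\<^esub> lwhisker K A B C g s"
  using hcomp_eq[OF assms] by simp

text \<open>Two 1-cells are linked when some 2-cell between them exists. Where hom-categories are
  setoidal this is an equivalence relation, and it takes the place of explicit 2-cells in the
  arguments about orthogonality and bilimits.\<close>

lemma linked_trans: "A \<in> Obj K \<Longrightarrow> B \<in> Obj K \<Longrightarrow> hom (Hom K A B) f g \<noteq> {} \<Longrightarrow> hom (Hom K A B) g h \<noteq> {} \<Longrightarrow> hom (Hom K A B) f h \<noteq> {}"
  using category.cmp_hom[OF Hom_category] by blast

lemma linked_post: "A \<in> Obj K \<Longrightarrow> B \<in> Obj K \<Longrightarrow> C \<in> Obj K \<Longrightarrow> g \<in> Ob (Hom K B C) \<Longrightarrow> hom (Hom K A B) f f' \<noteq> {} \<Longrightarrow>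
   hom (Hom K A C) (cmp1 K A B C g f) (cmp1 K A B C g f') \<noteq> {}"
  using lw_hom by blast

lemma linked_pre: "A \<in> Obj K \<Longrightarrow> B \<in> Obj K \<Longrightarrow> C \<in> Obj K \<Longrightarrow> f \<in> Ob (Hom K A B) \<Longrightarrow> hom (Hom K B C) g g' \<noteq> {} \<Longrightarrow>
   hom (Hom K A C) (cmp1 K A B C g f) (cmp1 K A B C g' f) \<noteq> {}"
  using rw_hom by blast

subsection \<open>Invariance under equivalence\<close>

context
  fixes A B f g \<eta> \<epsilon>
  assumes AB: "A \<in> Obj K" "B \<in> Obj K" and f: "f \<in> Ob (Hom K A B)" and g: "g \<in> Ob (Hom K B A)"
    and \<eta>: "\<eta> \<in> hom (Hom K A A) (id1 K A) (cmp1 K A B A g f)" "is_iso (Hom K A A) \<eta>"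
    and \<epsilon>: "\<epsilon> \<in> hom (Hom K B B) (cmp1 K B A B f g) (id1 K B)" "is_iso (Hom K B B) \<epsilon>"
begin

lemma equiv_unit:
  assumes G: "G \<in> Obj K" and x: "x \<in> Ob (Hom K G A)"
  shows "rwhisker K G A A \<eta> x \<in> hom (Hom K G A) x (cmp1 K G B A g (cmp1 K G A B f x))"
    "is_iso (Hom K G A) (rwhisker K G A A \<eta> x)"
    "hom (Hom K G A) (cmp1 K G B A g (cmp1 K G A B f x)) x \<noteq> {}"
proof -
  show 1: "rwhisker K G A A \<eta> x \<in> hom (Hom K G A) x (cmp1 K G B A g (cmp1 K G A B f x))"
    using rw_hom[OF G AB(1,1) x \<eta>(1)] cmp1_id_left[OF G AB(1) x] cmp1_assoc[OF G AB AB(1) x f g] by simp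
  show 2: "is_iso (Hom K G A) (rwhisker K G A A \<eta> x)" by (rule rw_iso[OF G AB(1,1) x \<eta>])
  show "hom (Hom K G A) (cmp1 K G B A g (cmp1 K G A B f x)) x \<noteq> {}" using isoE[OF 2 1] by blast
qed

lemma equiv_reflects_linked:
  assumes G: "G \<in> Obj K" and x: "x \<in> Ob (Hom K G A)" and y: "y \<in> Ob (Hom K G A)"
    and l: "hom (Hom K G B) (cmp1 K G A B f x) (cmp1 K G A B f y) \<noteq> {}"
  shows "hom (Hom K G A) x y \<noteq> {}"
  using linked_trans[OF G AB(1) _ linked_trans[OF G AB(1) linked_post[OF G AB(2,1) g l] equiv_unit(3)[OF G y]], of x]
    equiv_unit(1)[OF G x] by blast

text \<open>Whiskering with \<open>f\<close> is faithful, because whiskering with \<open>g\<close>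
  after \<open>f\<close> is conjugate to the identity by \<open>\<eta>\<close>. Equality of parallel
  2-cells and the existence of a reverse 2-cell can therefore be decided after composing with
  \<open>f\<close>.\<close>

lemma equiv_locally_setoidal:
  assumes st: "locally_setoidal K B"
  shows "locally_setoidal K A"
  unfolding locally_setoidal_def setoidal_def
proof (intro ballI conjI allI impI)
  fix G x y s t assume G: "G \<in> Obj K" and s: "s \<in> hom (Hom K G A) x y" and t: "t \<in> hom (Hom K G A) x y"
  interpret GA: category "Hom K G A" using Hom_category G AB by auto
  have x: "x \<in> Ob (Hom K G A)" and y: "y \<in> Ob (Hom K G A)" using GA.hom_ObD[OF s] by auto
  have st': "setoidal (Hom K G B)" using st G by (auto simp: locally_setoidal_def)
  have "lwhisker K G A B f s = lwhisker K G A B f t"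
    using setoidalD(1)[OF st' lw_hom[OF G AB f s] lw_hom[OF G AB f t]] .
  then have e: "lwhisker K G A A (cmp1 K A B A g f) s = lwhisker K G A A (cmp1 K A B A g f) t"
    using lw_lw[OF G AB AB(1) _ f g] s t by (metis hom_iff)
  have l: "lwhisker K G A A (id1 K A) r = r" if "r \<in> hom (Hom K G A) x y" for r
    using that cmp2_id_left[OF G AB(1)] by (simp add: lwhisker_def hom_iff)
  have "rwhisker K G A A \<eta> y \<cdot>\<^bsub>Hom K G A\<^esub> s = rwhisker K G A A \<eta> y \<cdot>\<^bsub>Hom K G A\<^esub> t"
    using whisker_swap[OF G AB(1,1) s \<eta>(1)] whisker_swap[OF G AB(1,1) t \<eta>(1)] by (simp add: e l s t)
  then show "s = t" using GA.iso_mono[OF equiv_unit(2)[OF G y], of s t] equiv_unit(1)[OF G y] s t by (auto simp: hom_iff)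
next
  fix G x y assume G: "G \<in> Obj K" and l: "hom (Hom K G A) x y \<noteq> {}"
  interpret GA: category "Hom K G A" using Hom_category G AB by auto
  have x: "x \<in> Ob (Hom K G A)" and y: "y \<in> Ob (Hom K G A)" using GA.hom_ObD l by auto
  have st': "setoidal (Hom K G B)" using st G by (auto simp: locally_setoidal_def)
  show "hom (Hom K G A) y x \<noteq> {}"
    by (rule equiv_reflects_linked[OF G y x setoidalD(2)[OF st' linked_post[OF G AB f l]]])
qed

text \<open>An extension of \<open>x\<close> along \<open>j\<close> is obtained by applying
  \<open>g\<close> to an extension of \<open>f x\<close>, and links between 1-cells into
  \<open>A\<close> are reflected by \<open>f\<close>.\<close>

lemma equiv_orthogonal:
  assumes G: "G \<in> Obj K" "T \<in> Obj K" and j: "j \<in> Ob (Hom K G T)" and o: "orthogonal K G T j B"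
  shows "orthogonal K G T j A"
  unfolding orthogonal_def
proof (intro conjI ballI impI)
  fix x assume x: "x \<in> Ob (Hom K G A)"
  note fx = cmp1_Hom[OF G(1) AB x f]
  obtain y where y: "y \<in> Ob (Hom K T B)" and l: "hom (Hom K G B) (cmp1 K G T B y j) (cmp1 K G A B f x) \<noteq> {}"
    using o fx unfolding orthogonal_def by blast
  note gy = cmp1_Hom[OF G(2) AB(2,1) y g]
  have "hom (Hom K G A) (cmp1 K G T A (cmp1 K T B A g y) j) x \<noteq> {}"
    using linked_trans[OF G(1) AB(1) linked_post[OF G(1) AB(2,1) g l] equiv_unit(3)[OF G(1) x]]
    by (simp add: cmp1_assoc[OF G AB(2,1) j y g])
  then show "\<exists>y\<in>Ob (Hom K T A). hom (Hom K G A) (cmp1 K G T A y j) x \<noteq> {}" using gy by blast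
next
  fix y y' assume y: "y \<in> Ob (Hom K T A)" and y': "y' \<in> Ob (Hom K T A)"
    and l: "hom (Hom K G A) (cmp1 K G T A y j) (cmp1 K G T A y' j) \<noteq> {}"
  have "hom (Hom K G B) (cmp1 K G T B (cmp1 K T A B f y) j) (cmp1 K G T B (cmp1 K T A B f y') j) \<noteq> {}"
    using linked_post[OF G(1) AB f l] by (simp add: cmp1_assoc[OF G AB j _ f] y y')
  then have "hom (Hom K T B) (cmp1 K T A B f y) (cmp1 K T A B f y') \<noteq> {}"
    using o cmp1_Hom[OF G(2) AB y f] cmp1_Hom[OF G(2) AB y' f] unfolding orthogonal_def by blast
  then show "hom (Hom K T A) y y' \<noteq> {}" by (rule equiv_reflects_linked[OF G(2) y y'])
qed

end

subsection \<open>Bilimits of locally essentially discrete objects\<close>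

context
  fixes I :: "('i,'j) cat" and F :: "('i,'j,'o,'m,'c) psftr" and L l n
  assumes I: "category I" and F: "pseudofunctor I K F"
    and st: "\<And>i. i \<in> Ob I \<Longrightarrow> locally_setoidal K (pob F i)"
    and L: "is_bilimit I K F L (l, n)"
begin

lemma bilimit_typing:
  "L \<in> Obj K" "i \<in> Ob I \<Longrightarrow> pob F i \<in> Obj K" "i \<in> Ob I \<Longrightarrow> l i \<in> Ob (Hom K L (pob F i))"
  "u \<in> hom I i i' \<Longrightarrow> par F u \<in> Ob (Hom K (pob F i) (pob F i'))"
  "u \<in> hom I i i' \<Longrightarrow> n u \<in> hom (Hom K L (pob F i')) (cmp1 K L (pob F i) (pob F i') (par F u) (l i)) (l i')"
  using L F I category.hom_ObD[OF I, of u i i'] unfolding is_bilimit_def pseudofunctor_def pseudocone_def by auto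

lemma bilimit_equivalence: "B \<in> Obj K \<Longrightarrow> is_equivalence (Hom K B L) (pseudocones I K F B) (cone_ftr I K F L (l,n) B)"
  using L unfolding is_bilimit_def by blast

lemma bilimit_fob:
  assumes B: "B \<in> Obj K" and h: "h \<in> Ob (Hom K B L)"
  shows "pseudocone I K F B (fob (cone_ftr I K F L (l,n) B) h)"
    "i \<in> Ob I \<Longrightarrow> fst (fob (cone_ftr I K F L (l,n) B) h) i = cmp1 K B L (pob F i) (l i) h"
proof -
  have "is_functor (Hom K B L) (pseudocones I K F B) (cone_ftr I K F L (l,n) B)"
    using bilimit_equivalence[OF B] unfolding is_equivalence_def by blast
  from functor_Ob[OF this h] show "pseudocone I K F B (fob (cone_ftr I K F L (l,n) B) h)" by (simp add: pseudocones_def)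
  show "i \<in> Ob I \<Longrightarrow> fst (fob (cone_ftr I K F L (l,n) B) h) i = cmp1 K B L (pob F i) (l i) h"
    using h by (simp add: cone_ftr_def precompose_cone_def)
qed

text \<open>The components can be chosen independently of each other: each compatibility square
  compares two parallel 2-cells into \<open>pob F j\<close>, and these are equal by
  \<open>st\<close>.\<close>

lemma pseudocone_linked:
  assumes B: "B \<in> Obj K" and x: "pseudocone I K F B x" and y: "pseudocone I K F B y"
    and lk: "\<And>i. i \<in> Ob I \<Longrightarrow> hom (Hom K B (pob F i)) (fst x i) (fst y i) \<noteq> {}"
  shows "hom (pseudocones I K F B) x y \<noteq> {}"
proof -
  have "\<exists>m. \<forall>i\<in>Ob I. m i \<in> hom (Hom K B (pob F i)) (fst x i) (fst y i)"
    using lk by (intro bchoice) blast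
  then obtain m where m: "\<And>i. i \<in> Ob I \<Longrightarrow> m i \<in> hom (Hom K B (pob F i)) (fst x i) (fst y i)" by blast
  have "snd y u \<cdot>\<^bsub>Hom K B (pob F j)\<^esub> lwhisker K B (pob F i) (pob F j) (par F u) (m i) = m j \<cdot>\<^bsub>Hom K B (pob F j)\<^esub> snd x u"
    if i: "i \<in> Ob I" and j: "j \<in> Ob I" and u: "u \<in> hom I i j" for i j u
  proof -
    interpret Bj: category "Hom K B (pob F j)" using Hom_category B bilimit_typing(2) j by auto
    have xu: "snd x u \<in> hom (Hom K B (pob F j)) (cmp1 K B (pob F i) (pob F j) (par F u) (fst x i)) (fst x j)"
      and yu: "snd y u \<in> hom (Hom K B (pob F j)) (cmp1 K B (pob F i) (pob F j) (par F u) (fst y i)) (fst y j)"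
      using x y i j u unfolding pseudocone_def by (auto simp: case_prod_unfold)
    have "setoidal (Hom K B (pob F j))" using st[OF j] B by (auto simp: locally_setoidal_def)
    then show ?thesis
      by (rule setoidalD(1)[OF _ Bj.cmp_hom[OF lw_hom[OF B bilimit_typing(2)[OF i] bilimit_typing(2)[OF j] bilimit_typing(4)[OF u] m[OF i]] yu]
        Bj.cmp_hom[OF xu m[OF j]]])
  qed
  then have "(x, y, restrict m (Ob I)) \<in> hom (pseudocones I K F B) x y"
    using x y m by (auto simp: pseudocones_def hom_def)
  then show ?thesis by blast
qed

lemma bilimit_linked:
  assumes B: "B \<in> Obj K" and h: "h \<in> Ob (Hom K B L)" "h' \<in> Ob (Hom K B L)"
    and lk: "\<And>i. i \<in> Ob I \<Longrightarrow> hom (Hom K B (pob F i)) (cmp1 K B L (pob F i) (l i) h) (cmp1 K B L (pob F i) (l i) h') \<noteq> {}"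
  shows "hom (Hom K B L) h h' \<noteq> {}"
  by (rule equivalence_hom_nonempty[OF Hom_category[OF B bilimit_typing(1)] bilimit_equivalence[OF B] h])
    (rule pseudocone_linked[OF B bilimit_fob(1)[OF B h(1)] bilimit_fob(1)[OF B h(2)]], simp add: bilimit_fob[OF B] h lk)

text \<open>In the setoidal categories \<open>sB\<close> every 2-cell is invertible, and the unit
  and cocycle conditions of a pseudocone are equations between parallel 2-cells. So arbitrary links
  between the \<open>z i\<close> already form a pseudocone, which the bilimit represents.\<close>

lemma bilimit_lift:
  assumes B: "B \<in> Obj K" and z: "\<And>i. i \<in> Ob I \<Longrightarrow> z i \<in> Ob (Hom K B (pob F i))"
    and lk: "\<And>u i j. u \<in> hom I i j \<Longrightarrow> hom (Hom K B (pob F j)) (cmp1 K B (pob F i) (pob F j) (par F u) (z i)) (z j) \<noteq> {}"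
  shows "\<exists>h \<in> Ob (Hom K B L). \<forall>i \<in> Ob I. hom (Hom K B (pob F i)) (cmp1 K B L (pob F i) (l i) h) (z i) \<noteq> {}"
proof -
  note o = bilimit_typing(2)
  have sB: "setoidal (Hom K B (pob F j))" if "j \<in> Ob I" for j using st[OF that] B by (auto simp: locally_setoidal_def)
  have "\<exists>m. \<forall>u\<in>Ar I. m u \<in> hom (Hom K B (pob F (tgt I u))) (cmp1 K B (pob F (src I u)) (pob F (tgt I u)) (par F u) (z (src I u))) (z (tgt I u))"
    using lk[unfolded hom_iff] by (intro bchoice) (metis all_not_in_conv)
  then obtain m where "\<And>u. u \<in> Ar I \<Longrightarrow> m u \<in> hom (Hom K B (pob F (tgt I u))) (cmp1 K B (pob F (src I u)) (pob F (tgt I u)) (par F u) (z (src I u))) (z (tgt I u))"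
    by blast
  then have m: "m u \<in> hom (Hom K B (pob F j)) (cmp1 K B (pob F i) (pob F j) (par F u) (z i)) (z j)" if "u \<in> hom I i j" for u i j
    using that by (auto simp: hom_iff)
  have Ari: "u \<in> Ar I" if "u \<in> hom I i j" for u i j using that by (simp add: hom_iff)
  have "pseudocone I K F B (restrict z (Ob I), restrict m (Ar I))"
    unfolding pseudocone_def prod.case
  proof (intro conjI ballI)
    fix i assume i: "i \<in> Ob I" then show "restrict z (Ob I) i \<in> Ob (Hom K B (pob F i))" using z by simp
    interpret Bi: category "Hom K B (pob F i)" using Hom_category B o i by auto
    note ii = category.idn_hom[OF I i]
    have p: "pidn F i \<in> hom (Hom K (pob F i) (pob F i)) (id1 K (pob F i)) (par F (idn I i))"
      using F i unfolding pseudofunctor_def by blast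
    have "rwhisker K B (pob F i) (pob F i) (pidn F i) (z i) \<in> hom (Hom K B (pob F i)) (z i) (cmp1 K B (pob F i) (pob F i) (par F (idn I i)) (z i))"
      using rw_hom[OF B o[OF i] o[OF i] z[OF i] p] cmp1_id_left[OF B o[OF i] z[OF i]] by simp
    from setoidalD(1)[OF sB[OF i] Bi.cmp_hom[OF this m[OF ii]] Bi.idn_hom[OF z[OF i]]]
    show "restrict m (Ar I) (idn I i) \<cdot>\<^bsub>Hom K B (pob F i)\<^esub> rwhisker K B (pob F i) (pob F i) (pidn F i) (restrict z (Ob I) i)
       = idn (Hom K B (pob F i)) (restrict z (Ob I) i)"
      using i Ari[OF ii] by simp
  next
    fix i j u assume i: "i \<in> Ob I" and j: "j \<in> Ob I" and u: "u \<in> hom I i j"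
    show "restrict m (Ar I) u \<in> hom (Hom K B (pob F j)) (cmp1 K B (pob F i) (pob F j) (par F u) (restrict z (Ob I) i)) (restrict z (Ob I) j)"
      using i j u m by (simp add: Ari)
    show "is_iso (Hom K B (pob F j)) (restrict m (Ar I) u)"
      using setoidal_iso[OF Hom_category[OF B o[OF j]] sB[OF j] m[OF u]] Ari[OF u] by simp
  next
    fix i j k u v assume i: "i \<in> Ob I" and j: "j \<in> Ob I" and k: "k \<in> Ob I" and u: "u \<in> hom I i j" and v: "v \<in> hom I j k"
    interpret Bk: category "Hom K B (pob F k)" using Hom_category B o k by auto
    note vu = category.cmp_hom[OF I u v]
    have "pcmp F v u \<in> hom (Hom K (pob F i) (pob F k)) (cmp1 K (pob F i) (pob F j) (pob F k) (par F v) (par F u)) (par F (v \<cdot>\<^bsub>I\<^esub> u))"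
      using F i j k u v unfolding pseudofunctor_def by blast
    note p = rw_hom[OF B o[OF i] o[OF k] z[OF i] this,
        unfolded cmp1_assoc[OF B o[OF i] o[OF j] o[OF k] z[OF i] bilimit_typing(4)[OF u] bilimit_typing(4)[OF v]]]
    note q = lw_hom[OF B o[OF j] o[OF k] bilimit_typing(4)[OF v] m[OF u]]
    show "restrict m (Ar I) (v \<cdot>\<^bsub>I\<^esub> u) \<cdot>\<^bsub>Hom K B (pob F k)\<^esub> rwhisker K B (pob F i) (pob F k) (pcmp F v u) (restrict z (Ob I) i)
        = restrict m (Ar I) v \<cdot>\<^bsub>Hom K B (pob F k)\<^esub> lwhisker K B (pob F j) (pob F k) (par F v) (restrict m (Ar I) u)"
      using setoidalD(1)[OF sB[OF k] Bk.cmp_hom[OF p m[OF vu]] Bk.cmp_hom[OF q m[OF v]]] Ari[OF u] Ari[OF v] Ari[OF vu] i by simp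
  qed auto
  then have "(restrict z (Ob I), restrict m (Ar I)) \<in> Ob (pseudocones I K F B)" by (simp add: pseudocones_def)
  then obtain h e where h: "h \<in> Ob (Hom K B L)"
    and e: "e \<in> hom (pseudocones I K F B) (fob (cone_ftr I K F L (l,n) B) h) (restrict z (Ob I), restrict m (Ar I))"
    using equivalence_ess_surj[OF bilimit_equivalence[OF B]] unfolding ess_surj_def by blast
  have "snd (snd e) i \<in> hom (Hom K B (pob F i)) (fst (fob (cone_ftr I K F L (l,n) B) h) i) (restrict z (Ob I) i)" if "i \<in> Ob I" for i
    using e that by (auto simp: hom_def pseudocones_def)
  then show ?thesis using h bilimit_fob(2)[OF B h] by (intro bexI[of _ h]) auto
qed

text \<open>The cone functor is faithful, so 2-cells into \<open>L\<close> are equal once their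
  whiskerings with all \<open>l i\<close> are. A reverse 2-cell exists because one exists for each
  \<open>i\<close>.\<close>

lemma bilimit_locally_setoidal: "locally_setoidal K L"
  unfolding locally_setoidal_def setoidal_def
proof (intro ballI conjI allI impI)
  fix B x y s t assume B: "B \<in> Obj K" and s: "s \<in> hom (Hom K B L) x y" and t: "t \<in> hom (Hom K B L) x y"
  have "lwhisker K B L (pob F i) (l i) s = lwhisker K B L (pob F i) (l i) t" if i: "i \<in> Ob I" for i
    using setoidalD(1) st[OF i] B lw_hom[OF B bilimit_typing(1,2,3) s] lw_hom[OF B bilimit_typing(1,2,3) t] i
    unfolding locally_setoidal_def by metis
  then have "far (cone_ftr I K F L (l,n) B) s = far (cone_ftr I K F L (l,n) B) t"
    using s t by (auto simp: cone_ftr_def hom_iff restrict_def fun_eq_iff)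
  then show "s = t"
    using equivalence_faithful[OF Hom_category[OF B bilimit_typing(1)] bilimit_equivalence[OF B] s t] by blast
next
  fix B x y assume B: "B \<in> Obj K" and lk: "hom (Hom K B L) x y \<noteq> {}"
  have xy: "x \<in> Ob (Hom K B L)" "y \<in> Ob (Hom K B L)" using lk homOb[OF B bilimit_typing(1)] by auto
  show "hom (Hom K B L) y x \<noteq> {}"
  proof (rule bilimit_linked[OF B xy(2,1)])
    fix i assume i: "i \<in> Ob I"
    show "hom (Hom K B (pob F i)) (cmp1 K B L (pob F i) (l i) y) (cmp1 K B L (pob F i) (l i) x) \<noteq> {}"
      using setoidalD(2) st[OF i] B linked_post[OF B bilimit_typing(1) bilimit_typing(2)[OF i] bilimit_typing(3)[OF i] lk]
      unfolding locally_setoidal_def by metis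
  qed
qed

text \<open>The composites of \<open>x\<close> with the projections are extended along
  \<open>j\<close> one by one. That the extensions \<open>z i\<close> are compatible with the
  transition 1-cells can be tested after restriction along \<open>j\<close>, by the second half of
  orthogonality, and there it holds because \<open>x\<close> maps into a cone. Then
  \<open>bilimit_lift\<close> combines them.\<close>

lemma bilimit_orthogonal:
  assumes B: "B \<in> Obj K" "T \<in> Obj K" and j: "j \<in> Ob (Hom K B T)"
    and orth: "\<And>i. i \<in> Ob I \<Longrightarrow> orthogonal K B T j (pob F i)"
  shows "orthogonal K B T j L"
  unfolding orthogonal_def
proof (intro conjI ballI impI)
  note o = bilimit_typing(2) and p = bilimit_typing(3)
  note Lo = bilimit_typing(1)
  have sym: "hom (Hom K B (pob F i)) b a \<noteq> {}" if "i \<in> Ob I" "hom (Hom K B (pob F i)) a b \<noteq> {}" for i a b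
    using st[OF that(1)] B(1) that(2) setoidalD(2) unfolding locally_setoidal_def by metis
  fix x assume x: "x \<in> Ob (Hom K B L)"
  have "\<exists>z. \<forall>i\<in>Ob I. z i \<in> Ob (Hom K T (pob F i)) \<and>
      hom (Hom K B (pob F i)) (cmp1 K B T (pob F i) (z i) j) (cmp1 K B L (pob F i) (l i) x) \<noteq> {}"
    using orth cmp1_Hom[OF B(1) Lo o x p] unfolding orthogonal_def by (intro bchoice) blast
  then obtain z where z: "\<And>i. i \<in> Ob I \<Longrightarrow> z i \<in> Ob (Hom K T (pob F i))"
    and zl: "\<And>i. i \<in> Ob I \<Longrightarrow> hom (Hom K B (pob F i)) (cmp1 K B T (pob F i) (z i) j) (cmp1 K B L (pob F i) (l i) x) \<noteq> {}"
    by blast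
  have "hom (Hom K T (pob F k)) (cmp1 K T (pob F i) (pob F k) (par F u) (z i)) (z k) \<noteq> {}" if u: "u \<in> hom I i k" for u i k
  proof -
    have i: "i \<in> Ob I" and k: "k \<in> Ob I" using category.hom_ObD[OF I u] by auto
    note P = bilimit_typing(4)[OF u]
    have "hom (Hom K B (pob F k)) (cmp1 K B (pob F i) (pob F k) (par F u) (cmp1 K B T (pob F i) (z i) j))
        (cmp1 K B (pob F i) (pob F k) (par F u) (cmp1 K B L (pob F i) (l i) x)) \<noteq> {}"
      by (rule linked_post[OF B(1) o[OF i] o[OF k] P zl[OF i]])
    moreover have "hom (Hom K B (pob F k)) (cmp1 K B (pob F i) (pob F k) (par F u) (cmp1 K B L (pob F i) (l i) x))
        (cmp1 K B L (pob F k) (l k) x) \<noteq> {}"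
      using rw_hom[OF B(1) Lo o[OF k] x bilimit_typing(5)[OF u]] cmp1_assoc[OF B(1) Lo o[OF i] o[OF k] x p[OF i] P] by auto
    ultimately have "hom (Hom K B (pob F k)) (cmp1 K B (pob F i) (pob F k) (par F u) (cmp1 K B T (pob F i) (z i) j))
        (cmp1 K B T (pob F k) (z k) j) \<noteq> {}"
      using linked_trans[OF B(1) o[OF k]] sym[OF k zl[OF k]] by blast
    then show ?thesis
      using orth[OF k] cmp1_Hom[OF B(2) o[OF i] o[OF k] z[OF i] P] z[OF k] cmp1_assoc[OF B o[OF i] o[OF k] j z[OF i] P]
      unfolding orthogonal_def by metis
  qed
  then obtain h where h: "h \<in> Ob (Hom K T L)" and hl: "\<And>i. i \<in> Ob I \<Longrightarrow> hom (Hom K T (pob F i)) (cmp1 K T L (pob F i) (l i) h) (z i) \<noteq> {}"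
    using bilimit_lift[OF B(2) z] by blast
  have "hom (Hom K B L) (cmp1 K B T L h j) x \<noteq> {}"
  proof (rule bilimit_linked[OF B(1) cmp1_Hom[OF B Lo j h] x])
    fix i assume i: "i \<in> Ob I"
    show "hom (Hom K B (pob F i)) (cmp1 K B L (pob F i) (l i) (cmp1 K B T L h j)) (cmp1 K B L (pob F i) (l i) x) \<noteq> {}"
      using linked_trans[OF B(1) o[OF i] linked_pre[OF B o[OF i] j hl[OF i]] zl[OF i]]
      by (simp add: cmp1_assoc[OF B Lo o[OF i] j h p[OF i]])
  qed
  then show "\<exists>y\<in>Ob (Hom K T L). hom (Hom K B L) (cmp1 K B T L y j) x \<noteq> {}" using h by blast
next
  note o = bilimit_typing(2) and p = bilimit_typing(3)
  note Lo = bilimit_typing(1)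
  fix y y' assume y: "y \<in> Ob (Hom K T L)" "y' \<in> Ob (Hom K T L)"
    and lk: "hom (Hom K B L) (cmp1 K B T L y j) (cmp1 K B T L y' j) \<noteq> {}"
  show "hom (Hom K T L) y y' \<noteq> {}"
  proof (rule bilimit_linked[OF B(2) y])
    fix i assume i: "i \<in> Ob I"
    have "hom (Hom K B (pob F i)) (cmp1 K B T (pob F i) (cmp1 K T L (pob F i) (l i) y) j) (cmp1 K B T (pob F i) (cmp1 K T L (pob F i) (l i) y') j) \<noteq> {}"
      using linked_post[OF B(1) Lo o[OF i] p[OF i] lk] by (simp add: cmp1_assoc[OF B Lo o[OF i] j _ p[OF i]] y)
    then show "hom (Hom K T (pob F i)) (cmp1 K T L (pob F i) (l i) y) (cmp1 K T L (pob F i) (l i) y') \<noteq> {}"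
      using orth[OF i] cmp1_Hom[OF B(2) Lo o[OF i] _ p[OF i]] y unfolding orthogonal_def by blast
  qed
qed

end

end

section \<open>Opfibrations from orthogonality to one end of a tensor\<close>

context two_category
begin

lemma postcompose_functor:
  assumes "B \<in> Obj K" "C \<in> Obj K" "D \<in> Obj K" "f \<in> Ob (Hom K C D)"
  shows "ftor (Hom K B C) (Hom K B D) (postcompose K B C D f)"
proof (rule ftorI)
  show c: "category (Hom K B C)" "category (Hom K B D)" using Hom_category assms by auto
  interpret category "Hom K B C" by fact
  note w = lw_hom[OF assms]
  show "is_functor (Hom K B C) (Hom K B D) (postcompose K B C D f)"
  proof (rule functorI[OF c(1)])
    fix x assume "x \<in> Ob (Hom K B C)"
    then show "fob (postcompose K B C D f) x \<in> Ob (Hom K B D)" by (simp add: postcompose_def cmp1_Hom assms)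
    show "far (postcompose K B C D f) (idn (Hom K B C) x) = idn (Hom K B D) (fob (postcompose K B C D f) x)"
      using \<open>x \<in> _\<close> by (simp add: postcompose_def lw_idn assms)
  next
    fix s x y assume s: "s \<in> hom (Hom K B C) x y"
    then show "far (postcompose K B C D f) s \<in> hom (Hom K B D) (fob (postcompose K B C D f) x) (fob (postcompose K B C D f) y)"
      using w[OF s] hom_ObD[OF s] by (simp add: postcompose_def hom_iff)
    fix t z assume t: "t \<in> hom (Hom K B C) y z"
    have "t \<cdot>\<^bsub>Hom K B C\<^esub> s \<in> Ar (Hom K B C)" using s t by (simp add: hom_iff)
    then show "far (postcompose K B C D f) (t \<cdot>\<^bsub>Hom K B C\<^esub> s) = far (postcompose K B C D f) t \<cdot>\<^bsub>Hom K B D\<^esub> far (postcompose K B C D f) s"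
      using lw_cmp[OF assms s t] s t by (simp add: postcompose_def hom_iff)
  qed (auto simp: postcompose_def)
qed

lemma rw_idn: "A \<in> Obj K \<Longrightarrow> B \<in> Obj K \<Longrightarrow> C \<in> Obj K \<Longrightarrow> f \<in> Ob (Hom K A B) \<Longrightarrow> g \<in> Ob (Hom K B C) \<Longrightarrow>
   rwhisker K A B C (idn (Hom K B C) g) f = idn (Hom K A C) (cmp1 K A B C g f)"
  by (simp add: rwhisker_def cmp2_idn)

context
  fixes B T i0 i1 \<tau>
  assumes B: "B \<in> Obj K" and ten: "arrow_tensor K B T i0 i1 \<tau>"
begin

lemma tensor_typing: "T \<in> Obj K" "i0 \<in> Ob (Hom K B T)" "i1 \<in> Ob (Hom K B T)" "\<tau> \<in> hom (Hom K B T) i0 i1"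
  using ten unfolding arrow_tensor_def by auto

lemma tensor_represent:
  assumes "D \<in> Obj K" "\<alpha> \<in> hom (Hom K B D) g g'"
  obtains a \<kappa>0 \<kappa>1 where "a \<in> Ob (Hom K T D)" "\<kappa>0 \<in> hom (Hom K B D) g (cmp1 K B T D a i0)" "\<kappa>1 \<in> hom (Hom K B D) g' (cmp1 K B T D a i1)"
    "is_iso (Hom K B D) \<kappa>0" "is_iso (Hom K B D) \<kappa>1" "lwhisker K B T D a \<tau> \<cdot>\<^bsub>Hom K B D\<^esub> \<kappa>0 = \<kappa>1 \<cdot>\<^bsub>Hom K B D\<^esub> \<alpha>"
  using ten assms unfolding arrow_tensor_def by metis

lemma tensor_unique:
  assumes "D \<in> Obj K" "a \<in> Ob (Hom K T D)" "b \<in> Ob (Hom K T D)"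
    "\<sigma>0 \<in> hom (Hom K B D) (cmp1 K B T D a i0) (cmp1 K B T D b i0)"
    "\<sigma>1 \<in> hom (Hom K B D) (cmp1 K B T D a i1) (cmp1 K B T D b i1)"
    "lwhisker K B T D b \<tau> \<cdot>\<^bsub>Hom K B D\<^esub> \<sigma>0 = \<sigma>1 \<cdot>\<^bsub>Hom K B D\<^esub> lwhisker K B T D a \<tau>"
  shows "\<exists>!\<sigma>. \<sigma> \<in> hom (Hom K T D) a b \<and> rwhisker K B T D \<sigma> i0 = \<sigma>0 \<and> rwhisker K B T D \<sigma> i1 = \<sigma>1"
  using ten assms unfolding arrow_tensor_def by blast

lemma tensor_ext:
  assumes D: "D \<in> Obj K" and s: "\<sigma> \<in> hom (Hom K T D) a b" and t: "\<sigma>' \<in> hom (Hom K T D) a b"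
    and e: "rwhisker K B T D \<sigma> i0 = rwhisker K B T D \<sigma>' i0" "rwhisker K B T D \<sigma> i1 = rwhisker K B T D \<sigma>' i1"
  shows "\<sigma> = \<sigma>'"
proof -
  note T = tensor_typing
  have ab: "a \<in> Ob (Hom K T D)" "b \<in> Ob (Hom K T D)" using homOb[OF T(1) D s] by auto
  show ?thesis
    using tensor_unique[OF D ab rw_hom[OF B T(1) D T(2) s] rw_hom[OF B T(1) D T(3) s] whisker_swap[OF B T(1) D T(4) s]] s t e by auto
qed

text \<open>The inverses \<open>r0\<close> and \<open>r1\<close> of the two restrictions are again
  compatible with \<open>\<tau>\<close>, so they come from a single 2-cell \<open>q\<close>, and
  \<open>tensor_ext\<close> shows that it is inverse to \<open>\<sigma>\<close>.\<close>

lemma tensor_iso: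
  assumes D: "D \<in> Obj K" and s: "\<sigma> \<in> hom (Hom K T D) a b"
    and i: "is_iso (Hom K B D) (rwhisker K B T D \<sigma> i0)" "is_iso (Hom K B D) (rwhisker K B T D \<sigma> i1)"
  shows "is_iso (Hom K T D) \<sigma>"
proof -
  note T = tensor_typing
  interpret TD: category "Hom K T D" using Hom_category T D by auto
  interpret BD: category "Hom K B D" using Hom_category B D by auto
  have ab: "a \<in> Ob (Hom K T D)" "b \<in> Ob (Hom K T D)" using homOb[OF T(1) D s] by auto
  note w0 = rw_hom[OF B T(1) D T(2) s] and w1 = rw_hom[OF B T(1) D T(3) s]
  obtain r0 where r0: "r0 \<in> hom (Hom K B D) (cmp1 K B T D b i0) (cmp1 K B T D a i0)"
     "r0 \<cdot>\<^bsub>Hom K B D\<^esub> rwhisker K B T D \<sigma> i0 = idn (Hom K B D) (cmp1 K B T D a i0)"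
     "rwhisker K B T D \<sigma> i0 \<cdot>\<^bsub>Hom K B D\<^esub> r0 = idn (Hom K B D) (cmp1 K B T D b i0)" using isoE[OF i(1) w0] .
  obtain r1 where r1: "r1 \<in> hom (Hom K B D) (cmp1 K B T D b i1) (cmp1 K B T D a i1)"
     "r1 \<cdot>\<^bsub>Hom K B D\<^esub> rwhisker K B T D \<sigma> i1 = idn (Hom K B D) (cmp1 K B T D a i1)"
     "rwhisker K B T D \<sigma> i1 \<cdot>\<^bsub>Hom K B D\<^esub> r1 = idn (Hom K B D) (cmp1 K B T D b i1)" using isoE[OF i(2) w1] .
  note la = lw_hom[OF B T(1) D ab(1) T(4)] and lb = lw_hom[OF B T(1) D ab(2) T(4)]
  have sw: "lwhisker K B T D b \<tau> \<cdot>\<^bsub>Hom K B D\<^esub> rwhisker K B T D \<sigma> i0 = rwhisker K B T D \<sigma> i1 \<cdot>\<^bsub>Hom K B D\<^esub> lwhisker K B T D a \<tau>"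
    by (rule whisker_swap[OF B T(1) D T(4) s])
  have "lwhisker K B T D a \<tau> \<cdot>\<^bsub>Hom K B D\<^esub> r0 = (r1 \<cdot>\<^bsub>Hom K B D\<^esub> (rwhisker K B T D \<sigma> i1 \<cdot>\<^bsub>Hom K B D\<^esub> lwhisker K B T D a \<tau>)) \<cdot>\<^bsub>Hom K B D\<^esub> r0"
    using BD.reassoc[OF r1(2), of "lwhisker K B T D a \<tau>"] la w1 r1 r0 by (simp add: hom_iff)
  also have "\<dots> = r1 \<cdot>\<^bsub>Hom K B D\<^esub> lwhisker K B T D b \<tau>"
    unfolding sw[symmetric] using la lb w0 w1 r1 r0 by (simp add: hom_iff BD.assoc)
  finally obtain q where v: "q \<in> hom (Hom K T D) b a" "rwhisker K B T D q i0 = r0" "rwhisker K B T D q i1 = r1"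
    using tensor_unique[OF D ab(2,1) r0(1) r1(1)] by blast
  have "q \<cdot>\<^bsub>Hom K T D\<^esub> \<sigma> = idn (Hom K T D) a"
    by (rule tensor_ext[OF D TD.cmp_hom[OF s v(1)] TD.idn_hom[OF ab(1)]])
      (simp_all add: rw_cmp[OF B T(1) D _ s v(1)] T v r0 r1 rw_idn B D ab)
  moreover have "\<sigma> \<cdot>\<^bsub>Hom K T D\<^esub> q = idn (Hom K T D) b"
    by (rule tensor_ext[OF D TD.cmp_hom[OF v(1) s] TD.idn_hom[OF ab(2)]])
      (simp_all add: rw_cmp[OF B T(1) D _ v(1) s] T v r0 r1 rw_idn B D ab)
  ultimately show ?thesis by (rule isoI[OF s v(1)])
qed

context
  fixes C D f
  assumes C: "C \<in> Obj K" and D: "D \<in> Obj K" and f: "f \<in> Ob (Hom K C D)"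
    and ls: "locally_setoidal (PS D) (C, f)"
    and orth: "\<And>a. a \<in> Ob (Hom K T D) \<Longrightarrow> orthogonal (PS D) (B, cmp1 K B T D a i0) (T, a)
        (i0, idn (Hom K B D) (cmp1 K B T D a i0)) (C, f)"
begin

text \<open>Both are 2-cells of the pseudoslice from \<open>h\<close> with identity triangle to
  \<open>k\<close> with the triangle \<open>f s\<close>. Triangles in the pseudoslice are
  invertible, which is where the last hypothesis comes from; the general case is
  \<open>lwhisker_faithful\<close>.\<close>

lemma lifted_eq:
  assumes s: "s \<in> hom (Hom K B C) h k" and t: "t \<in> hom (Hom K B C) h k"
    and e: "lwhisker K B C D f s = lwhisker K B C D f t" and i: "is_iso (Hom K B D) (lwhisker K B C D f s)"
  shows "s = t"
proof -
  interpret BD: category "Hom K B D" using Hom_category B D by auto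
  have hk: "h \<in> Ob (Hom K B C)" "k \<in> Ob (Hom K B C)" using homOb[OF B C s] by auto
  note fh = cmp1_Hom[OF B C D hk(1) f]
  note fs = lw_hom[OF B C D f s]
  have st: "setoidal (Hom (PS D) (B, cmp1 K B C D f h) (C, f))"
    using ls B fh unfolding locally_setoidal_def by (simp add: PS_Obj)
  have "((h, idn (Hom K B D) (cmp1 K B C D f h)), (k, lwhisker K B C D f s), r) \<in>
      hom (Hom (PS D) (B, cmp1 K B C D f h) (C, f)) (h, idn (Hom K B D) (cmp1 K B C D f h)) (k, lwhisker K B C D f s)"
    if r: "r \<in> hom (Hom K B C) h k" "lwhisker K B C D f r = lwhisker K B C D f s" for r
    unfolding PS_hom using r hk fh i fs iso_idn[OF BD.category_axioms fh] BD.idn_hom[OF fh] by (auto simp: PS_Ob hom_iff)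
  from setoidalD(1)[OF st this[OF s refl] this[OF t e[symmetric]]] show ?thesis by simp
qed

text \<open>The 2-cells \<open>\<psi>\<close> and \<open>\<psi>'\<close> become 1-cells
  \<open>k\<close> and \<open>k'\<close> from the tensor to \<open>C\<close>. The identity of
  \<open>e\<close> together with \<open>\<theta>\<close> makes \<open>f k\<close> and
  \<open>f k'\<close> isomorphic by \<open>\<phi>\<close>, so both are lifts of \<open>f k\<close>,
  and they are isomorphic at the end \<open>i0\<close>. Orthogonality extends this to
  \<open>\<rho> : k \<Rightarrow> k'\<close>, and the restriction of \<open>\<rho>\<close> to
  \<open>i1\<close> gives \<open>\<omega>\<close>.\<close>

lemma opcartesian_transport:
  assumes p: "\<psi> \<in> hom (Hom K B C) e e1" "\<psi>' \<in> hom (Hom K B C) e e2"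
    and th: "\<theta> \<in> hom (Hom K B D) (cmp1 K B C D f e1) (cmp1 K B C D f e2)" "is_iso (Hom K B D) \<theta>"
    and eq: "\<theta> \<cdot>\<^bsub>Hom K B D\<^esub> lwhisker K B C D f \<psi> = lwhisker K B C D f \<psi>'"
  shows "\<exists>\<omega> \<in> hom (Hom K B C) e1 e2. lwhisker K B C D f \<omega> = \<theta> \<and> \<omega> \<cdot>\<^bsub>Hom K B C\<^esub> \<psi> = \<psi>'"
proof -
  note T = tensor_typing
  let ?P = "postcompose K B C D f"
  interpret TD: category "Hom K T D" using Hom_category T D by auto
  interpret TC: category "Hom K T C" using Hom_category T C by auto
  interpret BC: category "Hom K B C" using Hom_category B C by auto
  interpret BD: category "Hom K B D" using Hom_category B D by auto
  interpret P: ftor "Hom K B C" "Hom K B D" ?P by (rule postcompose_functor[OF B C D f])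
  have P: "lwhisker K B C D f s = far ?P s" if "s \<in> Ar (Hom K B C)" for s using that by (simp add: postcompose_def)
  have Po: "cmp1 K B C D f x = fob ?P x" if "x \<in> Ob (Hom K B C)" for x using that by (simp add: postcompose_def)
  obtain k l0 l1 where k: "k \<in> Ob (Hom K T C)" and l0: "l0 \<in> hom (Hom K B C) e (cmp1 K B T C k i0)" "is_iso (Hom K B C) l0"
    and l1: "l1 \<in> hom (Hom K B C) e1 (cmp1 K B T C k i1)" "is_iso (Hom K B C) l1"
    and kt: "lwhisker K B T C k \<tau> \<cdot>\<^bsub>Hom K B C\<^esub> l0 = l1 \<cdot>\<^bsub>Hom K B C\<^esub> \<psi>"
    using tensor_represent[OF C p(1)] .
  obtain k' l0' l1' where k': "k' \<in> Ob (Hom K T C)" and l0': "l0' \<in> hom (Hom K B C) e (cmp1 K B T C k' i0)" "is_iso (Hom K B C) l0'"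
    and l1': "l1' \<in> hom (Hom K B C) e2 (cmp1 K B T C k' i1)" "is_iso (Hom K B C) l1'"
    and kt': "lwhisker K B T C k' \<tau> \<cdot>\<^bsub>Hom K B C\<^esub> l0' = l1' \<cdot>\<^bsub>Hom K B C\<^esub> \<psi>'"
    using tensor_represent[OF C p(2)] .
  obtain m0 where m0: "m0 \<in> hom (Hom K B C) (cmp1 K B T C k i0) e" "m0 \<cdot>\<^bsub>Hom K B C\<^esub> l0 = idn (Hom K B C) e"
     "l0 \<cdot>\<^bsub>Hom K B C\<^esub> m0 = idn (Hom K B C) (cmp1 K B T C k i0)" "is_iso (Hom K B C) m0"
    using BC.iso_inverse[OF l0(2,1)] by blast
  obtain m1 where m1: "m1 \<in> hom (Hom K B C) (cmp1 K B T C k i1) e1" "m1 \<cdot>\<^bsub>Hom K B C\<^esub> l1 = idn (Hom K B C) e1"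
     "l1 \<cdot>\<^bsub>Hom K B C\<^esub> m1 = idn (Hom K B C) (cmp1 K B T C k i1)" "is_iso (Hom K B C) m1"
    using BC.iso_inverse[OF l1(2,1)] by blast
  obtain m1' where m1': "m1' \<in> hom (Hom K B C) (cmp1 K B T C k' i1) e2" "m1' \<cdot>\<^bsub>Hom K B C\<^esub> l1' = idn (Hom K B C) e2"
     "l1' \<cdot>\<^bsub>Hom K B C\<^esub> m1' = idn (Hom K B C) (cmp1 K B T C k' i1)"
    using BC.iso_inverse[OF l1'(2,1)] by blast
  note fk = cmp1_Hom[OF T(1) C D k f] and fk' = cmp1_Hom[OF T(1) C D k' f]
  have tA: "\<tau> \<in> Ar (Hom K B T)" using T(4) by (simp add: hom_iff)
  note kth = lw_hom[OF B T(1) C k T(4)] and kth' = lw_hom[OF B T(1) C k' T(4)]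
  have o: "cmp1 K B T D (cmp1 K T C D f k) i0 = fob ?P (cmp1 K B T C k i0)" "cmp1 K B T D (cmp1 K T C D f k) i1 = fob ?P (cmp1 K B T C k i1)"
     "cmp1 K B T D (cmp1 K T C D f k') i0 = fob ?P (cmp1 K B T C k' i0)" "cmp1 K B T D (cmp1 K T C D f k') i1 = fob ?P (cmp1 K B T C k' i1)"
    using T k k' by (simp_all add: cmp1_assoc[OF B T(1) C D _ _ f] Po cmp1_Hom[OF B T(1) C])
  have ee: "e \<in> Ob (Hom K B C)" "e1 \<in> Ob (Hom K B C)" "e2 \<in> Ob (Hom K B C)" using p by (auto simp: hom_iff)
  note H = p l0(1) l1(1) l0'(1) l1'(1) m0(1) m1(1) m1'(1) kth kth'
  note th' = th(1)[unfolded Po[OF ee(2)] Po[OF ee(3)]]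
  \<comment> \<open>The identity of \<open>f e\<close> and the 2-cell \<open>\<theta>\<close>,
    transported along the isomorphisms between \<open>\<psi>\<close>, \<open>\<psi>'\<close> and
    their representatives.\<close>
  define s0 where "s0 = far ?P l0' \<cdot>\<^bsub>Hom K B D\<^esub> far ?P m0"
  define s1 where "s1 = far ?P l1' \<cdot>\<^bsub>Hom K B D\<^esub> (\<theta> \<cdot>\<^bsub>Hom K B D\<^esub> far ?P m1)"
  have s0: "s0 \<in> hom (Hom K B D) (cmp1 K B T D (cmp1 K T C D f k) i0) (cmp1 K B T D (cmp1 K T C D f k') i0)"
    and s1: "s1 \<in> hom (Hom K B D) (cmp1 K B T D (cmp1 K T C D f k) i1) (cmp1 K B T D (cmp1 K T C D f k') i1)"
    using H th' by (auto simp: o s0_def s1_def hom_iff)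
  have s0P: "s0 = far ?P (l0' \<cdot>\<^bsub>Hom K B C\<^esub> m0)" using H by (simp add: s0_def P.far_cmp hom_iff)
  have i0: "is_iso (Hom K B D) s0"
    unfolding s0P by (rule P.far_iso[OF iso_cmp[OF BC.category_axioms m0(4) l0'(2) m0(1) l0'(1)]])
  have "is_iso (Hom K B D) (far ?P l1')" "is_iso (Hom K B D) (far ?P m1)" using P.far_iso l1' m1 by auto
  then have i1: "is_iso (Hom K B D) s1"
    unfolding s1_def
    using iso_cmp[OF BD.category_axioms iso_cmp[OF BD.category_axioms _ th(2) _ th'], of "far ?P m1" _ "far ?P l1'"] H th'
    by (auto simp: hom_iff)
  have "m1 \<cdot>\<^bsub>Hom K B C\<^esub> ((lwhisker K B T C k \<tau> \<cdot>\<^bsub>Hom K B C\<^esub> l0) \<cdot>\<^bsub>Hom K B C\<^esub> m0) = \<psi> \<cdot>\<^bsub>Hom K B C\<^esub> m0"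
    unfolding kt using H BC.reassoc[OF m1(2), of "\<psi> \<cdot>\<^bsub>Hom K B C\<^esub> m0"] by (simp add: BC.assoc hom_iff)
  then have mk: "m1 \<cdot>\<^bsub>Hom K B C\<^esub> lwhisker K B T C k \<tau> = \<psi> \<cdot>\<^bsub>Hom K B C\<^esub> m0"
    using H by (simp add: BC.assoc m0 hom_iff)
  have "lwhisker K B T D (cmp1 K T C D f k') \<tau> \<cdot>\<^bsub>Hom K B D\<^esub> s0 = far ?P ((lwhisker K B T C k' \<tau> \<cdot>\<^bsub>Hom K B C\<^esub> l0') \<cdot>\<^bsub>Hom K B C\<^esub> m0)"
    using H by (simp add: lw_lw[OF B T(1) C D tA k' f, symmetric] P s0P P.far_cmp BC.assoc hom_iff)
  also have "\<dots> = far ?P l1' \<cdot>\<^bsub>Hom K B D\<^esub> ((\<theta> \<cdot>\<^bsub>Hom K B D\<^esub> far ?P \<psi>) \<cdot>\<^bsub>Hom K B D\<^esub> far ?P m0)"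
    unfolding kt' using H eq by (simp add: P P.far_cmp BC.assoc BD.assoc hom_iff)
  also have "\<dots> = far ?P l1' \<cdot>\<^bsub>Hom K B D\<^esub> (\<theta> \<cdot>\<^bsub>Hom K B D\<^esub> far ?P (\<psi> \<cdot>\<^bsub>Hom K B C\<^esub> m0))"
    using H th' by (simp add: P.far_cmp BC.assoc BD.assoc hom_iff)
  also have "\<dots> = s1 \<cdot>\<^bsub>Hom K B D\<^esub> lwhisker K B T D (cmp1 K T C D f k) \<tau>"
    unfolding mk[symmetric] using H th' by (simp add: lw_lw[OF B T(1) C D tA k f, symmetric] P s1_def P.far_cmp BD.assoc hom_iff)
  finally obtain \<phi> where ph: "\<phi> \<in> hom (Hom K T D) (cmp1 K T C D f k) (cmp1 K T C D f k')"
      "rwhisker K B T D \<phi> i0 = s0" "rwhisker K B T D \<phi> i1 = s1"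
    using tensor_unique[OF D fk fk' s0 s1] by blast
  have pi: "is_iso (Hom K T D) \<phi>" by (rule tensor_iso[OF D ph(1)]) (simp_all add: ph i0 i1)
  \<comment> \<open>Over \<open>f k\<close> the 1-cell \<open>k\<close> is a lift by the identity
    triangle and \<open>k'\<close> a lift by \<open>\<phi>\<close>. The facts \<open>yj\<close> and
    \<open>yj'\<close> compute the restrictions of these lifts along \<open>i0\<close>.\<close>
  let ?g = "cmp1 K B T D (cmp1 K T C D f k) i0"
  let ?j = "(i0, idn (Hom K B D) ?g)"
  have g: "?g \<in> Ob (Hom K B D)" using cmp1_Hom[OF B T(1) D T(2) fk] .
  have y: "(k, idn (Hom K T D) (cmp1 K T C D f k)) \<in> Ob (Hom (PS D) (T, cmp1 K T C D f k) (C, f))"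
    using k TD.idn_hom[OF fk] iso_idn[OF TD.category_axioms fk] by (simp add: PS_Ob)
  have y': "(k', \<phi>) \<in> Ob (Hom (PS D) (T, cmp1 K T C D f k) (C, f))" using k' ph pi by (simp add: PS_Ob)
  have yj: "cmp1 (PS D) (B, ?g) (T, cmp1 K T C D f k) (C, f) (k, idn (Hom K T D) (cmp1 K T C D f k)) ?j = (cmp1 K B T C k i0, idn (Hom K B D) ?g)"
    using g by (simp add: PS_sel rw_idn[OF B T(1) D T(2) fk])
  have yj': "cmp1 (PS D) (B, ?g) (T, cmp1 K T C D f k) (C, f) (k', \<phi>) ?j = (cmp1 K B T C k' i0, s0)"
    using g s0 by (simp add: PS_sel ph hom_iff)
  have "((cmp1 K B T C k i0, idn (Hom K B D) ?g), (cmp1 K B T C k' i0, s0), l0' \<cdot>\<^bsub>Hom K B C\<^esub> m0)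
      \<in> hom (Hom (PS D) (B, ?g) (C, f)) (cmp1 K B T C k i0, idn (Hom K B D) ?g) (cmp1 K B T C k' i0, s0)"
    using H s0 i0 g iso_idn[OF BD.category_axioms g] T k k'
    unfolding PS_hom by (auto simp: PS_Ob hom_iff o Po P s0P cmp1_Hom[OF B T(1) C])
  then obtain r where "r \<in> hom (Hom (PS D) (T, cmp1 K T C D f k) (C, f)) (k, idn (Hom K T D) (cmp1 K T C D f k)) (k', \<phi>)"
    using orth[OF fk] y y' unfolding orthogonal_def yj[symmetric] yj'[symmetric] by blast
  then obtain \<rho> where r: "\<rho> \<in> hom (Hom K T C) k k'" "lwhisker K T C D f \<rho> \<cdot>\<^bsub>Hom K T D\<^esub> idn (Hom K T D) (cmp1 K T C D f k) = \<phi>"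
    by (auto simp: PS_hom)
  then have fr: "lwhisker K T C D f \<rho> = \<phi>" using lw_hom[OF T(1) C D f r(1)] by (simp add: hom_iff)
  note r0h = rw_hom[OF B T(1) C T(2) r(1)] and r1h = rw_hom[OF B T(1) C T(3) r(1)]
  have rA: "\<rho> \<in> Ar (Hom K T C)" using r by (simp add: hom_iff)
  have fr0: "lwhisker K B C D f (rwhisker K B T C \<rho> i0) = s0" and fr1: "lwhisker K B C D f (rwhisker K B T C \<rho> i1) = s1"
    using lw_rw[OF B T(1) C D T(2) rA f] lw_rw[OF B T(1) C D T(3) rA f] by (simp_all add: fr ph)
  \<comment> \<open>Orthogonality yields just some \<open>\<rho>\<close> over \<open>\<phi>\<close>.
    At \<open>i0\<close> it has to be the expected comparison, since a lift of the invertible 2-cell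
    \<open>s0\<close> is unique by \<open>lifted_eq\<close>.\<close>
  have r0: "rwhisker K B T C \<rho> i0 = l0' \<cdot>\<^bsub>Hom K B C\<^esub> m0"
    by (rule lifted_eq[OF r0h]) (use H i0 in \<open>auto simp: fr0 hom_iff P s0P\<close>)
  have sw: "lwhisker K B T C k' \<tau> \<cdot>\<^bsub>Hom K B C\<^esub> rwhisker K B T C \<rho> i0 = rwhisker K B T C \<rho> i1 \<cdot>\<^bsub>Hom K B C\<^esub> lwhisker K B T C k \<tau>"
    by (rule whisker_swap[OF B T(1) C T(4) r(1)])
  define w where "w = m1' \<cdot>\<^bsub>Hom K B C\<^esub> (rwhisker K B T C \<rho> i1 \<cdot>\<^bsub>Hom K B C\<^esub> l1)"
  have w: "w \<in> hom (Hom K B C) e1 e2" unfolding w_def using H r1h by (auto simp: hom_iff)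
  have "far ?P m1' \<cdot>\<^bsub>Hom K B D\<^esub> far ?P l1' = idn (Hom K B D) (fob ?P e2)"
    using P.far_cmp[of l1' m1'] H ee by (simp add: m1' hom_iff)
  from BD.reassoc[OF this] have "far ?P m1' \<cdot>\<^bsub>Hom K B D\<^esub> (far ?P l1' \<cdot>\<^bsub>Hom K B D\<^esub> x) = x" if "x \<in> hom (Hom K B D) z (fob ?P e2)" for x z
    using that H by (simp add: hom_iff)
  moreover have "far ?P m1 \<cdot>\<^bsub>Hom K B D\<^esub> far ?P l1 = idn (Hom K B D) (fob ?P e1)"
    using P.far_cmp[of l1 m1] H ee by (simp add: m1 hom_iff)
  moreover have "lwhisker K B C D f w = far ?P m1' \<cdot>\<^bsub>Hom K B D\<^esub> (s1 \<cdot>\<^bsub>Hom K B D\<^esub> far ?P l1)"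
    using H r1h w fr1 by (simp add: w_def P P.far_cmp hom_iff)
  ultimately have "lwhisker K B C D f w = \<theta>"
    using H th' ee by (simp add: s1_def BD.assoc hom_iff)
  moreover have "w \<cdot>\<^bsub>Hom K B C\<^esub> \<psi> = m1' \<cdot>\<^bsub>Hom K B C\<^esub> (rwhisker K B T C \<rho> i1 \<cdot>\<^bsub>Hom K B C\<^esub> (lwhisker K B T C k \<tau> \<cdot>\<^bsub>Hom K B C\<^esub> l0))"
    unfolding kt w_def using H r1h by (simp add: BC.assoc hom_iff)
  moreover have "\<dots> = m1' \<cdot>\<^bsub>Hom K B C\<^esub> ((lwhisker K B T C k' \<tau> \<cdot>\<^bsub>Hom K B C\<^esub> rwhisker K B T C \<rho> i0) \<cdot>\<^bsub>Hom K B C\<^esub> l0)"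
    unfolding sw using H r1h by (simp add: BC.assoc hom_iff)
  moreover have "\<dots> = m1' \<cdot>\<^bsub>Hom K B C\<^esub> (lwhisker K B T C k' \<tau> \<cdot>\<^bsub>Hom K B C\<^esub> l0')"
    unfolding r0 using H by (simp add: BC.assoc m0 hom_iff)
  moreover have "\<dots> = \<psi>'"
    unfolding kt' using H BC.reassoc[OF m1'(2), of \<psi>'] by (simp add: hom_iff)
  ultimately show ?thesis using w by auto
qed

text \<open>Transport over the identity of \<open>f k\<close> yields an endo-2-cell \<open>w\<close>
  of \<open>k\<close> that takes \<open>s\<close> to \<open>t\<close>. It lies over an identity, so
  \<open>lifted_eq\<close> makes it the identity.\<close>

lemma lwhisker_faithful:
  assumes s: "s \<in> hom (Hom K B C) h k" and t: "t \<in> hom (Hom K B C) h k"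
    and e: "lwhisker K B C D f s = lwhisker K B C D f t"
  shows "s = t"
proof -
  interpret BC: category "Hom K B C" using Hom_category B C by auto
  interpret BD: category "Hom K B D" using Hom_category B D by auto
  have k: "k \<in> Ob (Hom K B C)" using s by (auto simp: hom_iff)
  have fk: "cmp1 K B C D f k \<in> Ob (Hom K B D)" by (rule cmp1_Hom[OF B C D k f])
  have id: "is_iso (Hom K B D) (idn (Hom K B D) (cmp1 K B C D f k))" by (rule iso_idn[OF BD.category_axioms fk])
  have "idn (Hom K B D) (cmp1 K B C D f k) \<cdot>\<^bsub>Hom K B D\<^esub> lwhisker K B C D f s = lwhisker K B C D f t"
    using lw_hom[OF B C D f s] e by (simp add: hom_iff)
  then obtain w where w: "w \<in> hom (Hom K B C) k k" "lwhisker K B C D f w = idn (Hom K B D) (cmp1 K B C D f k)" "w \<cdot>\<^bsub>Hom K B C\<^esub> s = t"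
    using opcartesian_transport[OF s t BD.idn_hom[OF fk] id] by blast
  have "w = idn (Hom K B C) k"
    by (rule lifted_eq[OF w(1) BC.idn_hom[OF k]]) (simp_all add: w lw_idn B C D k f id)
  then show ?thesis using w s by (simp add: hom_iff)
qed

text \<open>The 2-cell \<open>\<alpha>\<close> is represented by a 1-cell \<open>a\<close> from the
  tensor to \<open>D\<close>, whose restriction to \<open>i0\<close> lifts to \<open>e\<close>.
  Orthogonality lifts all of \<open>a\<close> to some \<open>k\<close>, and \<open>\<chi>\<close> is
  \<open>k\<close> whiskered with the universal 2-cell, after the comparison \<open>r\<close> at
  \<open>i0\<close>. The isomorphisms at \<open>i1\<close> make up \<open>\<theta>\<close>.\<close>

lemma opcartesian_lift:
  assumes e: "e \<in> Ob (Hom K B C)" and al: "\<alpha> \<in> hom (Hom K B D) (cmp1 K B C D f e) g"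
  shows "\<exists>e' \<chi> \<theta>. \<chi> \<in> hom (Hom K B C) e e' \<and> \<theta> \<in> hom (Hom K B D) g (cmp1 K B C D f e') \<and> is_iso (Hom K B D) \<theta> \<and>
    lwhisker K B C D f \<chi> = \<theta> \<cdot>\<^bsub>Hom K B D\<^esub> \<alpha>"
proof -
  note T = tensor_typing
  interpret BC: category "Hom K B C" using Hom_category B C by auto
  interpret BD: category "Hom K B D" using Hom_category B D by auto
  have tA: "\<tau> \<in> Ar (Hom K B T)" using T(4) by (simp add: hom_iff)
  obtain a k0 k1 where a: "a \<in> Ob (Hom K T D)" and k0: "k0 \<in> hom (Hom K B D) (cmp1 K B C D f e) (cmp1 K B T D a i0)" "is_iso (Hom K B D) k0"
    and k1: "k1 \<in> hom (Hom K B D) g (cmp1 K B T D a i1)" "is_iso (Hom K B D) k1"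
    and at: "lwhisker K B T D a \<tau> \<cdot>\<^bsub>Hom K B D\<^esub> k0 = k1 \<cdot>\<^bsub>Hom K B D\<^esub> \<alpha>"
    using tensor_represent[OF D al] .
  obtain n0 where n0: "n0 \<in> hom (Hom K B D) (cmp1 K B T D a i0) (cmp1 K B C D f e)" "is_iso (Hom K B D) n0"
     "n0 \<cdot>\<^bsub>Hom K B D\<^esub> k0 = idn (Hom K B D) (cmp1 K B C D f e)"
    using BD.iso_inverse[OF k0(2,1)] by blast
  let ?g = "cmp1 K B T D a i0"
  have g: "?g \<in> Ob (Hom K B D)" by (rule cmp1_Hom[OF B T(1) D T(2) a])
  have x: "(e, n0) \<in> Ob (Hom (PS D) (B, ?g) (C, f))" using e n0 by (simp add: PS_Ob)
  then obtain y where y: "y \<in> Ob (Hom (PS D) (T, a) (C, f))"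
    and l: "hom (Hom (PS D) (B, ?g) (C, f)) (cmp1 (PS D) (B, ?g) (T, a) (C, f) y (i0, idn (Hom K B D) ?g)) (e, n0) \<noteq> {}"
    using orth[OF a] unfolding orthogonal_def by blast
  obtain k \<phi> where ky: "y = (k, \<phi>)" by (cases y)
  have k: "k \<in> Ob (Hom K T C)" and ph: "\<phi> \<in> hom (Hom K T D) a (cmp1 K T C D f k)" "is_iso (Hom K T D) \<phi>"
    using y by (auto simp: ky PS_Ob)
  have "setoidal (Hom (PS D) (B, ?g) (C, f))"
    using ls B g unfolding locally_setoidal_def by (simp add: PS_Obj)
  from setoidalD(2)[OF this l] obtain r where r: "r \<in> hom (Hom K B C) e (cmp1 K B T C k i0)"
     "lwhisker K B C D f r \<cdot>\<^bsub>Hom K B D\<^esub> n0 = rwhisker K B T D \<phi> i0 \<cdot>\<^bsub>Hom K B D\<^esub> idn (Hom K B D) ?g"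
    by (auto simp: ky PS_hom PS_sel)
  note p0 = rw_hom[OF B T(1) D T(2) ph(1)] and p1 = rw_hom[OF B T(1) D T(3) ph(1)]
  note kt = lw_hom[OF B T(1) C k T(4)]
  note fr = lw_hom[OF B C D f r(1)] and fkt = lw_hom[OF B C D f kt] and at' = lw_hom[OF B T(1) D a T(4)]
  have o: "cmp1 K B T D (cmp1 K T C D f k) i0 = cmp1 K B C D f (cmp1 K B T C k i0)" "cmp1 K B T D (cmp1 K T C D f k) i1 = cmp1 K B C D f (cmp1 K B T C k i1)"
    using T k by (simp_all add: cmp1_assoc[OF B T(1) C D _ _ f])
  have "lwhisker K B C D f r = (lwhisker K B C D f r \<cdot>\<^bsub>Hom K B D\<^esub> n0) \<cdot>\<^bsub>Hom K B D\<^esub> k0"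
    using fr n0 k0 by (simp add: BD.assoc hom_iff)
  also have "\<dots> = rwhisker K B T D \<phi> i0 \<cdot>\<^bsub>Hom K B D\<^esub> k0"
    unfolding r(2) using p0 k0 g by (simp add: hom_iff)
  finally have fr': "lwhisker K B C D f r = rwhisker K B T D \<phi> i0 \<cdot>\<^bsub>Hom K B D\<^esub> k0" .
  have sw: "lwhisker K B C D f (lwhisker K B T C k \<tau>) \<cdot>\<^bsub>Hom K B D\<^esub> rwhisker K B T D \<phi> i0 = rwhisker K B T D \<phi> i1 \<cdot>\<^bsub>Hom K B D\<^esub> lwhisker K B T D a \<tau>"
    using whisker_swap[OF B T(1) D T(4) ph(1)] by (simp add: lw_lw[OF B T(1) C D tA k f])
  define \<chi> where "\<chi> = lwhisker K B T C k \<tau> \<cdot>\<^bsub>Hom K B C\<^esub> r"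
  define \<theta> where "\<theta> = rwhisker K B T D \<phi> i1 \<cdot>\<^bsub>Hom K B D\<^esub> k1"
  have "\<chi> \<in> hom (Hom K B C) e (cmp1 K B T C k i1)" unfolding \<chi>_def by (rule BC.cmp_hom[OF r(1) kt])
  moreover have "\<theta> \<in> hom (Hom K B D) g (cmp1 K B C D f (cmp1 K B T C k i1))"
    unfolding \<theta>_def by (rule BD.cmp_hom[OF k1(1) p1[unfolded o]])
  moreover have "is_iso (Hom K B D) \<theta>"
    unfolding \<theta>_def by (rule iso_cmp[OF BD.category_axioms k1(2) rw_iso[OF B T(1) D T(3) ph] k1(1) p1])
  moreover have "lwhisker K B C D f \<chi> = (lwhisker K B C D f (lwhisker K B T C k \<tau>) \<cdot>\<^bsub>Hom K B D\<^esub> rwhisker K B T D \<phi> i0) \<cdot>\<^bsub>Hom K B D\<^esub> k0"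
    unfolding \<chi>_def lw_cmp[OF B C D f r(1) kt] fr' using fkt p0 k0 by (simp add: BD.assoc hom_iff o)
  moreover have "\<dots> = rwhisker K B T D \<phi> i1 \<cdot>\<^bsub>Hom K B D\<^esub> (lwhisker K B T D a \<tau> \<cdot>\<^bsub>Hom K B D\<^esub> k0)"
    unfolding sw using p1 at' k0 by (simp add: BD.assoc hom_iff)
  moreover have "\<dots> = \<theta> \<cdot>\<^bsub>Hom K B D\<^esub> \<alpha>"
    unfolding at \<theta>_def using p1 k1 al by (simp add: BD.assoc hom_iff)
  ultimately show ?thesis by auto
qed

text \<open>To lift \<open>\<gamma>\<close> itself, first lift it to \<open>w0\<close>, which ends
  in an object \<open>e3\<close> lying over the target of \<open>\<gamma>\<close> only up to
  \<open>\<theta>\<close>. The composite of \<open>\<chi>\<close> and \<open>w0\<close> differs from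
  \<open>\<psi>\<close> below by the inverse of \<open>\<theta>\<close>, so
  \<open>opcartesian_transport\<close> supplies the correction \<open>w1\<close>. Uniqueness is
  \<open>lwhisker_faithful\<close>.\<close>

lemma opcartesian_all:
  assumes ch: "\<chi> \<in> Ar (Hom K B C)"
  shows "opcartesian (Hom K B C) (Hom K B D) (postcompose K B C D f) \<chi>"
  unfolding opcartesian_def
proof (intro conjI ballI impI ch)
  let ?P = "postcompose K B C D f"
  interpret BC: category "Hom K B C" using Hom_category B C by auto
  interpret BD: category "Hom K B D" using Hom_category B D by auto
  interpret P: ftor "Hom K B C" "Hom K B D" ?P by (rule postcompose_functor[OF B C D f])
  have P: "far ?P s = lwhisker K B C D f s" if "s \<in> Ar (Hom K B C)" for s using that by (simp add: postcompose_def)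
  have Po: "fob ?P x = cmp1 K B C D f x" if "x \<in> Ob (Hom K B C)" for x using that by (simp add: postcompose_def)
  fix \<psi> \<gamma> assume ps: "\<psi> \<in> Ar (Hom K B C)" "src (Hom K B C) \<psi> = src (Hom K B C) \<chi>"
    and ga: "\<gamma> \<in> hom (Hom K B D) (fob ?P (tgt (Hom K B C) \<chi>)) (fob ?P (tgt (Hom K B C) \<psi>))"
    and eq: "\<gamma> \<cdot>\<^bsub>Hom K B D\<^esub> far ?P \<chi> = far ?P \<psi>"
  let ?e' = "tgt (Hom K B C) \<chi>" and ?e'' = "tgt (Hom K B C) \<psi>"
  obtain e3 w0 \<theta> where w0: "w0 \<in> hom (Hom K B C) ?e' e3" and th: "\<theta> \<in> hom (Hom K B D) (cmp1 K B C D f ?e'') (cmp1 K B C D f e3)"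
     "is_iso (Hom K B D) \<theta>" and fw: "lwhisker K B C D f w0 = \<theta> \<cdot>\<^bsub>Hom K B D\<^esub> \<gamma>"
    using opcartesian_lift[of ?e' \<gamma> "cmp1 K B C D f ?e''"] ga ch ps by (auto simp: Po)
  obtain n where n: "n \<in> hom (Hom K B D) (cmp1 K B C D f e3) (cmp1 K B C D f ?e'')" "is_iso (Hom K B D) n"
     "n \<cdot>\<^bsub>Hom K B D\<^esub> \<theta> = idn (Hom K B D) (cmp1 K B C D f ?e'')"
    using BD.iso_inverse[OF th(2,1)] by blast
  have c: "w0 \<cdot>\<^bsub>Hom K B C\<^esub> \<chi> \<in> hom (Hom K B C) (src (Hom K B C) \<chi>) e3" using w0 ch by (auto simp: hom_iff)
  have p: "\<psi> \<in> hom (Hom K B C) (src (Hom K B C) \<chi>) ?e''" using ps by (auto simp: hom_iff)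
  have nt: "n \<cdot>\<^bsub>Hom K B D\<^esub> (\<theta> \<cdot>\<^bsub>Hom K B D\<^esub> \<gamma>) = \<gamma>"
    using BD.reassoc[OF n(3), of \<gamma>] n th ga ch ps by (simp add: hom_iff Po)
  have fc: "lwhisker K B C D f (w0 \<cdot>\<^bsub>Hom K B C\<^esub> \<chi>) = (\<theta> \<cdot>\<^bsub>Hom K B D\<^esub> \<gamma>) \<cdot>\<^bsub>Hom K B D\<^esub> far ?P \<chi>"
    using w0 ch by (simp add: P[symmetric] fw[symmetric] P.far_cmp hom_iff)
  have "n \<cdot>\<^bsub>Hom K B D\<^esub> lwhisker K B C D f (w0 \<cdot>\<^bsub>Hom K B C\<^esub> \<chi>) = (n \<cdot>\<^bsub>Hom K B D\<^esub> (\<theta> \<cdot>\<^bsub>Hom K B D\<^esub> \<gamma>)) \<cdot>\<^bsub>Hom K B D\<^esub> far ?P \<chi>"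
    unfolding fc using n th ga ch ps by (simp add: BD.assoc hom_iff Po)
  then have "n \<cdot>\<^bsub>Hom K B D\<^esub> lwhisker K B C D f (w0 \<cdot>\<^bsub>Hom K B C\<^esub> \<chi>) = lwhisker K B C D f \<psi>"
    unfolding nt eq using ps by (simp add: P)
  then obtain w1 where w1: "w1 \<in> hom (Hom K B C) e3 ?e''" "lwhisker K B C D f w1 = n" "w1 \<cdot>\<^bsub>Hom K B C\<^esub> (w0 \<cdot>\<^bsub>Hom K B C\<^esub> \<chi>) = \<psi>"
    using opcartesian_transport[OF c p n(1,2)] by blast
  show "\<exists>!\<omega>. \<omega> \<in> hom (Hom K B C) ?e' ?e'' \<and> far ?P \<omega> = \<gamma> \<and> \<omega> \<cdot>\<^bsub>Hom K B C\<^esub> \<chi> = \<psi>"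
  proof (rule ex1I[of _ "w1 \<cdot>\<^bsub>Hom K B C\<^esub> w0"], intro conjI)
    show "w1 \<cdot>\<^bsub>Hom K B C\<^esub> w0 \<in> hom (Hom K B C) ?e' ?e''" by (rule BC.cmp_hom[OF w0 w1(1)])
    show "far ?P (w1 \<cdot>\<^bsub>Hom K B C\<^esub> w0) = \<gamma>"
      using w0 w1(1) P.far_cmp[of w0 w1] by (simp add: P[of w0] P[of w1] hom_iff fw w1(2) nt)
    show "(w1 \<cdot>\<^bsub>Hom K B C\<^esub> w0) \<cdot>\<^bsub>Hom K B C\<^esub> \<chi> = \<psi>"
      using w0 w1(1) ch by (simp add: BC.assoc hom_iff w1(3))
    fix \<omega> assume om: "\<omega> \<in> hom (Hom K B C) ?e' ?e'' \<and> far ?P \<omega> = \<gamma> \<and> \<omega> \<cdot>\<^bsub>Hom K B C\<^esub> \<chi> = \<psi>"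
    show "\<omega> = w1 \<cdot>\<^bsub>Hom K B C\<^esub> w0"
      using lwhisker_faithful[of \<omega> ?e' ?e'' "w1 \<cdot>\<^bsub>Hom K B C\<^esub> w0"] om BC.cmp_hom[OF w0 w1(1)] \<open>far ?P (w1 \<cdot>\<^bsub>Hom K B C\<^esub> w0) = \<gamma>\<close>
      by (auto simp: P hom_iff)
  qed
qed

lemma cat_opfibration_postcompose: "cat_opfibration (Hom K B C) (Hom K B D) (postcompose K B C D f)"
  unfolding cat_opfibration_def
proof (intro conjI ballI impI)
  interpret P: ftor "Hom K B C" "Hom K B D" "postcompose K B C D f" by (rule postcompose_functor[OF B C D f])
  show "is_functor (Hom K B C) (Hom K B D) (postcompose K B C D f)" by (rule P.F)
  fix e \<alpha> assume e: "e \<in> Ob (Hom K B C)" and al: "\<alpha> \<in> Ar (Hom K B D)" "src (Hom K B D) \<alpha> = fob (postcompose K B C D f) e"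
  obtain e' \<chi> \<theta> where "\<chi> \<in> hom (Hom K B C) e e'" "\<theta> \<in> hom (Hom K B D) (tgt (Hom K B D) \<alpha>) (cmp1 K B C D f e')"
      "is_iso (Hom K B D) \<theta>" "lwhisker K B C D f \<chi> = \<theta> \<cdot>\<^bsub>Hom K B D\<^esub> \<alpha>"
    using opcartesian_lift[OF e, of \<alpha> "tgt (Hom K B D) \<alpha>"] al e by (auto simp: hom_iff postcompose_def)
  then show "\<exists>\<chi> \<theta>. opcartesian (Hom K B C) (Hom K B D) (postcompose K B C D f) \<chi> \<and> src (Hom K B C) \<chi> = e \<and>
     \<theta> \<in> hom (Hom K B D) (tgt (Hom K B D) \<alpha>) (fob (postcompose K B C D f) (tgt (Hom K B C) \<chi>)) \<and>
     is_iso (Hom K B D) \<theta> \<and> far (postcompose K B C D f) \<chi> = \<theta> \<cdot>\<^bsub>Hom K B D\<^esub> \<alpha>"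
    using opcartesian_all[of \<chi>] P.C.tgt_Ob[of \<chi>] by (intro exI[of _ \<chi>] exI[of _ \<theta>]) (auto simp: postcompose_def hom_iff)
qed

end

end

text \<open>Orthogonality is assumed for each \<open>a\<close> separately, because \<open>i0\<close>
  becomes a 1-cell over \<open>D\<close> only after \<open>a\<close> is fixed; its triangle is then
  an identity.\<close>

theorem discrete_opfibration_of_orthogonal:
  assumes C: "C \<in> Obj K" and D: "D \<in> Obj K" and f: "f \<in> Ob (Hom K C D)"
    and ls: "locally_setoidal (PS D) (C, f)"
    and ten: "\<And>B. B \<in> Obj K \<Longrightarrow> \<exists>T i0 i1 \<tau>. arrow_tensor K B T i0 i1 \<tau> \<and>
      (\<forall>a \<in> Ob (Hom K T D). orthogonal (PS D) (B, cmp1 K B T D a i0) (T, a) (i0, idn (Hom K B D) (cmp1 K B T D a i0)) (C, f))"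
  shows "discrete_opfibration K C D f"
  unfolding discrete_opfibration_def opfibration_def discrete_object_def
proof (intro conjI ballI)
  fix B assume B: "B \<in> Obj K"
  then show "cat_opfibration (Hom K B C) (Hom K B D) (postcompose K B C D f)"
    using ten[OF B] cat_opfibration_postcompose[OF B _ C D f ls] by blast
next
  fix G assume G: "G \<in> Obj (PS D)"
  have "(C, f) \<in> Obj (PS D)" using C f by (simp add: PS_Obj)
  then show "equivalent_to_discrete (Hom (PS D) G (C, f))"
    using two_category.Hom_category[OF two_category_pseudoslice[OF D] G] ls G setoidal_discrete
    unfolding locally_setoidal_def by blast
qed

end

section \<open>Terminal objects, pullbacks and left exact functors\<close>

definition terminal_in :: "('o,'a) cat \<Rightarrow> 'o \<Rightarrow> bool" where
  "terminal_in C t \<longleftrightarrow> t \<in> Ob C \<and> (\<forall>x \<in> Ob C. \<exists>!f. f \<in> hom C x t)"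

lemma terminal_in_unique: "terminal_in C t \<Longrightarrow> x \<in> Ob C \<Longrightarrow> f \<in> hom C x t \<Longrightarrow> g \<in> hom C x t \<Longrightarrow> f = g"
  unfolding terminal_in_def by blast

lemma terminal_in_ex: "terminal_in C t \<Longrightarrow> x \<in> Ob C \<Longrightarrow> \<exists>f. f \<in> hom C x t"
  unfolding terminal_in_def by blast

lemma terminal_in_iso:
  assumes "category C" "terminal_in C t" "terminal_in C t'" "f \<in> hom C t t'"
  shows "is_iso C f"
proof -
  interpret category C by fact
  have t: "t \<in> Ob C" "t' \<in> Ob C" using assms by (auto simp: terminal_in_def)
  obtain g where g: "g \<in> hom C t' t" using terminal_in_ex[OF assms(2) t(2)] by blast
  show ?thesis
    using terminal_in_unique[OF assms(2) t(1) cmp_hom[OF assms(4) g] idn_hom[OF t(1)]]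
      terminal_in_unique[OF assms(3) t(2) cmp_hom[OF g assms(4)] idn_hom[OF t(2)]]
    by (rule isoI[OF assms(4) g])
qed

lemma pullbackD:
  assumes "is_pullback C f g p q"
  shows "f \<in> Ar C" "g \<in> Ar C" "p \<in> Ar C" "q \<in> Ar C" "tgt C f = tgt C g"
     "src C q = src C p" "tgt C p = src C f" "tgt C q = src C g" "f \<cdot>\<^bsub>C\<^esub> p = g \<cdot>\<^bsub>C\<^esub> q"
  using assms unfolding is_pullback_def by auto

lemma pullback_factor:
  assumes "is_pullback C f g p q" "p' \<in> hom C z (src C f)" "q' \<in> hom C z (src C g)" "f \<cdot>\<^bsub>C\<^esub> p' = g \<cdot>\<^bsub>C\<^esub> q'"
  obtains k where "k \<in> hom C z (src C p)" "p \<cdot>\<^bsub>C\<^esub> k = p'" "q \<cdot>\<^bsub>C\<^esub> k = q'"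
  using assms unfolding is_pullback_def hom_iff by metis

lemma (in category) pullback_ext:
  assumes "is_pullback C f g p q" "k \<in> hom C z (src C p)" "k' \<in> hom C z (src C p)"
    "p \<cdot>\<^bsub>C\<^esub> k = p \<cdot>\<^bsub>C\<^esub> k'" "q \<cdot>\<^bsub>C\<^esub> k = q \<cdot>\<^bsub>C\<^esub> k'"
  shows "k = k'"
proof -
  note p = pullbackD[OF assms(1)]
  have 1: "f \<cdot>\<^bsub>C\<^esub> (p \<cdot>\<^bsub>C\<^esub> k) = g \<cdot>\<^bsub>C\<^esub> (q \<cdot>\<^bsub>C\<^esub> k)"
    using p assms(2) by (simp add: assoc[symmetric] hom_iff)
  have "\<exists>!l. l \<in> hom C (src C (p \<cdot>\<^bsub>C\<^esub> k)) (src C p) \<and> p \<cdot>\<^bsub>C\<^esub> l = p \<cdot>\<^bsub>C\<^esub> k \<and> q \<cdot>\<^bsub>C\<^esub> l = q \<cdot>\<^bsub>C\<^esub> k"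
  proof -
    have "p \<cdot>\<^bsub>C\<^esub> k \<in> Ar C" "q \<cdot>\<^bsub>C\<^esub> k \<in> Ar C" "src C (p \<cdot>\<^bsub>C\<^esub> k) = src C (q \<cdot>\<^bsub>C\<^esub> k)"
      "tgt C (p \<cdot>\<^bsub>C\<^esub> k) = src C f" "tgt C (q \<cdot>\<^bsub>C\<^esub> k) = src C g" using p assms(2) by (simp_all add: hom_iff)
    then show ?thesis using assms(1) 1 unfolding is_pullback_def by blast
  qed
  moreover have "k \<in> hom C (src C (p \<cdot>\<^bsub>C\<^esub> k)) (src C p)" "k' \<in> hom C (src C (p \<cdot>\<^bsub>C\<^esub> k)) (src C p)"
    using p assms(2,3) by (simp_all add: hom_iff)
  ultimately show ?thesis using assms(4,5) by metis
qed

lemma (in category) pullbackI: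
  assumes "f \<in> Ar C" "g \<in> Ar C" "p \<in> Ar C" "q \<in> Ar C" "tgt C f = tgt C g"
     "src C q = src C p" "tgt C p = src C f" "tgt C q = src C g" "f \<cdot>\<^bsub>C\<^esub> p = g \<cdot>\<^bsub>C\<^esub> q"
   and ex: "\<And>z p' q'. p' \<in> hom C z (src C f) \<Longrightarrow> q' \<in> hom C z (src C g) \<Longrightarrow> f \<cdot>\<^bsub>C\<^esub> p' = g \<cdot>\<^bsub>C\<^esub> q' \<Longrightarrow>
      \<exists>k \<in> hom C z (src C p). p \<cdot>\<^bsub>C\<^esub> k = p' \<and> q \<cdot>\<^bsub>C\<^esub> k = q'"
   and un: "\<And>z k k'. k \<in> hom C z (src C p) \<Longrightarrow> k' \<in> hom C z (src C p) \<Longrightarrow> p \<cdot>\<^bsub>C\<^esub> k = p \<cdot>\<^bsub>C\<^esub> k' \<Longrightarrow>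
      q \<cdot>\<^bsub>C\<^esub> k = q \<cdot>\<^bsub>C\<^esub> k' \<Longrightarrow> k = k'"
 shows "is_pullback C f g p q"
  unfolding is_pullback_def
proof (intro conjI ballI impI)
  fix p' q' assume a: "p' \<in> Ar C" "q' \<in> Ar C" "src C p' = src C q' \<and> tgt C p' = src C f \<and> tgt C q' = src C g \<and> f \<cdot>\<^bsub>C\<^esub> p' = g \<cdot>\<^bsub>C\<^esub> q'"
  obtain k where "k \<in> hom C (src C p') (src C p)" "p \<cdot>\<^bsub>C\<^esub> k = p'" "q \<cdot>\<^bsub>C\<^esub> k = q'"
    using ex[of p' "src C p'" q'] a by (auto simp: hom_iff)
  then show "\<exists>!k. k \<in> hom C (src C p') (src C p) \<and> p \<cdot>\<^bsub>C\<^esub> k = p' \<and> q \<cdot>\<^bsub>C\<^esub> k = q'"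
  proof (intro ex1I[of _ k])
    fix l assume "l \<in> hom C (src C p') (src C p) \<and> p \<cdot>\<^bsub>C\<^esub> l = p' \<and> q \<cdot>\<^bsub>C\<^esub> l = q'"
    then show "l = k" using un[of l "src C p'" k] \<open>k \<in> _\<close> \<open>p \<cdot>\<^bsub>C\<^esub> k = p'\<close> \<open>q \<cdot>\<^bsub>C\<^esub> k = q'\<close> by simp
  qed simp
qed (use assms in auto)

text \<open>Limits of the empty diagram are terminal objects. Such a diagram has no values and its
  cones have no components, hence \<open>undefined\<close>.\<close>

lemma left_exact_terminal:
  assumes "ftor C D F" and lex: "left_exact C D F" and t: "terminal_in C t"
  shows "terminal_in D (fob F t)"
proof -
  interpret ftor C D F by fact
  define J :: "(nat,nat) cat" where "J = \<lparr>Ob = {}, Ar = {}, src = id, tgt = id, idn = id, cmp = (\<lambda>g f. f)\<rparr>"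
  have J: "Ob J = {}" "Ar J = {}" by (auto simp: J_def)
  then have "finite_category J" unfolding finite_category_def category_def hom_def by auto
  moreover define G where "G = (\<lparr>fob = (\<lambda>x. undefined), far = (\<lambda>x. undefined)\<rparr> :: (nat,nat,'a,'b) ftr)"
  have "is_functor J C G" by (auto simp: is_functor_def J G_def)
  moreover have "is_limit J C G t (\<lambda>_. undefined)"
    using t by (auto simp: is_limit_def is_cone_def J terminal_in_def)
  ultimately have "is_limit J D (cmp_ftr J F G) (fob F t) (\<lambda>j. far F undefined)"
    using lex unfolding left_exact_def by blast
  then show ?thesis by (auto simp: is_limit_def is_cone_def J terminal_in_def)
qed

lemma left_exact_pullback:
  assumes "ftor C D F" and lex: "left_exact C D F" and pb: "is_pullback C f g p q"
  shows "is_pullback D (far F f) (far F g) (far F p) (far F q)"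
proof -
  interpret ftor C D F by fact
  note P = pullbackD[OF pb]
  \<comment> \<open>The cospan: 0, 1 and 2 are objects and at the same time their own identities, 3
    goes from 0 to 2 and 4 from 1 to 2. In every composite one factor is an identity, so the other
    factor is returned.\<close>
  define J :: "(nat,nat) cat" where "J = \<lparr>Ob = {0,1,2}, Ar = {0,1,2,3,4},
    src = (\<lambda>n. if n = 3 then 0 else if n = 4 then 1 else n), tgt = (\<lambda>n. if n < 3 then n else 2),
    idn = id, cmp = (\<lambda>g f. if g < 3 then f else g)\<rparr>"
  have J: "category J" by unfold_locales (auto simp: J_def hom_def)
  then have fin: "finite_category J" by (simp add: finite_category_def) (simp add: J_def)
  define G where "G = \<lparr>fob = (\<lambda>n \<in> Ob J. if n = 0 then src C f else if n = 1 then src C g else tgt C f),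
     far = (\<lambda>n \<in> Ar J. if n = 3 then f else if n = 4 then g
        else idn C (if n = 0 then src C f else if n = 1 then src C g else tgt C f))\<rparr>"
  have G: "is_functor J C G"
    unfolding is_functor_def by (simp add: G_def J_def hom_def P PiE_def)
  define c where "c j = (if j = 0 then p else if j = (1::nat) then q else f \<cdot>\<^bsub>C\<^esub> p)" for j
  have "is_limit J C G (src C p) c"
    unfolding is_limit_def
  proof (intro conjI allI impI)
    show "is_cone J C G (src C p) c" using P by (auto simp: is_cone_def J_def G_def c_def hom_def)
    fix M d assume "is_cone J C G M d"
    then have d: "d 0 \<in> hom C M (src C f)" "d 1 \<in> hom C M (src C g)" "f \<cdot>\<^bsub>C\<^esub> d 0 = d 2" "g \<cdot>\<^bsub>C\<^esub> d 1 = d 2"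
      by (auto simp: is_cone_def J_def G_def)
    obtain k where k: "k \<in> hom C M (src C p)" "p \<cdot>\<^bsub>C\<^esub> k = d 0" "q \<cdot>\<^bsub>C\<^esub> k = d 1"
      using pullback_factor[OF pb d(1,2)] d(3,4) by metis
    then have "f \<cdot>\<^bsub>C\<^esub> p \<cdot>\<^bsub>C\<^esub> k = d 2" using d P by (simp add: C.assoc hom_iff)
    then show "\<exists>!h. h \<in> hom C M (src C p) \<and> (\<forall>j\<in>Ob J. c j \<cdot>\<^bsub>C\<^esub> h = d j)"
      using k C.pullback_ext[OF pb] by (intro ex1I[of _ k]) (auto simp: J_def c_def)
  qed
  then have lim: "is_limit J D (cmp_ftr J F G) (fob F (src C p)) (\<lambda>j. far F (c j))"
    using lex fin G unfolding left_exact_def by blast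
  have Js: "Ob J = {0,1,2}" "Ar J = {0,1,2,3,4}" "src J 0 = 0" "src J 1 = 1" "src J 2 = 2" "src J 3 = 0" "src J 4 = 1"
    "tgt J 0 = 0" "tgt J 1 = 1" "tgt J 2 = 2" "tgt J 3 = 2" "tgt J 4 = 2"
    by (auto simp: J_def)
  define M where "M = cmp_ftr J F G"
  have FG: "fob M 0 = fob F (src C f)" "fob M 1 = fob F (src C g)" "fob M 2 = fob F (tgt C g)"
    "far M 3 = far F f" "far M 4 = far F g"
    "far M 0 = idn D (fob F (src C f))" "far M 1 = idn D (fob F (src C g))" "far M 2 = idn D (fob F (tgt C g))"
    using P by (auto simp: M_def cmp_fob cmp_far J_def G_def)
  show ?thesis
  proof (rule D.pullbackI)
    show "far F f \<cdot>\<^bsub>D\<^esub> far F p = far F g \<cdot>\<^bsub>D\<^esub> far F q" using P by (simp add: far_cmp[symmetric])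
    fix z p' q' assume p': "p' \<in> hom D z (src D (far F f))" and q': "q' \<in> hom D z (src D (far F g))"
      and e: "far F f \<cdot>\<^bsub>D\<^esub> p' = far F g \<cdot>\<^bsub>D\<^esub> q'"
    define d where "d j = (if j = 0 then p' else if j = (1::nat) then q' else far F f \<cdot>\<^bsub>D\<^esub> p')" for j
    have "is_cone J D (cmp_ftr J F G) z d"
      using p' q' e P D.hom_ObD[OF p'] unfolding is_cone_def M_def[symmetric] by (simp add: Js d_def FG hom_iff del: One_nat_def)
    then obtain k where "k \<in> hom D z (fob F (src C p))" "\<forall>j\<in>Ob J. far F (c j) \<cdot>\<^bsub>D\<^esub> k = d j"
      using lim unfolding is_limit_def by blast
    then show "\<exists>k\<in>hom D z (src D (far F p)). far F p \<cdot>\<^bsub>D\<^esub> k = p' \<and> far F q \<cdot>\<^bsub>D\<^esub> k = q'"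
      using P by (intro bexI[of _ k]) (auto simp: Js c_def d_def)
  next
    fix z k k' assume k: "k \<in> hom D z (src D (far F p))" "k' \<in> hom D z (src D (far F p))"
     "far F p \<cdot>\<^bsub>D\<^esub> k = far F p \<cdot>\<^bsub>D\<^esub> k'" "far F q \<cdot>\<^bsub>D\<^esub> k = far F q \<cdot>\<^bsub>D\<^esub> k'"
    define d where "d j = far F (c j) \<cdot>\<^bsub>D\<^esub> k" for j
    have "is_cone J D (cmp_ftr J F G) z d"
      using k P D.hom_ObD[OF k(1)] unfolding is_cone_def
M_def[symmetric]
      by (simp add: Js d_def FG hom_iff c_def far_cmp D.assoc del: One_nat_def) (use P in \<open>simp add: far_cmp[symmetric] D.assoc[symmetric]\<close>)
    then have "\<exists>!h. h \<in> hom D z (fob F (src C p)) \<and> (\<forall>j\<in>Ob J. far F (c j) \<cdot>\<^bsub>D\<^esub> h = d j)"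
      using lim unfolding is_limit_def by blast
    moreover have "far F (c j) \<cdot>\<^bsub>D\<^esub> k' = d j" if "j \<in> Ob J" for j
      using that k P by (auto simp: d_def c_def Js far_cmp D.assoc hom_iff)
    ultimately show "k = k'" using k P d_def by (metis D.hom_ObD src_far)
  qed (use P in auto)
qed

subsection \<open>Slices\<close>

locale slice_category = category E for E :: "('u,'u) cat" +
  fixes X :: 'u
  assumes inf: "infinite (UNIV :: 'u set)"
begin

lemma decode [simp]: "pair_decode (pair_code z) = (z :: 'u \<times> 'u)"
  unfolding pair_decode_def using inj_pair_code[OF inf] by (simp add: inv_f_f)

lemma code_eq [simp]: "pair_code (g, y) = pair_code (g', y') \<longleftrightarrow> g = g' \<and> (y :: 'u) = y'"
  using decode by (metis prod.inject)

lemma slice_sel [simp]: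
  "x \<in> Ob (slice E X) \<longleftrightarrow> x \<in> Ar E \<and> tgt E x = X"
  "pair_code (g, y) \<in> Ar (slice E X) \<longleftrightarrow> g \<in> Ar E \<and> y \<in> Ar E \<and> tgt E g = src E y \<and> tgt E y = X"
  "src (slice E X) (pair_code (g, y)) = y \<cdot>\<^bsub>E\<^esub> g"
  "tgt (slice E X) (pair_code (g, y)) = y"
  "slice_arrow (pair_code (g, y)) = g"
  by (auto simp: slice_def slice_arrow_def)

lemma slice_Ar [simp]:
  assumes "a \<in> Ar (slice E X)"
  shows "slice_arrow a \<in> Ar E" "src E (slice_arrow a) = src E (src (slice E X) a)"
    "tgt E (slice_arrow a) = src E (tgt (slice E X) a)"
    "tgt (slice E X) a \<cdot>\<^bsub>E\<^esub> slice_arrow a = src (slice E X) a"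
  using assms by (auto simp: slice_def slice_arrow_def)

lemma slice_code: "a \<in> Ar (slice E X) \<Longrightarrow> pair_code (slice_arrow a, tgt (slice E X) a) = a"
  by (auto simp: slice_def slice_arrow_def)

lemma slice_cmp [simp]: "slice_arrow (b \<cdot>\<^bsub>slice E X\<^esub> a) = slice_arrow b \<cdot>\<^bsub>E\<^esub> slice_arrow a"
  "slice_arrow (idn (slice E X) x) = idn E (src E x)"
  by (auto simp: slice_def slice_arrow_def)

lemma slice_ext:
  "a \<in> Ar (slice E X) \<Longrightarrow> b \<in> Ar (slice E X) \<Longrightarrow> tgt (slice E X) a = tgt (slice E X) b \<Longrightarrow>
    slice_arrow a = slice_arrow b \<Longrightarrow> a = b"
  using slice_code by metis

sublocale S: category "slice E X"
  by (rule category_slice[OF category_axioms inf])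

lemma slice_Ob_Ar [simp]:
  assumes "a \<in> Ar (slice E X)"
  shows "src (slice E X) a \<in> Ar E" "tgt E (src (slice E X) a) = X" "tgt (slice E X) a \<in> Ar E" "tgt E (tgt (slice E X) a) = X"
  using S.src_Ob[OF assms] S.tgt_Ob[OF assms] by auto

lemma slice_terminal: "X \<in> Ob E \<Longrightarrow> terminal_in (slice E X) (idn E X)"
  unfolding terminal_in_def
proof (intro conjI ballI)
  fix y assume X: "X \<in> Ob E" and y: "y \<in> Ob (slice E X)"
  show "\<exists>!f. f \<in> hom (slice E X) y (idn E X)"
  proof (rule ex1I[of _ "pair_code (y, idn E X)"])
    fix f assume "f \<in> hom (slice E X) y (idn E X)"
    then have f: "f \<in> Ar (slice E X)" "src (slice E X) f = y" "tgt (slice E X) f = idn E X" by (auto simp: hom_iff)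
    have "slice_arrow f = y" using slice_Ar(1,3,4)[OF f(1)] X by (simp add: f)
    then show "f = pair_code (y, idn E X)" using slice_code[OF f(1)] f by simp
  qed (use X y in \<open>auto simp: hom_iff\<close>)
qed simp

end

section \<open>The etale geometric morphism over \<open>E\<close> and graphs of arrows into
  \<open>X\<close>\<close>

locale etale = slice_category E X for E :: "('u,'u) cat" and X :: 'u +
  fixes p :: "'u geom" and q :: "'u \<Rightarrow> 'u"
  assumes X [simp]: "X \<in> Ob E" and et: "is_etale E X p q"
begin

abbreviation "S \<equiv> slice E X"
abbreviation "\<pi> \<equiv> inv_im p"

sublocale P: ftor E S \<pi>
  using et geom_dest(1) S.category_axioms category_axioms unfolding is_etale_def by (intro ftorI) auto

lemma pr [simp]:
  assumes "D \<in> Ob E"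
  shows "fob \<pi> D \<in> Ar E" "tgt E (fob \<pi> D) = X" "q D \<in> Ar E" "src E (q D) = src E (fob \<pi> D)" "tgt E (q D) = D"
  using et assms unfolding is_etale_def is_product_def by auto

lemma pr_ex:
  assumes "D \<in> Ob E" "f \<in> hom E z X" "g \<in> hom E z D"
  shows "\<exists>!k. k \<in> hom E z (src E (fob \<pi> D)) \<and> fob \<pi> D \<cdot>\<^bsub>E\<^esub> k = f \<and> q D \<cdot>\<^bsub>E\<^esub> k = g"
proof -
  have "is_product E X D (fob \<pi> D) (q D)" using et assms(1) unfolding is_etale_def by blast
  moreover have "f \<in> Ar E" "g \<in> Ar E" "src E f = src E g \<and> tgt E f = X \<and> tgt E g = D" "src E f = z"
    using assms by (auto simp: hom_iff)
  ultimately show ?thesis unfolding is_product_def by blast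
qed

lemma pr_ext:
  assumes "D \<in> Ob E" "k \<in> Ar E" "l \<in> Ar E" "tgt E k = src E (fob \<pi> D)" "tgt E l = src E (fob \<pi> D)" "src E k = src E l"
    "fob \<pi> D \<cdot>\<^bsub>E\<^esub> k = fob \<pi> D \<cdot>\<^bsub>E\<^esub> l" "q D \<cdot>\<^bsub>E\<^esub> k = q D \<cdot>\<^bsub>E\<^esub> l"
  shows "k = l"
  using pr_ex[OF assms(1), of "fob \<pi> D \<cdot>\<^bsub>E\<^esub> l" "src E l" "q D \<cdot>\<^bsub>E\<^esub> l"] assms by (auto simp: hom_iff)

lemma pr_nat: "h \<in> Ar E \<Longrightarrow> q (tgt E h) \<cdot>\<^bsub>E\<^esub> slice_arrow (far \<pi> h) = h \<cdot>\<^bsub>E\<^esub> q (src E h)"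
  using et unfolding is_etale_def by auto

text \<open>The graph \<open>(y, id)\<close> from \<open>Y\<close> to \<open>X \<times> Y\<close> of
  an arrow \<open>y : Y \<rightarrow> X\<close>. As the arrow \<open>graph y\<close> of the slice it
  is the unit at \<open>y\<close> of the adjunction between the forgetful functor
  \<open>E/X \<rightarrow> E\<close> and \<open>\<pi>\<close>, with counit \<open>q\<close>.\<close>

definition graph_ar :: "'u \<Rightarrow> 'u" where
  "graph_ar y = (THE k. k \<in> hom E (src E y) (src E (fob \<pi> (src E y))) \<and> fob \<pi> (src E y) \<cdot>\<^bsub>E\<^esub> k = y \<and> q (src E y) \<cdot>\<^bsub>E\<^esub> k = idn E (src E y))"

definition graph :: "'u \<Rightarrow> 'u" where
  "graph y = pair_code (graph_ar y, fob \<pi> (src E y))"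

lemma graph_ar [simp]:
  assumes "y \<in> Ar E" "tgt E y = X"
  shows "graph_ar y \<in> Ar E" "src E (graph_ar y) = src E y" "tgt E (graph_ar y) = src E (fob \<pi> (src E y))"
    "fob \<pi> (src E y) \<cdot>\<^bsub>E\<^esub> graph_ar y = y" "q (src E y) \<cdot>\<^bsub>E\<^esub> graph_ar y = idn E (src E y)"
  using theI'[OF pr_ex[of "src E y" y "src E y" "idn E (src E y)"]] assms unfolding graph_ar_def by (auto simp: hom_iff)

lemma graph [simp]:
  assumes "y \<in> Ar E" "tgt E y = X"
  shows "graph y \<in> Ar S" "src S (graph y) = y" "tgt S (graph y) = fob \<pi> (src E y)" "slice_arrow (graph y) = graph_ar y"
  using assms by (auto simp: graph_def)

abbreviation "bang y \<equiv> pair_code (y, idn E X)"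

lemma far_pr [simp]:
  assumes "h \<in> Ar E"
  shows "fob \<pi> (tgt E h) \<cdot>\<^bsub>E\<^esub> slice_arrow (far \<pi> h) = fob \<pi> (src E h)"
  using slice_Ar(4)[of "far \<pi> h"] assms by simp

lemma far_pr_reassoc:
  assumes "h \<in> Ar E" "k \<in> Ar E" "tgt E k = src E (fob \<pi> (src E h))"
  shows "fob \<pi> (tgt E h) \<cdot>\<^bsub>E\<^esub> (slice_arrow (far \<pi> h) \<cdot>\<^bsub>E\<^esub> k) = fob \<pi> (src E h) \<cdot>\<^bsub>E\<^esub> k"
    "q (tgt E h) \<cdot>\<^bsub>E\<^esub> (slice_arrow (far \<pi> h) \<cdot>\<^bsub>E\<^esub> k) = h \<cdot>\<^bsub>E\<^esub> (q (src E h) \<cdot>\<^bsub>E\<^esub> k)"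
  using assms reassoc[OF far_pr] reassoc[OF pr_nat] by (auto simp: assoc)

text \<open>Naturality of the unit, tested on the two projections of the product. The triangle
  identity for \<open>\<pi>\<close> is \<open>pr_graph\<close>.\<close>

lemma graph_nat:
  assumes "m \<in> Ar S"
  shows "far \<pi> (slice_arrow m) \<cdot>\<^bsub>S\<^esub> graph (src S m) = graph (tgt S m) \<cdot>\<^bsub>S\<^esub> m"
proof (rule slice_ext)
  have *: "q (src E (tgt S m)) \<cdot>\<^bsub>E\<^esub> (graph_ar (tgt S m) \<cdot>\<^bsub>E\<^esub> slice_arrow m) = slice_arrow m"
    "fob \<pi> (src E (tgt S m)) \<cdot>\<^bsub>E\<^esub> (graph_ar (tgt S m) \<cdot>\<^bsub>E\<^esub> slice_arrow m) = src S m"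
    using assms reassoc[OF graph_ar(5)] reassoc[OF graph_ar(4)] by auto
  show "slice_arrow (far \<pi> (slice_arrow m) \<cdot>\<^bsub>S\<^esub> graph (src S m)) = slice_arrow (graph (tgt S m) \<cdot>\<^bsub>S\<^esub> m)"
    using assms far_pr_reassoc[of "slice_arrow m" "graph_ar (src S m)"]
    by - (rule pr_ext[of "src E (tgt S m)"], auto simp: *)
qed (use assms in auto)

lemma pr_graph: "D \<in> Ob E \<Longrightarrow> far \<pi> (q D) \<cdot>\<^bsub>S\<^esub> graph (fob \<pi> D) = idn S (fob \<pi> D)"
proof (rule slice_ext)
  assume D: "D \<in> Ob E"
  show "slice_arrow (far \<pi> (q D) \<cdot>\<^bsub>S\<^esub> graph (fob \<pi> D)) = slice_arrow (idn S (fob \<pi> D))"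
    using D far_pr_reassoc[of "q D" "graph_ar (fob \<pi> D)"] by - (rule pr_ext[of D], auto)
qed auto

text \<open>An object \<open>y : Y \<rightarrow> X\<close> of the slice is the fibre of \<open>X \<times> y\<close> over the diagonal.\<close>

lemma graph_pullback:
  assumes y: "y \<in> Ar E" "tgt E y = X"
  shows "is_pullback S (far \<pi> y) (graph (idn E X)) (graph y) (bang y)"
proof (rule S.pullbackI)
  have b: "pair_code (y, idn E X) \<in> Ar S" using y by simp
  show "far \<pi> y \<cdot>\<^bsub>S\<^esub> graph y = graph (idn E X) \<cdot>\<^bsub>S\<^esub> bang y"
    using graph_nat[OF b] y by simp
next
  fix z r s assume r: "r \<in> hom S z (src S (far \<pi> y))" and s: "s \<in> hom S z (src S (graph (idn E X)))"
    and e: "far \<pi> y \<cdot>\<^bsub>S\<^esub> r = graph (idn E X) \<cdot>\<^bsub>S\<^esub> s"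
  have z: "z \<in> Ar E" "tgt E z = X" using S.hom_ObD[OF s] by auto
  let ?Y = "src E y" let ?k = "q ?Y \<cdot>\<^bsub>E\<^esub> slice_arrow r"
  have r': "r \<in> Ar S" "src S r = z" "tgt S r = fob \<pi> ?Y" using r y by (auto simp: hom_iff)
  have s': "s \<in> Ar S" "src S s = z" "tgt S s = idn E X" using s y by (auto simp: hom_iff)
  have sz: "slice_arrow s = z" using slice_Ar[OF s'(1)] s' by simp
  have "slice_arrow (far \<pi> y) \<cdot>\<^bsub>E\<^esub> slice_arrow r = graph_ar (idn E X) \<cdot>\<^bsub>E\<^esub> z"
    using arg_cong[OF e, of slice_arrow] by (simp add: sz)
  then have "q X \<cdot>\<^bsub>E\<^esub> (slice_arrow (far \<pi> y) \<cdot>\<^bsub>E\<^esub> slice_arrow r) = q X \<cdot>\<^bsub>E\<^esub> (graph_ar (idn E X) \<cdot>\<^bsub>E\<^esub> z)" by simp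
  then have yk: "y \<cdot>\<^bsub>E\<^esub> ?k = z"
    using far_pr_reassoc(2)[of y "slice_arrow r"] reassoc[OF graph_ar(5)[of "idn E X"], of z] y r' z by simp
  have k: "pair_code (?k, y) \<in> hom S z y" using y r' z yk by (auto simp: hom_iff)
  moreover have "graph y \<cdot>\<^bsub>S\<^esub> pair_code (?k, y) = r"
  proof (rule slice_ext)
    have *: "fob \<pi> ?Y \<cdot>\<^bsub>E\<^esub> slice_arrow r = z" using slice_Ar(4)[OF r'(1)] r' by simp
    show "slice_arrow (graph y \<cdot>\<^bsub>S\<^esub> pair_code (?k, y)) = slice_arrow r"
      using y r' z reassoc[OF graph_ar(4)[OF y], of ?k] reassoc[OF graph_ar(5)[OF y], of ?k]
      by - (rule pr_ext[of ?Y], auto simp: * yk)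
  qed (use y r' k in \<open>auto simp: hom_iff\<close>)
  moreover have "bang y \<cdot>\<^bsub>S\<^esub> pair_code (?k, y) = s"
    by (rule slice_ext) (use y r' s' k sz yk in \<open>auto simp: hom_iff\<close>)
  ultimately show "\<exists>k\<in>hom S z (src S (graph y)). graph y \<cdot>\<^bsub>S\<^esub> k = r \<and> bang y \<cdot>\<^bsub>S\<^esub> k = s" using y by auto
next
  fix z k k' assume k: "k \<in> hom S z (src S (graph y))" "k' \<in> hom S z (src S (graph y))" and e: "graph y \<cdot>\<^bsub>S\<^esub> k = graph y \<cdot>\<^bsub>S\<^esub> k'"
  have k': "k \<in> Ar S" "src S k = z" "tgt S k = y" "k' \<in> Ar S" "src S k' = z" "tgt S k' = y" using k y by (auto simp: hom_iff)
  have "graph_ar y \<cdot>\<^bsub>E\<^esub> slice_arrow k = graph_ar y \<cdot>\<^bsub>E\<^esub> slice_arrow k'" using arg_cong[OF e, of slice_arrow] y by simp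
  then have "q (src E y) \<cdot>\<^bsub>E\<^esub> (graph_ar y \<cdot>\<^bsub>E\<^esub> slice_arrow k) = q (src E y) \<cdot>\<^bsub>E\<^esub> (graph_ar y \<cdot>\<^bsub>E\<^esub> slice_arrow k')" by simp
  then have "slice_arrow k = slice_arrow k'"
    using reassoc[OF graph_ar(5)[OF y], of "slice_arrow k"] reassoc[OF graph_ar(5)[OF y], of "slice_arrow k'"] y k' by simp
  then show "k = k'" using slice_ext k' by simp
qed (use y in auto)

end

section \<open>1-cells into \<open>E/X\<close> and their generic sections\<close>

text \<open>
  \<open>H\<close> is the inverse image of a 1-cell from \<open>T\<close> to \<open>E/X\<close> over \<open>E\<close>, \<open>A\<close> that of the structure morphism \<open>T \<rightarrow> E\<close>;
  \<open>section\<close> is the corresponding generalized element of \<open>X\<close>.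
\<close>

locale etale_point = etale E X p q + H: ftor "slice E X" T H + A: ftor E T A
  for E :: "('u,'u) cat" and X p q and T :: "('u,'u) cat" and A H +
  fixes \<psi> :: "'u \<Rightarrow> 'u"
  assumes lex: "left_exact (slice E X) T H"
    and psi: "nat_trans E T (cmp_ftr E H (inv_im p)) A \<psi>"
    and psi_iso: "D \<in> Ob E \<Longrightarrow> is_iso T (\<psi> D)"
begin

lemma psi_sel [simp]:
  assumes "D \<in> Ob E"
  shows "\<psi> D \<in> Ar T" "src T (\<psi> D) = fob H (fob \<pi> D)" "tgt T (\<psi> D) = fob A D"
  using psi assms by (auto simp: nat_trans_def hom_iff cmp_fob)

lemma psi_nat: "f \<in> Ar E \<Longrightarrow> \<psi> (tgt E f) \<cdot>\<^bsub>T\<^esub> far H (far \<pi> f) = far A f \<cdot>\<^bsub>T\<^esub> \<psi> (src E f)"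
  using psi by (auto simp: nat_trans_def cmp_far)

text \<open>For \<open>y : Y \<rightarrow> X\<close> this is a comparison from \<open>H y\<close> to
  \<open>A Y\<close>. Through it \<open>fib_pullback\<close> identifies \<open>H y\<close> with the
  fibre of \<open>A y\<close> over \<open>section\<close>.\<close>

definition fib :: "'u \<Rightarrow> 'u" where "fib y = \<psi> (src E y) \<cdot>\<^bsub>T\<^esub> far H (graph y)"

definition "section" :: 'u where "section = fib (idn E X)"

lemma fib [simp]:
  assumes "y \<in> Ar E" "tgt E y = X"
  shows "fib y \<in> Ar T" "src T (fib y) = fob H y" "tgt T (fib y) = fob A (src E y)"
  using assms by (auto simp: fib_def)

lemma section_hom: "section \<in> hom T (fob H (idn E X)) (fob A X)"
  by (simp add: section_def hom_iff)

text \<open>\<open>H\<close> preserves the square \<open>graph_pullback\<close>, and the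
  isomorphisms \<open>\<psi>\<close> replace the images of \<open>\<pi>\<close> in it by values of
  \<open>A\<close>. Hence \<open>H\<close> is determined by \<open>A\<close> and the single arrow
  \<open>section\<close>.\<close>

lemma fib_pullback:
  assumes y: "y \<in> Ar E" "tgt E y = X"
  shows "is_pullback T (far A y) section (fib y) (far H (bang y))"
proof -
  let ?x = "idn E X"
  note pb = left_exact_pullback[OF H.ftor_axioms lex graph_pullback[OF y]]
  have iX: "is_iso T (\<psi> X)" and iY: "is_iso T (\<psi> (src E y))" using psi_iso y by auto
  have nat: "far A y \<cdot>\<^bsub>T\<^esub> fib y = \<psi> X \<cdot>\<^bsub>T\<^esub> (far H (far \<pi> y) \<cdot>\<^bsub>T\<^esub> far H (graph y))"
    using psi_nat[OF y(1)] y H.D.assoc[of "far H (graph y)" "far H (far \<pi> y)" "\<psi> X"]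
    by (simp add: fib_def H.D.assoc[symmetric])
  obtain j where j: "j \<in> hom T (fob A (src E y)) (fob H (fob \<pi> (src E y)))"
     "j \<cdot>\<^bsub>T\<^esub> \<psi> (src E y) = idn T (fob H (fob \<pi> (src E y)))" "\<psi> (src E y) \<cdot>\<^bsub>T\<^esub> j = idn T (fob A (src E y))"
    using isoE[OF iY, of "fob H (fob \<pi> (src E y))" "fob A (src E y)"] y by (auto simp: hom_iff)
  show ?thesis
  proof (rule H.D.pullbackI)
    show "far A y \<cdot>\<^bsub>T\<^esub> fib y = section \<cdot>\<^bsub>T\<^esub> far H (bang y)"
      unfolding nat using pullbackD(9)[OF pb] y by (simp add: section_def fib_def H.D.assoc)
  next
    fix z r s assume r: "r \<in> hom T z (src T (far A y))" and s: "s \<in> hom T z (src T section)"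
      and e: "far A y \<cdot>\<^bsub>T\<^esub> r = section \<cdot>\<^bsub>T\<^esub> s"
    have jr: "j \<cdot>\<^bsub>T\<^esub> r \<in> hom T z (src T (far H (far \<pi> y)))" using j r y by (auto simp: hom_iff)
    have pj: "\<psi> (src E y) \<cdot>\<^bsub>T\<^esub> (j \<cdot>\<^bsub>T\<^esub> r) = r" using H.D.reassoc[OF j(3), of r] j(1) r y by (simp add: hom_iff)
    have "\<psi> X \<cdot>\<^bsub>T\<^esub> (far H (far \<pi> y) \<cdot>\<^bsub>T\<^esub> (j \<cdot>\<^bsub>T\<^esub> r)) = far A y \<cdot>\<^bsub>T\<^esub> (\<psi> (src E y) \<cdot>\<^bsub>T\<^esub> (j \<cdot>\<^bsub>T\<^esub> r))"
      using H.D.reassoc[OF psi_nat[OF y(1)], of "j \<cdot>\<^bsub>T\<^esub> r"] j(1) r y by (simp add: hom_iff H.D.assoc)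
    also have "\<dots> = \<psi> X \<cdot>\<^bsub>T\<^esub> (far H (graph ?x) \<cdot>\<^bsub>T\<^esub> s)"
      unfolding pj e using s by (simp add: section_def fib_def H.D.assoc hom_iff)
    finally have "far H (far \<pi> y) \<cdot>\<^bsub>T\<^esub> (j \<cdot>\<^bsub>T\<^esub> r) = far H (graph ?x) \<cdot>\<^bsub>T\<^esub> s"
      using H.D.iso_mono[OF iX] jr s y by (auto simp: hom_iff section_def)
    then obtain k where "k \<in> hom T z (src T (far H (graph y)))" "far H (graph y) \<cdot>\<^bsub>T\<^esub> k = j \<cdot>\<^bsub>T\<^esub> r" "far H (bang y) \<cdot>\<^bsub>T\<^esub> k = s"
      using pullback_factor[OF pb jr] s y by (auto simp: section_def hom_iff)
    then show "\<exists>k\<in>hom T z (src T (fib y)). fib y \<cdot>\<^bsub>T\<^esub> k = r \<and> far H (bang y) \<cdot>\<^bsub>T\<^esub> k = s"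
      using y pj by (intro bexI[of _ k]) (auto simp: fib_def hom_iff H.D.assoc)
  next
    fix z k k' assume k: "k \<in> hom T z (src T (fib y))" "k' \<in> hom T z (src T (fib y))" "fib y \<cdot>\<^bsub>T\<^esub> k = fib y \<cdot>\<^bsub>T\<^esub> k'"
      "far H (bang y) \<cdot>\<^bsub>T\<^esub> k = far H (bang y) \<cdot>\<^bsub>T\<^esub> k'"
    have "far H (graph y) \<cdot>\<^bsub>T\<^esub> k = far H (graph y) \<cdot>\<^bsub>T\<^esub> k'"
      by (rule H.D.iso_mono[OF iY]) (use k y in \<open>auto simp: hom_iff fib_def H.D.assoc\<close>)
    then show "k = k'" using H.D.pullback_ext[OF pb] k y by auto
  qed (use y in \<open>auto simp: section_def\<close>)
qed

text \<open>The triangle identity \<open>pr_graph\<close> recovers \<open>\<psi>\<close> from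
  \<open>fib\<close>. So a transformation that respects \<open>fib\<close> also respects
  \<open>\<psi>\<close>.\<close>

lemma psi_fib: "D \<in> Ob E \<Longrightarrow> \<psi> D = far A (q D) \<cdot>\<^bsub>T\<^esub> fib (fob \<pi> D)"
proof -
  assume D: "D \<in> Ob E"
  have "far A (q D) \<cdot>\<^bsub>T\<^esub> fib (fob \<pi> D) = \<psi> D \<cdot>\<^bsub>T\<^esub> (far H (far \<pi> (q D)) \<cdot>\<^bsub>T\<^esub> far H (graph (fob \<pi> D)))"
    using psi_nat[of "q D"] D by (simp add: fib_def H.D.assoc[symmetric])
  also have "far H (far \<pi> (q D)) \<cdot>\<^bsub>T\<^esub> far H (graph (fob \<pi> D)) = idn T (fob H (fob \<pi> D))"
    using D by (simp add: H.far_cmp[symmetric] pr_graph)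
  finally show ?thesis using D by simp
qed

lemma fib_nat: "m \<in> Ar S \<Longrightarrow> far A (slice_arrow m) \<cdot>\<^bsub>T\<^esub> fib (src S m) = fib (tgt S m) \<cdot>\<^bsub>T\<^esub> far H m"
  using H.D.reassoc[OF psi_nat[of "slice_arrow m"], of "far H (graph (src S m))"]
    H.far_cmp[of "graph (src S m)" "far \<pi> (slice_arrow m)"] H.far_cmp[of m "graph (tgt S m)"]
  by (simp add: fib_def graph_nat H.D.assoc)

lemma terminal_unit: "terminal_in T (fob H (idn E X))"
  by (rule left_exact_terminal[OF H.ftor_axioms lex slice_terminal]) simp

text \<open>Naturality of \<open>\<sigma>\<close> at \<open>graph y\<close>, combined with
  compatibility with \<open>\<psi>\<close> and \<open>\<chi>\<close>. For the identity of
  \<open>X\<close> it compares the two generic sections.\<close>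

lemma point_arrow_fib:
  assumes K: "etale_point E X p q T A K \<chi>" and s: "nat_trans S T H K \<sigma>"
    and e: "\<And>D. D \<in> Ob E \<Longrightarrow> \<chi> D \<cdot>\<^bsub>T\<^esub> \<sigma> (fob \<pi> D) = \<psi> D"
    and y: "y \<in> Ar E" "tgt E y = X"
  shows "etale_point.fib E p q T K \<chi> y \<cdot>\<^bsub>T\<^esub> \<sigma> y = fib y"
proof -
  interpret K: etale_point E X p q T A K \<chi> by fact
  have sy: "\<sigma> y \<in> Ar T" "src T (\<sigma> y) = fob H y" "tgt T (\<sigma> y) = fob K y"
    "\<sigma> (fob \<pi> (src E y)) \<in> Ar T" "src T (\<sigma> (fob \<pi> (src E y))) = fob H (fob \<pi> (src E y))" "tgt T (\<sigma> (fob \<pi> (src E y))) = fob K (fob \<pi> (src E y))"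
    using s y by (auto simp: nat_trans_def hom_iff)
  have n: "\<sigma> (fob \<pi> (src E y)) \<cdot>\<^bsub>T\<^esub> far H (graph y) = far K (graph y) \<cdot>\<^bsub>T\<^esub> \<sigma> y"
    using s y graph[OF y] unfolding nat_trans_def by metis
  have "K.fib y \<cdot>\<^bsub>T\<^esub> \<sigma> y = \<chi> (src E y) \<cdot>\<^bsub>T\<^esub> (\<sigma> (fob \<pi> (src E y)) \<cdot>\<^bsub>T\<^esub> far H (graph y))"
    unfolding n using y sy by (simp add: K.fib_def H.D.assoc)
  also have "\<dots> = fib y" using H.D.reassoc[OF e, of "src E y" "far H (graph y)"] y sy by (simp add: fib_def)
  finally show ?thesis .
qed

text \<open>\<open>K y\<close> is a pullback, so \<open>\<sigma> y\<close> is determined by its two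
  projections. One of them is prescribed by \<open>point_arrow_fib\<close>, the other goes to the
  terminal object \<open>K (idn E X)\<close>.\<close>

lemma point_arrow_unique:
  assumes K: "etale_point E X p q T A K \<chi>" and s: "nat_trans S T H K \<sigma>" "nat_trans S T H K \<sigma>'"
    and e: "\<And>D. D \<in> Ob E \<Longrightarrow> \<chi> D \<cdot>\<^bsub>T\<^esub> \<sigma> (fob \<pi> D) = \<psi> D" "\<And>D. D \<in> Ob E \<Longrightarrow> \<chi> D \<cdot>\<^bsub>T\<^esub> \<sigma>' (fob \<pi> D) = \<psi> D"
  shows "\<sigma> = \<sigma>'"
proof (rule nt_eq[OF s(2)])
  interpret K: etale_point E X p q T A K \<chi> by fact
  show "\<sigma> \<in> extensional (Ob S)" using s by (auto simp: nat_trans_def)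
  fix y assume y: "y \<in> Ob S"
  then have y': "y \<in> Ar E" "tgt E y = X" by auto
  have h: "\<sigma> y \<in> hom T (fob H y) (fob K y)" "\<sigma>' y \<in> hom T (fob H y) (fob K y)" using s y by (auto simp: nat_trans_def)
  have "K.fib y \<cdot>\<^bsub>T\<^esub> \<sigma> y = K.fib y \<cdot>\<^bsub>T\<^esub> \<sigma>' y"
    using point_arrow_fib[OF K s(1) e(1) y'] point_arrow_fib[OF K s(2) e(2) y'] by simp
  moreover have "far K (bang y) \<cdot>\<^bsub>T\<^esub> \<sigma> y = far K (bang y) \<cdot>\<^bsub>T\<^esub> \<sigma>' y"
    by (rule terminal_in_unique[OF K.terminal_unit, of "fob H y"]) (use h y' in \<open>auto simp: hom_iff\<close>)
  ultimately show "\<sigma> y = \<sigma>' y"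
    by - (rule H.D.pullback_ext[OF K.fib_pullback[OF y'], of _ "fob H y"], use h y' in auto)
qed

text \<open>\<open>fib y\<close> and the map \<open>v\<close> after \<open>H (bang y)\<close> form a
  cone over the cospan of \<open>K y\<close>, precisely because \<open>v\<close> takes one section
  to the other. The induced map is \<open>\<sigma> y\<close>, and its naturality is tested on both
  projections.\<close>

lemma point_arrow_exists:
  assumes K: "etale_point E X p q T A K \<chi>"
    and v: "v \<in> hom T (fob H (idn E X)) (fob K (idn E X))"
    and e: "etale_point.section E X p q T K \<chi> \<cdot>\<^bsub>T\<^esub> v = section"
  shows "\<exists>\<sigma>. nat_trans S T H K \<sigma> \<and> (\<forall>D \<in> Ob E. \<chi> D \<cdot>\<^bsub>T\<^esub> \<sigma> (fob \<pi> D) = \<psi> D)"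
proof -
  interpret K: etale_point E X p q T A K \<chi> by fact
  note K.fib [simp] fib [simp] and vs = v[unfolded hom_iff]
  have Ks: "K.section \<in> Ar T" "src T K.section = fob K (idn E X)" "tgt T K.section = fob A X"
    using K.section_hom by (auto simp: hom_iff)
  have "\<exists>k. k \<in> hom T (fob H y) (fob K y) \<and> K.fib y \<cdot>\<^bsub>T\<^esub> k = fib y \<and> far K (bang y) \<cdot>\<^bsub>T\<^esub> k = v \<cdot>\<^bsub>T\<^esub> far H (bang y)"
    if y: "y \<in> Ob S" for y
  proof -
    have y': "y \<in> Ar E" "tgt E y = X" using y by auto
    have 1: "far A y \<cdot>\<^bsub>T\<^esub> fib y = K.section \<cdot>\<^bsub>T\<^esub> (v \<cdot>\<^bsub>T\<^esub> far H (bang y))"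
      using pullbackD(9)[OF fib_pullback[OF y']] vs Ks y' by (simp add: H.D.assoc[symmetric] e)
    show ?thesis
      by (rule pullback_factor[OF K.fib_pullback[OF y'] _ _ 1, of "fob H y"]) (use y' vs Ks in \<open>auto simp: hom_iff\<close>)
  qed
  then obtain \<sigma> where s: "\<And>y. y \<in> Ob S \<Longrightarrow> \<sigma> y \<in> hom T (fob H y) (fob K y) \<and> K.fib y \<cdot>\<^bsub>T\<^esub> \<sigma> y = fib y \<and>
      far K (bang y) \<cdot>\<^bsub>T\<^esub> \<sigma> y = v \<cdot>\<^bsub>T\<^esub> far H (bang y)" by metis
  then have s': "\<sigma> y \<in> Ar T" "src T (\<sigma> y) = fob H y" "tgt T (\<sigma> y) = fob K y" "K.fib y \<cdot>\<^bsub>T\<^esub> \<sigma> y = fib y"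
    "far K (bang y) \<cdot>\<^bsub>T\<^esub> \<sigma> y = v \<cdot>\<^bsub>T\<^esub> far H (bang y)" if "y \<in> Ar E" "tgt E y = X" for y
    using that by (auto simp: hom_iff)
  have "nat_trans S T H K (restrict \<sigma> (Ob S))"
    unfolding nat_trans_def
  proof (intro conjI ballI)
    fix m assume m: "m \<in> Ar S"
    let ?x = "src S m" and ?y = "tgt S m"
    have xy: "?x \<in> Ar E" "tgt E ?x = X" "?y \<in> Ar E" "tgt E ?y = X" using m by auto
    have bm: "bang ?y \<cdot>\<^bsub>S\<^esub> m = bang ?x" by (rule slice_ext) (use m xy in auto)
    have "\<sigma> ?y \<cdot>\<^bsub>T\<^esub> far H m = far K m \<cdot>\<^bsub>T\<^esub> \<sigma> ?x"
    proof (rule H.D.pullback_ext[OF K.fib_pullback[OF xy(3,4)], of _ "fob H ?x"])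
      show "\<sigma> ?y \<cdot>\<^bsub>T\<^esub> far H m \<in> hom T (fob H ?x) (src T (K.fib ?y))" "far K m \<cdot>\<^bsub>T\<^esub> \<sigma> ?x \<in> hom T (fob H ?x) (src T (K.fib ?y))"
        using m xy s' by (auto simp: hom_iff)
      have "K.fib ?y \<cdot>\<^bsub>T\<^esub> (\<sigma> ?y \<cdot>\<^bsub>T\<^esub> far H m) = fib ?y \<cdot>\<^bsub>T\<^esub> far H m"
        using H.D.reassoc[OF s'(4), of ?y "far H m"] m xy s' by simp
      also have "\<dots> = far A (slice_arrow m) \<cdot>\<^bsub>T\<^esub> (K.fib ?x \<cdot>\<^bsub>T\<^esub> \<sigma> ?x)" using m xy s' by (simp add: fib_nat)
      also have "\<dots> = K.fib ?y \<cdot>\<^bsub>T\<^esub> (far K m \<cdot>\<^bsub>T\<^esub> \<sigma> ?x)"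
        using H.D.reassoc[OF K.fib_nat[OF m], of "\<sigma> ?x"] m xy s' by (simp add: H.D.assoc)
      finally show "K.fib ?y \<cdot>\<^bsub>T\<^esub> (\<sigma> ?y \<cdot>\<^bsub>T\<^esub> far H m) = K.fib ?y \<cdot>\<^bsub>T\<^esub> (far K m \<cdot>\<^bsub>T\<^esub> \<sigma> ?x)" .
      have "far K (bang ?y) \<cdot>\<^bsub>T\<^esub> (\<sigma> ?y \<cdot>\<^bsub>T\<^esub> far H m) = v \<cdot>\<^bsub>T\<^esub> far H (bang ?x)"
        using H.D.reassoc[OF s'(5), of ?y "far H m"] m xy s' vs H.far_cmp[of m "bang ?y"] by (simp add: bm H.D.assoc)
      also have "\<dots> = far K (bang ?y) \<cdot>\<^bsub>T\<^esub> (far K m \<cdot>\<^bsub>T\<^esub> \<sigma> ?x)"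
        unfolding s'(5)[OF xy(1,2), symmetric] using m xy s'(1-3) K.H.far_cmp[of m "bang ?y"] by (simp add: bm H.D.assoc)
      finally show "far K (bang ?y) \<cdot>\<^bsub>T\<^esub> (\<sigma> ?y \<cdot>\<^bsub>T\<^esub> far H m) = far K (bang ?y) \<cdot>\<^bsub>T\<^esub> (far K m \<cdot>\<^bsub>T\<^esub> \<sigma> ?x)" .
    qed
    then show "restrict \<sigma> (Ob S) ?y \<cdot>\<^bsub>T\<^esub> far H m = far K m \<cdot>\<^bsub>T\<^esub> restrict \<sigma> (Ob S) ?x" using xy by simp
  qed (use s' in \<open>auto simp: hom_iff\<close>)
  moreover have "\<chi> D \<cdot>\<^bsub>T\<^esub> restrict \<sigma> (Ob S) (fob \<pi> D) = \<psi> D" if "D \<in> Ob E" for D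
    using that s' by (simp add: K.psi_fib psi_fib H.D.assoc)
  ultimately show ?thesis by blast
qed

end

text \<open>\<open>J\<close> with a terminal object adjoined; the arrow \<open>j \<rightarrow> 0\<close> is \<open>2 * j + 2\<close> and \<open>f\<close> becomes \<open>2 * f + 1\<close>.\<close>

definition coned :: "(nat,nat) cat \<Rightarrow> (nat,nat) cat" where
  "coned J = \<lparr>Ob = insert 0 (Suc ` Ob J),
     Ar = insert 0 ((\<lambda>f. 2 * f + 1) ` Ar J \<union> (\<lambda>j. 2 * j + 2) ` Ob J),
     src = (\<lambda>a. if a = 0 then 0 else if odd a then Suc (src J (a div 2)) else Suc (a div 2 - 1)),
     tgt = (\<lambda>a. if odd a then Suc (tgt J (a div 2)) else 0),
     idn = (\<lambda>x. if x = 0 then 0 else 2 * idn J (x - 1) + 1),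
     cmp = (\<lambda>b a. if even a then a else if odd b then 2 * (b div 2 \<cdot>\<^bsub>J\<^esub> (a div 2)) + 1 else 2 * src J (a div 2) + 2)\<rparr>"

lemma coned_sel [simp]:
  "Ob (coned J) = insert 0 (Suc ` Ob J)"
  "Ar (coned J) = insert 0 ((\<lambda>f. 2 * f + 1) ` Ar J \<union> (\<lambda>j. 2 * j + 2) ` Ob J)"
  "src (coned J) 0 = 0" "src (coned J) (Suc (2 * f)) = Suc (src J f)" "src (coned J) (Suc (Suc (2 * j))) = Suc j"
  "tgt (coned J) 0 = 0" "tgt (coned J) (Suc (2 * f)) = Suc (tgt J f)" "tgt (coned J) (Suc (Suc (2 * j))) = 0"
  "idn (coned J) 0 = 0" "idn (coned J) (Suc j) = Suc (2 * idn J j)"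
  "b \<cdot>\<^bsub>coned J\<^esub> 0 = 0" "b \<cdot>\<^bsub>coned J\<^esub> Suc (Suc (2 * j)) = Suc (Suc (2 * j))"
  "0 \<cdot>\<^bsub>coned J\<^esub> Suc (2 * f) = Suc (Suc (2 * src J f))"
  "Suc (2 * g) \<cdot>\<^bsub>coned J\<^esub> Suc (2 * f) = Suc (2 * (g \<cdot>\<^bsub>J\<^esub> f))"
  "Suc (Suc (2 * j)) \<cdot>\<^bsub>coned J\<^esub> Suc (2 * f) = Suc (Suc (2 * src J f))"
  by (auto simp: coned_def)

lemma category_coned:
  assumes "category J"
  shows "category (coned J)"
proof -
  interpret category J by fact
  have ne: "Suc (2 * f) \<noteq> Suc (Suc (2 * j))" "Suc (Suc (2 * j)) \<noteq> Suc (2 * f)" for f j :: nat by presburger+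
  show ?thesis
    by unfold_locales (auto simp: hom_def ne assoc)
qed

lemma finite_coned: "finite_category J \<Longrightarrow> finite_category (coned J)"
  by (auto simp: finite_category_def category_coned)

lemma ball_coned: "(\<forall>a \<in> Ar (coned J). P a) \<longleftrightarrow> P 0 \<and> (\<forall>f \<in> Ar J. P (Suc (2 * f))) \<and> (\<forall>j \<in> Ob J. P (Suc (Suc (2 * j))))"
  "(\<forall>x \<in> Ob (coned J). Q x) \<longleftrightarrow> Q 0 \<and> (\<forall>j \<in> Ob J. Q (Suc j))"
  by auto

subsection \<open>Limits in a slice\<close>

context slice_category
begin

text \<open>A diagram in \<open>E/X\<close> is a diagram in \<open>E\<close> on the enlarged index
  category, with \<open>X\<close> at the adjoined object and the structure maps on the new arrows.
  Objects are shifted by one, old arrows have odd and new ones even codes, whence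
  \<open>x - 1\<close>, \<open>a div 2\<close> and \<open>a div 2 - 1\<close>.\<close>

definition slice_diagram :: "(nat,nat) cat \<Rightarrow> (nat,nat,'u,'u) ftr \<Rightarrow> (nat,nat,'u,'u) ftr" where
  "slice_diagram J G = \<lparr>fob = (\<lambda>x \<in> Ob (coned J). if x = 0 then X else src E (fob G (x - 1))),
     far = (\<lambda>a \<in> Ar (coned J). if a = 0 then idn E X else if odd a then slice_arrow (far G (a div 2))
        else fob G (a div 2 - 1))\<rparr>"

lemma slice_diagram_sel [simp]:
  "fob (slice_diagram J G) 0 = X" "j \<in> Ob J \<Longrightarrow> fob (slice_diagram J G) (Suc j) = src E (fob G j)"
  "far (slice_diagram J G) 0 = idn E X" "f \<in> Ar J \<Longrightarrow> far (slice_diagram J G) (Suc (2 * f)) = slice_arrow (far G f)"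
  "j \<in> Ob J \<Longrightarrow> far (slice_diagram J G) (Suc (Suc (2 * j))) = fob G j"
  by (auto simp: slice_diagram_def)

lemma slice_diagram_functor:
  assumes J: "category J" and G: "is_functor J (slice E X) G" and X: "X \<in> Ob E"
  shows "is_functor (coned J) E (slice_diagram J G)"
proof -
  interpret G: ftor J "slice E X" G by (rule ftorI[OF J S.category_axioms G])
  have o: "fob G j \<in> Ar E" "tgt E (fob G j) = X" if "j \<in> Ob J" for j using G.fob_Ob[OF that] by auto
  have [simp]: "fob G (tgt J f) \<cdot>\<^bsub>E\<^esub> slice_arrow (far G f) = fob G (src J f)" if "f \<in> Ar J" for f
    using slice_Ar(4)[OF G.far_Ar[OF that]] that by simp
  have ext: "fob (slice_diagram J G) \<in> extensional (Ob (coned J))" "far (slice_diagram J G) \<in> extensional (Ar (coned J))"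
    unfolding slice_diagram_def by (simp_all del: coned_sel(1,2))
  show ?thesis
    unfolding is_functor_def PiE_def ball_coned Int_iff Pi_iff
    by (use ext X in \<open>auto simp: hom_iff o G.far_cmp simp del: coned_sel(1,2)\<close>)
qed

text \<open>A cone over \<open>slice_diagram J G\<close> has a component \<open>d 0\<close> at the
  adjoined object. It turns the vertex into an object of the slice and the remaining components into
  arrows over \<open>X\<close>, that is, into a cone over \<open>G\<close>.\<close>

lemma slice_limit:
  assumes J: "category J" and G: "is_functor J (slice E X) G" and X: "X \<in> Ob E"
    and lim: "is_limit J (slice E X) G L c"
  shows "is_limit (coned J) E (slice_diagram J G) (src E L) (\<lambda>x. if x = 0 then L else slice_arrow (c (x - 1)))"
    (is "is_limit _ _ _ _ ?c")
proof -
  interpret G: ftor J "slice E X" G by (rule ftorI[OF J S.category_axioms G])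
  have o: "fob G j \<in> Ar E" "tgt E (fob G j) = X" if "j \<in> Ob J" for j using G.fob_Ob[OF that] by auto
  have L: "L \<in> Ar E" "tgt E L = X" and c: "\<And>j. j \<in> Ob J \<Longrightarrow> c j \<in> hom (slice E X) L (fob G j)"
    and cu: "\<And>u. u \<in> Ar J \<Longrightarrow> far G u \<cdot>\<^bsub>slice E X\<^esub> c (src J u) = c (tgt J u)"
    using lim by (auto simp: is_limit_def is_cone_def)
  have c': "slice_arrow (c j) \<in> Ar E" "src E (slice_arrow (c j)) = src E L" "tgt E (slice_arrow (c j)) = src E (fob G j)"
    "fob G j \<cdot>\<^bsub>E\<^esub> slice_arrow (c j) = L" if "j \<in> Ob J" for j
  proof -
    have cj: "c j \<in> Ar (slice E X)" "src (slice E X) (c j) = L" "tgt (slice E X) (c j) = fob G j"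
      using c[OF that] by (simp_all add: hom_iff)
    show "slice_arrow (c j) \<in> Ar E" "src E (slice_arrow (c j)) = src E L" "tgt E (slice_arrow (c j)) = src E (fob G j)"
      "fob G j \<cdot>\<^bsub>E\<^esub> slice_arrow (c j) = L" using slice_Ar[OF cj(1)] unfolding cj by auto
  qed
  have cu': "slice_arrow (far G u) \<cdot>\<^bsub>E\<^esub> slice_arrow (c (src J u)) = slice_arrow (c (tgt J u))" if "u \<in> Ar J" for u
    using arg_cong[OF cu[OF that], of slice_arrow] by simp
  show ?thesis
    unfolding is_limit_def
  proof (intro conjI allI impI)
    show "is_cone (coned J) E (slice_diagram J G) (src E L) ?c"
      unfolding is_cone_def ball_coned using L c' cu' X by (auto simp: hom_iff)
    fix M d assume "is_cone (coned J) E (slice_diagram J G) M d"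
    then have M: "M \<in> Ob E" and d0: "d 0 \<in> hom E M X" and d: "\<And>j. j \<in> Ob J \<Longrightarrow> d (Suc j) \<in> hom E M (src E (fob G j))"
      and df: "\<And>f. f \<in> Ar J \<Longrightarrow> slice_arrow (far G f) \<cdot>\<^bsub>E\<^esub> d (Suc (src J f)) = d (Suc (tgt J f))"
      and dj: "\<And>j. j \<in> Ob J \<Longrightarrow> fob G j \<cdot>\<^bsub>E\<^esub> d (Suc j) = d 0"
      unfolding is_cone_def ball_coned by auto
    have "is_cone J (slice E X) G (d 0) (\<lambda>j. pair_code (d (Suc j), fob G j))"
      unfolding is_cone_def
    proof (intro conjI ballI)
      fix u assume u: "u \<in> Ar J"
      have 1: "pair_code (d (Suc (src J u)), fob G (src J u)) \<in> Ar (slice E X)"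
        using d[of "src J u"] u o by (auto simp: hom_iff)
      have 2: "pair_code (d (Suc (tgt J u)), fob G (tgt J u)) \<in> Ar (slice E X)"
        using d[of "tgt J u"] u o by (auto simp: hom_iff)
      show "far G u \<cdot>\<^bsub>slice E X\<^esub> pair_code (d (Suc (src J u)), fob G (src J u)) = pair_code (d (Suc (tgt J u)), fob G (tgt J u))"
        using u 1 2 df by - (rule slice_ext, auto)
    next
      fix j assume j: "j \<in> Ob J"
      then show "pair_code (d (Suc j), fob G j) \<in> hom (slice E X) (d 0) (fob G j)"
        using d[OF j] o[OF j] dj[OF j] by (auto simp: hom_iff)
    qed (use d0 in \<open>auto simp: hom_iff\<close>)
    then have ex1: "\<exists>!h. h \<in> hom (slice E X) (d 0) L \<and> (\<forall>j\<in>Ob J. c j \<cdot>\<^bsub>slice E X\<^esub> h = pair_code (d (Suc j), fob G j))"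
      using lim unfolding is_limit_def by blast
    then obtain h where h: "h \<in> hom (slice E X) (d 0) L" "\<And>j. j \<in> Ob J \<Longrightarrow> c j \<cdot>\<^bsub>slice E X\<^esub> h = pair_code (d (Suc j), fob G j)"
      by blast
    have h': "slice_arrow h \<in> hom E M (src E L)" "L \<cdot>\<^bsub>E\<^esub> slice_arrow h = d 0"
    proof -
      have hh: "h \<in> Ar (slice E X)" "src (slice E X) h = d 0" "tgt (slice E X) h = L" using h(1) by (simp_all add: hom_iff)
      show "slice_arrow h \<in> hom E M (src E L)" "L \<cdot>\<^bsub>E\<^esub> slice_arrow h = d 0"
        using slice_Ar[OF hh(1)] d0 unfolding hh by (auto simp: hom_iff)
    qed
    have hc: "slice_arrow (c j) \<cdot>\<^bsub>E\<^esub> slice_arrow h = d (Suc j)" if "j \<in> Ob J" for j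
      using arg_cong[OF h(2)[OF that], of slice_arrow] by simp
    show "\<exists>!h. h \<in> hom E M (src E L) \<and> (\<forall>j\<in>Ob (coned J). ?c j \<cdot>\<^bsub>E\<^esub> h = d j)"
      unfolding ball_coned
    proof (rule ex1I[of _ "slice_arrow h"])
      fix k assume k: "k \<in> hom E M (src E L) \<and> (if 0 = 0 then L else slice_arrow (c (0 - 1))) \<cdot>\<^bsub>E\<^esub> k = d 0 \<and>
         (\<forall>j\<in>Ob J. (if Suc j = 0 then L else slice_arrow (c (Suc j - 1))) \<cdot>\<^bsub>E\<^esub> k = d (Suc j))"
      have kk: "pair_code (k, L) \<in> hom (slice E X) (d 0) L" using k L by (auto simp: hom_iff)
      have "c j \<cdot>\<^bsub>slice E X\<^esub> pair_code (k, L) = pair_code (d (Suc j), fob G j)" if j: "j \<in> Ob J" for j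
      proof (rule slice_ext)
        show "pair_code (d (Suc j), fob G j) \<in> Ar (slice E X)" using d[OF j] o[OF j] by (auto simp: hom_iff)
      qed (use c[OF j] kk k j in \<open>auto simp: hom_iff\<close>)
      then have "pair_code (k, L) = h" using ex1 kk h by blast
      then show "k = slice_arrow h" using slice_sel(5) by metis
    qed (use h' hc in auto)
  qed
qed

end

subsection \<open>Points from sections\<close>

text \<open>The data for the converse construction: a global element \<open>s\<close> of
  \<open>A X\<close> and a chosen fibre of each \<open>A y\<close> over it. These fibres form the
  functor that is to be the inverse image of a 1-cell with generic section \<open>s\<close>.\<close>

locale etale_section = etale E X p q + A: ftor E T A
  for E :: "('u,'u) cat" and X p q and T :: "('u,'u) cat" and A +
  fixes t s :: 'u and r w :: "'u \<Rightarrow> 'u"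
  assumes lexA: "left_exact E T A" and t: "terminal_in T t" and s: "s \<in> hom T t (fob A X)"
    and pb: "\<And>y. y \<in> Ar E \<Longrightarrow> tgt E y = X \<Longrightarrow> is_pullback T (far A y) s (r y) (w y)"
begin

lemma s_sel [simp]: "s \<in> Ar T" "src T s = t" "tgt T s = fob A X"
  using s by (auto simp: hom_iff)

lemma rw [simp]:
  assumes "y \<in> Ar E" "tgt E y = X"
  shows "r y \<in> Ar T" "w y \<in> Ar T" "src T (w y) = src T (r y)" "tgt T (r y) = fob A (src E y)" "tgt T (w y) = t"
    "far A y \<cdot>\<^bsub>T\<^esub> r y = s \<cdot>\<^bsub>T\<^esub> w y"
  using pullbackD[OF pb[OF assms]] assms by auto

lemma to_t: "f \<in> Ar T \<Longrightarrow> g \<in> Ar T \<Longrightarrow> src T f = src T g \<Longrightarrow> tgt T f = t \<Longrightarrow> tgt T g = t \<Longrightarrow> f = g"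
  using terminal_in_unique[OF t, of "src T g" f g] by (simp add: hom_iff)

text \<open>Maps into the terminal object \<open>t\<close> agree, so the projection
  \<open>w y\<close> cannot distinguish \<open>k\<close> from \<open>l\<close>. Thus
  \<open>r y\<close> is monic, and equations about \<open>fibre_map\<close> are checked inside
  values of \<open>A\<close>.\<close>

lemma r_ext:
  assumes "y \<in> Ar E" "tgt E y = X" "k \<in> Ar T" "l \<in> Ar T" "src T k = src T l" "tgt T k = src T (r y)" "tgt T l = src T (r y)"
    "r y \<cdot>\<^bsub>T\<^esub> k = r y \<cdot>\<^bsub>T\<^esub> l"
  shows "k = l"
  by (rule A.D.pullback_ext[OF pb[OF assms(1,2)], of _ "src T l"]) (use assms in \<open>auto simp: hom_iff intro: to_t\<close>)

lemma r_lift: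
  assumes "y \<in> Ar E" "tgt E y = X" "f \<in> hom T z (fob A (src E y))" "u \<in> hom T z t" "far A y \<cdot>\<^bsub>T\<^esub> f = s \<cdot>\<^bsub>T\<^esub> u"
  shows "\<exists>k. k \<in> hom T z (src T (r y)) \<and> r y \<cdot>\<^bsub>T\<^esub> k = f"
  by (rule pullback_factor[OF pb[OF assms(1,2)] _ _ assms(5), of z]) (use assms in auto)

definition fibre_map :: "'u \<Rightarrow> 'u" where
  "fibre_map m = (SOME k. k \<in> hom T (src T (r (src S m))) (src T (r (tgt S m))) \<and>
     r (tgt S m) \<cdot>\<^bsub>T\<^esub> k = far A (slice_arrow m) \<cdot>\<^bsub>T\<^esub> r (src S m))"

lemma fibre_map [simp]:
  assumes m: "m \<in> Ar S"
  shows "fibre_map m \<in> Ar T" "src T (fibre_map m) = src T (r (src S m))" "tgt T (fibre_map m) = src T (r (tgt S m))"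
    "r (tgt S m) \<cdot>\<^bsub>T\<^esub> fibre_map m = far A (slice_arrow m) \<cdot>\<^bsub>T\<^esub> r (src S m)"
proof -
  have 1: "far A (tgt S m) \<cdot>\<^bsub>T\<^esub> far A (slice_arrow m) = far A (src S m)"
    using A.far_cmp[of "slice_arrow m" "tgt S m"] slice_Ar(4)[OF m] m by simp
  have "far A (tgt S m) \<cdot>\<^bsub>T\<^esub> (far A (slice_arrow m) \<cdot>\<^bsub>T\<^esub> r (src S m)) = s \<cdot>\<^bsub>T\<^esub> w (src S m)"
    using A.D.reassoc[OF 1, of "r (src S m)"] m by simp
  then have "\<exists>k. k \<in> hom T (src T (r (src S m))) (src T (r (tgt S m))) \<and>
     r (tgt S m) \<cdot>\<^bsub>T\<^esub> k = far A (slice_arrow m) \<cdot>\<^bsub>T\<^esub> r (src S m)"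
    by (rule r_lift[rotated 4]) (use m in \<open>auto simp: hom_iff\<close>)
  from someI_ex[OF this] show "fibre_map m \<in> Ar T" "src T (fibre_map m) = src T (r (src S m))" "tgt T (fibre_map m) = src T (r (tgt S m))"
    "r (tgt S m) \<cdot>\<^bsub>T\<^esub> fibre_map m = far A (slice_arrow m) \<cdot>\<^bsub>T\<^esub> r (src S m)"
    unfolding fibre_map_def by (auto simp: hom_iff)
qed

lemma fibre_map_reassoc: "m \<in> Ar S \<Longrightarrow> k \<in> Ar T \<Longrightarrow> tgt T k = src T (r (src S m)) \<Longrightarrow>
   r (tgt S m) \<cdot>\<^bsub>T\<^esub> (fibre_map m \<cdot>\<^bsub>T\<^esub> k) = far A (slice_arrow m) \<cdot>\<^bsub>T\<^esub> (r (src S m) \<cdot>\<^bsub>T\<^esub> k)"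
  using A.D.reassoc[OF fibre_map(4), of m k] by (simp add: A.D.assoc)

definition fibre :: "('u,'u,'u,'u) ftr" where
  "fibre = \<lparr>fob = (\<lambda>y \<in> Ob S. src T (r y)), far = (\<lambda>m \<in> Ar S. fibre_map m)\<rparr>"

lemma fibre_sel [simp]: "y \<in> Ar E \<Longrightarrow> tgt E y = X \<Longrightarrow> fob fibre y = src T (r y)" "m \<in> Ar S \<Longrightarrow> far fibre m = fibre_map m"
  by (auto simp: fibre_def)

sublocale fibre: ftor S T fibre
proof (rule ftorI[OF S.category_axioms A.D.category_axioms functorI[OF S.category_axioms]])
  fix x assume "x \<in> Ob S"
  then have x: "x \<in> Ar E" "tgt E x = X" by auto
  have i: "idn S x \<in> Ar S" "src S (idn S x) = x" "tgt S (idn S x) = x"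
    using x S.idn_Ar[of x] S.src_idn[of x] S.tgt_idn[of x] by auto
  have "fibre_map (idn S x) = idn T (src T (r x))"
    using fibre_map[OF i(1)] x by - (rule r_ext[of x], auto simp: i)
  then show "far fibre (idn S x) = idn T (fob fibre x)" using i x by simp
next
  fix f g x y z assume "f \<in> hom S x y" "g \<in> hom S y z"
  then have f: "f \<in> Ar S" "src S f = x" "tgt S f = y" and g: "g \<in> Ar S" "src S g = y" "tgt S g = z" by (auto simp: hom_iff)
  have gf: "g \<cdot>\<^bsub>S\<^esub> f \<in> Ar S" "src S (g \<cdot>\<^bsub>S\<^esub> f) = x" "tgt S (g \<cdot>\<^bsub>S\<^esub> f) = z" using f g by auto
  have o: "x \<in> Ar E" "tgt E x = X" "y \<in> Ar E" "tgt E y = X" "z \<in> Ar E" "tgt E z = X"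
    using slice_Ob_Ar[OF f(1)] slice_Ob_Ar[OF g(1)] f g by auto
  have "fibre_map (g \<cdot>\<^bsub>S\<^esub> f) = fibre_map g \<cdot>\<^bsub>T\<^esub> fibre_map f"
  proof (rule r_ext[of z])
    have "r z \<cdot>\<^bsub>T\<^esub> (fibre_map g \<cdot>\<^bsub>T\<^esub> fibre_map f) = far A (slice_arrow g) \<cdot>\<^bsub>T\<^esub> (far A (slice_arrow f) \<cdot>\<^bsub>T\<^esub> r x)"
      using fibre_map_reassoc[OF g(1), of "fibre_map f"] fibre_map[OF f(1)] f g by simp
    also have "\<dots> = r z \<cdot>\<^bsub>T\<^esub> fibre_map (g \<cdot>\<^bsub>S\<^esub> f)"
      using fibre_map(4)[OF gf(1)] gf f g o slice_Ar[OF f(1)] slice_Ar[OF g(1)] by (simp add: A.far_cmp A.D.assoc)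
    finally show "r z \<cdot>\<^bsub>T\<^esub> fibre_map (g \<cdot>\<^bsub>S\<^esub> f) = r z \<cdot>\<^bsub>T\<^esub> (fibre_map g \<cdot>\<^bsub>T\<^esub> fibre_map f)" by simp
  qed (use o gf fibre_map[OF f(1)] fibre_map[OF g(1)] fibre_map[OF gf(1)] f g in auto)
  then show "far fibre (g \<cdot>\<^bsub>S\<^esub> f) = far fibre g \<cdot>\<^bsub>T\<^esub> far fibre f" using f g gf by simp
qed (auto simp: hom_iff, auto simp: fibre_def)

text \<open>After the monomorphisms \<open>r\<close>, a cone of fibres becomes a cone over the image
  under \<open>A\<close> of \<open>slice_diagram J G\<close>, and \<open>A\<close> preserves the
  limit of that diagram by \<open>slice_limit\<close>. The component at the adjoined object forces
  the induced map to lie over \<open>s\<close>, so it lifts to the fibre of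
  \<open>A L\<close>.\<close>

lemma fibre_left_exact: "left_exact S T fibre"
  unfolding left_exact_def
proof (intro allI impI, elim conjE)
  fix J :: "(nat,nat) cat" and G L c
  assume fin: "finite_category J" and G: "is_functor J S G" and lim: "is_limit J S G L c"
  have J: "category J" using fin by (simp add: finite_category_def)
  interpret G: ftor J S G by (rule ftorI[OF J S.category_axioms G])
  have o: "fob G j \<in> Ar E" "tgt E (fob G j) = X" if "j \<in> Ob J" for j using G.fob_Ob[OF that] by auto
  have L: "L \<in> Ar E" "tgt E L = X" and c: "\<And>j. j \<in> Ob J \<Longrightarrow> c j \<in> Ar S \<and> src S (c j) = L \<and> tgt S (c j) = fob G j"
    and cu: "\<And>u. u \<in> Ar J \<Longrightarrow> far G u \<cdot>\<^bsub>S\<^esub> c (src J u) = c (tgt J u)"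
    using lim by (auto simp: is_limit_def is_cone_def hom_iff)
  let ?G' = "slice_diagram J G"
  let ?c = "\<lambda>x. if x = 0 then L else slice_arrow (c (x - 1))"
  note G' = slice_diagram_functor[OF J G X]
  have limA: "is_limit (coned J) T (cmp_ftr (coned J) A ?G') (fob A (src E L)) (\<lambda>j. far A (?c j))"
    using lexA finite_coned[OF fin] G' slice_limit[OF J G X lim] unfolding left_exact_def by blast
  have AG: "fob (cmp_ftr (coned J) A ?G') 0 = fob A X" "j \<in> Ob J \<Longrightarrow> fob (cmp_ftr (coned J) A ?G') (Suc j) = fob A (src E (fob G j))"
    "far (cmp_ftr (coned J) A ?G') 0 = idn T (fob A X)" "f \<in> Ar J \<Longrightarrow> far (cmp_ftr (coned J) A ?G') (Suc (2 * f)) = far A (slice_arrow (far G f))"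
    "j \<in> Ob J \<Longrightarrow> far (cmp_ftr (coned J) A ?G') (Suc (Suc (2 * j))) = far A (fob G j)" for f j
    by (auto simp: cmp_fob cmp_far)
  have c': "slice_arrow (c j) \<in> Ar E" "src E (slice_arrow (c j)) = src E L" "tgt E (slice_arrow (c j)) = src E (fob G j)" if "j \<in> Ob J" for j
    using slice_Ar[of "c j"] c[OF that] by auto
  show "is_limit J T (cmp_ftr J fibre G) (fob fibre L) (\<lambda>j. far fibre (c j))"
    unfolding is_limit_def
  proof (intro conjI allI impI)
    show "is_cone J T (cmp_ftr J fibre G) (fob fibre L) (\<lambda>j. far fibre (c j))"
      unfolding is_cone_def
    proof (intro conjI ballI)
      fix u assume u: "u \<in> Ar J"
      then show "far (cmp_ftr J fibre G) u \<cdot>\<^bsub>T\<^esub> far fibre (c (src J u)) = far fibre (c (tgt J u))"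
        using fibre.far_cmp[of "c (src J u)" "far G u"] c[of "src J u"] by (simp add: cmp_far cu)
    next
      fix j assume j: "j \<in> Ob J"
      show "far fibre (c j) \<in> hom T (fob fibre L) (fob (cmp_ftr J fibre G) j)"
        using c[OF j] j o[OF j] L fibre_map[of "c j"] by (auto simp: cmp_fob hom_iff)
    qed (use L in auto)
    fix M d assume cone: "is_cone J T (cmp_ftr J fibre G) M d"
    then have M: "M \<in> Ob T" and d: "\<And>j. j \<in> Ob J \<Longrightarrow> d j \<in> Ar T \<and> src T (d j) = M \<and> tgt T (d j) = src T (r (fob G j))"
      and du: "\<And>u. u \<in> Ar J \<Longrightarrow> fibre_map (far G u) \<cdot>\<^bsub>T\<^esub> d (src J u) = d (tgt J u)"
      using o by (auto simp: is_cone_def cmp_fob cmp_far hom_iff)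
    \<comment> \<open>The map \<open>s\<close> after \<open>b\<close> serves as component at the
      adjoined object and records that the cone lies over the section.\<close>
    obtain b where b: "b \<in> Ar T" "src T b = M" "tgt T b = t" using terminal_in_ex[OF t M] by (auto simp: hom_iff)
    define e where "e x = (if x = 0 then s \<cdot>\<^bsub>T\<^esub> b else r (fob G (x - 1)) \<cdot>\<^bsub>T\<^esub> d (x - 1))" for x
    have wd: "w (fob G j) \<cdot>\<^bsub>T\<^esub> d j = b" if "j \<in> Ob J" for j using to_t[of "w (fob G j) \<cdot>\<^bsub>T\<^esub> d j" b] b d[OF that] o[OF that] by simp
    have "is_cone (coned J) T (cmp_ftr (coned J) A ?G') M e"
      unfolding is_cone_def ball_coned
    proof (intro conjI ballI M)
      fix u assume u: "u \<in> Ar J"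
      have "r (fob G (tgt J u)) \<cdot>\<^bsub>T\<^esub> (fibre_map (far G u) \<cdot>\<^bsub>T\<^esub> d (src J u)) = far A (slice_arrow (far G u)) \<cdot>\<^bsub>T\<^esub> (r (fob G (src J u)) \<cdot>\<^bsub>T\<^esub> d (src J u))"
        using fibre_map_reassoc[of "far G u" "d (src J u)"] u d[of "src J u"] by simp
      then show "far (cmp_ftr (coned J) A ?G') (Suc (2 * u)) \<cdot>\<^bsub>T\<^esub> e (src (coned J) (Suc (2 * u))) = e (tgt (coned J) (Suc (2 * u)))"
        using u by (simp add: e_def AG du)
    next
      fix j assume j: "j \<in> Ob J"
      show "far (cmp_ftr (coned J) A ?G') (Suc (Suc (2 * j))) \<cdot>\<^bsub>T\<^esub> e (src (coned J) (Suc (Suc (2 * j)))) = e (tgt (coned J) (Suc (Suc (2 * j))))"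
        using j A.D.reassoc[OF rw(6)[OF o[OF j]], of "d j"] d[OF j] o[OF j] wd[OF j] by (simp add: e_def AG A.D.assoc)
    qed (use b d o in \<open>auto simp: hom_iff e_def AG\<close>)
    then have ex1: "\<exists>!h. h \<in> hom T M (fob A (src E L)) \<and> (\<forall>j\<in>Ob (coned J). far A (?c j) \<cdot>\<^bsub>T\<^esub> h = e j)"
      using limA unfolding is_limit_def by blast
    then obtain h where h: "h \<in> hom T M (fob A (src E L))" "far A L \<cdot>\<^bsub>T\<^esub> h = s \<cdot>\<^bsub>T\<^esub> b"
      "\<And>j. j \<in> Ob J \<Longrightarrow> far A (slice_arrow (c j)) \<cdot>\<^bsub>T\<^esub> h = r (fob G j) \<cdot>\<^bsub>T\<^esub> d j"
      unfolding ball_coned by (auto simp: e_def)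
    obtain k where k: "k \<in> hom T M (src T (r L))" "r L \<cdot>\<^bsub>T\<^esub> k = h"
      using r_lift[OF L h(1) _ h(2)] b by (auto simp: hom_iff)
    show "\<exists>!h. h \<in> hom T M (fob fibre L) \<and> (\<forall>j\<in>Ob J. far fibre (c j) \<cdot>\<^bsub>T\<^esub> h = d j)"
    proof (rule ex1I[of _ k], intro conjI ballI)
      fix j assume j: "j \<in> Ob J"
      have "r (fob G j) \<cdot>\<^bsub>T\<^esub> (fibre_map (c j) \<cdot>\<^bsub>T\<^esub> k) = r (fob G j) \<cdot>\<^bsub>T\<^esub> d j"
        using fibre_map_reassoc[of "c j" k] c[OF j] k h(3)[OF j] by (simp add: hom_iff)
      then have "fibre_map (c j) \<cdot>\<^bsub>T\<^esub> k = d j"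
        using fibre_map[of "c j"] c[OF j] k d[OF j] o[OF j] by - (rule r_ext[of "fob G j"], auto simp: hom_iff)
      then show "far fibre (c j) \<cdot>\<^bsub>T\<^esub> k = d j" using c[OF j] by simp
    next
      fix l assume l: "l \<in> hom T M (fob fibre L) \<and> (\<forall>j\<in>Ob J. far fibre (c j) \<cdot>\<^bsub>T\<^esub> l = d j)"
      then have l': "l \<in> Ar T" "src T l = M" "tgt T l = src T (r L)" using L by (auto simp: hom_iff)
      have "w L \<cdot>\<^bsub>T\<^esub> l = b" using to_t[of "w L \<cdot>\<^bsub>T\<^esub> l" b] b l' L by simp
      then have 0: "far A L \<cdot>\<^bsub>T\<^esub> (r L \<cdot>\<^bsub>T\<^esub> l) = s \<cdot>\<^bsub>T\<^esub> b"
        using A.D.reassoc[OF rw(6)[OF L], of l] l' L by (simp add: A.D.assoc)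
      have 1: "far A (slice_arrow (c j)) \<cdot>\<^bsub>T\<^esub> (r L \<cdot>\<^bsub>T\<^esub> l) = r (fob G j) \<cdot>\<^bsub>T\<^esub> d j" if j: "j \<in> Ob J" for j
      proof -
        have "fibre_map (c j) \<cdot>\<^bsub>T\<^esub> l = d j" using l c[OF j] j by auto
        then show ?thesis using fibre_map_reassoc[of "c j" l] c[OF j] l' by simp
      qed
      have "r L \<cdot>\<^bsub>T\<^esub> l \<in> hom T M (fob A (src E L)) \<and> (\<forall>j\<in>Ob (coned J). far A (?c j) \<cdot>\<^bsub>T\<^esub> (r L \<cdot>\<^bsub>T\<^esub> l) = e j)"
        unfolding ball_coned using l' L 0 1 by (auto simp: hom_iff e_def)
      moreover have "h \<in> hom T M (fob A (src E L)) \<and> (\<forall>j\<in>Ob (coned J). far A (?c j) \<cdot>\<^bsub>T\<^esub> h = e j)"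
        unfolding ball_coned using h by (auto simp: e_def)
      ultimately have "r L \<cdot>\<^bsub>T\<^esub> l = h" using ex1 by blast
      then show "l = k" using k l' by - (rule r_ext[OF L], auto simp: hom_iff)
    qed (use k L in auto)
  qed
qed

definition fibre_iso :: "'u \<Rightarrow> 'u" where
  "fibre_iso = (\<lambda>D \<in> Ob E. far A (q D) \<cdot>\<^bsub>T\<^esub> r (fob \<pi> D))"

lemma fibre_iso_nat: "nat_trans E T (cmp_ftr E fibre \<pi>) A fibre_iso"
  unfolding nat_trans_def
proof (intro conjI ballI)
  fix f assume f: "f \<in> Ar E"
  have "far A (q (tgt E f)) \<cdot>\<^bsub>T\<^esub> (r (fob \<pi> (tgt E f)) \<cdot>\<^bsub>T\<^esub> fibre_map (far \<pi> f))
      = far A (q (tgt E f)) \<cdot>\<^bsub>T\<^esub> (far A (slice_arrow (far \<pi> f)) \<cdot>\<^bsub>T\<^esub> r (fob \<pi> (src E f)))"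
    using fibre_map(4)[of "far \<pi> f"] f by simp
  also have "\<dots> = far A f \<cdot>\<^bsub>T\<^esub> (far A (q (src E f)) \<cdot>\<^bsub>T\<^esub> r (fob \<pi> (src E f)))"
    using f A.far_cmp[of "slice_arrow (far \<pi> f)" "q (tgt E f)"] A.far_cmp[of "q (src E f)" f]
    by (simp add: A.D.assoc[symmetric] pr_nat)
  finally show "fibre_iso (tgt E f) \<cdot>\<^bsub>T\<^esub> far (cmp_ftr E fibre \<pi>) f = far A f \<cdot>\<^bsub>T\<^esub> fibre_iso (src E f)"
    using f fibre_map[of "far \<pi> f"] by (simp add: fibre_iso_def cmp_far A.D.assoc)
qed (auto simp: fibre_iso_def cmp_fob hom_iff)

text \<open>\<open>A\<close> preserves the product of \<open>X\<close> and \<open>D\<close>, seen as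
  a pullback over a terminal object \<open>one\<close>. The fibre over \<open>s\<close> of the
  projection from \<open>A X \<times> A D\<close> to \<open>A X\<close> is \<open>A D\<close>; the
  inverse is the lift of the map \<open>n\<close> with components \<open>s\<close> after
  \<open>b\<close> and the identity.\<close>

lemma fibre_iso_iso:
  assumes one: "terminal_in E one" and D: "D \<in> Ob E"
  shows "is_iso T (fibre_iso D)"
proof -
  have one': "one \<in> Ob E" using one by (simp add: terminal_in_def)
  obtain x where x: "x \<in> Ar E" "src E x = X" "tgt E x = one" using terminal_in_ex[OF one X] by (auto simp: hom_iff)
  obtain y where y: "y \<in> Ar E" "src E y = D" "tgt E y = one" using terminal_in_ex[OF one D] by (auto simp: hom_iff)
  have eq1: "f = g" if "f \<in> Ar E" "g \<in> Ar E" "src E f = src E g" "tgt E f = one" "tgt E g = one" for f g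
    using terminal_in_unique[OF one, of "src E g" f g] that by (simp add: hom_iff)
  have prod: "is_pullback E x y (fob \<pi> D) (q D)"
  proof (rule pullbackI)
    show "x \<cdot>\<^bsub>E\<^esub> fob \<pi> D = y \<cdot>\<^bsub>E\<^esub> q D" using x y D by - (rule eq1, auto)
    fix z f g assume "f \<in> hom E z (src E x)" "g \<in> hom E z (src E y)"
    then show "\<exists>k\<in>hom E z (src E (fob \<pi> D)). fob \<pi> D \<cdot>\<^bsub>E\<^esub> k = f \<and> q D \<cdot>\<^bsub>E\<^esub> k = g"
      using pr_ex[OF D, of f z g] x y by auto
  next
    fix z k l assume "k \<in> hom E z (src E (fob \<pi> D))" "l \<in> hom E z (src E (fob \<pi> D))" "fob \<pi> D \<cdot>\<^bsub>E\<^esub> k = fob \<pi> D \<cdot>\<^bsub>E\<^esub> l" "q D \<cdot>\<^bsub>E\<^esub> k = q D \<cdot>\<^bsub>E\<^esub> l"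
    then show "k = l" using pr_ext[OF D, of k l] by (auto simp: hom_iff)
  qed (use x y D in auto)
  note pbA = left_exact_pullback[OF A.ftor_axioms lexA prod]
  note tA = left_exact_terminal[OF A.ftor_axioms lexA one]
  let ?P = "fob \<pi> D"
  obtain b where b: "b \<in> Ar T" "src T b = fob A D" "tgt T b = t" using terminal_in_ex[OF t, of "fob A D"] D by (auto simp: hom_iff)
  have "far A x \<cdot>\<^bsub>T\<^esub> (s \<cdot>\<^bsub>T\<^esub> b) = far A y \<cdot>\<^bsub>T\<^esub> idn T (fob A D)"
    by (rule terminal_in_unique[OF tA, of "fob A D"]) (use x y b D in \<open>auto simp: hom_iff\<close>)
  then obtain n where n: "n \<in> Ar T" "src T n = fob A D" "tgt T n = fob A (src E ?P)" "far A ?P \<cdot>\<^bsub>T\<^esub> n = s \<cdot>\<^bsub>T\<^esub> b" "far A (q D) \<cdot>\<^bsub>T\<^esub> n = idn T (fob A D)"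
    using pullback_factor[OF pbA, of "s \<cdot>\<^bsub>T\<^esub> b" "fob A D" "idn T (fob A D)"] b x y D by (auto simp: hom_iff)
  obtain k where k: "k \<in> Ar T" "src T k = fob A D" "tgt T k = src T (r ?P)" "r ?P \<cdot>\<^bsub>T\<^esub> k = n"
    using r_lift[of ?P n "fob A D" b] n b D by (auto simp: hom_iff)
  have i: "fibre_iso D = far A (q D) \<cdot>\<^bsub>T\<^esub> r ?P" using D by (simp add: fibre_iso_def)
  have 1: "fibre_iso D \<cdot>\<^bsub>T\<^esub> k = idn T (fob A D)" unfolding i using D k n by (simp add: A.D.assoc)
  have "n \<cdot>\<^bsub>T\<^esub> fibre_iso D = r ?P"
  proof (rule A.D.pullback_ext[OF pbA, of _ "src T (r ?P)"])
    show "far A ?P \<cdot>\<^bsub>T\<^esub> (n \<cdot>\<^bsub>T\<^esub> fibre_iso D) = far A ?P \<cdot>\<^bsub>T\<^esub> r ?P"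
      using A.D.reassoc[OF n(4), of "fibre_iso D"] n b D to_t[of "b \<cdot>\<^bsub>T\<^esub> fibre_iso D" "w ?P"] by (simp add: i A.D.assoc)
    show "far A (q D) \<cdot>\<^bsub>T\<^esub> (n \<cdot>\<^bsub>T\<^esub> fibre_iso D) = far A (q D) \<cdot>\<^bsub>T\<^esub> r ?P"
      using A.D.reassoc[OF n(5), of "fibre_iso D"] n D by (simp add: i A.D.assoc)
  qed (use n D i in \<open>auto simp: hom_iff\<close>)
  then have "k \<cdot>\<^bsub>T\<^esub> fibre_iso D = idn T (src T (r ?P))"
    using k D A.D.reassoc[OF k(4), of "fibre_iso D"] by - (rule r_ext[of ?P], auto simp: i A.D.assoc)
  then show ?thesis
    using 1 k D by (intro isoI[of _ T "src T (r ?P)" "fob A D" k]) (auto simp: hom_iff i)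
qed

text \<open>The second part shows that every section occurs: \<open>w (idn E X)\<close> merely
  compares two terminal objects.\<close>

lemma fibre_point:
  assumes one: "terminal_in E one"
  shows "etale_point E X p q T A fibre fibre_iso"
    and "etale_point.section E X p q T fibre fibre_iso = s \<cdot>\<^bsub>T\<^esub> w (idn E X)"
proof -
  show "etale_point E X p q T A fibre fibre_iso"
    by unfold_locales (auto simp: fibre_left_exact fibre_iso_nat fibre_iso_iso[OF one])
  then interpret pt: etale_point E X p q T A fibre fibre_iso .
  have g: "graph (idn E X) \<in> Ar S" by simp
  have i: "fibre_iso X = far A (q X) \<cdot>\<^bsub>T\<^esub> r (fob \<pi> X)" by (simp add: fibre_iso_def)
  have "pt.section = far A (q X) \<cdot>\<^bsub>T\<^esub> (r (fob \<pi> X) \<cdot>\<^bsub>T\<^esub> fibre_map (graph (idn E X)))"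
    using fibre_map(1-3)[OF g] by (simp add: pt.section_def pt.fib_def i A.D.assoc)
  also have "\<dots> = far A (q X) \<cdot>\<^bsub>T\<^esub> (far A (graph_ar (idn E X)) \<cdot>\<^bsub>T\<^esub> r (idn E X))"
    using fibre_map(4)[OF g] by simp
  also have "\<dots> = far A (idn E X) \<cdot>\<^bsub>T\<^esub> r (idn E X)"
    using A.far_cmp[of "graph_ar (idn E X)" "q X"] graph_ar(5)[of "idn E X"] by (simp add: A.D.assoc[symmetric])
  also have "\<dots> = s \<cdot>\<^bsub>T\<^esub> w (idn E X)" by (rule rw(6)) auto
  finally show "pt.section = s \<cdot>\<^bsub>T\<^esub> w (idn E X)" .
qed

end

section \<open>Transport of limits and adjoints along an equivalence\<close>

definition has_pullbacks :: "('o,'a) cat \<Rightarrow> bool" where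
  "has_pullbacks C \<longleftrightarrow> (\<forall>f \<in> Ar C. \<forall>g \<in> Ar C. tgt C f = tgt C g \<longrightarrow> (\<exists>p q. is_pullback C f g p q))"

definition initial_in :: "('o,'a) cat \<Rightarrow> 'o \<Rightarrow> bool" where
  "initial_in C i \<longleftrightarrow> i \<in> Ob C \<and> (\<forall>x \<in> Ob C. \<exists>!f. f \<in> hom C i x)"

context ftor
begin

context
  assumes ff: "fully_faithful C D F" and eso: "ess_surj C D F"
begin

lemma ff_eq: "f \<in> Ar C \<Longrightarrow> g \<in> Ar C \<Longrightarrow> src C f = src C g \<Longrightarrow> tgt C f = tgt C g \<Longrightarrow> far F f = far F g \<Longrightarrow> f = g"
  using fully_faithful_eq[OF ff, of "src C f" "tgt C f" f g] by (auto simp: hom_iff)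

lemma ff_full:
  assumes "x \<in> Ob C" "y \<in> Ob C" "k \<in> Ar D" "src D k = fob F x" "tgt D k = fob F y"
  shows "\<exists>f. f \<in> Ar C \<and> src C f = x \<and> tgt C f = y \<and> far F f = k"
  using fully_faithful_full[OF ff assms(1,2), of k] assms by (auto simp: hom_iff)

lemma eso_obtain:
  assumes "d \<in> Ob D"
  obtains c i j where "c \<in> Ob C" "i \<in> Ar D" "src D i = fob F c" "tgt D i = d" "j \<in> Ar D" "src D j = d" "tgt D j = fob F c"
    "j \<cdot>\<^bsub>D\<^esub> i = idn D (fob F c)" "i \<cdot>\<^bsub>D\<^esub> j = idn D d"
proof -
  obtain c i where c: "c \<in> Ob C" and i: "i \<in> hom D (fob F c) d" "is_iso D i" using eso assms unfolding ess_surj_def by blast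
  obtain j where "j \<in> hom D d (fob F c)" "j \<cdot>\<^bsub>D\<^esub> i = idn D (fob F c)" "i \<cdot>\<^bsub>D\<^esub> j = idn D d" using isoE[OF i(2,1)] .
  then show ?thesis using that[of c i j] c i(1) by (auto simp: hom_iff)
qed

text \<open>A test object \<open>d\<close> of \<open>D\<close> is isomorphic to some
  \<open>fob F c\<close>. After replacing it, fullness brings the test cone back to
  \<open>C\<close>.\<close>

lemma equivalence_preserves_pullback:
  assumes pb: "is_pullback C f g p q"
  shows "is_pullback D (far F f) (far F g) (far F p) (far F q)"
proof (rule D.pullbackI)
  note P = pullbackD[OF pb]
  show "far F f \<cdot>\<^bsub>D\<^esub> far F p = far F g \<cdot>\<^bsub>D\<^esub> far F q" using P by (simp add: far_cmp[symmetric])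
  fix d p' q' assume p': "p' \<in> hom D d (src D (far F f))" and q': "q' \<in> hom D d (src D (far F g))"
    and e: "far F f \<cdot>\<^bsub>D\<^esub> p' = far F g \<cdot>\<^bsub>D\<^esub> q'"
  obtain c i j where c: "c \<in> Ob C" and i: "i \<in> Ar D" "src D i = fob F c" "tgt D i = d" "j \<in> Ar D" "src D j = d" "tgt D j = fob F c"
    "j \<cdot>\<^bsub>D\<^esub> i = idn D (fob F c)" "i \<cdot>\<^bsub>D\<^esub> j = idn D d" using eso_obtain D.hom_ObD[OF p'] by metis
  obtain p0 where p0: "p0 \<in> Ar C" "src C p0 = c" "tgt C p0 = src C f" "far F p0 = p' \<cdot>\<^bsub>D\<^esub> i"
    using ff_full[OF c, of "src C f" "p' \<cdot>\<^bsub>D\<^esub> i"] p' i P by (auto simp: hom_iff)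
  obtain q0 where q0: "q0 \<in> Ar C" "src C q0 = c" "tgt C q0 = src C g" "far F q0 = q' \<cdot>\<^bsub>D\<^esub> i"
    using ff_full[OF c, of "src C g" "q' \<cdot>\<^bsub>D\<^esub> i"] q' i P by (auto simp: hom_iff)
  have "far F (f \<cdot>\<^bsub>C\<^esub> p0) = far F (g \<cdot>\<^bsub>C\<^esub> q0)"
    using D.reassoc[OF e, of i] p0 q0 P p' q' i by (simp add: far_cmp hom_iff D.assoc)
  then have "f \<cdot>\<^bsub>C\<^esub> p0 = g \<cdot>\<^bsub>C\<^esub> q0" using p0 q0 P by - (rule ff_eq, auto)
  then obtain k where k: "k \<in> hom C c (src C p)" "p \<cdot>\<^bsub>C\<^esub> k = p0" "q \<cdot>\<^bsub>C\<^esub> k = q0"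
    using pullback_factor[OF pb, of p0 c q0] p0 q0 by (auto simp: hom_iff)
  have "far F p \<cdot>\<^bsub>D\<^esub> far F k = p' \<cdot>\<^bsub>D\<^esub> i" "far F q \<cdot>\<^bsub>D\<^esub> far F k = q' \<cdot>\<^bsub>D\<^esub> i"
    using k P p0 q0 far_cmp[of k p] far_cmp[of k q] by (auto simp: hom_iff)
  then have "far F p \<cdot>\<^bsub>D\<^esub> (far F k \<cdot>\<^bsub>D\<^esub> j) = p' \<cdot>\<^bsub>D\<^esub> (i \<cdot>\<^bsub>D\<^esub> j)" "far F q \<cdot>\<^bsub>D\<^esub> (far F k \<cdot>\<^bsub>D\<^esub> j) = q' \<cdot>\<^bsub>D\<^esub> (i \<cdot>\<^bsub>D\<^esub> j)"
    using D.reassoc[of "far F p" "far F k" _ j] D.reassoc[of "far F q" "far F k" _ j] k P p' q' i by (simp_all add: D.assoc hom_iff)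
  then show "\<exists>k\<in>hom D d (src D (far F p)). far F p \<cdot>\<^bsub>D\<^esub> k = p' \<and> far F q \<cdot>\<^bsub>D\<^esub> k = q'"
    using k P p' q' i by (intro bexI[of _ "far F k \<cdot>\<^bsub>D\<^esub> j"]) (auto simp: hom_iff)
next
  note P = pullbackD[OF pb]
  fix d k k' assume k: "k \<in> hom D d (src D (far F p))" "k' \<in> hom D d (src D (far F p))"
     "far F p \<cdot>\<^bsub>D\<^esub> k = far F p \<cdot>\<^bsub>D\<^esub> k'" "far F q \<cdot>\<^bsub>D\<^esub> k = far F q \<cdot>\<^bsub>D\<^esub> k'"
  obtain c i j where c: "c \<in> Ob C" and i: "i \<in> Ar D" "src D i = fob F c" "tgt D i = d" "j \<in> Ar D" "src D j = d" "tgt D j = fob F c"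
    "j \<cdot>\<^bsub>D\<^esub> i = idn D (fob F c)" "i \<cdot>\<^bsub>D\<^esub> j = idn D d" using eso_obtain D.hom_ObD[OF k(1)] by metis
  obtain l where l: "l \<in> Ar C" "src C l = c" "tgt C l = src C p" "far F l = k \<cdot>\<^bsub>D\<^esub> i"
    using ff_full[OF c, of "src C p" "k \<cdot>\<^bsub>D\<^esub> i"] k i P by (auto simp: hom_iff)
  obtain l' where l': "l' \<in> Ar C" "src C l' = c" "tgt C l' = src C p" "far F l' = k' \<cdot>\<^bsub>D\<^esub> i"
    using ff_full[OF c, of "src C p" "k' \<cdot>\<^bsub>D\<^esub> i"] k i P by (auto simp: hom_iff)
  have "far F (p \<cdot>\<^bsub>C\<^esub> l) = far F (p \<cdot>\<^bsub>C\<^esub> l')" "far F (q \<cdot>\<^bsub>C\<^esub> l) = far F (q \<cdot>\<^bsub>C\<^esub> l')"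
    using l l' P k i D.reassoc[OF k(3), of i] D.reassoc[OF k(4), of i] by (simp_all add: far_cmp hom_iff D.assoc)
  then have "p \<cdot>\<^bsub>C\<^esub> l = p \<cdot>\<^bsub>C\<^esub> l'" "q \<cdot>\<^bsub>C\<^esub> l = q \<cdot>\<^bsub>C\<^esub> l'"
    using l l' P ff_eq[of "p \<cdot>\<^bsub>C\<^esub> l" "p \<cdot>\<^bsub>C\<^esub> l'"] ff_eq[of "q \<cdot>\<^bsub>C\<^esub> l" "q \<cdot>\<^bsub>C\<^esub> l'"] by auto
  then have "l = l'" using C.pullback_ext[OF pb, of l c l'] l l' by (auto simp: hom_iff)
  then have "(k \<cdot>\<^bsub>D\<^esub> i) \<cdot>\<^bsub>D\<^esub> j = (k' \<cdot>\<^bsub>D\<^esub> i) \<cdot>\<^bsub>D\<^esub> j" using l l' by simp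
  then show "k = k'" using k i by (simp add: D.assoc hom_iff)
qed (use pullbackD[OF pb] in auto)

lemma equivalence_reflects_pullback:
  assumes ar: "f \<in> Ar C" "g \<in> Ar C" "p \<in> Ar C" "q \<in> Ar C" "tgt C f = tgt C g" "src C q = src C p" "tgt C p = src C f" "tgt C q = src C g"
    and pb: "is_pullback D (far F f) (far F g) (far F p) (far F q)"
  shows "is_pullback C f g p q"
proof (rule C.pullbackI[OF ar])
  show "f \<cdot>\<^bsub>C\<^esub> p = g \<cdot>\<^bsub>C\<^esub> q"
    using pullbackD(9)[OF pb] ar by - (rule ff_eq, auto simp: far_cmp)
  fix z p' q' assume p': "p' \<in> hom C z (src C f)" and q': "q' \<in> hom C z (src C g)" and e: "f \<cdot>\<^bsub>C\<^esub> p' = g \<cdot>\<^bsub>C\<^esub> q'"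
  have "far F f \<cdot>\<^bsub>D\<^esub> far F p' = far F g \<cdot>\<^bsub>D\<^esub> far F q'"
    using e ar p' q' far_cmp[of p' f] far_cmp[of q' g] by (auto simp: hom_iff)
  then obtain k where k: "k \<in> hom D (fob F z) (src D (far F p))" "far F p \<cdot>\<^bsub>D\<^esub> k = far F p'" "far F q \<cdot>\<^bsub>D\<^esub> k = far F q'"
    using pullback_factor[OF pb, of "far F p'" "fob F z" "far F q'"] ar p' q' by (auto simp: hom_iff)
  obtain l where l: "l \<in> Ar C" "src C l = z" "tgt C l = src C p" "far F l = k"
    using ff_full[of z "src C p" k] k ar C.hom_ObD[OF p'] by (auto simp: hom_iff)
  have "p \<cdot>\<^bsub>C\<^esub> l = p'" "q \<cdot>\<^bsub>C\<^esub> l = q'"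
    using l k p' q' ar ff_eq[of "p \<cdot>\<^bsub>C\<^esub> l" p'] ff_eq[of "q \<cdot>\<^bsub>C\<^esub> l" q'] by (auto simp: hom_iff far_cmp)
  then show "\<exists>k\<in>hom C z (src C p). p \<cdot>\<^bsub>C\<^esub> k = p' \<and> q \<cdot>\<^bsub>C\<^esub> k = q'" using l by (intro bexI[of _ l]) (auto simp: hom_iff)
next
  fix z k k' assume k: "k \<in> hom C z (src C p)" "k' \<in> hom C z (src C p)" and e: "p \<cdot>\<^bsub>C\<^esub> k = p \<cdot>\<^bsub>C\<^esub> k'" "q \<cdot>\<^bsub>C\<^esub> k = q \<cdot>\<^bsub>C\<^esub> k'"
  have "far F p \<cdot>\<^bsub>D\<^esub> far F k = far F p \<cdot>\<^bsub>D\<^esub> far F k'" "far F q \<cdot>\<^bsub>D\<^esub> far F k = far F q \<cdot>\<^bsub>D\<^esub> far F k'"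
    using arg_cong[OF e(1), of "far F"] arg_cong[OF e(2), of "far F"] k ar by (auto simp: far_cmp hom_iff)
  then have "far F k = far F k'"
    using D.pullback_ext[OF pb, of "far F k" "fob F z" "far F k'"] k ar by (auto simp: hom_iff)
  then show "k = k'" using ff_eq[of k k'] k by (auto simp: hom_iff)
qed

lemma equivalence_has_pullbacks:
  assumes "has_pullbacks D"
  shows "has_pullbacks C"
  unfolding has_pullbacks_def
proof (intro ballI impI)
  fix f g assume fg: "f \<in> Ar C" "g \<in> Ar C" "tgt C f = tgt C g"
  then obtain p q where pb: "is_pullback D (far F f) (far F g) p q" using assms unfolding has_pullbacks_def by fastforce
  note P = pullbackD[OF pb]
  obtain c i j where c: "c \<in> Ob C" and i: "i \<in> Ar D" "src D i = fob F c" "tgt D i = src D p" "j \<in> Ar D" "src D j = src D p" "tgt D j = fob F c"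
    "j \<cdot>\<^bsub>D\<^esub> i = idn D (fob F c)" "i \<cdot>\<^bsub>D\<^esub> j = idn D (src D p)" using eso_obtain[of "src D p"] P by auto
  obtain p0 where p0: "p0 \<in> Ar C" "src C p0 = c" "tgt C p0 = src C f" "far F p0 = p \<cdot>\<^bsub>D\<^esub> i"
    using ff_full[OF c, of "src C f" "p \<cdot>\<^bsub>D\<^esub> i"] i P fg by auto
  obtain q0 where q0: "q0 \<in> Ar C" "src C q0 = c" "tgt C q0 = src C g" "far F q0 = q \<cdot>\<^bsub>D\<^esub> i"
    using ff_full[OF c, of "src C g" "q \<cdot>\<^bsub>D\<^esub> i"] i P fg by auto
  have "is_pullback D (far F f) (far F g) (p \<cdot>\<^bsub>D\<^esub> i) (q \<cdot>\<^bsub>D\<^esub> i)"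
  proof (rule D.pullbackI)
    show "far F f \<cdot>\<^bsub>D\<^esub> (p \<cdot>\<^bsub>D\<^esub> i) = far F g \<cdot>\<^bsub>D\<^esub> (q \<cdot>\<^bsub>D\<^esub> i)" using D.reassoc[OF P(9), of i] P i by (simp add: D.assoc)
    fix z p' q' assume a: "p' \<in> hom D z (src D (far F f))" "q' \<in> hom D z (src D (far F g))" "far F f \<cdot>\<^bsub>D\<^esub> p' = far F g \<cdot>\<^bsub>D\<^esub> q'"
    obtain k where k: "k \<in> hom D z (src D p)" "p \<cdot>\<^bsub>D\<^esub> k = p'" "q \<cdot>\<^bsub>D\<^esub> k = q'" using pullback_factor[OF pb a] .
    have "i \<cdot>\<^bsub>D\<^esub> (j \<cdot>\<^bsub>D\<^esub> k) = k" using D.reassoc[OF i(8), of k] k i by (simp add: hom_iff)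
    then show "\<exists>k\<in>hom D z (src D (p \<cdot>\<^bsub>D\<^esub> i)). p \<cdot>\<^bsub>D\<^esub> i \<cdot>\<^bsub>D\<^esub> k = p' \<and> q \<cdot>\<^bsub>D\<^esub> i \<cdot>\<^bsub>D\<^esub> k = q'"
      using k i P by (intro bexI[of _ "j \<cdot>\<^bsub>D\<^esub> k"]) (auto simp: hom_iff D.assoc)
  next
    fix z k k' assume k: "k \<in> hom D z (src D (p \<cdot>\<^bsub>D\<^esub> i))" "k' \<in> hom D z (src D (p \<cdot>\<^bsub>D\<^esub> i))"
       "p \<cdot>\<^bsub>D\<^esub> i \<cdot>\<^bsub>D\<^esub> k = p \<cdot>\<^bsub>D\<^esub> i \<cdot>\<^bsub>D\<^esub> k'" "q \<cdot>\<^bsub>D\<^esub> i \<cdot>\<^bsub>D\<^esub> k = q \<cdot>\<^bsub>D\<^esub> i \<cdot>\<^bsub>D\<^esub> k'"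
    have "i \<cdot>\<^bsub>D\<^esub> k = i \<cdot>\<^bsub>D\<^esub> k'"
      using k i P by - (rule D.pullback_ext[OF pb, of _ z], auto simp: hom_iff D.assoc)
    then have "j \<cdot>\<^bsub>D\<^esub> (i \<cdot>\<^bsub>D\<^esub> k) = j \<cdot>\<^bsub>D\<^esub> (i \<cdot>\<^bsub>D\<^esub> k')" by simp
    then show "k = k'" using D.reassoc[OF i(7), of k] D.reassoc[OF i(7), of k'] k i P by (simp add: hom_iff)
  qed (use P i fg in auto)
  then have "is_pullback C f g p0 q0"
    using fg p0 q0 by (intro equivalence_reflects_pullback) auto
  then show "\<exists>p q. is_pullback C f g p q" by blast
qed

lemma equivalence_preserves_terminal:
  assumes t: "terminal_in C t"
  shows "terminal_in D (fob F t)"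
  unfolding terminal_in_def
proof (intro conjI ballI)
  have tO: "t \<in> Ob C" using t by (simp add: terminal_in_def)
  then show "fob F t \<in> Ob D" by simp
  fix d assume "d \<in> Ob D"
  then obtain c i j where c: "c \<in> Ob C" and i: "i \<in> Ar D" "src D i = fob F c" "tgt D i = d" "j \<in> Ar D" "src D j = d" "tgt D j = fob F c"
    "j \<cdot>\<^bsub>D\<^esub> i = idn D (fob F c)" "i \<cdot>\<^bsub>D\<^esub> j = idn D d" using eso_obtain by metis
  obtain f where f: "f \<in> Ar C" "src C f = c" "tgt C f = t" using terminal_in_ex[OF t c] by (auto simp: hom_iff)
  show "\<exists>!f. f \<in> hom D d (fob F t)"
  proof (rule ex1I[of _ "far F f \<cdot>\<^bsub>D\<^esub> j"])
    fix g assume g: "g \<in> hom D d (fob F t)"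
    obtain h where h: "h \<in> Ar C" "src C h = c" "tgt C h = t" "far F h = g \<cdot>\<^bsub>D\<^esub> i" using ff_full[OF c tO, of "g \<cdot>\<^bsub>D\<^esub> i"] g i by (auto simp: hom_iff)
    have "h = f" using terminal_in_unique[OF t c, of h f] h f by (auto simp: hom_iff)
    then have "(g \<cdot>\<^bsub>D\<^esub> i) \<cdot>\<^bsub>D\<^esub> j = far F f \<cdot>\<^bsub>D\<^esub> j" using h by simp
    then show "g = far F f \<cdot>\<^bsub>D\<^esub> j" using g i by (simp add: D.assoc hom_iff)
  qed (use f i in \<open>auto simp: hom_iff\<close>)
qed

lemma equivalence_has_terminal:
  assumes t: "terminal_in D t"
  shows "\<exists>t. terminal_in C t"
proof -
  have "t \<in> Ob D" using t by (simp add: terminal_in_def)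
  then obtain c i j where c: "c \<in> Ob C" and i: "i \<in> Ar D" "src D i = fob F c" "tgt D i = t" "j \<in> Ar D" "src D j = t" "tgt D j = fob F c"
    "j \<cdot>\<^bsub>D\<^esub> i = idn D (fob F c)" "i \<cdot>\<^bsub>D\<^esub> j = idn D t" using eso_obtain by metis
  have "\<exists>!f. f \<in> hom C x c" if x: "x \<in> Ob C" for x
  proof -
    obtain b where b: "b \<in> Ar D" "src D b = fob F x" "tgt D b = t" using terminal_in_ex[OF t, of "fob F x"] x by (auto simp: hom_iff)
    obtain f where f: "f \<in> Ar C" "src C f = x" "tgt C f = c" using ff_full[OF x c, of "j \<cdot>\<^bsub>D\<^esub> b"] b i by auto
    show ?thesis
    proof (rule ex1I[of _ f])
      fix g assume g: "g \<in> hom C x c"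
      have "i \<cdot>\<^bsub>D\<^esub> far F g = i \<cdot>\<^bsub>D\<^esub> far F f"
        by (rule terminal_in_unique[OF t, of "fob F x"]) (use f g i x in \<open>auto simp: hom_iff\<close>)
      then have "j \<cdot>\<^bsub>D\<^esub> (i \<cdot>\<^bsub>D\<^esub> far F g) = j \<cdot>\<^bsub>D\<^esub> (i \<cdot>\<^bsub>D\<^esub> far F f)" by simp
      then have "far F g = far F f"
        using D.reassoc[OF i(7), of "far F g"] D.reassoc[OF i(7), of "far F f"] f g i by (simp add: hom_iff)
      then show "g = f" using ff_eq[of g f] f g by (auto simp: hom_iff)
    qed (use f in \<open>auto simp: hom_iff\<close>)
  qed
  then show ?thesis using c unfolding terminal_in_def by blast
qed

lemma equivalence_has_initial:
  assumes t: "initial_in D t"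
  shows "\<exists>t. initial_in C t"
proof -
  have "t \<in> Ob D" using t by (simp add: initial_in_def)
  then obtain c i j where c: "c \<in> Ob C" and i: "i \<in> Ar D" "src D i = fob F c" "tgt D i = t" "j \<in> Ar D" "src D j = t" "tgt D j = fob F c"
    "j \<cdot>\<^bsub>D\<^esub> i = idn D (fob F c)" "i \<cdot>\<^bsub>D\<^esub> j = idn D t" using eso_obtain by metis
  have "\<exists>!f. f \<in> hom C c x" if x: "x \<in> Ob C" for x
  proof -
    have ex1: "\<exists>!f. f \<in> hom D t (fob F x)" using t x unfolding initial_in_def by simp
    then obtain b where b: "b \<in> Ar D" "src D b = t" "tgt D b = fob F x" by (auto simp: hom_iff)
    obtain f where f: "f \<in> Ar C" "src C f = c" "tgt C f = x" using ff_full[OF c x, of "b \<cdot>\<^bsub>D\<^esub> i"] b i by auto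
    show ?thesis
    proof (rule ex1I[of _ f])
      fix g assume g: "g \<in> hom C c x"
      have "far F g \<cdot>\<^bsub>D\<^esub> j \<in> hom D t (fob F x)" "far F f \<cdot>\<^bsub>D\<^esub> j \<in> hom D t (fob F x)" using f g i by (auto simp: hom_iff)
      then have "far F g \<cdot>\<^bsub>D\<^esub> j = far F f \<cdot>\<^bsub>D\<^esub> j" using ex1 by blast
      then have "(far F g \<cdot>\<^bsub>D\<^esub> j) \<cdot>\<^bsub>D\<^esub> i = (far F f \<cdot>\<^bsub>D\<^esub> j) \<cdot>\<^bsub>D\<^esub> i" by simp
      then have "far F g = far F f" using f g i by (simp add: hom_iff D.assoc)
      then show "g = f" using ff_eq[of g f] f g by (auto simp: hom_iff)
    qed (use f in \<open>auto simp: hom_iff\<close>)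
  qed
  then show ?thesis using c unfolding initial_in_def by blast
qed

end

end

lemma couniversal_lift:
  assumes "couniversal C D F d R e" "x \<in> Ob C" "m \<in> hom D (fob F x) d"
  obtains k where "k \<in> hom C x R" "e \<cdot>\<^bsub>D\<^esub> far F k = m"
  using assms unfolding couniversal_def by blast

lemma (in ftor) couniversal_ext:
  assumes "couniversal C D F d R e" "k \<in> hom C x R" "k' \<in> hom C x R" "e \<cdot>\<^bsub>D\<^esub> far F k = e \<cdot>\<^bsub>D\<^esub> far F k'"
  shows "k = k'"
proof -
  have "e \<cdot>\<^bsub>D\<^esub> far F k' \<in> hom D (fob F x) d" "x \<in> Ob C"
    using assms unfolding couniversal_def by (auto simp: hom_iff)
  then show ?thesis using assms unfolding couniversal_def by blast
qed

text \<open>\<open>P\<close> is isomorphic to some \<open>\<Phi> c\<close>, and the couniversal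
  arrow at \<open>c\<close> is carried over. The composite of \<open>A\<close> with
  \<open>\<Phi>\<close> needs this adjoint because dependent products are formed in
  \<open>Z\<close>.\<close>

lemma couniversal_equivalence:
  assumes A: "ftor E T A" and Phi: "ftor T Z \<Phi>" and ff: "fully_faithful T Z \<Phi>" and eso: "ess_surj T Z \<Phi>"
    and cu: "\<And>c. c \<in> Ob T \<Longrightarrow> \<exists>R e. couniversal E T A c R e" and P: "P \<in> Ob Z"
  shows "\<exists>R e. couniversal E Z (cmp_ftr E \<Phi> A) P R e"
proof -
  interpret A: ftor E T A by fact
  interpret Phi: ftor T Z \<Phi> by fact
  obtain c i j where c: "c \<in> Ob T" and i: "i \<in> Ar Z" "src Z i = fob \<Phi> c" "tgt Z i = P" "j \<in> Ar Z" "src Z j = P" "tgt Z j = fob \<Phi> c"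
    "j \<cdot>\<^bsub>Z\<^esub> i = idn Z (fob \<Phi> c)" "i \<cdot>\<^bsub>Z\<^esub> j = idn Z P" using Phi.eso_obtain[OF ff eso P] .
  obtain R e where Re: "couniversal E T A c R e" using cu[OF c] by blast
  then have R: "R \<in> Ob E" and e: "e \<in> Ar T" "src T e = fob A R" "tgt T e = c" by (auto simp: couniversal_def hom_iff)
  have "couniversal E Z (cmp_ftr E \<Phi> A) P R (i \<cdot>\<^bsub>Z\<^esub> far \<Phi> e)"
    unfolding couniversal_def
  proof (intro conjI ballI)
    fix x m assume x: "x \<in> Ob E" and "m \<in> hom Z (fob (cmp_ftr E \<Phi> A) x) P"
    then have m: "m \<in> Ar Z" "src Z m = fob \<Phi> (fob A x)" "tgt Z m = P" by (auto simp: hom_iff cmp_fob)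
    obtain n where n: "n \<in> Ar T" "src T n = fob A x" "tgt T n = c" "far \<Phi> n = j \<cdot>\<^bsub>Z\<^esub> m"
      using Phi.ff_full[OF ff eso, of "fob A x" c "j \<cdot>\<^bsub>Z\<^esub> m"] x c m i by auto
    obtain k where k: "k \<in> Ar E" "src E k = x" "tgt E k = R" "e \<cdot>\<^bsub>T\<^esub> far A k = n"
      using couniversal_lift[OF Re x, of n] n by (auto simp: hom_iff)
    show "\<exists>!k. k \<in> hom E x R \<and> i \<cdot>\<^bsub>Z\<^esub> far \<Phi> e \<cdot>\<^bsub>Z\<^esub> far (cmp_ftr E \<Phi> A) k = m"
    proof (rule ex1I[of _ k], intro conjI)
      have "i \<cdot>\<^bsub>Z\<^esub> (far \<Phi> e \<cdot>\<^bsub>Z\<^esub> far \<Phi> (far A k)) = i \<cdot>\<^bsub>Z\<^esub> (j \<cdot>\<^bsub>Z\<^esub> m)" using k e n Phi.far_cmp[of "far A k" e] by simp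
      also have "\<dots> = m" using Phi.D.reassoc[OF i(8), of m] i m by simp
      finally show "i \<cdot>\<^bsub>Z\<^esub> far \<Phi> e \<cdot>\<^bsub>Z\<^esub> far (cmp_ftr E \<Phi> A) k = m" using k e i by (simp add: cmp_far Phi.D.assoc)
      fix l assume l: "l \<in> hom E x R \<and> i \<cdot>\<^bsub>Z\<^esub> far \<Phi> e \<cdot>\<^bsub>Z\<^esub> far (cmp_ftr E \<Phi> A) l = m"
      then have l': "l \<in> Ar E" "src E l = x" "tgt E l = R" by (auto simp: hom_iff)
      have "j \<cdot>\<^bsub>Z\<^esub> (i \<cdot>\<^bsub>Z\<^esub> (far \<Phi> e \<cdot>\<^bsub>Z\<^esub> far \<Phi> (far A l))) = j \<cdot>\<^bsub>Z\<^esub> m"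
        using l l' e i by (simp add: cmp_far Phi.D.assoc)
      then have "far \<Phi> (e \<cdot>\<^bsub>T\<^esub> far A l) = far \<Phi> n"
        using Phi.D.reassoc[OF i(7), of "far \<Phi> e \<cdot>\<^bsub>Z\<^esub> far \<Phi> (far A l)"] l' e i n by (simp add: Phi.far_cmp)
      then have "e \<cdot>\<^bsub>T\<^esub> far A l = n" using Phi.ff_eq[OF ff eso, of "e \<cdot>\<^bsub>T\<^esub> far A l" n] l' e n by auto
      then show "l = k" using A.couniversal_ext[OF Re, of l x k] k l by (auto simp: hom_iff)
    qed (use k in \<open>auto simp: hom_iff\<close>)
  qed (use R e i in \<open>auto simp: hom_iff cmp_fob\<close>)
  then show ?thesis by blast
qed

subsection \<open>Dependent products along a point\<close>

text \<open>\<open>z\<close> is the dependent product of \<open>b\<close> along the global element \<open>s\<close>, with evaluation \<open>ev\<close> on its fibre \<open>p\<close> over \<open>s\<close>.\<close>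

definition point_Pi :: "('o,'a) cat \<Rightarrow> 'a \<Rightarrow> 'o \<Rightarrow> 'a \<Rightarrow> 'a \<Rightarrow> 'a \<Rightarrow> 'a \<Rightarrow> bool" where
  "point_Pi Z s b z p u ev \<longleftrightarrow> is_pullback Z z s p u \<and> ev \<in> hom Z (src Z p) b \<and>
     (\<forall>w r v f. is_pullback Z w s r v \<longrightarrow> f \<in> hom Z (src Z r) b \<longrightarrow>
       (\<exists>!k. k \<in> hom Z (src Z w) (src Z z) \<and> z \<cdot>\<^bsub>Z\<^esub> k = w \<and>
          (\<exists>l \<in> hom Z (src Z r) (src Z p). p \<cdot>\<^bsub>Z\<^esub> l = k \<cdot>\<^bsub>Z\<^esub> r \<and> ev \<cdot>\<^bsub>Z\<^esub> l = f)))"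

context etale_section
begin

text \<open>\<open>fibre\<close> is the functor \<open>E/X \<rightarrow> T/A X\<close> induced by
  \<open>A\<close>, followed by pulling back along \<open>s\<close>. The right adjoint of the second
  sends \<open>b\<close> to the dependent product \<open>z\<close>. That of the first takes the
  direct image \<open>zs\<close> of \<open>z\<close> and pulls it back along the unit
  \<open>\<eta>\<close> of \<open>X\<close>, giving \<open>\<rho>\<close>. As \<open>z\<close> is
  only available in \<open>Z\<close>, everything between is carried out there, through
  \<open>\<Phi>\<close>.\<close>

lemma fibre_couniversal:
  assumes Phi: "ftor T Z \<Phi>" and ff: "fully_faithful T Z \<Phi>" and eso: "ess_surj T Z \<Phi>"
    and cu: "\<And>c. c \<in> Ob T \<Longrightarrow> \<exists>R e. couniversal E T A c R e"
    and hp: "has_pullbacks E"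
    and Pi: "\<And>b. b \<in> Ob Z \<Longrightarrow> \<exists>z p u ev. point_Pi Z (far \<Phi> s) b z p u ev"
    and b: "b \<in> Ob T"
  shows "\<exists>R e. couniversal S T fibre b R e"
proof -
  interpret Phi: ftor T Z \<Phi> by fact
  let ?G = "cmp_ftr E \<Phi> A"
  interpret G: ftor E Z ?G
    by (rule ftorI[OF category_axioms Phi.D.category_axioms cmp_functor[OF category_axioms A.F Phi.F]])
  have GA: "far ?G k = far \<Phi> (far A k)" if "k \<in> Ar E" for k using that by (simp add: cmp_far)
  have GO: "fob ?G x = fob \<Phi> (fob A x)" if "x \<in> Ob E" for x using that by (simp add: cmp_fob)
  obtain z p0 u ev where PI: "point_Pi Z (far \<Phi> s) (fob \<Phi> b) z p0 u ev" using Pi[of "fob \<Phi> b"] b by auto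
  then have pz: "is_pullback Z z (far \<Phi> s) p0 u" and ev: "ev \<in> Ar Z" "src Z ev = src Z p0" "tgt Z ev = fob \<Phi> b"
    by (auto simp: point_Pi_def hom_iff)
  have UP: "\<exists>!k. k \<in> hom Z (src Z v) (src Z z) \<and> z \<cdot>\<^bsub>Z\<^esub> k = v \<and>
          (\<exists>l \<in> hom Z (src Z r') (src Z p0). p0 \<cdot>\<^bsub>Z\<^esub> l = k \<cdot>\<^bsub>Z\<^esub> r' \<and> ev \<cdot>\<^bsub>Z\<^esub> l = f)"
    if "is_pullback Z v (far \<Phi> s) r' w'" "f \<in> hom Z (src Z r') (fob \<Phi> b)" for v r' w' f
    using PI that unfolding point_Pi_def by blast
  note zP = pullbackD[OF pz]
  let ?P = "src Z z"
  \<comment> \<open>\<open>R1\<close> and \<open>RX\<close> are the values of the right adjoint of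
    \<open>?G\<close> at the domain of \<open>z\<close> and at the image of \<open>X\<close>; below,
    \<open>zs\<close> is its value at \<open>z\<close> and \<open>\<eta>\<close> the unit at
    \<open>X\<close>.\<close>
  obtain R1 e1 where C1: "couniversal E Z ?G ?P R1 e1"
    using couniversal_equivalence[OF A.ftor_axioms Phi ff eso cu, of ?P] zP by auto
  obtain RX eX where CX: "couniversal E Z ?G (fob ?G X) RX eX"
    using couniversal_equivalence[OF A.ftor_axioms Phi ff eso cu, of "fob ?G X"] by auto
  have R1: "R1 \<in> Ob E" "e1 \<in> Ar Z" "src Z e1 = fob ?G R1" "tgt Z e1 = ?P" using C1 by (auto simp: couniversal_def hom_iff)
  have RX: "RX \<in> Ob E" "eX \<in> Ar Z" "src Z eX = fob ?G RX" "tgt Z eX = fob ?G X" using CX by (auto simp: couniversal_def hom_iff)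
  have tz: "tgt Z z = fob ?G X" using zP by (simp add: GO)
  obtain zs where zs: "zs \<in> Ar E" "src E zs = R1" "tgt E zs = RX" "eX \<cdot>\<^bsub>Z\<^esub> far ?G zs = z \<cdot>\<^bsub>Z\<^esub> e1"
    using couniversal_lift[OF CX R1(1), of "z \<cdot>\<^bsub>Z\<^esub> e1"] R1 zP tz by (auto simp: hom_iff)
  obtain \<eta> where eta: "\<eta> \<in> Ar E" "src E \<eta> = X" "tgt E \<eta> = RX" "eX \<cdot>\<^bsub>Z\<^esub> far ?G \<eta> = idn Z (fob ?G X)"
    using couniversal_lift[OF CX X, of "idn Z (fob ?G X)"] by (auto simp: hom_iff)
  obtain \<rho> \<kappa> where pbR: "is_pullback E \<eta> zs \<rho> \<kappa>" using hp eta zs unfolding has_pullbacks_def by metis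
  note RP = pullbackD[OF pbR]
  have rho: "\<rho> \<in> Ar E" "tgt E \<rho> = X" and kap: "\<kappa> \<in> Ar E" "src E \<kappa> = src E \<rho>" "tgt E \<kappa> = R1" "\<eta> \<cdot>\<^bsub>E\<^esub> \<rho> = zs \<cdot>\<^bsub>E\<^esub> \<kappa>"
    using RP eta zs by auto
  have zk: "z \<cdot>\<^bsub>Z\<^esub> (e1 \<cdot>\<^bsub>Z\<^esub> far ?G k) = eX \<cdot>\<^bsub>Z\<^esub> far ?G (zs \<cdot>\<^bsub>E\<^esub> k)" if "k \<in> Ar E" "tgt E k = R1" for k
    using Phi.D.reassoc[OF zs(4), of "far ?G k"] that zs RX R1 zP by (simp add: G.far_cmp Phi.D.assoc)
  have ek: "eX \<cdot>\<^bsub>Z\<^esub> far ?G (\<eta> \<cdot>\<^bsub>E\<^esub> k) = far ?G k" if "k \<in> Ar E" "tgt E k = X" for k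
    using Phi.D.reassoc[OF eta(4), of "far ?G k"] that eta RX by (simp add: G.far_cmp)
  let ?m = "e1 \<cdot>\<^bsub>Z\<^esub> far ?G \<kappa>"
  have m: "?m \<in> Ar Z" "src Z ?m = fob ?G (src E \<rho>)" "tgt Z ?m = ?P" using R1 kap by auto
  have zm: "z \<cdot>\<^bsub>Z\<^esub> ?m = far ?G \<rho>" using zk[of \<kappa>] ek[of \<rho>] kap rho by simp
  have pby: "is_pullback Z (far ?G y) (far \<Phi> s) (far \<Phi> (r y)) (far \<Phi> (w y))" if "y \<in> Ar E" "tgt E y = X" for y
    using Phi.equivalence_preserves_pullback[OF ff eso pb[OF that]] that by (simp add: GA)
  have "z \<cdot>\<^bsub>Z\<^esub> (?m \<cdot>\<^bsub>Z\<^esub> far \<Phi> (r \<rho>)) = far \<Phi> s \<cdot>\<^bsub>Z\<^esub> far \<Phi> (w \<rho>)"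
    using Phi.D.reassoc[OF zm, of "far \<Phi> (r \<rho>)"] pullbackD(9)[OF pby[OF rho]] m rho zP by (simp add: GO)
  then obtain l where l: "l \<in> Ar Z" "src Z l = fob \<Phi> (src T (r \<rho>))" "tgt Z l = src Z p0" "p0 \<cdot>\<^bsub>Z\<^esub> l = ?m \<cdot>\<^bsub>Z\<^esub> far \<Phi> (r \<rho>)"
    using pullback_factor[OF pz, of "?m \<cdot>\<^bsub>Z\<^esub> far \<Phi> (r \<rho>)" "fob \<Phi> (src T (r \<rho>))" "far \<Phi> (w \<rho>)"] m rho by (auto simp: hom_iff GO)
  obtain e where e: "e \<in> Ar T" "src T e = src T (r \<rho>)" "tgt T e = b" "far \<Phi> e = ev \<cdot>\<^bsub>Z\<^esub> l"
    using Phi.ff_full[OF ff eso, of "src T (r \<rho>)" b "ev \<cdot>\<^bsub>Z\<^esub> l"] l ev b rho by auto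
  have tt: "terminal_in Z (fob \<Phi> t)" by (rule Phi.equivalence_preserves_terminal[OF ff eso t])
  \<comment> \<open>\<open>p0\<close> is monic, being a pullback of a global element.\<close>
  have p0_ext: "k = k'" if "k \<in> hom Z x (src Z p0)" "k' \<in> hom Z x (src Z p0)" "p0 \<cdot>\<^bsub>Z\<^esub> k = p0 \<cdot>\<^bsub>Z\<^esub> k'" for k k' x
  proof (rule Phi.D.pullback_ext[OF pz that])
    show "u \<cdot>\<^bsub>Z\<^esub> k = u \<cdot>\<^bsub>Z\<^esub> k'"
      by (rule terminal_in_unique[OF tt, of x]) (use that zP Phi.D.hom_ObD[OF that(1)] in \<open>auto simp: hom_iff\<close>)
  qed
  \<comment> \<open>An arrow \<open>a : y \<rightarrow> \<rho>\<close> has two descriptions: the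
    transpose of \<open>\<kappa>\<close> after \<open>a\<close>, a map into the domain of
    \<open>z\<close>, and the map \<open>l\<close> after \<open>fibre_map a\<close> on fibres over
    \<open>s\<close>. The last equation says that the second is the restriction of the first, as the
    universal property of \<open>z\<close> demands.\<close>
  have step: "slice_arrow a \<in> Ar E \<and> src E (slice_arrow a) = src E y \<and> tgt E (slice_arrow a) = src E \<rho> \<and> \<rho> \<cdot>\<^bsub>E\<^esub> slice_arrow a = y \<and>
     fibre_map a \<in> Ar T \<and> src T (fibre_map a) = src T (r y) \<and> tgt T (fibre_map a) = src T (r \<rho>) \<and>
     p0 \<cdot>\<^bsub>Z\<^esub> (l \<cdot>\<^bsub>Z\<^esub> far \<Phi> (fibre_map a)) = (e1 \<cdot>\<^bsub>Z\<^esub> far ?G (\<kappa> \<cdot>\<^bsub>E\<^esub> slice_arrow a)) \<cdot>\<^bsub>Z\<^esub> far \<Phi> (r y)"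
    if a: "a \<in> hom S y \<rho>" for a y
  proof -
    have a': "a \<in> Ar S" "src S a = y" "tgt S a = \<rho>" using a by (auto simp: hom_iff)
    have y: "y \<in> Ar E" "tgt E y = X" using slice_Ob_Ar[OF a'(1)] a' by auto
    note sa = slice_Ar[OF a'(1), unfolded a'] and fa = fibre_map[OF a'(1), unfolded a']
    have "p0 \<cdot>\<^bsub>Z\<^esub> (l \<cdot>\<^bsub>Z\<^esub> far \<Phi> (fibre_map a)) = ?m \<cdot>\<^bsub>Z\<^esub> far \<Phi> (r \<rho> \<cdot>\<^bsub>T\<^esub> fibre_map a)"
      using Phi.D.reassoc[OF l(4), of "far \<Phi> (fibre_map a)"] l fa(1-3) m rho zP by (simp add: Phi.far_cmp Phi.D.assoc GO)
    also have "\<dots> = (e1 \<cdot>\<^bsub>Z\<^esub> far ?G (\<kappa> \<cdot>\<^bsub>E\<^esub> slice_arrow a)) \<cdot>\<^bsub>Z\<^esub> far \<Phi> (r y)"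
      unfolding fa(4) using sa y rho kap R1 by (simp add: Phi.far_cmp GA A.far_cmp Phi.D.assoc GO)
    finally show ?thesis using sa fa by simp
  qed
  have "couniversal S T fibre b \<rho> e"
    unfolding couniversal_def
  proof (intro conjI ballI)
    fix y f assume "y \<in> Ob S" and f0: "f \<in> hom T (fob fibre y) b"
    then have y: "y \<in> Ar E" "tgt E y = X" by auto
    have f: "f \<in> Ar T" "src T f = src T (r y)" "tgt T f = b" using f0 y by (auto simp: hom_iff)
    have "far \<Phi> f \<in> hom Z (src Z (far \<Phi> (r y))) (fob \<Phi> b)" using f y by (auto simp: hom_iff)
    note up = UP[OF pby[OF y] this]
    then obtain k l' where k0: "k \<in> hom Z (src Z (far ?G y)) ?P" "z \<cdot>\<^bsub>Z\<^esub> k = far ?G y"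
       and l': "l' \<in> hom Z (src Z (far \<Phi> (r y))) (src Z p0)" "p0 \<cdot>\<^bsub>Z\<^esub> l' = k \<cdot>\<^bsub>Z\<^esub> far \<Phi> (r y)" "ev \<cdot>\<^bsub>Z\<^esub> l' = far \<Phi> f" by blast
    have k: "k \<in> hom Z (fob ?G (src E y)) ?P" "z \<cdot>\<^bsub>Z\<^esub> k = far ?G y" using k0 y by auto
    obtain kt where kt: "kt \<in> Ar E" "src E kt = src E y" "tgt E kt = R1" "e1 \<cdot>\<^bsub>Z\<^esub> far ?G kt = k"
      using couniversal_lift[OF C1 _ k(1)] y by (auto simp: hom_iff)
    have "\<eta> \<cdot>\<^bsub>E\<^esub> y = zs \<cdot>\<^bsub>E\<^esub> kt"
    proof (rule G.couniversal_ext[OF CX, of _ "src E y"])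
      show "eX \<cdot>\<^bsub>Z\<^esub> far ?G (\<eta> \<cdot>\<^bsub>E\<^esub> y) = eX \<cdot>\<^bsub>Z\<^esub> far ?G (zs \<cdot>\<^bsub>E\<^esub> kt)" using ek[OF y] zk[of kt] kt k by simp
    qed (use eta y zs kt in \<open>auto simp: hom_iff\<close>)
    then obtain m0 where m0: "m0 \<in> Ar E" "src E m0 = src E y" "tgt E m0 = src E \<rho>" "\<rho> \<cdot>\<^bsub>E\<^esub> m0 = y" "\<kappa> \<cdot>\<^bsub>E\<^esub> m0 = kt"
      using pullback_factor[OF pbR, of y "src E y" kt] eta zs kt y by (auto simp: hom_iff)
    let ?a = "pair_code (m0, \<rho>)"
    have a: "?a \<in> hom S y \<rho>" using m0 rho by (auto simp: hom_iff)
    have la: "l \<cdot>\<^bsub>Z\<^esub> far \<Phi> (fibre_map ?a) = l'"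
      by (rule p0_ext[of _ "src Z (far \<Phi> (r y))"]) (use step[OF a] l l' m0 kt y in \<open>auto simp: hom_iff\<close>)
    show "\<exists>!k. k \<in> hom S y \<rho> \<and> e \<cdot>\<^bsub>T\<^esub> far fibre k = f"
    proof (rule ex1I[of _ ?a], intro conjI a)
      have "far \<Phi> (e \<cdot>\<^bsub>T\<^esub> fibre_map ?a) = far \<Phi> f"
        using step[OF a] e l ev la l' by (simp add: Phi.far_cmp Phi.D.assoc)
      then have "e \<cdot>\<^bsub>T\<^esub> fibre_map ?a = f" using Phi.ff_eq[OF ff eso, of "e \<cdot>\<^bsub>T\<^esub> fibre_map ?a" f] step[OF a] e f by simp
      then show "e \<cdot>\<^bsub>T\<^esub> far fibre ?a = f" using a by (auto simp: hom_iff)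
      fix a' assume a': "a' \<in> hom S y \<rho> \<and> e \<cdot>\<^bsub>T\<^esub> far fibre a' = f"
      then have aS: "a' \<in> Ar S" "tgt S a' = \<rho>" by (auto simp: hom_iff)
      note st = step[OF conjunct1[OF a']]
      let ?k' = "e1 \<cdot>\<^bsub>Z\<^esub> far ?G (\<kappa> \<cdot>\<^bsub>E\<^esub> slice_arrow a')"
      have "?k' \<in> hom Z (src Z (far ?G y)) ?P" using st kap R1 y by (auto simp: hom_iff)
      moreover have "z \<cdot>\<^bsub>Z\<^esub> ?k' = far ?G y"
      proof -
        have "zs \<cdot>\<^bsub>E\<^esub> (\<kappa> \<cdot>\<^bsub>E\<^esub> slice_arrow a') = \<eta> \<cdot>\<^bsub>E\<^esub> y"
          using reassoc[OF kap(4), of "slice_arrow a'"] st rho eta zs kap by (simp add: assoc)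
        then show ?thesis using zk[of "\<kappa> \<cdot>\<^bsub>E\<^esub> slice_arrow a'"] ek[OF y] st kap by simp
      qed
      moreover have "l \<cdot>\<^bsub>Z\<^esub> far \<Phi> (fibre_map a') \<in> hom Z (src Z (far \<Phi> (r y))) (src Z p0)" using st l y by (auto simp: hom_iff)
      moreover have "ev \<cdot>\<^bsub>Z\<^esub> (l \<cdot>\<^bsub>Z\<^esub> far \<Phi> (fibre_map a')) = far \<Phi> f"
      proof -
        have "e \<cdot>\<^bsub>T\<^esub> fibre_map a' = f" using a' aS by simp
        then show ?thesis using Phi.far_cmp[of "fibre_map a'" e] st e l ev by (simp add: Phi.D.assoc)
      qed
      ultimately have "?k' = k" using up k0 l' st by blast
      then have "\<kappa> \<cdot>\<^bsub>E\<^esub> slice_arrow a' = kt"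
        using G.couniversal_ext[OF C1, of "\<kappa> \<cdot>\<^bsub>E\<^esub> slice_arrow a'" "src E y" kt] kt st kap by (auto simp: hom_iff)
      then have "slice_arrow a' = m0"
        using pullback_ext[OF pbR, of "slice_arrow a'" "src E y" m0] st m0 by (auto simp: hom_iff)
      then show "a' = ?a" using slice_code[OF aS(1)] aS by simp
    qed
  qed (use rho e in \<open>auto simp: hom_iff\<close>)
  then show ?thesis by blast
qed

end

subsection \<open>Small sets\<close>

lemma inaccessible_infinite: "inaccessible TYPE('u) \<Longrightarrow> infinite (UNIV :: 'u set)"
  unfolding inaccessible_def by (metis infinite_iff_natLeq_ordLeq ordLess_imp_ordLeq)

lemma card_of_image_less: "|A| <o r \<Longrightarrow> |f ` A| <o r"
  using card_of_image ordLeq_ordLess_trans by blast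

lemma card_of_subset_less: "A \<subseteq> B \<Longrightarrow> |B| <o r \<Longrightarrow> |A| <o r"
  using card_of_mono1 ordLeq_ordLess_trans by blast

lemma small_subset: "A \<subseteq> B \<Longrightarrow> small B \<Longrightarrow> small A"
  unfolding small_def by (rule card_of_subset_less)

lemma card_of_UN_less:
  assumes "inaccessible TYPE('u)" "|I| <o |UNIV :: 'u set|" "\<And>i. i \<in> I \<Longrightarrow> |A i| <o |UNIV :: 'u set|"
  shows "|\<Union>i \<in> I. A i| <o |UNIV :: 'u set|"
proof -
  have "Cinfinite |UNIV :: 'u set|"
    using inaccessible_infinite[OF assms(1)] by (auto simp: cinfinite_def Field_card_of card_of_card_order_on)
  moreover have "regularCard |UNIV :: 'u set|" using assms(1) by (simp add: inaccessible_def)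
  ultimately show ?thesis using card_of_UNION_ordLess_infinite_Field_regularCard assms(2,3) by blast
qed

lemma card_of_Times_less:
  assumes "inaccessible TYPE('u)" "|A| <o |UNIV :: 'u set|" "|B| <o |UNIV :: 'u set|"
  shows "|A \<times> B| <o |UNIV :: 'u set|"
proof -
  have "A \<times> B = (\<Union>a \<in> A. Pair a ` B)" by auto
  then show ?thesis using card_of_UN_less[OF assms(1,2) card_of_image_less[OF assms(3)], of Pair] by metis
qed

lemma card_of_finite_less:
  assumes "inaccessible TYPE('u)" "finite A"
  shows "|A| <o |UNIV :: 'u set|"
  using inaccessible_infinite[OF assms(1)] assms(2) by (metis card_of_Well_order Field_card_of finite_ordLess_infinite)

lemma small_finite: "inaccessible TYPE('u) \<Longrightarrow> finite A \<Longrightarrow> small (A :: 'u set)"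
  unfolding small_def by (rule card_of_finite_less)

text \<open>A function is determined by its graph. The graph is coded as a subset of
  \<open>'u\<close>, because the power set clause of \<open>inaccessible\<close> speaks of subsets
  of \<open>'u\<close> only.\<close>

lemma card_of_PiE_less:
  fixes D :: "'u set" and V :: "'u \<Rightarrow> 'u set"
  assumes inacc: "inaccessible TYPE('u)" and "small D" "\<And>d. d \<in> D \<Longrightarrow> small (V d)"
  shows "|PiE D V| <o |UNIV :: 'u set|"
proof -
  let ?W = "\<Union>d \<in> D. V d"
  have W: "|D \<times> ?W| <o |UNIV :: 'u set|"
    using assms by (intro card_of_Times_less card_of_UN_less) (auto simp: small_def)
  let ?A = "(pair_code ` (D \<times> ?W)) :: 'u set"
  have "|?A| <o |UNIV :: 'u set|" using card_of_image_less[OF W] .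
  then have P: "|Pow ?A| <o |UNIV :: 'u set|" using inacc unfolding inaccessible_def by blast
  let ?g = "\<lambda>f. pair_code ` {(d, f d) | d. d \<in> D}"
  have "inj_on ?g (PiE D V)"
  proof (rule inj_onI)
    fix f f' assume f: "f \<in> PiE D V" "f' \<in> PiE D V" and e: "?g f = ?g f'"
    then have "{(d, f d) | d. d \<in> D} = {(d, f' d) | d. d \<in> D}"
      unfolding inj_image_eq_iff[OF inj_pair_code[OF inaccessible_infinite[OF inacc]]] by simp
    then have "f d = f' d" if "d \<in> D" for d using that by blast
    then show "f = f'" using f by (intro PiE_ext)
  qed
  moreover have "?g ` PiE D V \<subseteq> Pow ?A" by (auto simp: PiE_def Pi_def)
  ultimately have "|PiE D V| \<le>o |Pow ?A|" using card_of_ordLeq by blast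
  then show ?thesis using P ordLeq_ordLess_trans by blast
qed

text \<open>Sections of sheaves and objects of sites have to be elements of \<open>'u\<close>. This
  brings small sets of other types, such as functions and truth values, into it.\<close>

lemma card_of_less_encode:
  assumes "|A| <o |UNIV :: 'u set|"
  obtains e :: "'a \<Rightarrow> 'u" where "inj_on e A"
  using assms ordLess_imp_ordLeq card_of_ordLeq[of A "UNIV :: 'u set"] by (metis)

subsection \<open>Categories of sheaves\<close>

type_synonym 'u sheaf_map = "'u psh \<times> 'u psh \<times> ('u \<Rightarrow> 'u \<Rightarrow> 'u)"

locale site = category C for C :: "('u,'u) cat" +
  fixes J :: "'u \<Rightarrow> 'u set set"
  assumes inacc: "inaccessible TYPE('u)" and small_Ob: "small (Ob C)" and small_Ar: "small (Ar C)"
    and top: "grothendieck_topology C J"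
begin

lemma inf: "infinite (UNIV :: 'u set)"
  by (rule inaccessible_infinite[OF inacc])

lemma decode [simp]: "pair_decode (pair_code z) = (z :: 'u \<times> 'u)"
  unfolding pair_decode_def using inj_pair_code[OF inf] by (simp add: inv_f_f)

lemma code_eq [simp]: "pair_code z = pair_code z' \<longleftrightarrow> (z :: 'u \<times> 'u) = z'"
  using decode by metis

lemma coverD:
  assumes "R \<in> J c" "c \<in> Ob C" "f \<in> R"
  shows "f \<in> Ar C" "tgt C f = c" "g \<in> Ar C \<Longrightarrow> tgt C g = src C f \<Longrightarrow> f \<cdot>\<^bsub>C\<^esub> g \<in> R"
  using top assms unfolding grothendieck_topology_def sieve_def by auto

lemma cover_pull: "c \<in> Ob C \<Longrightarrow> R \<in> J c \<Longrightarrow> h \<in> Ar C \<Longrightarrow> tgt C h = c \<Longrightarrow> pull_sieve C h R \<in> J (src C h)"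
  using top unfolding grothendieck_topology_def by auto

lemma presheafD:
  assumes "presheaf C P"
  shows "c \<in> Ob C \<Longrightarrow> small (sec P c)"
    "f \<in> Ar C \<Longrightarrow> a \<in> sec P (tgt C f) \<Longrightarrow> res P f a \<in> sec P (src C f)"
    "c \<in> Ob C \<Longrightarrow> a \<in> sec P c \<Longrightarrow> res P (idn C c) a = a"
    "f \<in> Ar C \<Longrightarrow> g \<in> Ar C \<Longrightarrow> tgt C g = src C f \<Longrightarrow> a \<in> sec P (tgt C f) \<Longrightarrow> res P (f \<cdot>\<^bsub>C\<^esub> g) a = res P g (res P f a)"
  using assms unfolding presheaf_def by auto

lemma sheaf_presheaf: "sheaf C J P \<Longrightarrow> presheaf C P"
  by (simp add: sheaf_def)

lemmas sheafD = presheafD[OF sheaf_presheaf]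

lemma sheaf_glue:
  assumes "sheaf C J P" "c \<in> Ob C" "R \<in> J c" "\<And>f. f \<in> R \<Longrightarrow> x f \<in> sec P (src C f)"
    "\<And>f g. f \<in> R \<Longrightarrow> g \<in> Ar C \<Longrightarrow> tgt C g = src C f \<Longrightarrow> x (f \<cdot>\<^bsub>C\<^esub> g) = res P g (x f)"
  shows "\<exists>!a. a \<in> sec P c \<and> (\<forall>f \<in> R. res P f a = x f)"
proof -
  have "\<forall>x. (\<forall>f \<in> R. x f \<in> sec P (src C f)) \<and>
        (\<forall>f \<in> R. \<forall>g \<in> Ar C. tgt C g = src C f \<longrightarrow> x (f \<cdot>\<^bsub>C\<^esub> g) = res P g (x f)) \<longrightarrow>
        (\<exists>!a. a \<in> sec P c \<and> (\<forall>f \<in> R. res P f a = x f))"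
    by (rule bspec[OF bspec[OF conjunct2[OF assms(1)[unfolded sheaf_def]] assms(2)] assms(3)])
  from spec[OF this, of x] show ?thesis using assms(4,5) by simp
qed

lemma sheaf_separated:
  assumes P: "sheaf C J P" and c: "c \<in> Ob C" and R: "R \<in> J c" and ab: "a \<in> sec P c" "b \<in> sec P c"
    and e: "\<And>f. f \<in> R \<Longrightarrow> res P f a = res P f b"
  shows "a = b"
proof -
  have "\<exists>!a'. a' \<in> sec P c \<and> (\<forall>f \<in> R. res P f a' = res P f b)"
    using coverD[OF R c] sheafD(2,4)[OF P] ab by (intro sheaf_glue[OF P c R]) auto
  then show ?thesis using ab e by blast
qed

lemma sheafI:
  assumes "presheaf C P"
    and "\<And>c R a b. c \<in> Ob C \<Longrightarrow> R \<in> J c \<Longrightarrow> a \<in> sec P c \<Longrightarrow> b \<in> sec P c \<Longrightarrow> (\<And>f. f \<in> R \<Longrightarrow> res P f a = res P f b) \<Longrightarrow> a = b"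
    and "\<And>c R x. c \<in> Ob C \<Longrightarrow> R \<in> J c \<Longrightarrow> (\<And>f. f \<in> R \<Longrightarrow> x f \<in> sec P (src C f)) \<Longrightarrow>
      (\<And>f g. f \<in> R \<Longrightarrow> g \<in> Ar C \<Longrightarrow> tgt C g = src C f \<Longrightarrow> x (f \<cdot>\<^bsub>C\<^esub> g) = res P g (x f)) \<Longrightarrow>
      \<exists>a \<in> sec P c. \<forall>f \<in> R. res P f a = x f"
  shows "sheaf C J P"
  unfolding sheaf_def
proof (intro conjI ballI allI impI assms(1), elim conjE)
  fix c R x assume c: "c \<in> Ob C" "R \<in> J c" and x: "\<forall>f\<in>R. x f \<in> sec P (src C f)"
    "\<forall>f\<in>R. \<forall>g\<in>Ar C. tgt C g = src C f \<longrightarrow> x (f \<cdot>\<^bsub>C\<^esub> g) = res P g (x f)"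
  obtain a where "a \<in> sec P c" "\<forall>f\<in>R. res P f a = x f" using assms(3)[OF c, of x] x by blast
  then show "\<exists>!a. a \<in> sec P c \<and> (\<forall>f\<in>R. res P f a = x f)" using assms(2)[OF c] by (intro ex1I[of _ a]) auto
qed

definition mk_psh :: "('u \<Rightarrow> 'u set) \<Rightarrow> ('u \<Rightarrow> 'u \<Rightarrow> 'u) \<Rightarrow> 'u psh" where
  "mk_psh s \<rho> = \<lparr>sec = (\<lambda>c \<in> Ob C. s c), res = (\<lambda>f \<in> Ar C. \<lambda>a \<in> s (tgt C f). \<rho> f a)\<rparr>"

lemma mk_psh_sel [simp]:
  "c \<in> Ob C \<Longrightarrow> sec (mk_psh s \<rho>) c = s c" "f \<in> Ar C \<Longrightarrow> a \<in> s (tgt C f) \<Longrightarrow> res (mk_psh s \<rho>) f a = \<rho> f a"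
  by (auto simp: mk_psh_def)

lemma mk_psh_presheaf:
  assumes "\<And>c. c \<in> Ob C \<Longrightarrow> small (s c)" "\<And>f a. f \<in> Ar C \<Longrightarrow> a \<in> s (tgt C f) \<Longrightarrow> \<rho> f a \<in> s (src C f)"
    "\<And>c a. c \<in> Ob C \<Longrightarrow> a \<in> s c \<Longrightarrow> \<rho> (idn C c) a = a"
    "\<And>f g a. f \<in> Ar C \<Longrightarrow> g \<in> Ar C \<Longrightarrow> tgt C g = src C f \<Longrightarrow> a \<in> s (tgt C f) \<Longrightarrow> \<rho> (f \<cdot>\<^bsub>C\<^esub> g) a = \<rho> g (\<rho> f a)"
  shows "presheaf C (mk_psh s \<rho>)"
  unfolding presheaf_def using assms by (auto simp: mk_psh_def)

abbreviation "H \<equiv> Sh C J"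

definition ap :: "'u sheaf_map \<Rightarrow> 'u \<Rightarrow> 'u \<Rightarrow> 'u" where
  "ap m = snd (snd m)"

definition mk_map :: "'u psh \<Rightarrow> 'u psh \<Rightarrow> ('u \<Rightarrow> 'u \<Rightarrow> 'u) \<Rightarrow> 'u sheaf_map" where
  "mk_map P Q \<phi> = (P, Q, \<lambda>c \<in> Ob C. \<lambda>a \<in> sec P c. \<phi> c a)"

lemma Sh_Ob [simp]: "P \<in> Ob H \<longleftrightarrow> sheaf C J P"
  by (simp add: Sh_def)

lemma ap_mk_map [simp]: "c \<in> Ob C \<Longrightarrow> a \<in> sec P c \<Longrightarrow> ap (mk_map P Q \<phi>) c a = \<phi> c a"
  by (simp add: ap_def mk_map_def)

lemma Sh_hom: "m \<in> hom H P Q \<longleftrightarrow> (\<exists>\<eta>. m = (P, Q, \<eta>) \<and> sheaf C J P \<and> sheaf C J Q \<and> \<eta> \<in> extensional (Ob C) \<and>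
              (\<forall>c \<in> Ob C. \<eta> c \<in> sec P c \<rightarrow>\<^sub>E sec Q c) \<and>
              (\<forall>f \<in> Ar C. \<forall>a \<in> sec P (tgt C f). \<eta> (src C f) (res P f a) = res Q f (\<eta> (tgt C f) a)))"
  by (auto simp: Sh_def hom_def)

lemma ap_in: "m \<in> hom H P Q \<Longrightarrow> c \<in> Ob C \<Longrightarrow> a \<in> sec P c \<Longrightarrow> ap m c a \<in> sec Q c"
  unfolding Sh_hom ap_def by (metis PiE_mem snd_conv)

lemma ap_nat: "m \<in> hom H P Q \<Longrightarrow> f \<in> Ar C \<Longrightarrow> a \<in> sec P (tgt C f) \<Longrightarrow> ap m (src C f) (res P f a) = res Q f (ap m (tgt C f) a)"
  and hom_sheaf: "m \<in> hom H P Q \<Longrightarrow> sheaf C J P \<and> sheaf C J Q"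
  by (auto simp: Sh_hom ap_def)

lemma ap_ext:
  assumes "m \<in> hom H P Q" "m' \<in> hom H P Q" "\<And>c a. c \<in> Ob C \<Longrightarrow> a \<in> sec P c \<Longrightarrow> ap m c a = ap m' c a"
  shows "m = m'"
proof -
  obtain \<eta> where m: "m = (P, Q, \<eta>)" "\<eta> \<in> extensional (Ob C)" "\<And>c. c \<in> Ob C \<Longrightarrow> \<eta> c \<in> sec P c \<rightarrow>\<^sub>E sec Q c" using assms(1) by (auto simp: Sh_hom)
  obtain \<eta>' where m': "m' = (P, Q, \<eta>')" "\<eta>' \<in> extensional (Ob C)" "\<And>c. c \<in> Ob C \<Longrightarrow> \<eta>' c \<in> sec P c \<rightarrow>\<^sub>E sec Q c" using assms(2) by (auto simp: Sh_hom)
  have "\<eta> c = \<eta>' c" if "c \<in> Ob C" for c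
    using m(3)[OF that] m'(3)[OF that] assms(3)[OF that] by (intro PiE_ext) (auto simp: ap_def m m')
  then have "\<eta> = \<eta>'" using m(2) m'(2) by - (rule extensionalityI[of _ "Ob C"], auto)
  then show ?thesis using m m' by simp
qed

lemma mk_map_hom:
  assumes "sheaf C J P" "sheaf C J Q" "\<And>c a. c \<in> Ob C \<Longrightarrow> a \<in> sec P c \<Longrightarrow> \<phi> c a \<in> sec Q c"
    "\<And>f a. f \<in> Ar C \<Longrightarrow> a \<in> sec P (tgt C f) \<Longrightarrow> \<phi> (src C f) (res P f a) = res Q f (\<phi> (tgt C f) a)"
  shows "mk_map P Q \<phi> \<in> hom H P Q"
  unfolding Sh_hom mk_map_def using assms sheafD(2)[OF assms(1)] by auto

lemma Sh_cmp: "(Q, R, \<theta>) \<cdot>\<^bsub>H\<^esub> (P, Q', \<eta>) = (P, R, \<lambda>c \<in> Ob C. compose (sec P c) (\<theta> c) (\<eta> c))"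
  by (simp add: Sh_def)

lemma ap_cmp: "m \<in> hom H P Q \<Longrightarrow> n \<in> hom H Q R \<Longrightarrow> c \<in> Ob C \<Longrightarrow> a \<in> sec P c \<Longrightarrow> ap (n \<cdot>\<^bsub>H\<^esub> m) c a = ap n c (ap m c a)"
  by (auto simp: Sh_hom Sh_cmp ap_def compose_def)

lemma Sh_idn: "idn H P = mk_map P P (\<lambda>c a. a)"
  by (simp add: Sh_def mk_map_def)

lemma Sh_cmp_hom:
  assumes "m \<in> hom H P Q" "n \<in> hom H Q R"
  shows "n \<cdot>\<^bsub>H\<^esub> m \<in> hom H P R"
proof -
  obtain \<eta> \<theta> where e: "m = (P, Q, \<eta>)" "n = (Q, R, \<theta>)" using assms by (auto simp: Sh_hom)
  have "n \<cdot>\<^bsub>H\<^esub> m = mk_map P R (\<lambda>c a. ap n c (ap m c a))"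
    by (simp add: e Sh_cmp mk_map_def compose_def ap_def)
  then show ?thesis
    using mk_map_hom[of P R "\<lambda>c a. ap n c (ap m c a)"] hom_sheaf[OF assms(1)] hom_sheaf[OF assms(2)]
      ap_in[OF assms(1)] ap_in[OF assms(2)] ap_nat[OF assms(1)] ap_nat[OF assms(2)] by auto
qed

sublocale H: category H
proof
  fix f assume "f \<in> Ar H" then show "src H f \<in> Ob H" "tgt H f \<in> Ob H" by (auto simp: Sh_def)
next
  fix x assume "x \<in> Ob H" then show i: "idn H x \<in> hom H x x" unfolding Sh_idn by (intro mk_map_hom) auto
next
  fix f g x y z assume "f \<in> hom H x y" "g \<in> hom H y z" then show "g \<cdot>\<^bsub>H\<^esub> f \<in> hom H x z" by (rule Sh_cmp_hom)
next
  fix f x y assume f: "f \<in> hom H x y"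
  have i: "idn H x \<in> hom H x x" "idn H y \<in> hom H y y" unfolding Sh_idn using hom_sheaf[OF f] by (auto intro: mk_map_hom)
  show "idn H y \<cdot>\<^bsub>H\<^esub> f = f"
    by (rule ap_ext[OF Sh_cmp_hom[OF f i(2)] f]) (use ap_in[OF f] in \<open>simp add: ap_cmp[OF f i(2)]\<close>, use ap_in[OF f] in \<open>simp add: Sh_idn\<close>)
  show "f \<cdot>\<^bsub>H\<^esub> idn H x = f"
    by (rule ap_ext[OF Sh_cmp_hom[OF i(1) f] f]) (simp add: ap_cmp[OF i(1) f], simp add: Sh_idn)
next
  fix f g h w x y z assume f: "f \<in> hom H w x" and g: "g \<in> hom H x y" and h: "h \<in> hom H y z"
  show "h \<cdot>\<^bsub>H\<^esub> g \<cdot>\<^bsub>H\<^esub> f = h \<cdot>\<^bsub>H\<^esub> (g \<cdot>\<^bsub>H\<^esub> f)"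
    by (rule ap_ext[OF Sh_cmp_hom[OF f Sh_cmp_hom[OF g h]] Sh_cmp_hom[OF Sh_cmp_hom[OF f g] h]])
      (simp add: ap_cmp[OF f Sh_cmp_hom[OF g h]] ap_cmp[OF Sh_cmp_hom[OF f g] h] ap_cmp[OF f g] ap_cmp[OF g h] ap_in[OF f])
qed

lemma Sh_has_terminal: "\<exists>t. terminal_in H t \<and> (\<forall>c \<in> Ob C. \<exists>x. sec t c = {x})"
proof -
  define t where "t = mk_psh (\<lambda>c. {undefined}) (\<lambda>f a. undefined)"
  have "presheaf C t" unfolding t_def by (rule mk_psh_presheaf) (use small_finite[OF inacc] in auto)
  then have t: "sheaf C J t"
    by (rule sheafI) (use coverD in \<open>auto simp: t_def\<close>)
  have "\<exists>!f. f \<in> hom H P t" if "P \<in> Ob H" for P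
  proof (rule ex1I[of _ "mk_map P t (\<lambda>c a. undefined)"])
    show "mk_map P t (\<lambda>c a. undefined) \<in> hom H P t" using that t by (intro mk_map_hom) (auto simp: t_def)
    then show "f = mk_map P t (\<lambda>c a. undefined)" if f: "f \<in> hom H P t" for f
      using ap_in[OF f] ap_in[of "mk_map P t (\<lambda>c a. undefined)" P t] by (intro ap_ext[OF f]) (auto simp: t_def)
  qed
  then show ?thesis using t by (intro exI[of _ t]) (auto simp: terminal_in_def t_def)
qed

text \<open>Any terminal sheaf is isomorphic to the explicit one of
  \<open>Sh_has_terminal\<close>.\<close>

lemma Sh_terminal_singleton:
  assumes t: "terminal_in H t" and c: "c \<in> Ob C"
  shows "\<exists>x. sec t c = {x}"
proof -
  obtain t' where t': "terminal_in H t'" "\<exists>x. sec t' c = {x}" using Sh_has_terminal c by blast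
  have o: "t \<in> Ob H" "t' \<in> Ob H" using t t' by (auto simp: terminal_in_def)
  obtain f where f: "f \<in> hom H t t'" using terminal_in_ex[OF t'(1) o(1)] by blast
  obtain g where g: "g \<in> hom H t' t" using terminal_in_ex[OF t o(2)] by blast
  have "g \<cdot>\<^bsub>H\<^esub> f = idn H t" using terminal_in_unique[OF t o(1) H.cmp_hom[OF f g] H.idn_hom[OF o(1)]] .
  then have "ap g c (ap f c x) = x" if "x \<in> sec t c" for x
    using ap_cmp[OF f g c that] c that by (simp add: Sh_idn)
  then show ?thesis using t'(2) ap_in[OF f c] ap_in[OF g c] by (metis singletonD singletonI set_eqI)
qed

text \<open>Where the empty sieve covers, every sheaf has exactly one section, so the empty presheaf
  is not a sheaf in general. The initial sheaf has a single section over those objects and none over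
  the others.\<close>

lemma Sh_has_initial: "\<exists>i. initial_in H i"
proof -
  define i where "i = mk_psh (\<lambda>c. if {} \<in> J c then {undefined} else {}) (\<lambda>f a. undefined)"
  have pull: "{} \<in> J (src C f)" if "f \<in> Ar C" "{} \<in> J (tgt C f)" for f
    using cover_pull[of "tgt C f" "{}" f] that by (simp add: pull_sieve_def)
  have "presheaf C i" unfolding i_def
    by (rule mk_psh_presheaf) (use small_finite[OF inacc] pull in \<open>auto split: if_splits\<close>)
  \<comment> \<open>Transitivity of the topology: \<open>i\<close> has a section over
    \<open>c\<close> as soon as it has one locally.\<close>
  moreover have "{} \<in> J c" if "c \<in> Ob C" "R \<in> J c" "\<And>f. f \<in> R \<Longrightarrow> {} \<in> J (src C f)" for c R
  proof -
    have "pull_sieve C h {} \<in> J (src C h)" if "h \<in> R" for h using \<open>\<And>f. f \<in> R \<Longrightarrow> _\<close> that by (simp add: pull_sieve_def)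
    moreover have "sieve C c {}" by (simp add: sieve_def)
    ultimately show ?thesis using top that(1,2) unfolding grothendieck_topology_def by blast
  qed
  ultimately have i: "sheaf C J i"
  proof (intro sheafI)
    fix c R x assume a: "c \<in> Ob C" "R \<in> J c" "\<And>f. f \<in> R \<Longrightarrow> x f \<in> sec i (src C f)"
      and cov: "\<And>c R. c \<in> Ob C \<Longrightarrow> R \<in> J c \<Longrightarrow> (\<And>f. f \<in> R \<Longrightarrow> {} \<in> J (src C f)) \<Longrightarrow> {} \<in> J c"
    have x: "{} \<in> J (src C f) \<and> x f = undefined" if "f \<in> R" for f
      using a(3)[OF that] coverD(1)[OF a(2,1) that] by (auto simp: i_def split: if_splits)
    then have "{} \<in> J c" using cov[OF a(1,2)] by blast
    then show "\<exists>b\<in>sec i c. \<forall>f\<in>R. res i f b = x f"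
      using x coverD(1,2)[OF a(2,1)] a(1) by (intro bexI[of _ undefined]) (auto simp: i_def)
  qed (auto simp: i_def split: if_splits)
  have "\<exists>!f. f \<in> hom H i P" if P: "P \<in> Ob H" for P
  proof -
    have one: "\<exists>!a. a \<in> sec P c" if "c \<in> Ob C" "{} \<in> J c" for c
      using sheaf_glue[of P c "{}"] that P by auto
    define \<phi> where "\<phi> c a = (THE a. a \<in> sec P c)" for c and a :: 'u
    have \<phi>: "\<phi> c a \<in> sec P c" if "c \<in> Ob C" "{} \<in> J c" for c a using theI'[OF one[OF that]] by (simp add: \<phi>_def)
    have m: "mk_map i P \<phi> \<in> hom H i P"
    proof (rule mk_map_hom[OF i])
      fix f a assume "f \<in> Ar C" "a \<in> sec i (tgt C f)"
      then show "\<phi> (src C f) (res i f a) = res P f (\<phi> (tgt C f) a)"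
        using one[of "src C f"] pull[of f] \<phi>[of "src C f"] \<phi>[of "tgt C f"] sheafD(2)[of P f "\<phi> (tgt C f) a"] P
        by (auto simp: i_def split: if_splits)
    qed (use P \<phi> in \<open>auto simp: i_def split: if_splits\<close>)
    show ?thesis
    proof (rule ex1I[of _ "mk_map i P \<phi>"], rule m)
      fix f assume f: "f \<in> hom H i P"
      show "f = mk_map i P \<phi>"
      proof (rule ap_ext[OF f m])
        fix c a assume c: "c \<in> Ob C" and a: "a \<in> sec i c"
        then have "{} \<in> J c" by (auto simp: i_def split: if_splits)
        then show "ap f c a = ap (mk_map i P \<phi>) c a" using one[OF c] ap_in[OF f c a] ap_in[OF m c a] by blast
      qed
    qed
  qed
  then show ?thesis using i Sh_Ob unfolding initial_in_def by blast
qed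

text \<open>Pairs of sections with the same image, coded in \<open>'u\<close>, form the pullback;
  glueing works in both coordinates, and the condition on the images is local because the common
  target is separated. The second conjunct keeps this description of sections for later use.\<close>

lemma Sh_pullback:
  assumes m: "m \<in> hom H P R" and n: "n \<in> hom H Q R"
  shows "\<exists>p q. is_pullback H m n p q \<and> (\<forall>c \<in> Ob C. \<forall>a \<in> sec P c. \<forall>b \<in> sec Q c. ap m c a = ap n c b \<longrightarrow>
    (\<exists>!z. z \<in> sec (src H p) c \<and> ap p c z = a \<and> ap q c z = b))"
proof -
  note P = conjunct1[OF hom_sheaf[OF m]] and Q = conjunct1[OF hom_sheaf[OF n]]
  define s where "s c = pair_code ` {(a,b). a \<in> sec P c \<and> b \<in> sec Q c \<and> ap m c a = ap n c b}" for c
  define A where "A z = fst (pair_decode z)" for z :: 'u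
  define B where "B z = snd (pair_decode z)" for z :: 'u
  have AB [simp]: "A (pair_code (a,b)) = a" "B (pair_code (a,b)) = b" for a b by (auto simp: A_def B_def)
  have s: "A z \<in> sec P c" "B z \<in> sec Q c" "ap m c (A z) = ap n c (B z)" "pair_code (A z, B z) = z" if "z \<in> s c" for z c
    using that by (auto simp: s_def)
  have sI: "pair_code (a,b) \<in> s c" if "a \<in> sec P c" "b \<in> sec Q c" "ap m c a = ap n c b" for a b c
    using that by (auto simp: s_def)
  define \<rho> where "\<rho> f z = pair_code (res P f (A z), res Q f (B z))" for f z
  define W where "W = mk_psh s \<rho>"
  have sm: "small (s c)" if "c \<in> Ob C" for c
  proof -
    have "|sec P c \<times> sec Q c| <o |UNIV :: 'u set|"
      using sheafD(1)[OF P that] sheafD(1)[OF Q that] by (intro card_of_Times_less[OF inacc]) (auto simp: small_def)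
    then have "|pair_code ` (sec P c \<times> sec Q c)| <o |UNIV :: 'u set|" by (rule card_of_image_less)
    then show ?thesis unfolding small_def by (rule card_of_subset_less[rotated]) (auto simp: s_def)
  qed
  have rin: "\<rho> f z \<in> s (src C f)" if "f \<in> Ar C" "z \<in> s (tgt C f)" for f z
    unfolding \<rho>_def using that s[OF that(2)] sheafD(2)[OF P] sheafD(2)[OF Q] ap_nat[OF m] ap_nat[OF n] by (intro sI) auto
  have W0: "presheaf C W" unfolding W_def
    by (rule mk_psh_presheaf) (use sm rin s sheafD[OF P] sheafD[OF Q] in \<open>auto simp: \<rho>_def\<close>)
  have W: "sheaf C J W"
  proof (rule sheafI[OF W0])
    fix c R' a b assume c: "c \<in> Ob C" "R' \<in> J c" and ab: "a \<in> sec W c" "b \<in> sec W c" and e: "\<And>f. f \<in> R' \<Longrightarrow> res W f a = res W f b"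
    have ab': "a \<in> s c" "b \<in> s c" using ab c by (auto simp: W_def)
    have *: "res P f (A a) = res P f (A b)" "res Q f (B a) = res Q f (B b)" if "f \<in> R'" for f
      using e[OF that] coverD(1,2)[OF c(2,1) that] ab' by (simp_all add: W_def \<rho>_def)
    have "A a = A b" by (rule sheaf_separated[OF P c s(1)[OF ab'(1)] s(1)[OF ab'(2)]]) (rule *)
    moreover have "B a = B b" by (rule sheaf_separated[OF Q c s(2)[OF ab'(1)] s(2)[OF ab'(2)]]) (rule *)
    ultimately show "a = b" using s(4)[OF ab'(1)] s(4)[OF ab'(2)] by metis
  next
    fix c R' x assume c: "c \<in> Ob C" "R' \<in> J c" and x: "\<And>f. f \<in> R' \<Longrightarrow> x f \<in> sec W (src C f)"
      and xm: "\<And>f g. f \<in> R' \<Longrightarrow> g \<in> Ar C \<Longrightarrow> tgt C g = src C f \<Longrightarrow> x (f \<cdot>\<^bsub>C\<^esub> g) = res W g (x f)"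
    have x': "x f \<in> s (src C f)" if "f \<in> R'" for f using x[OF that] coverD(1)[OF c(2,1) that] by (simp add: W_def)
    have xm': "x (f \<cdot>\<^bsub>C\<^esub> g) = \<rho> g (x f)" if "f \<in> R'" "g \<in> Ar C" "tgt C g = src C f" for f g
      using xm[OF that] x'[OF that(1)] that by (simp add: W_def)
    have "\<exists>!a. a \<in> sec P c \<and> (\<forall>f \<in> R'. res P f a = A (x f))"
      by (rule sheaf_glue[OF P c]) (simp_all add: s(1)[OF x'] xm' \<rho>_def)
    then obtain a where a: "a \<in> sec P c" "\<And>f. f \<in> R' \<Longrightarrow> res P f a = A (x f)" by blast
    have "\<exists>!b. b \<in> sec Q c \<and> (\<forall>f \<in> R'. res Q f b = B (x f))"
      by (rule sheaf_glue[OF Q c]) (simp_all add: s(2)[OF x'] xm' \<rho>_def)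
    then obtain b where b: "b \<in> sec Q c" "\<And>f. f \<in> R' \<Longrightarrow> res Q f b = B (x f)" by blast
    have "ap m c a = ap n c b"
    proof (rule sheaf_separated[OF conjunct2[OF hom_sheaf[OF m]] c])
      fix f assume f: "f \<in> R'"
      show "res R f (ap m c a) = res R f (ap n c b)"
        using ap_nat[OF m, of f a] ap_nat[OF n, of f b] a b f coverD(1,2)[OF c(2,1) f] s(3)[OF x'[OF f]] by simp
    qed (use ap_in[OF m c(1)] ap_in[OF n c(1)] a b in auto)
    then have ab: "pair_code (a,b) \<in> s c" using sI a b by auto
    show "\<exists>a\<in>sec W c. \<forall>f\<in>R'. res W f a = x f"
      using ab c coverD(1,2)[OF c(2,1)] a b s(4)[OF x'] by (intro bexI[of _ "pair_code (a,b)"]) (auto simp: W_def \<rho>_def)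
  qed
  define p where "p = mk_map W P (\<lambda>c z. A z)"
  define q where "q = mk_map W Q (\<lambda>c z. B z)"
  have p: "p \<in> hom H W P" unfolding p_def by (rule mk_map_hom[OF W P]) (use s in \<open>auto simp: W_def \<rho>_def\<close>)
  have q: "q \<in> hom H W Q" unfolding q_def by (rule mk_map_hom[OF W Q]) (use s in \<open>auto simp: W_def \<rho>_def\<close>)
  have pq: "ap p c z = A z" "ap q c z = B z" if "c \<in> Ob C" "z \<in> s c" for c z
    using that by (auto simp: p_def q_def W_def)
  have sW: "sec W c = s c" if "c \<in> Ob C" for c using that by (simp add: W_def)
  note hh = m[unfolded hom_iff] n[unfolded hom_iff] p[unfolded hom_iff] q[unfolded hom_iff]
  have "is_pullback H m n p q"
  proof (rule H.pullbackI)
    show "m \<cdot>\<^bsub>H\<^esub> p = n \<cdot>\<^bsub>H\<^esub> q"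
      by (rule ap_ext[OF H.cmp_hom[OF p m] H.cmp_hom[OF q n]]) (use s in \<open>simp add: ap_cmp[OF p m] ap_cmp[OF q n] sW pq\<close>)
    fix Z p' q' assume "p' \<in> hom H Z (src H m)" "q' \<in> hom H Z (src H n)" and e: "m \<cdot>\<^bsub>H\<^esub> p' = n \<cdot>\<^bsub>H\<^esub> q'"
    then have p': "p' \<in> hom H Z P" and q': "q' \<in> hom H Z Q" using hh by auto
    have e': "ap m c (ap p' c z) = ap n c (ap q' c z)" if "c \<in> Ob C" "z \<in> sec Z c" for c z
      using ap_cmp[OF p' m that] ap_cmp[OF q' n that] e by simp
    let ?k = "mk_map Z W (\<lambda>c z. pair_code (ap p' c z, ap q' c z))"
    have k: "?k \<in> hom H Z W"
    proof (rule mk_map_hom[OF _ W])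
      show "sheaf C J Z" using hom_sheaf[OF p'] by blast
      show *: "pair_code (ap p' c a, ap q' c a) \<in> sec W c" if "c \<in> Ob C" "a \<in> sec Z c" for c a
        using that ap_in[OF p' that] ap_in[OF q' that] e' by (simp add: sW sI)
      fix f a assume f: "f \<in> Ar C" "a \<in> sec Z (tgt C f)"
      then show "pair_code (ap p' (src C f) (res Z f a), ap q' (src C f) (res Z f a)) = res W f (pair_code (ap p' (tgt C f) a, ap q' (tgt C f) a))"
        using *[of "tgt C f" a] ap_nat[OF p' f] ap_nat[OF q' f] by (simp add: sW) (simp add: W_def \<rho>_def)
    qed
    have kin: "pair_code (ap p' c z, ap q' c z) \<in> s c" if "c \<in> Ob C" "z \<in> sec Z c" for c z
      using ap_in[OF k that] that by (simp add: sW)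
    have "p \<cdot>\<^bsub>H\<^esub> ?k = p'" by (rule ap_ext[OF H.cmp_hom[OF k p] p']) (simp add: ap_cmp[OF k p] pq kin)
    moreover have "q \<cdot>\<^bsub>H\<^esub> ?k = q'" by (rule ap_ext[OF H.cmp_hom[OF k q] q']) (simp add: ap_cmp[OF k q] pq kin)
    ultimately show "\<exists>k\<in>hom H Z (src H p). p \<cdot>\<^bsub>H\<^esub> k = p' \<and> q \<cdot>\<^bsub>H\<^esub> k = q'" using k hh by auto
  next
    fix Z k k' assume "k \<in> hom H Z (src H p)" "k' \<in> hom H Z (src H p)" and e: "p \<cdot>\<^bsub>H\<^esub> k = p \<cdot>\<^bsub>H\<^esub> k'" "q \<cdot>\<^bsub>H\<^esub> k = q \<cdot>\<^bsub>H\<^esub> k'"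
    then have k: "k \<in> hom H Z W" "k' \<in> hom H Z W" using hh by auto
    show "k = k'"
    proof (rule ap_ext[OF k])
      fix c z assume cz: "c \<in> Ob C" "z \<in> sec Z c"
      note in1 = ap_in[OF k(1) cz, unfolded sW[OF cz(1)]] and in2 = ap_in[OF k(2) cz, unfolded sW[OF cz(1)]]
      have "A (ap k c z) = A (ap k' c z)" "B (ap k c z) = B (ap k' c z)"
        using arg_cong[OF e(1), of "\<lambda>m. ap m c z"] arg_cong[OF e(2), of "\<lambda>m. ap m c z"]
          ap_cmp[OF k(1) p cz] ap_cmp[OF k(2) p cz] ap_cmp[OF k(1) q cz] ap_cmp[OF k(2) q cz] pq[OF cz(1) in1] pq[OF cz(1) in2] by auto
      then show "ap k c z = ap k' c z" using s(4)[OF in1] s(4)[OF in2] by metis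
    qed
  qed (use hh in auto)
  moreover have "\<exists>!z. z \<in> sec (src H p) c \<and> ap p c z = a \<and> ap q c z = b"
    if "c \<in> Ob C" "a \<in> sec P c" "b \<in> sec Q c" "ap m c a = ap n c b" for c a b
  proof (rule ex1I[of _ "pair_code (a, b)"])
    fix z assume z: "z \<in> sec (src H p) c \<and> ap p c z = a \<and> ap q c z = b"
    then have "z \<in> s c" using hh that by (simp add: sW)
    then show "z = pair_code (a, b)" using z pq[OF that(1)] s(4) by metis
  qed (use that hh sI pq in \<open>simp add: sW\<close>)
  ultimately show ?thesis by blast
qed

lemma Sh_has_pullbacks: "has_pullbacks H"
  unfolding has_pullbacks_def using Sh_pullback by (metis hom_iff)

text \<open>An arbitrary pullback is isomorphic to the one constructed in
  \<open>Sh_pullback\<close>, so its sections are given by pairs as well.\<close>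

lemma Sh_pullback_element:
  assumes pb: "is_pullback H m n p q" and c: "c \<in> Ob C" and ab: "a \<in> sec (src H m) c" "b \<in> sec (src H n) c" "ap m c a = ap n c b"
  shows "\<exists>!z. z \<in> sec (src H p) c \<and> ap p c z = a \<and> ap q c z = b"
proof -
  note P = pullbackD[OF pb]
  have m: "m \<in> hom H (src H m) (tgt H m)" and n: "n \<in> hom H (src H n) (tgt H m)" and p: "p \<in> hom H (src H p) (src H m)" and q: "q \<in> hom H (src H p) (src H n)"
    using P by (auto simp: hom_iff)
  obtain p' q' where pb': "is_pullback H m n p' q'" and el: "\<exists>!z. z \<in> sec (src H p') c \<and> ap p' c z = a \<and> ap q' c z = b"
    and el': "\<And>a b. a \<in> sec (src H m) c \<Longrightarrow> b \<in> sec (src H n) c \<Longrightarrow> ap m c a = ap n c b \<Longrightarrow> \<exists>!z. z \<in> sec (src H p') c \<and> ap p' c z = a \<and> ap q' c z = b"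
    using Sh_pullback[OF m n] c ab by blast
  note P' = pullbackD[OF pb']
  have p': "p' \<in> hom H (src H p') (src H m)" and q': "q' \<in> hom H (src H p') (src H n)"
    using P' by (auto simp: hom_iff)
  obtain k where k: "k \<in> hom H (src H p') (src H p)" "p \<cdot>\<^bsub>H\<^esub> k = p'" "q \<cdot>\<^bsub>H\<^esub> k = q'" using pullback_factor[OF pb p' q' P'(9)] .
  obtain l where l: "l \<in> hom H (src H p) (src H p')" "p' \<cdot>\<^bsub>H\<^esub> l = p" "q' \<cdot>\<^bsub>H\<^esub> l = q" using pullback_factor[OF pb' p q P(9)] .
  have "k \<cdot>\<^bsub>H\<^esub> l = idn H (src H p)"
    by (rule H.pullback_ext[OF pb H.cmp_hom[OF l(1) k(1)] H.idn_hom])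
      (use P k l P' H.reassoc[OF k(2), of l] H.reassoc[OF k(3), of l] in \<open>auto simp: hom_iff simp del: Sh_Ob\<close>)
  then have kl: "ap k c (ap l c z) = z" if "z \<in> sec (src H p) c" for z
    using ap_cmp[OF l(1) k(1) c that] c that by (simp add: Sh_idn)
  obtain z where z: "z \<in> sec (src H p') c" "ap p' c z = a" "ap q' c z = b" using el by blast
  show ?thesis
  proof (rule ex1I[of _ "ap k c z"], intro conjI)
    show "ap k c z \<in> sec (src H p) c" using ap_in[OF k(1) c z(1)] .
    show "ap p c (ap k c z) = a" using ap_cmp[OF k(1) p c z(1)] k z by simp
    show "ap q c (ap k c z) = b" using ap_cmp[OF k(1) q c z(1)] k z by simp
    fix y assume y: "y \<in> sec (src H p) c \<and> ap p c y = a \<and> ap q c y = b"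
    then have "ap l c y \<in> sec (src H p') c \<and> ap p' c (ap l c y) = a \<and> ap q' c (ap l c y) = b"
      using ap_in[OF l(1) c] ap_cmp[OF l(1) p' c] ap_cmp[OF l(1) q' c] l by metis
    then have "ap l c y = z" using el z by blast
    then show "y = ap k c z" using kl[of y] y by simp
  qed
qed

end

section \<open>The dependent product of a sheaf along a global element\<close>

context site
begin

context
  fixes t Z b :: "'u psh" and s
  assumes t: "terminal_in H t" and s: "s \<in> hom H t Z" and b: "sheaf C J b"
begin

definition pt :: "'u \<Rightarrow> 'u" where "pt c = ap s c (THE x. x \<in> sec t c)"

lemma Z: "sheaf C J Z" using hom_sheaf[OF s] by blast

lemma pt_eq: "c \<in> Ob C \<Longrightarrow> x \<in> sec t c \<Longrightarrow> ap s c x = pt c"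
  using Sh_terminal_singleton[OF t, of c] by (auto simp: pt_def)

lemma pt_ex: "c \<in> Ob C \<Longrightarrow> \<exists>x. x \<in> sec t c"
  using Sh_terminal_singleton[OF t, of c] by auto

lemma pt_in: "c \<in> Ob C \<Longrightarrow> pt c \<in> sec Z c"
  using pt_ex[of c] pt_eq[of c] ap_in[OF s, of c] by metis

lemma pt_nat: "f \<in> Ar C \<Longrightarrow> res Z f (pt (tgt C f)) = pt (src C f)"
  using pt_ex[of "tgt C f"] pt_eq[of "tgt C f"] pt_eq[of "src C f"] ap_nat[OF s, of f] sheafD(2)[of t f] hom_sheaf[OF s]
    tgt_Ob src_Ob by metis

text \<open>The sieve of those \<open>f\<close> along which \<open>x\<close> restricts to the global
  element: the fibre over it of the map from the representable at \<open>c\<close> that corresponds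
  to \<open>x\<close>.\<close>

definition locus :: "'u \<Rightarrow> 'u \<Rightarrow> 'u set" where
  "locus c x = {f \<in> Ar C. tgt C f = c \<and> res Z f x = pt (src C f)}"

text \<open>Maps to \<open>b\<close> from the locus, viewed as a subfunctor of the representable at
  \<open>c\<close>. By Yoneda a section of the dependent product over \<open>c\<close> has to be an
  \<open>x\<close> together with such a map.\<close>

definition families :: "'u \<Rightarrow> 'u \<Rightarrow> ('u \<Rightarrow> 'u) set" where
  "families c x = {\<tau> \<in> PiE (locus c x) (\<lambda>f. sec b (src C f)).
     \<forall>f \<in> locus c x. \<forall>g \<in> Ar C. tgt C g = src C f \<longrightarrow> \<tau> (f \<cdot>\<^bsub>C\<^esub> g) = res b g (\<tau> f)}"

lemma locusD: "f \<in> locus c x \<Longrightarrow> f \<in> Ar C \<and> tgt C f = c \<and> res Z f x = pt (src C f)"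
  by (simp add: locus_def)

lemma locus_cmp: "x \<in> sec Z c \<Longrightarrow> f \<in> locus c x \<Longrightarrow> g \<in> Ar C \<Longrightarrow> tgt C g = src C f \<Longrightarrow> f \<cdot>\<^bsub>C\<^esub> g \<in> locus c x"
  using sheafD(4)[OF Z, of f g x] pt_nat[of g] by (auto simp: locus_def)

lemma locus_res:
  assumes "h \<in> Ar C" "x \<in> sec Z (tgt C h)"
  shows "f \<in> locus (src C h) (res Z h x) \<longleftrightarrow> f \<in> Ar C \<and> tgt C f = src C h \<and> h \<cdot>\<^bsub>C\<^esub> f \<in> locus (tgt C h) x"
  using assms sheafD(4)[OF Z, of h f x] by (auto simp: locus_def)

lemma locus_idn: "c \<in> Ob C \<Longrightarrow> idn C c \<in> locus c x \<longleftrightarrow> res Z (idn C c) x = pt c"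
  by (simp add: locus_def)

lemma familiesD:
  assumes "\<tau> \<in> families c x" "f \<in> locus c x"
  shows "\<tau> f \<in> sec b (src C f)" "g \<in> Ar C \<Longrightarrow> tgt C g = src C f \<Longrightarrow> \<tau> (f \<cdot>\<^bsub>C\<^esub> g) = res b g (\<tau> f)"
  using assms by (auto simp: families_def dest: PiE_mem)

lemma families_res:
  assumes h: "h \<in> Ar C" and x: "x \<in> sec Z (tgt C h)" and tau: "\<tau> \<in> families (tgt C h) x"
  shows "(\<lambda>f \<in> locus (src C h) (res Z h x). \<tau> (h \<cdot>\<^bsub>C\<^esub> f)) \<in> families (src C h) (res Z h x)"
proof -
  have x': "res Z h x \<in> sec Z (src C h)" using sheafD(2)[OF Z h x] .
  show ?thesis
    unfolding families_def
  proof (intro CollectI conjI ballI impI PiE_I)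
    fix f assume "f \<in> locus (src C h) (res Z h x)"
    then show "(\<lambda>f\<in>locus (src C h) (res Z h x). \<tau> (h \<cdot>\<^bsub>C\<^esub> f)) f \<in> sec b (src C f)"
      using familiesD(1)[OF tau, of "h \<cdot>\<^bsub>C\<^esub> f"] locus_res[OF h x, of f] h by simp
    fix g assume "g \<in> Ar C" "tgt C g = src C f"
    then show "(\<lambda>f\<in>locus (src C h) (res Z h x). \<tau> (h \<cdot>\<^bsub>C\<^esub> f)) (f \<cdot>\<^bsub>C\<^esub> g) = res b g ((\<lambda>f\<in>locus (src C h) (res Z h x). \<tau> (h \<cdot>\<^bsub>C\<^esub> f)) f)"
      using familiesD(2)[OF tau, of "h \<cdot>\<^bsub>C\<^esub> f" g] locus_res[OF h x, of f] h locus_cmp[OF x', of f g] \<open>f \<in> locus _ _\<close>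
      by (simp add: assoc)
  qed simp
qed

definition all_families :: "('u \<Rightarrow> 'u) set" where
  "all_families = (\<Union>c \<in> Ob C. \<Union>x \<in> sec Z c. families c x)"

lemma card_families: "c \<in> Ob C \<Longrightarrow> |families c x| <o |UNIV :: 'u set|"
proof -
  assume c: "c \<in> Ob C"
  have "|PiE (locus c x) (\<lambda>f. sec b (src C f))| <o |UNIV :: 'u set|"
    by (rule card_of_PiE_less[OF inacc small_subset[OF _ small_Ar]]) (use sheafD(1)[OF b] in \<open>auto simp: locus_def\<close>)
  then show ?thesis by (rule card_of_subset_less[rotated]) (auto simp: families_def)
qed

lemma card_all_families: "|all_families| <o |UNIV :: 'u set|"
  unfolding all_families_def
  using small_Ob sheafD(1)[OF Z] by (intro card_of_UN_less[OF inacc] card_families) (auto simp: small_def)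

text \<open>Families are functions, whereas sections must be elements of \<open>'u\<close>. A single
  injection serves all stages and all \<open>x\<close>; it exists because there are few families
  altogether.\<close>

definition enc :: "('u \<Rightarrow> 'u) \<Rightarrow> 'u" where "enc = (SOME e. inj_on e all_families)"

lemma inj_enc: "inj_on enc all_families"
  unfolding enc_def using card_of_less_encode[OF card_all_families] by (metis someI_ex)

definition pi_mk :: "'u \<Rightarrow> ('u \<Rightarrow> 'u) \<Rightarrow> 'u" where "pi_mk x \<tau> = pair_code (x, enc \<tau>)"
definition pi_base :: "'u \<Rightarrow> 'u" where "pi_base z = fst (pair_decode z)"
definition pi_fam :: "'u \<Rightarrow> 'u \<Rightarrow> 'u" where "pi_fam z = inv_into all_families enc (snd (pair_decode z))"

definition pi_sec :: "'u \<Rightarrow> 'u set" where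
  "pi_sec c = {pi_mk x \<tau> | x \<tau>. x \<in> sec Z c \<and> \<tau> \<in> families c x}"

definition pi_res :: "'u \<Rightarrow> 'u \<Rightarrow> 'u" where
  "pi_res h z = pi_mk (res Z h (pi_base z)) (\<lambda>f \<in> locus (src C h) (res Z h (pi_base z)). pi_fam z (h \<cdot>\<^bsub>C\<^esub> f))"

lemma pi_mk [simp]:
  assumes "c \<in> Ob C" "x \<in> sec Z c" "\<tau> \<in> families c x"
  shows "pi_mk x \<tau> \<in> pi_sec c" "pi_base (pi_mk x \<tau>) = x" "pi_fam (pi_mk x \<tau>) = \<tau>"
proof -
  have "\<tau> \<in> all_families" using assms by (auto simp: all_families_def)
  then show "pi_fam (pi_mk x \<tau>) = \<tau>" using inv_into_f_f[OF inj_enc] by (simp add: pi_fam_def pi_mk_def)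
qed (use assms in \<open>auto simp: pi_sec_def pi_base_def pi_mk_def\<close>)

lemma pi_secD:
  assumes "c \<in> Ob C" "z \<in> pi_sec c"
  shows "pi_base z \<in> sec Z c" "pi_fam z \<in> families c (pi_base z)" "pi_mk (pi_base z) (pi_fam z) = z"
  using assms by (auto simp: pi_sec_def)

lemma pi_ext:
  assumes c: "c \<in> Ob C" and z: "z \<in> pi_sec c" "z' \<in> pi_sec c" and e: "pi_base z = pi_base z'"
    and f: "\<And>f. f \<in> locus c (pi_base z') \<Longrightarrow> pi_fam z f = pi_fam z' f"
  shows "z = z'"
proof -
  have "pi_fam z \<in> PiE (locus c (pi_base z')) (\<lambda>f. sec b (src C f))" "pi_fam z' \<in> PiE (locus c (pi_base z')) (\<lambda>f. sec b (src C f))"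
    using pi_secD(2)[OF c z(1)] pi_secD(2)[OF c z(2)] e by (auto simp: families_def)
  then have "pi_fam z = pi_fam z'" using f by (rule PiE_ext)
  then show ?thesis using pi_secD(3)[OF c z(1)] pi_secD(3)[OF c z(2)] e by metis
qed

lemma pi_res [simp]:
  assumes h: "h \<in> Ar C" and z: "z \<in> pi_sec (tgt C h)"
  shows "pi_res h z \<in> pi_sec (src C h)" "pi_base (pi_res h z) = res Z h (pi_base z)"
    "f \<in> locus (src C h) (res Z h (pi_base z)) \<Longrightarrow> pi_fam (pi_res h z) f = pi_fam z (h \<cdot>\<^bsub>C\<^esub> f)"
proof -
  note d = pi_secD[OF tgt_Ob[OF h] z]
  note m = pi_mk[OF src_Ob[OF h] sheafD(2)[OF Z h d(1)] families_res[OF h d(1,2)]]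
  show "pi_res h z \<in> pi_sec (src C h)" "pi_base (pi_res h z) = res Z h (pi_base z)"
    "f \<in> locus (src C h) (res Z h (pi_base z)) \<Longrightarrow> pi_fam (pi_res h z) f = pi_fam z (h \<cdot>\<^bsub>C\<^esub> f)"
    unfolding pi_res_def by (simp_all add: m)
qed

definition Pi_sheaf :: "'u psh" where "Pi_sheaf = mk_psh pi_sec pi_res"

lemma Pi_sel [simp]: "c \<in> Ob C \<Longrightarrow> sec Pi_sheaf c = pi_sec c"
  "f \<in> Ar C \<Longrightarrow> a \<in> pi_sec (tgt C f) \<Longrightarrow> res Pi_sheaf f a = pi_res f a"
  by (auto simp: Pi_sheaf_def)

lemma Pi_presheaf: "presheaf C Pi_sheaf"
  unfolding Pi_sheaf_def
proof (rule mk_psh_presheaf)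
  fix c assume c: "c \<in> Ob C"
  have "pi_sec c = (\<Union>x \<in> sec Z c. pi_mk x ` families c x)" by (auto simp: pi_sec_def)
  moreover have "|\<Union>x \<in> sec Z c. pi_mk x ` families c x| <o |UNIV :: 'u set|"
    using sheafD(1)[OF Z c] by (intro card_of_UN_less[OF inacc] card_of_image_less card_families[OF c]) (auto simp: small_def)
  ultimately show "small (pi_sec c)" by (simp add: small_def)
  fix a assume a: "a \<in> pi_sec c"
  note d = pi_secD[OF c a]
  have i: "idn C c \<in> Ar C" "a \<in> pi_sec (tgt C (idn C c))" using c a by auto
  show "pi_res (idn C c) a = a"
  proof (rule pi_ext[OF c _ a])
    show "pi_res (idn C c) a \<in> pi_sec c" using pi_res(1)[OF i] c by simp
    show e: "pi_base (pi_res (idn C c) a) = pi_base a" using pi_res(2)[OF i] d sheafD(3)[OF Z c] by simp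
    fix f assume "f \<in> locus c (pi_base a)"
    then show "pi_fam (pi_res (idn C c) a) f = pi_fam a f"
      using pi_res(3)[OF i, of f] c d sheafD(3)[OF Z c] locusD[of f c] by simp
  qed
next
  fix f g a assume f: "f \<in> Ar C" and g: "g \<in> Ar C" "tgt C g = src C f" and a: "a \<in> pi_sec (tgt C f)"
  note d = pi_secD[OF tgt_Ob[OF f] a]
  have r: "pi_res f a \<in> pi_sec (tgt C g)" using f g a by simp
  have fg: "f \<cdot>\<^bsub>C\<^esub> g \<in> Ar C" "a \<in> pi_sec (tgt C (f \<cdot>\<^bsub>C\<^esub> g))" using f g a by auto
  show "pi_res (f \<cdot>\<^bsub>C\<^esub> g) a = pi_res g (pi_res f a)"
  proof (rule pi_ext[of "src C g"])
    show "pi_base (pi_res (f \<cdot>\<^bsub>C\<^esub> g) a) = pi_base (pi_res g (pi_res f a))"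
      using pi_res(2)[OF fg] pi_res(2)[OF g(1) r] pi_res(2)[OF f a] sheafD(4)[OF Z f g d(1)] by simp
    fix k assume "k \<in> locus (src C g) (pi_base (pi_res g (pi_res f a)))"
    then have k: "k \<in> locus (src C g) (res Z g (res Z f (pi_base a)))"
      using pi_res(2)[OF g(1) r] pi_res(2)[OF f a] by simp
    have x: "res Z f (pi_base a) \<in> sec Z (tgt C g)" using sheafD(2)[OF Z f d(1)] g by simp
    have k': "k \<in> Ar C" "tgt C k = src C g" "g \<cdot>\<^bsub>C\<^esub> k \<in> locus (src C f) (res Z f (pi_base a))"
      using k locus_res[OF g(1) x, of k] g by auto
    have "pi_fam (pi_res (f \<cdot>\<^bsub>C\<^esub> g) a) k = pi_fam a ((f \<cdot>\<^bsub>C\<^esub> g) \<cdot>\<^bsub>C\<^esub> k)"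
      using pi_res(3)[OF fg, of k] k f g sheafD(4)[OF Z f g d(1)] by simp
    also have "\<dots> = pi_fam (pi_res f a) (g \<cdot>\<^bsub>C\<^esub> k)"
      using pi_res(3)[OF f a k'(3)] k' f g by (simp add: assoc)
    also have "\<dots> = pi_fam (pi_res g (pi_res f a)) k"
      using pi_res(3)[OF g(1) r, of k] k pi_res(2)[OF f a] by simp
    finally show "pi_fam (pi_res (f \<cdot>\<^bsub>C\<^esub> g) a) k = pi_fam (pi_res g (pi_res f a)) k" .
  qed (use pi_res(1)[OF fg] pi_res(1)[OF g(1) r] f g in auto)
qed simp

text \<open>The bases \<open>x\<close> glue since \<open>Z\<close> is a sheaf. A family over the
  glued base takes values in the sheaf \<open>b\<close>, so its value at \<open>g\<close> is
  determined, and can be found, on the cover pulled back along \<open>g\<close>.\<close>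

lemma Pi_sheaf: "sheaf C J Pi_sheaf"
proof (rule sheafI[OF Pi_presheaf])
  fix c R z z' assume c: "c \<in> Ob C" "R \<in> J c" and z0: "z \<in> sec Pi_sheaf c" "z' \<in> sec Pi_sheaf c"
    and e: "\<And>f. f \<in> R \<Longrightarrow> res Pi_sheaf f z = res Pi_sheaf f z'"
  have z: "z \<in> pi_sec c" "z' \<in> pi_sec c" using z0 c by auto
  note d = pi_secD[OF c(1) z(1)] and d' = pi_secD[OF c(1) z(2)]
  have e': "pi_res f z = pi_res f z'" if "f \<in> R" for f using e[OF that] coverD(1,2)[OF c(2,1) that] z by simp
  have base: "pi_base z = pi_base z'"
  proof (rule sheaf_separated[OF Z c d(1) d'(1)])
    fix f assume f: "f \<in> R"
    show "res Z f (pi_base z) = res Z f (pi_base z')"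
      using pi_res(2)[of f z] pi_res(2)[of f z'] e'[OF f] coverD(1,2)[OF c(2,1) f] z by simp
  qed
  show "z = z'"
  proof (rule pi_ext[OF c(1) z base])
    fix g assume g: "g \<in> locus c (pi_base z')"
    note g' = locusD[OF g]
    have pg: "pull_sieve C g R \<in> J (src C g)" using cover_pull[OF c, of g] g' by simp
    show "pi_fam z g = pi_fam z' g"
    proof (rule sheaf_separated[OF b _ pg])
      show "pi_fam z g \<in> sec b (src C g)" "pi_fam z' g \<in> sec b (src C g)"
        using familiesD(1)[OF d(2), of g] familiesD(1)[OF d'(2) g] g base by auto
      fix h assume "h \<in> pull_sieve C g R"
      then have h: "h \<in> Ar C" "tgt C h = src C g" "g \<cdot>\<^bsub>C\<^esub> h \<in> R" by (auto simp: pull_sieve_def)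
      have gh: "g \<cdot>\<^bsub>C\<^esub> h \<in> Ar C" "tgt C (g \<cdot>\<^bsub>C\<^esub> h) = c" "src C (g \<cdot>\<^bsub>C\<^esub> h) = src C h" using g' h by auto
      have ghl: "g \<cdot>\<^bsub>C\<^esub> h \<in> locus c (pi_base z')" by (rule locus_cmp[OF d'(1) g h(1,2)])
      \<comment> \<open>The value of a family at an arrow of \<open>R\<close> is the value at the
        identity of its restriction along that arrow, and these restrictions agree by
        assumption.\<close>
      have il: "idn C (src C h) \<in> locus (src C h) (res Z (g \<cdot>\<^bsub>C\<^esub> h) (pi_base z'))"
        using locus_res[of "g \<cdot>\<^bsub>C\<^esub> h" "pi_base z'" "idn C (src C h)"] gh ghl h d' by simp
      have "pi_fam z (g \<cdot>\<^bsub>C\<^esub> h) = pi_fam z' (g \<cdot>\<^bsub>C\<^esub> h)"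
        using pi_res(3)[of "g \<cdot>\<^bsub>C\<^esub> h" z "idn C (src C h)"] pi_res(3)[of "g \<cdot>\<^bsub>C\<^esub> h" z' "idn C (src C h)"] gh z il e'[OF h(3)] base h by simp
      then show "res b h (pi_fam z g) = res b h (pi_fam z' g)"
        using familiesD(2)[OF d(2), of g h] familiesD(2)[OF d'(2) g, of h] g base h by simp
    qed (use g' in auto)
  qed
next
  fix c R y assume c: "c \<in> Ob C" "R \<in> J c" and y0: "\<And>f. f \<in> R \<Longrightarrow> y f \<in> sec Pi_sheaf (src C f)"
    and ym0: "\<And>f g. f \<in> R \<Longrightarrow> g \<in> Ar C \<Longrightarrow> tgt C g = src C f \<Longrightarrow> y (f \<cdot>\<^bsub>C\<^esub> g) = res Pi_sheaf g (y f)"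
  note R = coverD[OF c(2,1)]
  have y: "y f \<in> pi_sec (src C f)" if "f \<in> R" for f using y0[OF that] R(1)[OF that] by simp
  have ym: "y (f \<cdot>\<^bsub>C\<^esub> g) = pi_res g (y f)" if "f \<in> R" "g \<in> Ar C" "tgt C g = src C f" for f g
    using ym0[OF that] y[OF that(1)] that by simp
  have d: "pi_base (y f) \<in> sec Z (src C f)" "pi_fam (y f) \<in> families (src C f) (pi_base (y f))" if "f \<in> R" for f
    using pi_secD[OF _ y[OF that]] R(1)[OF that] by auto
  have "\<exists>!x. x \<in> sec Z c \<and> (\<forall>f \<in> R. res Z f x = pi_base (y f))"
    by (rule sheaf_glue[OF Z c]) (use d ym y in auto)
  then obtain x where x: "x \<in> sec Z c" "\<And>f. f \<in> R \<Longrightarrow> res Z f x = pi_base (y f)" by blast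
  have il: "idn C (src C f) \<in> locus (src C f) (pi_base (y f))" if "f \<in> R" "f \<in> locus c x" for f
    using that R(1)[OF that(1)] locusD[OF that(2)] sheafD(3)[OF Z _ d(1)[OF that(1)]] x(2)[OF that(1)] by (simp add: locus_idn)
  \<comment> \<open>The value that the glued family has to take at an arrow \<open>f\<close>
    belonging to both \<open>R\<close> and the locus.\<close>
  define v where "v f = pi_fam (y f) (idn C (src C f))" for f
  have v_in: "v f \<in> sec b (src C f)" if "f \<in> R" "f \<in> locus c x" for f
    using familiesD(1)[OF d(2)[OF that(1)] il[OF that]] R(1)[OF that(1)] by (simp add: v_def)
  have v_res: "v (f \<cdot>\<^bsub>C\<^esub> g) = pi_fam (y f) g" if f: "f \<in> R" and g: "g \<in> locus (src C f) (pi_base (y f))" for f g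
  proof -
    note g' = locusD[OF g]
    have fg: "f \<cdot>\<^bsub>C\<^esub> g \<in> R" using R(3)[OF f] g' by blast
    have "idn C (src C g) \<in> locus (src C g) (res Z g (pi_base (y f)))"
      using locus_res[of g "pi_base (y f)" "idn C (src C g)"] g' g d(1)[OF f] by simp
    then have "pi_fam (pi_res g (y f)) (idn C (src C g)) = pi_fam (y f) (g \<cdot>\<^bsub>C\<^esub> idn C (src C g))"
      using pi_res(3)[of g "y f"] g' y[OF f] by simp
    then show ?thesis using ym[OF f, of g] g' R(1)[OF f] by (simp add: v_def)
  qed
  have v_cmp: "v (f \<cdot>\<^bsub>C\<^esub> g) = res b g (v f)" if f: "f \<in> R" "f \<in> locus c x" and g: "g \<in> Ar C" "tgt C g = src C f" for f g
  proof -
    have "idn C (src C f) \<cdot>\<^bsub>C\<^esub> g = g" using g by simp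
    then have gl: "g \<in> locus (src C f) (pi_base (y f))" using locus_cmp[OF d(1)[OF f(1)] il[OF f] g(1)] g R(1)[OF f(1)] by simp
    show ?thesis
      using v_res[OF f(1) gl] familiesD(2)[OF d(2)[OF f(1)] il[OF f], of g] g R(1)[OF f(1)] by (simp add: v_def)
  qed
  \<comment> \<open>At an arbitrary \<open>g\<close> of the locus the value is glued from the values
    \<open>v\<close> over the cover pulled back along \<open>g\<close>.\<close>
  have "\<exists>a. a \<in> sec b (src C g) \<and> (\<forall>h \<in> pull_sieve C g R. res b h a = v (g \<cdot>\<^bsub>C\<^esub> h))" if g: "g \<in> locus c x" for g
  proof -
    note g' = locusD[OF g]
    have pg: "pull_sieve C g R \<in> J (src C g)" using cover_pull[OF c, of g] g' by simp
    have ex1: "\<exists>!a. a \<in> sec b (src C g) \<and> (\<forall>h \<in> pull_sieve C g R. res b h a = v (g \<cdot>\<^bsub>C\<^esub> h))"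
    proof (rule sheaf_glue[OF b _ pg])
      fix h assume "h \<in> pull_sieve C g R"
      then have h: "h \<in> Ar C" "tgt C h = src C g" "g \<cdot>\<^bsub>C\<^esub> h \<in> R" by (auto simp: pull_sieve_def)
      have l: "g \<cdot>\<^bsub>C\<^esub> h \<in> locus c x" by (rule locus_cmp[OF x(1) g h(1,2)])
      show "v (g \<cdot>\<^bsub>C\<^esub> h) \<in> sec b (src C h)" using v_in[OF h(3) l] g' h by simp
      fix k assume k: "k \<in> Ar C" "tgt C k = src C h"
      show "v (g \<cdot>\<^bsub>C\<^esub> (h \<cdot>\<^bsub>C\<^esub> k)) = res b k (v (g \<cdot>\<^bsub>C\<^esub> h))"
        using v_cmp[OF h(3) l k(1)] k g' h by (simp add: assoc)
    qed (use g' in simp)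
    then show ?thesis by blast
  qed
  then obtain \<tau>0 where t0: "\<And>g. g \<in> locus c x \<Longrightarrow> \<tau>0 g \<in> sec b (src C g)"
    "\<And>g h. g \<in> locus c x \<Longrightarrow> h \<in> pull_sieve C g R \<Longrightarrow> res b h (\<tau>0 g) = v (g \<cdot>\<^bsub>C\<^esub> h)" by metis
  have fam: "restrict \<tau>0 (locus c x) \<in> families c x"
    unfolding families_def
  proof (intro CollectI conjI ballI impI)
    fix f g assume f: "f \<in> locus c x" and g: "g \<in> Ar C" "tgt C g = src C f"
    note f' = locusD[OF f]
    have fg: "f \<cdot>\<^bsub>C\<^esub> g \<in> locus c x" by (rule locus_cmp[OF x(1) f g])
    have pg: "pull_sieve C (f \<cdot>\<^bsub>C\<^esub> g) R \<in> J (src C g)" using cover_pull[OF c, of "f \<cdot>\<^bsub>C\<^esub> g"] f' g by simp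
    have "\<tau>0 (f \<cdot>\<^bsub>C\<^esub> g) = res b g (\<tau>0 f)"
    proof (rule sheaf_separated[OF b _ pg])
      show "\<tau>0 (f \<cdot>\<^bsub>C\<^esub> g) \<in> sec b (src C g)" using t0(1)[OF fg] f' g by simp
      show "res b g (\<tau>0 f) \<in> sec b (src C g)" using sheafD(2)[OF b g(1)] t0(1)[OF f] g by simp
      fix h assume hp: "h \<in> pull_sieve C (f \<cdot>\<^bsub>C\<^esub> g) R"
      then have h: "h \<in> Ar C" "tgt C h = src C g" "f \<cdot>\<^bsub>C\<^esub> g \<cdot>\<^bsub>C\<^esub> h \<in> R" using f' g by (auto simp: pull_sieve_def)
      have gh: "g \<cdot>\<^bsub>C\<^esub> h \<in> pull_sieve C f R" using h f' g by (simp add: pull_sieve_def assoc)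
      have "res b h (res b g (\<tau>0 f)) = res b (g \<cdot>\<^bsub>C\<^esub> h) (\<tau>0 f)" using sheafD(4)[OF b g(1) h(1,2), of "\<tau>0 f"] t0(1)[OF f] g by simp
      also have "\<dots> = v (f \<cdot>\<^bsub>C\<^esub> g \<cdot>\<^bsub>C\<^esub> h)" using t0(2)[OF f gh] f' g h by (simp add: assoc)
      finally show "res b h (\<tau>0 (f \<cdot>\<^bsub>C\<^esub> g)) = res b h (res b g (\<tau>0 f))" using t0(2)[OF fg hp] by simp
    qed (use g in simp)
    then show "restrict \<tau>0 (locus c x) (f \<cdot>\<^bsub>C\<^esub> g) = res b g (restrict \<tau>0 (locus c x) f)" using f fg by simp
  qed (use t0(1) in auto)
  let ?z = "pi_mk x (restrict \<tau>0 (locus c x))"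
  note zz = pi_mk[OF c(1) x(1) fam]
  have "pi_res f ?z = y f" if f: "f \<in> R" for f
  proof (rule pi_ext[of "src C f"])
    have z': "?z \<in> pi_sec (tgt C f)" using zz R(2)[OF f] by simp
    note r = pi_res[OF R(1)[OF f] z']
    show "pi_res f ?z \<in> pi_sec (src C f)" by (rule r(1))
    show e: "pi_base (pi_res f ?z) = pi_base (y f)" using r(2) zz x(2)[OF f] by simp
    fix g assume g: "g \<in> locus (src C f) (pi_base (y f))"
    note g' = locusD[OF g]
    have fg: "f \<cdot>\<^bsub>C\<^esub> g \<in> locus c x" using locus_res[OF R(1)[OF f], of x g] x f R(2)[OF f] g by simp
    have fgR: "f \<cdot>\<^bsub>C\<^esub> g \<in> R" using R(3)[OF f] g' by blast
    have i: "idn C (src C g) \<in> pull_sieve C (f \<cdot>\<^bsub>C\<^esub> g) R" using g' R(1)[OF f] fgR by (simp add: pull_sieve_def assoc)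
    have "pi_fam (pi_res f ?z) g = \<tau>0 (f \<cdot>\<^bsub>C\<^esub> g)" using r(3)[of g] g zz x(2)[OF f] fg by simp
    also have "\<dots> = res b (idn C (src C g)) (\<tau>0 (f \<cdot>\<^bsub>C\<^esub> g))"
      using sheafD(3)[OF b, of "src C g" "\<tau>0 (f \<cdot>\<^bsub>C\<^esub> g)"] t0(1)[OF fg] g' R(1)[OF f] by simp
    also have "\<dots> = v (f \<cdot>\<^bsub>C\<^esub> g)" using t0(2)[OF fg i] g' R(1)[OF f] by (simp add: assoc)
    also have "\<dots> = pi_fam (y f) g" by (rule v_res[OF f g])
    finally show "pi_fam (pi_res f ?z) g = pi_fam (y f) g" .
  qed (use R(1)[OF f] y[OF f] in auto)
  then show "\<exists>a\<in>sec Pi_sheaf c. \<forall>f\<in>R. res Pi_sheaf f a = y f"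
    using zz c R(1,2) by (intro bexI[of _ ?z]) auto
qed

text \<open>The map \<open>z\<close> takes a section to its base and \<open>ev\<close> evaluates its
  family at the identity. A map \<open>f\<close> on the fibre of \<open>w\<close> over the point is
  transposed by letting the family of \<open>y\<close> at \<open>g\<close> be \<open>f\<close> of
  the restriction of \<open>y\<close> along \<open>g\<close>; evaluating at identities after
  restriction shows that there is no other choice.\<close>

lemma Sh_point_Pi: "\<exists>z p u ev. point_Pi H s b z p u ev"
proof -
  define z where "z = mk_map Pi_sheaf Z (\<lambda>c. pi_base)"
  have zh: "z \<in> hom H Pi_sheaf Z" unfolding z_def
    by (rule mk_map_hom[OF Pi_sheaf Z]) (use pi_secD in auto)
  have apz: "ap z c a = pi_base a" if "c \<in> Ob C" "a \<in> pi_sec c" for c a using that by (simp add: z_def)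
  obtain p u where pb: "is_pullback H z s p u" using Sh_pullback[OF zh s] by blast
  note P = pullbackD[OF pb]
  let ?Q = "src H p"
  have ph: "p \<in> hom H ?Q Pi_sheaf" and uh: "u \<in> hom H ?Q t" using P zh s by (auto simp: hom_iff)
  have Q: "sheaf C J ?Q" using hom_sheaf[OF ph] by blast
  have pin: "ap p c a \<in> pi_sec c" if "c \<in> Ob C" "a \<in> sec ?Q c" for c a using ap_in[OF ph that] that by simp
  have base: "pi_base (ap p c a) = pt c" if "c \<in> Ob C" "a \<in> sec ?Q c" for c a
    using ap_cmp[OF ph zh that] ap_cmp[OF uh s that] P(9) apz[OF that(1) pin[OF that]] pt_eq[OF that(1) ap_in[OF uh that]] by simp
  have il: "idn C c \<in> locus c (pt c)" if "c \<in> Ob C" for c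
    using that sheafD(3)[OF Z that pt_in[OF that]] by (simp add: locus_idn)
  \<comment> \<open>A section of the fibre has the global element as its base, so its locus is the
    maximal sieve and contains the identity.\<close>
  define ev where "ev = mk_map ?Q b (\<lambda>c a. pi_fam (ap p c a) (idn C c))"
  have pfam: "pi_fam (ap p c a) \<in> families c (pt c)" if "c \<in> Ob C" "a \<in> sec ?Q c" for c a
    using pi_secD(2)[OF that(1) pin[OF that]] base[OF that] by simp
  have evh: "ev \<in> hom H ?Q b"
    unfolding ev_def
  proof (rule mk_map_hom[OF Q b])
    fix c a assume ca: "c \<in> Ob C" "a \<in> sec ?Q c"
    then show "pi_fam (ap p c a) (idn C c) \<in> sec b c"
      using familiesD(1)[OF pfam[OF ca] il[OF ca(1)]] by simp
  next
    fix f a assume f: "f \<in> Ar C" and a: "a \<in> sec ?Q (tgt C f)"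
    note pa = pin[OF tgt_Ob[OF f] a] and ba = base[OF tgt_Ob[OF f] a]
    have r: "ap p (src C f) (res ?Q f a) = pi_res f (ap p (tgt C f) a)" using ap_nat[OF ph f a] f pa by simp
    have "pi_fam (pi_res f (ap p (tgt C f) a)) (idn C (src C f)) = pi_fam (ap p (tgt C f) a) (f \<cdot>\<^bsub>C\<^esub> idn C (src C f))"
      using pi_res(3)[OF f pa, of "idn C (src C f)"] ba pt_nat[OF f] il[OF src_Ob[OF f]] by simp
    also have "\<dots> = pi_fam (ap p (tgt C f) a) (idn C (tgt C f) \<cdot>\<^bsub>C\<^esub> f)" using f by simp
    also have "\<dots> = res b f (pi_fam (ap p (tgt C f) a) (idn C (tgt C f)))"
      using familiesD(2)[OF pfam[OF tgt_Ob[OF f] a] il[OF tgt_Ob[OF f]], of f] f by simp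
    finally show "pi_fam (ap p (src C f) (res ?Q f a)) (idn C (src C f)) = res b f (pi_fam (ap p (tgt C f) a) (idn C (tgt C f)))"
      unfolding r .
  qed
  have apev: "ap ev c a = pi_fam (ap p c a) (idn C c)" if "c \<in> Ob C" "a \<in> sec ?Q c" for c a
    using that by (simp add: ev_def)
  have UP: "\<exists>!k. k \<in> hom H (src H w) (src H z) \<and> z \<cdot>\<^bsub>H\<^esub> k = w \<and>
          (\<exists>l \<in> hom H (src H r) (src H p). p \<cdot>\<^bsub>H\<^esub> l = k \<cdot>\<^bsub>H\<^esub> r \<and> ev \<cdot>\<^bsub>H\<^esub> l = f)"
    if pbw: "is_pullback H w s r v" and f: "f \<in> hom H (src H r) b" for w r v f
  proof -
    note PW = pullbackD[OF pbw]
    let ?W = "src H w" and ?R = "src H r"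
    have wh: "w \<in> hom H ?W Z" and rh: "r \<in> hom H ?R ?W" and vh: "v \<in> hom H ?R t" using PW s by (auto simp: hom_iff)
    have W: "sheaf C J ?W" using hom_sheaf[OF wh] by blast
    have wr: "ap w c (ap r c a) = pt c" if "c \<in> Ob C" "a \<in> sec ?R c" for c a
      using ap_cmp[OF rh wh that] ap_cmp[OF vh s that] PW(9) pt_eq[OF that(1) ap_in[OF vh that]] by simp
    have el: "\<exists>!a. a \<in> sec ?R c \<and> ap r c a = y" if "c \<in> Ob C" "y \<in> sec ?W c" "ap w c y = pt c" for c y
    proof -
      have "\<exists>x. x \<in> sec t c" using pt_ex[OF that(1)] .
      then obtain x where x: "x \<in> sec t c" by blast
      have st: "sec t c = {x}" using Sh_terminal_singleton[OF t that(1)] x by auto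
      have "\<exists>!a. a \<in> sec ?R c \<and> ap r c a = y \<and> ap v c a = x"
        using Sh_pullback_element[OF pbw that(1), of y x] that x s pt_eq[OF that(1) x] by (simp add: hom_iff)
      moreover have "ap v c a = x" if "a \<in> sec ?R c" for a using ap_in[OF vh \<open>c \<in> Ob C\<close> that] st by simp
      ultimately show ?thesis by metis
    qed
    \<comment> \<open>The inverse of \<open>r\<close> on those sections of the domain of
      \<open>w\<close> that lie over the point.\<close>
    define ri where "ri c y = (THE a. a \<in> sec ?R c \<and> ap r c a = y)" for c y
    have ri: "ri c y \<in> sec ?R c" "ap r c (ri c y) = y" if "c \<in> Ob C" "y \<in> sec ?W c" "ap w c y = pt c" for c y
      using theI'[OF el[OF that]] by (auto simp: ri_def)
    have ri_eq: "ri c (ap r c a) = a" if "c \<in> Ob C" "a \<in> sec ?R c" for c a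
      using el[OF that(1) ap_in[OF rh that] wr[OF that]] ri[OF that(1) ap_in[OF rh that] wr[OF that]] that by blast
    have ri_res: "ri (src C g) (res ?W g y) = res ?R g (ri (tgt C g) y)"
      if g: "g \<in> Ar C" and y: "y \<in> sec ?W (tgt C g)" "ap w (tgt C g) y = pt (tgt C g)" for g y
    proof -
      note a = ri[OF tgt_Ob[OF g] y]
      have "res ?R g (ri (tgt C g) y) \<in> sec ?R (src C g)" using sheafD(2)[of ?R g] hom_sheaf[OF rh] g a by blast
      from ri_eq[OF src_Ob[OF g] this] show ?thesis using ap_nat[OF rh g a(1)] a(2) by simp
    qed
    have loc: "res ?W g y \<in> sec ?W (src C g)" "ap w (src C g) (res ?W g y) = pt (src C g)"
      if "c \<in> Ob C" "y \<in> sec ?W c" "g \<in> locus c (ap w c y)" for c y g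
      using locusD[OF that(3)] that sheafD(2)[OF W, of g y] ap_nat[OF wh, of g y] by auto
    \<comment> \<open>Along an arrow \<open>g\<close> of the locus the section \<open>y\<close>
      restricts into the fibre, where \<open>f\<close> can be applied.\<close>
    define fam where "fam c y = (\<lambda>g \<in> locus c (ap w c y). ap f (src C g) (ri (src C g) (res ?W g y)))" for c y
    have fam: "fam c y \<in> families c (ap w c y)" if cy: "c \<in> Ob C" "y \<in> sec ?W c" for c y
      unfolding families_def
    proof (intro CollectI conjI ballI impI)
      show "fam c y \<in> PiE (locus c (ap w c y)) (\<lambda>g. sec b (src C g))"
        unfolding fam_def using ri(1)[OF _ loc[OF cy]] ap_in[OF f] locusD by (intro restrict_PiE_iff[THEN iffD2]) auto
      fix g h assume g: "g \<in> locus c (ap w c y)" and h: "h \<in> Ar C" "tgt C h = src C g"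
      note g' = locusD[OF g]
      have gh: "g \<cdot>\<^bsub>C\<^esub> h \<in> locus c (ap w c y)" by (rule locus_cmp[OF ap_in[OF wh cy] g h])
      have rr: "res ?W (g \<cdot>\<^bsub>C\<^esub> h) y = res ?W h (res ?W g y)" using sheafD(4)[OF W _ h, of y] g' cy by simp
      have l: "res ?W g y \<in> sec ?W (tgt C h)" "ap w (tgt C h) (res ?W g y) = pt (tgt C h)" using loc[OF cy g] h by auto
      have "ap f (src C h) (ri (src C h) (res ?W h (res ?W g y))) = res b h (ap f (tgt C h) (ri (tgt C h) (res ?W g y)))"
        unfolding ri_res[OF h(1) l] using ap_nat[OF f h(1) ri(1)[OF tgt_Ob[OF h(1)] l]] .
      then show "fam c y (g \<cdot>\<^bsub>C\<^esub> h) = res b h (fam c y g)"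
        using g gh g' h by (simp add: fam_def rr)
    qed
    define k where "k = mk_map ?W Pi_sheaf (\<lambda>c y. pi_mk (ap w c y) (fam c y))"
    note mk = pi_mk[OF _ ap_in[OF wh] fam]
    have kh: "k \<in> hom H ?W Pi_sheaf"
      unfolding k_def
    proof (rule mk_map_hom[OF W Pi_sheaf])
      fix g y assume g: "g \<in> Ar C" and y: "y \<in> sec ?W (tgt C g)"
      have rin: "res ?W g y \<in> sec ?W (src C g)" using sheafD(2)[OF W g y] .
      note m1 = mk[OF tgt_Ob[OF g] tgt_Ob[OF g] y tgt_Ob[OF g] y] and m2 = mk[OF src_Ob[OF g] src_Ob[OF g] rin src_Ob[OF g] rin]
      have wn: "ap w (src C g) (res ?W g y) = res Z g (ap w (tgt C g) y)" by (rule ap_nat[OF wh g y])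
      have "pi_mk (ap w (src C g) (res ?W g y)) (fam (src C g) (res ?W g y)) = pi_res g (pi_mk (ap w (tgt C g) y) (fam (tgt C g) y))"
      proof (rule pi_ext[OF src_Ob[OF g] m2(1)])
        show "pi_res g (pi_mk (ap w (tgt C g) y) (fam (tgt C g) y)) \<in> pi_sec (src C g)" using pi_res(1)[OF g m1(1)] .
        show "pi_base (pi_mk (ap w (src C g) (res ?W g y)) (fam (src C g) (res ?W g y))) = pi_base (pi_res g (pi_mk (ap w (tgt C g) y) (fam (tgt C g) y)))"
          using m1 m2 pi_res(2)[OF g m1(1)] wn by simp
        fix h assume "h \<in> locus (src C g) (pi_base (pi_res g (pi_mk (ap w (tgt C g) y) (fam (tgt C g) y))))"
        then have h: "h \<in> locus (src C g) (res Z g (ap w (tgt C g) y))" using pi_res(2)[OF g m1(1)] m1 by simp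
        note h' = locusD[OF h]
        have gh: "g \<cdot>\<^bsub>C\<^esub> h \<in> locus (tgt C g) (ap w (tgt C g) y)" using locus_res[OF g ap_in[OF wh tgt_Ob[OF g] y], of h] h by simp
        have "pi_fam (pi_res g (pi_mk (ap w (tgt C g) y) (fam (tgt C g) y))) h = fam (tgt C g) y (g \<cdot>\<^bsub>C\<^esub> h)"
          using pi_res(3)[OF g m1(1), of h] m1 h by simp
        also have "\<dots> = fam (src C g) (res ?W g y) h"
          using gh h h' g y wn sheafD(4)[OF W g, of h y] by (simp add: fam_def)
        finally show "pi_fam (pi_mk (ap w (src C g) (res ?W g y)) (fam (src C g) (res ?W g y))) h =
            pi_fam (pi_res g (pi_mk (ap w (tgt C g) y) (fam (tgt C g) y))) h" using m2 by simp
      qed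
      then show "pi_mk (ap w (src C g) (res ?W g y)) (fam (src C g) (res ?W g y)) = res Pi_sheaf g (pi_mk (ap w (tgt C g) y) (fam (tgt C g) y))"
        using g m1 by simp
    qed (use mk in auto)
    have apk: "ap k c y = pi_mk (ap w c y) (fam c y)" if "c \<in> Ob C" "y \<in> sec ?W c" for c y using that by (simp add: k_def)
    have zk: "z \<cdot>\<^bsub>H\<^esub> k = w"
      by (rule ap_ext[OF H.cmp_hom[OF kh zh] wh]) (use mk in \<open>simp add: ap_cmp[OF kh zh] apk apz\<close>)
    have kr: "k \<cdot>\<^bsub>H\<^esub> r \<in> hom H ?R Pi_sheaf" by (rule H.cmp_hom[OF rh kh])
    have "z \<cdot>\<^bsub>H\<^esub> (k \<cdot>\<^bsub>H\<^esub> r) = s \<cdot>\<^bsub>H\<^esub> v"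
      using H.reassoc[OF zk, of r] kh zh rh PW by (simp add: hom_iff)
    then obtain l where l: "l \<in> hom H ?R ?Q" "p \<cdot>\<^bsub>H\<^esub> l = k \<cdot>\<^bsub>H\<^esub> r" "u \<cdot>\<^bsub>H\<^esub> l = v"
      using pullback_factor[OF pb, of "k \<cdot>\<^bsub>H\<^esub> r" ?R v] kr vh zh s by (auto simp: hom_iff)
    have "ev \<cdot>\<^bsub>H\<^esub> l = f"
    proof (rule ap_ext[OF H.cmp_hom[OF l(1) evh] f])
      fix c a assume ca: "c \<in> Ob C" "a \<in> sec ?R c"
      note ra = ap_in[OF rh ca] and la = ap_in[OF l(1) ca]
      have "ap p c (ap l c a) = pi_mk (ap w c (ap r c a)) (fam c (ap r c a))"
        using ap_cmp[OF l(1) ph ca] ap_cmp[OF rh kh ca] l(2) apk[OF ca(1) ra] by simp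
      then have "ap ev c (ap l c a) = fam c (ap r c a) (idn C c)"
        using apev[OF ca(1) la] mk[OF ca(1) ca(1) ra ca(1) ra] by simp
      also have "\<dots> = ap f c a"
        using il[OF ca(1)] wr[OF ca] ca sheafD(3)[OF W ca(1) ra] ri_eq[OF ca] by (simp add: fam_def)
      finally show "ap (ev \<cdot>\<^bsub>H\<^esub> l) c a = ap f c a" using ap_cmp[OF l(1) evh ca] by simp
    qed
    show ?thesis
    proof (rule ex1I[of _ k])
      show "k \<in> hom H ?W (src H z) \<and> z \<cdot>\<^bsub>H\<^esub> k = w \<and> (\<exists>l\<in>hom H ?R ?Q. p \<cdot>\<^bsub>H\<^esub> l = k \<cdot>\<^bsub>H\<^esub> r \<and> ev \<cdot>\<^bsub>H\<^esub> l = f)"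
        using kh zk l \<open>ev \<cdot>\<^bsub>H\<^esub> l = f\<close> zh by (auto simp: hom_iff)
      fix k' assume a: "k' \<in> hom H ?W (src H z) \<and> z \<cdot>\<^bsub>H\<^esub> k' = w \<and> (\<exists>l\<in>hom H ?R ?Q. p \<cdot>\<^bsub>H\<^esub> l = k' \<cdot>\<^bsub>H\<^esub> r \<and> ev \<cdot>\<^bsub>H\<^esub> l = f)"
      then obtain l' where kh': "k' \<in> hom H ?W Pi_sheaf" and zk': "z \<cdot>\<^bsub>H\<^esub> k' = w" and l': "l' \<in> hom H ?R ?Q" "p \<cdot>\<^bsub>H\<^esub> l' = k' \<cdot>\<^bsub>H\<^esub> r" "ev \<cdot>\<^bsub>H\<^esub> l' = f"
        using zh by (auto simp: hom_iff)
      show "k' = k"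
      proof (rule ap_ext[OF kh' kh])
        fix c y assume cy: "c \<in> Ob C" "y \<in> sec ?W c"
        note k'y = ap_in[OF kh' cy, unfolded Pi_sel(1)[OF cy(1)]]
        note m = mk[OF cy(1) cy cy]
        have bs: "pi_base (ap k' c y) = ap w c y" using ap_cmp[OF kh' zh cy] zk' apz[OF cy(1) k'y] by simp
        show "ap k' c y = ap k c y"
          unfolding apk[OF cy]
        proof (rule pi_ext[OF cy(1) k'y m(1)])
          show "pi_base (ap k' c y) = pi_base (pi_mk (ap w c y) (fam c y))" using bs m by simp
          \<comment> \<open>The value of the family of \<open>k' y\<close> at \<open>g\<close> is
            found by restricting along \<open>g\<close> and evaluating at the identity. There
            \<open>k'\<close> factors through \<open>l'\<close>, and the evaluation of
            \<open>l'\<close> is \<open>f\<close>.\<close>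
          fix g assume "g \<in> locus c (pi_base (pi_mk (ap w c y) (fam c y)))"
          then have g: "g \<in> locus c (ap w c y)" using m by simp
          note g' = locusD[OF g] and lg = loc[OF cy g]
          let ?a = "ri (src C g) (res ?W g y)"
          have gO: "src C g \<in> Ob C" using g' by auto
          note a = ri[OF gO lg]
          have kg: "ap k' (src C g) (res ?W g y) = pi_res g (ap k' c y)"
            using ap_nat[OF kh', of g y] g' cy k'y by simp
          have "ap p (src C g) (ap l' (src C g) ?a) = ap k' (src C g) (res ?W g y)"
            using ap_cmp[OF l'(1) ph gO a(1)] ap_cmp[OF rh kh' gO a(1)] l'(2) a(2) by simp
          then have "ap ev (src C g) (ap l' (src C g) ?a) = pi_fam (pi_res g (ap k' c y)) (idn C (src C g))"
            using apev[OF gO ap_in[OF l'(1) gO a(1)]] kg by simp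
          also have "\<dots> = pi_fam (ap k' c y) (g \<cdot>\<^bsub>C\<^esub> idn C (src C g))"
            using pi_res(3)[of g "ap k' c y" "idn C (src C g)"] g' k'y bs il[OF gO] by simp
          finally have "ap f (src C g) ?a = pi_fam (ap k' c y) g"
            using ap_cmp[OF l'(1) evh gO a(1)] l'(3) g' by simp
          then show "pi_fam (ap k' c y) g = pi_fam (pi_mk (ap w c y) (fam c y)) g" using m g by (simp add: fam_def)
        qed
      qed
    qed
  qed
  show ?thesis
    unfolding point_Pi_def using pb evh UP by blast
qed

end

end

section \<open>Left exactness of functors with a left adjoint\<close>

definition universal :: "('o,'a) cat \<Rightarrow> ('p,'b) cat \<Rightarrow> ('o,'a,'p,'b) ftr \<Rightarrow> 'p \<Rightarrow> 'o \<Rightarrow> 'b \<Rightarrow> bool" where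
  "universal C D F d L u \<longleftrightarrow> L \<in> Ob C \<and> u \<in> hom D d (fob F L) \<and>
     (\<forall>x \<in> Ob C. \<forall>m \<in> hom D d (fob F x). \<exists>!k. k \<in> hom C L x \<and> far F k \<cdot>\<^bsub>D\<^esub> u = m)"

lemma ex1_eqI: "\<exists>!x. P x \<Longrightarrow> P a \<Longrightarrow> P b \<Longrightarrow> a = b"
  by blast

text \<open>The value \<open>N\<close> at \<open>M\<close> of the left adjoint represents maps from
  \<open>M\<close> into the image of \<open>F\<close>. Cones from \<open>M\<close> thus correspond
  to cones from \<open>N\<close> in \<open>C\<close>, where \<open>L\<close> is a limit.\<close>

lemma left_exact_of_universal:
  assumes "ftor C D F" and un: "\<And>d. d \<in> Ob D \<Longrightarrow> \<exists>L u. universal C D F d L u"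
  shows "left_exact C D F"
  unfolding left_exact_def
proof (intro allI impI, elim conjE)
  interpret ftor C D F by fact
  fix J :: "(nat,nat) cat" and G L c
  assume "finite_category J" and G: "is_functor J C G" and lim: "is_limit J C G L c"
  then have J: "category J" by (simp add: finite_category_def)
  interpret G: ftor J C G by (rule ftorI[OF J C.category_axioms G])
  have L: "L \<in> Ob C" and c: "\<And>j. j \<in> Ob J \<Longrightarrow> c j \<in> Ar C \<and> src C (c j) = L \<and> tgt C (c j) = fob G j"
    and cu: "\<And>f. f \<in> Ar J \<Longrightarrow> far G f \<cdot>\<^bsub>C\<^esub> c (src J f) = c (tgt J f)"
    using lim by (auto simp: is_limit_def is_cone_def hom_iff)
  show "is_limit J D (cmp_ftr J F G) (fob F L) (\<lambda>j. far F (c j))"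
    unfolding is_limit_def
  proof (intro conjI allI impI)
    show "is_cone J D (cmp_ftr J F G) (fob F L) (\<lambda>j. far F (c j))"
      unfolding is_cone_def
    proof (intro conjI ballI)
      fix f assume f: "f \<in> Ar J"
      then show "far (cmp_ftr J F G) f \<cdot>\<^bsub>D\<^esub> far F (c (src J f)) = far F (c (tgt J f))"
        using far_cmp[of "c (src J f)" "far G f"] c[of "src J f"] by (simp add: cmp_far cu)
    qed (use L c in \<open>auto simp: hom_iff cmp_fob\<close>)
    fix M d assume cone: "is_cone J D (cmp_ftr J F G) M d"
    then have M: "M \<in> Ob D" and d: "\<And>j. j \<in> Ob J \<Longrightarrow> d j \<in> hom D M (fob F (fob G j))"
      and df: "\<And>f. f \<in> Ar J \<Longrightarrow> far F (far G f) \<cdot>\<^bsub>D\<^esub> d (src J f) = d (tgt J f)"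
      by (auto simp: is_cone_def cmp_fob cmp_far)
    obtain N u where "universal C D F M N u" using un[OF M] by blast
    then have N: "N \<in> Ob C" and u: "u \<in> Ar D" "src D u = M" "tgt D u = fob F N"
      and ex1: "\<And>x m. x \<in> Ob C \<Longrightarrow> m \<in> hom D M (fob F x) \<Longrightarrow> \<exists>!k. k \<in> hom C N x \<and> far F k \<cdot>\<^bsub>D\<^esub> u = m"
      by (auto simp: universal_def hom_iff)
    have ext: "k = k'" if "k \<in> hom C N x" "k' \<in> hom C N x" "far F k \<cdot>\<^bsub>D\<^esub> u = far F k' \<cdot>\<^bsub>D\<^esub> u" for k k' x
    proof -
      have "far F k' \<cdot>\<^bsub>D\<^esub> u \<in> hom D M (fob F x)" "x \<in> Ob C" using that u by (auto simp: hom_iff)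
      then show ?thesis using ex1 that by blast
    qed
    have "\<exists>k. k \<in> hom C N (fob G j) \<and> far F k \<cdot>\<^bsub>D\<^esub> u = d j" if "j \<in> Ob J" for j using ex1[OF _ d[OF that]] that by auto
    then obtain k where k: "\<And>j. j \<in> Ob J \<Longrightarrow> k j \<in> hom C N (fob G j)" "\<And>j. j \<in> Ob J \<Longrightarrow> far F (k j) \<cdot>\<^bsub>D\<^esub> u = d j" by metis
    have "is_cone J C G N k"
      unfolding is_cone_def
    proof (intro conjI ballI N)
      fix f assume f: "f \<in> Ar J"
      have a: "k (src J f) \<in> hom C N (fob G (src J f))" "k (tgt J f) \<in> hom C N (fob G (tgt J f))" using f k by auto
      show "far G f \<cdot>\<^bsub>C\<^esub> k (src J f) = k (tgt J f)"
      proof (rule ext)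
        show "far F (far G f \<cdot>\<^bsub>C\<^esub> k (src J f)) \<cdot>\<^bsub>D\<^esub> u = far F (k (tgt J f)) \<cdot>\<^bsub>D\<^esub> u"
          using a f u df[OF f] k(2)[of "src J f"] k(2)[of "tgt J f"] by (simp add: far_cmp hom_iff D.assoc)
      qed (use a f in \<open>auto simp: hom_iff\<close>)
    qed (rule k(1))
    then have h1: "\<exists>!h. h \<in> hom C N L \<and> (\<forall>j\<in>Ob J. c j \<cdot>\<^bsub>C\<^esub> h = k j)" using lim unfolding is_limit_def by blast
    then obtain h where h: "h \<in> hom C N L" "\<And>j. j \<in> Ob J \<Longrightarrow> c j \<cdot>\<^bsub>C\<^esub> h = k j" by blast
    show "\<exists>!h. h \<in> hom D M (fob F L) \<and> (\<forall>j\<in>Ob J. far F (c j) \<cdot>\<^bsub>D\<^esub> h = d j)"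
    proof (rule ex1I[of _ "far F h \<cdot>\<^bsub>D\<^esub> u"], intro conjI ballI)
      show "far F h \<cdot>\<^bsub>D\<^esub> u \<in> hom D M (fob F L)" using h u by (auto simp: hom_iff)
      fix j assume j: "j \<in> Ob J"
      have "far F (c j) \<cdot>\<^bsub>D\<^esub> (far F h \<cdot>\<^bsub>D\<^esub> u) = far F (c j \<cdot>\<^bsub>C\<^esub> h) \<cdot>\<^bsub>D\<^esub> u"
        using h(1) u c[OF j] by (simp add: far_cmp D.assoc hom_iff)
      then show "far F (c j) \<cdot>\<^bsub>D\<^esub> (far F h \<cdot>\<^bsub>D\<^esub> u) = d j" using h(2)[OF j] k(2)[OF j] by simp
    next
      fix l assume l: "l \<in> hom D M (fob F L) \<and> (\<forall>j\<in>Ob J. far F (c j) \<cdot>\<^bsub>D\<^esub> l = d j)"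
      obtain n where n: "n \<in> hom C N L" "far F n \<cdot>\<^bsub>D\<^esub> u = l" using ex1[OF L] l by blast
      have "c j \<cdot>\<^bsub>C\<^esub> n = k j" if j: "j \<in> Ob J" for j
      proof (rule ext[of _ "fob G j"])
        have "far F (c j \<cdot>\<^bsub>C\<^esub> n) \<cdot>\<^bsub>D\<^esub> u = far F (c j) \<cdot>\<^bsub>D\<^esub> (far F n \<cdot>\<^bsub>D\<^esub> u)"
          using n(1) u c[OF j] by (simp add: far_cmp D.assoc hom_iff)
        then show "far F (c j \<cdot>\<^bsub>C\<^esub> n) \<cdot>\<^bsub>D\<^esub> u = far F (k j) \<cdot>\<^bsub>D\<^esub> u" using l k(2)[OF j] n j by simp
      qed (use n c[OF j] k(1)[OF j] in \<open>auto simp: hom_iff\<close>)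
      then have "n = h" using h1 h n by blast
      then show "l = far F h \<cdot>\<^bsub>D\<^esub> u" using n by simp
    qed
  qed
qed

subsection \<open>The category of arrows\<close>

text \<open>The square from \<open>v\<close> to \<open>w\<close> with \<open>a\<close> between the
  domains and \<open>b\<close> between the codomains. The arrows \<open>v\<close> and
  \<open>w\<close> are part of the code so that source and target can be read off.\<close>

definition sq :: "'u \<Rightarrow> 'u \<Rightarrow> 'u \<Rightarrow> 'u \<Rightarrow> 'u" where
  "sq v w a b = pair_code (pair_code (v, w), pair_code (a, b))"

definition sq_src :: "'u \<Rightarrow> 'u" where "sq_src m = fst (pair_decode (fst (pair_decode m)))"
definition sq_tgt :: "'u \<Rightarrow> 'u" where "sq_tgt m = snd (pair_decode (fst (pair_decode m)))"
definition sq_dom :: "'u \<Rightarrow> 'u" where "sq_dom m = fst (pair_decode (snd (pair_decode m)))"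
definition sq_cod :: "'u \<Rightarrow> 'u" where "sq_cod m = snd (pair_decode (snd (pair_decode m)))"

definition arrow_cat :: "('u,'u) cat \<Rightarrow> ('u,'u) cat" where
  "arrow_cat B = \<lparr>Ob = Ar B,
     Ar = {sq v w a b | v w a b. v \<in> Ar B \<and> w \<in> Ar B \<and> a \<in> hom B (src B v) (src B w) \<and> b \<in> hom B (tgt B v) (tgt B w) \<and>
        b \<cdot>\<^bsub>B\<^esub> v = w \<cdot>\<^bsub>B\<^esub> a},
     src = sq_src, tgt = sq_tgt,
     idn = (\<lambda>v. sq v v (idn B (src B v)) (idn B (tgt B v))),
     cmp = (\<lambda>n m. sq (sq_src m) (sq_tgt n) (sq_dom n \<cdot>\<^bsub>B\<^esub> sq_dom m) (sq_cod n \<cdot>\<^bsub>B\<^esub> sq_cod m))\<rparr>"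

text \<open>\<open>dom_ftr\<close> and \<open>cod_ftr\<close> are to be the inverse images of the
  two inclusions of \<open>B\<close> into the tensor.\<close>

definition dom_ftr :: "('u,'u) cat \<Rightarrow> ('u,'u,'u,'u) ftr" where
  "dom_ftr B = \<lparr>fob = (\<lambda>v \<in> Ar B. src B v), far = (\<lambda>m \<in> Ar (arrow_cat B). sq_dom m)\<rparr>"

definition cod_ftr :: "('u,'u) cat \<Rightarrow> ('u,'u,'u,'u) ftr" where
  "cod_ftr B = \<lparr>fob = (\<lambda>v \<in> Ar B. tgt B v), far = (\<lambda>m \<in> Ar (arrow_cat B). sq_cod m)\<rparr>"

locale arrow_category = B: category B for B :: "('u,'u) cat" +
  assumes inf: "infinite (UNIV :: 'u set)"
begin

abbreviation "T \<equiv> arrow_cat B"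

lemma decode [simp]: "pair_decode (pair_code z) = (z :: 'u \<times> 'u)"
  unfolding pair_decode_def using inj_pair_code[OF inf] by (simp add: inv_f_f)

lemma sq_sel [simp]: "sq_src (sq v w a b) = (v::'u)" "sq_tgt (sq v w a b) = w" "sq_dom (sq v w a b) = a" "sq_cod (sq v w a b) = b"
  by (auto simp: sq_def sq_src_def sq_tgt_def sq_dom_def sq_cod_def)

lemma T_sel [simp]:
  "Ob T = Ar B" "src T (sq v w a b) = v" "tgt T (sq v w a b) = w"
  "sq v w a b \<in> Ar T \<longleftrightarrow> v \<in> Ar B \<and> w \<in> Ar B \<and> a \<in> hom B (src B v) (src B w) \<and> b \<in> hom B (tgt B v) (tgt B w) \<and> b \<cdot>\<^bsub>B\<^esub> v = w \<cdot>\<^bsub>B\<^esub> a"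
  "sq_dom (n \<cdot>\<^bsub>T\<^esub> m) = sq_dom n \<cdot>\<^bsub>B\<^esub> sq_dom m" "sq_cod (n \<cdot>\<^bsub>T\<^esub> m) = sq_cod n \<cdot>\<^bsub>B\<^esub> sq_cod m"
  "sq_dom (idn T v) = idn B (src B v)" "sq_cod (idn T v) = idn B (tgt B v)"
  by (auto simp: arrow_cat_def) (metis sq_sel)+

lemma T_Ar:
  assumes "m \<in> Ar T"
  shows "src T m \<in> Ar B" "tgt T m \<in> Ar B" "sq_dom m \<in> Ar B" "src B (sq_dom m) = src B (src T m)" "tgt B (sq_dom m) = src B (tgt T m)"
    "sq_cod m \<in> Ar B" "src B (sq_cod m) = tgt B (src T m)" "tgt B (sq_cod m) = tgt B (tgt T m)"
    "sq_cod m \<cdot>\<^bsub>B\<^esub> src T m = tgt T m \<cdot>\<^bsub>B\<^esub> sq_dom m" "sq (src T m) (tgt T m) (sq_dom m) (sq_cod m) = m"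
proof -
  obtain v w a b where m: "m = sq v w a b" using assms by (auto simp: arrow_cat_def)
  show "src T m \<in> Ar B" "tgt T m \<in> Ar B" "sq_dom m \<in> Ar B" "src B (sq_dom m) = src B (src T m)" "tgt B (sq_dom m) = src B (tgt T m)"
    "sq_cod m \<in> Ar B" "src B (sq_cod m) = tgt B (src T m)" "tgt B (sq_cod m) = tgt B (tgt T m)"
    "sq_cod m \<cdot>\<^bsub>B\<^esub> src T m = tgt T m \<cdot>\<^bsub>B\<^esub> sq_dom m" "sq (src T m) (tgt T m) (sq_dom m) (sq_cod m) = m"
    using assms unfolding m T_sel sq_sel hom_iff by auto
qed

lemma sq_hom: "v \<in> Ar B \<Longrightarrow> w \<in> Ar B \<Longrightarrow> a \<in> hom B (src B v) (src B w) \<Longrightarrow> b \<in> hom B (tgt B v) (tgt B w) \<Longrightarrow> b \<cdot>\<^bsub>B\<^esub> v = w \<cdot>\<^bsub>B\<^esub> a \<Longrightarrow>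
   sq v w a b \<in> hom T v w"
  by (simp add: hom_iff)

lemma sq_ext: "m \<in> Ar T \<Longrightarrow> n \<in> Ar T \<Longrightarrow> src T m = src T n \<Longrightarrow> tgt T m = tgt T n \<Longrightarrow> sq_dom m = sq_dom n \<Longrightarrow> sq_cod m = sq_cod n \<Longrightarrow> m = n"
  using T_Ar(10) by metis

sublocale T: category T
proof
  fix x assume "x \<in> Ob T"
  then have x: "x \<in> Ar B" by simp
  have "idn T x = sq x x (idn B (src B x)) (idn B (tgt B x))" by (simp add: arrow_cat_def)
  then show "idn T x \<in> hom T x x" using x by (simp add: hom_iff)
next
  fix f g x y z assume "f \<in> hom T x y" "g \<in> hom T y z"
  then have f: "f \<in> Ar T" "src T f = x" "tgt T f = y" and g: "g \<in> Ar T" "src T g = y" "tgt T g = z" by (auto simp: hom_iff)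
  note F = T_Ar[OF f(1), unfolded f] and G = T_Ar[OF g(1), unfolded g]
  have "g \<cdot>\<^bsub>T\<^esub> f = sq x z (sq_dom g \<cdot>\<^bsub>B\<^esub> sq_dom f) (sq_cod g \<cdot>\<^bsub>B\<^esub> sq_cod f)"
    using f g by (simp add: arrow_cat_def)
  moreover have "(sq_cod g \<cdot>\<^bsub>B\<^esub> sq_cod f) \<cdot>\<^bsub>B\<^esub> x = z \<cdot>\<^bsub>B\<^esub> (sq_dom g \<cdot>\<^bsub>B\<^esub> sq_dom f)"
    using F(1-8) G(1-8) F(9) B.reassoc[OF G(9), of "sq_dom f"] by (simp add: B.assoc)
  ultimately show "g \<cdot>\<^bsub>T\<^esub> f \<in> hom T x z" using F(1-8) G(1-8) by (simp add: hom_iff)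
next
  fix f x y assume "f \<in> hom T x y"
  then have f: "f \<in> Ar T" "src T f = x" "tgt T f = y" by (auto simp: hom_iff)
  note F = T_Ar[OF f(1), unfolded f]
  show "idn T y \<cdot>\<^bsub>T\<^esub> f = f" using F f by (simp add: arrow_cat_def)
  show "f \<cdot>\<^bsub>T\<^esub> idn T x = f" using F f by (simp add: arrow_cat_def)
next
  fix f g h w x y z assume "f \<in> hom T w x" "g \<in> hom T x y" "h \<in> hom T y z"
  then have f: "f \<in> Ar T" "src T f = w" "tgt T f = x" and g: "g \<in> Ar T" "src T g = x" "tgt T g = y"
    and h: "h \<in> Ar T" "src T h = y" "tgt T h = z" by (auto simp: hom_iff)
  show "h \<cdot>\<^bsub>T\<^esub> g \<cdot>\<^bsub>T\<^esub> f = h \<cdot>\<^bsub>T\<^esub> (g \<cdot>\<^bsub>T\<^esub> f)"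
    using T_Ar[OF f(1), unfolded f] T_Ar[OF g(1), unfolded g] T_Ar[OF h(1), unfolded h]
    by (simp add: arrow_cat_def B.assoc)
next
  fix f assume "f \<in> Ar T" then show "src T f \<in> Ob T" "tgt T f \<in> Ob T" using T_Ar by auto
qed

lemma ftr_sel [simp]: "v \<in> Ar B \<Longrightarrow> fob (dom_ftr B) v = src B v" "v \<in> Ar B \<Longrightarrow> fob (cod_ftr B) v = tgt B v"
  "m \<in> Ar T \<Longrightarrow> far (dom_ftr B) m = sq_dom m" "m \<in> Ar T \<Longrightarrow> far (cod_ftr B) m = sq_cod m"
  by (auto simp: dom_ftr_def cod_ftr_def)

sublocale dom: ftor T B "dom_ftr B"
  by (rule ftorI[OF T.category_axioms B.category_axioms functorI[OF T.category_axioms]])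
    (auto simp: hom_iff T_Ar, auto simp: dom_ftr_def)

sublocale cod: ftor T B "cod_ftr B"
  by (rule ftorI[OF T.category_axioms B.category_axioms functorI[OF T.category_axioms]])
    (auto simp: hom_iff T_Ar, auto simp: cod_ftr_def)

text \<open>The left adjoint takes \<open>x\<close> to its identity arrow.\<close>

lemma dom_left_exact: "left_exact T B (dom_ftr B)"
proof (rule left_exact_of_universal[OF dom.ftor_axioms])
  fix x assume x: "x \<in> Ob B"
  have "universal T B (dom_ftr B) x (idn B x) (idn B x)"
    unfolding universal_def
  proof (intro conjI ballI)
    fix v m assume "v \<in> Ob T" and m: "m \<in> hom B x (fob (dom_ftr B) v)"
    then have v: "v \<in> Ar B" by simp
    let ?k = "sq (idn B x) v m (v \<cdot>\<^bsub>B\<^esub> m)"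
    have k: "?k \<in> hom T (idn B x) v" using m v x by (auto simp: hom_iff)
    show "\<exists>!k. k \<in> hom T (idn B x) v \<and> far (dom_ftr B) k \<cdot>\<^bsub>B\<^esub> idn B x = m"
    proof (rule ex1I[of _ ?k])
      show "?k \<in> hom T (idn B x) v \<and> far (dom_ftr B) ?k \<cdot>\<^bsub>B\<^esub> idn B x = m" using k m v x by (auto simp: hom_iff)
      fix k assume "k \<in> hom T (idn B x) v \<and> far (dom_ftr B) k \<cdot>\<^bsub>B\<^esub> idn B x = m"
      then have k': "k \<in> Ar T" "src T k = idn B x" "tgt T k = v" "far (dom_ftr B) k \<cdot>\<^bsub>B\<^esub> idn B x = m" by (auto simp: hom_iff)
      note K = T_Ar[OF k'(1), unfolded k']
      have "sq_dom k = m" using k'(4) K x v k'(1) by simp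
      moreover have "sq_cod k = v \<cdot>\<^bsub>B\<^esub> m" using K(9) K(1-8) x v calculation by simp
      ultimately show "k = ?k" using K(10) by simp
    qed
  qed (use x in \<open>auto simp: hom_iff\<close>)
  then show "\<exists>L u. universal T B (dom_ftr B) x L u" by blast
qed

text \<open>The left adjoint takes \<open>x\<close> to the arrow from the initial object.\<close>

lemma cod_left_exact:
  assumes i: "initial_in B i"
  shows "left_exact T B (cod_ftr B)"
proof (rule left_exact_of_universal[OF cod.ftor_axioms])
  fix x assume x: "x \<in> Ob B"
  have iO: "i \<in> Ob B" using i by (simp add: initial_in_def)
  have ieq: "f = g" if "f \<in> hom B i y" "g \<in> hom B i y" for f g y
    using i that B.hom_ObD unfolding initial_in_def by blast
  obtain o' where o: "o' \<in> Ar B" "src B o' = i" "tgt B o' = x" using i x unfolding initial_in_def hom_iff by blast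
  have "universal T B (cod_ftr B) x o' (idn B x)"
    unfolding universal_def
  proof (intro conjI ballI)
    fix v m assume "v \<in> Ob T" and m: "m \<in> hom B x (fob (cod_ftr B) v)"
    then have v: "v \<in> Ar B" by simp
    obtain z where z: "z \<in> Ar B" "src B z = i" "tgt B z = src B v" using i v unfolding initial_in_def hom_iff by (metis B.src_Ob)
    let ?k = "sq o' v z m"
    have "m \<cdot>\<^bsub>B\<^esub> o' = v \<cdot>\<^bsub>B\<^esub> z" by (rule ieq[of _ "tgt B v"]) (use m o v z in \<open>auto simp: hom_iff\<close>)
    then have k: "?k \<in> hom T o' v" using m v x o z by (auto simp: hom_iff)
    show "\<exists>!k. k \<in> hom T o' v \<and> far (cod_ftr B) k \<cdot>\<^bsub>B\<^esub> idn B x = m"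
    proof (rule ex1I[of _ ?k])
      have "far (cod_ftr B) ?k = m" using k by (simp add: hom_iff del: T_sel)
      then show "?k \<in> hom T o' v \<and> far (cod_ftr B) ?k \<cdot>\<^bsub>B\<^esub> idn B x = m" using k m x by (auto simp: hom_iff)
      fix k assume "k \<in> hom T o' v \<and> far (cod_ftr B) k \<cdot>\<^bsub>B\<^esub> idn B x = m"
      then have k': "k \<in> Ar T" "src T k = o'" "tgt T k = v" "far (cod_ftr B) k \<cdot>\<^bsub>B\<^esub> idn B x = m" by (auto simp: hom_iff)
      note K = T_Ar[OF k'(1), unfolded k']
      have "sq_cod k = m" using k'(4) K(1-8) x v k'(1) o by simp
      moreover have "sq_dom k = z" by (rule ieq[of _ "src B v"]) (use K(1-8) o z in \<open>auto simp: hom_iff\<close>)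
      ultimately show "k = ?k" using K(10) by simp
    qed
  qed (use x o in \<open>auto simp: hom_iff\<close>)
  then show "\<exists>L u. universal T B (cod_ftr B) x L u" by blast
qed

text \<open>The right adjoint takes \<open>b\<close> to the arrow into the terminal object.\<close>

lemma dom_couniversal:
  assumes t: "terminal_in B t" and b: "b \<in> Ob B"
  shows "\<exists>R e. couniversal T B (dom_ftr B) b R e"
proof -
  obtain o' where o: "o' \<in> Ar B" "src B o' = b" "tgt B o' = t" using terminal_in_ex[OF t b] by (auto simp: hom_iff)
  have teq: "f = g" if "f \<in> hom B x t" "g \<in> hom B x t" for f g x
    using terminal_in_unique[OF t _ that] B.hom_ObD[OF that(1)] by blast
  have "couniversal T B (dom_ftr B) b o' (idn B b)"
    unfolding couniversal_def
  proof (intro conjI ballI)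
    fix v m assume "v \<in> Ob T" and m: "m \<in> hom B (fob (dom_ftr B) v) b"
    then have v: "v \<in> Ar B" by simp
    obtain z where z: "z \<in> Ar B" "src B z = tgt B v" "tgt B z = t" using terminal_in_ex[OF t, of "tgt B v"] v by (auto simp: hom_iff)
    let ?k = "sq v o' m z"
    have "z \<cdot>\<^bsub>B\<^esub> v = o' \<cdot>\<^bsub>B\<^esub> m" by (rule teq[of _ "src B v"]) (use m o v z in \<open>auto simp: hom_iff\<close>)
    then have k: "?k \<in> hom T v o'" using m v o z by (auto simp: hom_iff)
    show "\<exists>!k. k \<in> hom T v o' \<and> idn B b \<cdot>\<^bsub>B\<^esub> far (dom_ftr B) k = m"
    proof (rule ex1I[of _ ?k])
      have "far (dom_ftr B) ?k = m" using k by (simp add: hom_iff del: T_sel)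
      then show "?k \<in> hom T v o' \<and> idn B b \<cdot>\<^bsub>B\<^esub> far (dom_ftr B) ?k = m" using k m b by (auto simp: hom_iff)
      fix k assume "k \<in> hom T v o' \<and> idn B b \<cdot>\<^bsub>B\<^esub> far (dom_ftr B) k = m"
      then have k': "k \<in> Ar T" "src T k = v" "tgt T k = o'" "idn B b \<cdot>\<^bsub>B\<^esub> far (dom_ftr B) k = m" by (auto simp: hom_iff)
      note K = T_Ar[OF k'(1), unfolded k']
      have "sq_dom k = m" using k'(4) K(1-8) b v k'(1) o by simp
      moreover have "sq_cod k = z" by (rule teq[of _ "tgt B v"]) (use K(1-8) o z in \<open>auto simp: hom_iff\<close>)
      ultimately show "k = ?k" using K(10) by simp
    qed
  qed (use b o in \<open>auto simp: hom_iff\<close>)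
  then show ?thesis by blast
qed

text \<open>The right adjoint takes \<open>b\<close> to its identity arrow.\<close>

lemma cod_couniversal:
  assumes b: "b \<in> Ob B"
  shows "\<exists>R e. couniversal T B (cod_ftr B) b R e"
proof -
  have "couniversal T B (cod_ftr B) b (idn B b) (idn B b)"
    unfolding couniversal_def
  proof (intro conjI ballI)
    fix v m assume "v \<in> Ob T" and m: "m \<in> hom B (fob (cod_ftr B) v) b"
    then have v: "v \<in> Ar B" by simp
    let ?k = "sq v (idn B b) (m \<cdot>\<^bsub>B\<^esub> v) m"
    have k: "?k \<in> hom T v (idn B b)" using m v b by (auto simp: hom_iff)
    show "\<exists>!k. k \<in> hom T v (idn B b) \<and> idn B b \<cdot>\<^bsub>B\<^esub> far (cod_ftr B) k = m"
    proof (rule ex1I[of _ ?k])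
      have "far (cod_ftr B) ?k = m" using k by (simp add: hom_iff del: T_sel)
      then show "?k \<in> hom T v (idn B b) \<and> idn B b \<cdot>\<^bsub>B\<^esub> far (cod_ftr B) ?k = m" using k m b by (auto simp: hom_iff)
      fix k assume "k \<in> hom T v (idn B b) \<and> idn B b \<cdot>\<^bsub>B\<^esub> far (cod_ftr B) k = m"
      then have k': "k \<in> Ar T" "src T k = v" "tgt T k = idn B b" "idn B b \<cdot>\<^bsub>B\<^esub> far (cod_ftr B) k = m" by (auto simp: hom_iff)
      note K = T_Ar[OF k'(1), unfolded k']
      have "sq_cod k = m" using k'(4) K(1-8) b v k'(1) by simp
      moreover have "sq_dom k = m \<cdot>\<^bsub>B\<^esub> v" using K(9) K(1-8) b v calculation by simp
      ultimately show "k = ?k" using K(10) by simp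
    qed
  qed (use b in \<open>auto simp: hom_iff\<close>)
  then show ?thesis by blast
qed

end

subsection \<open>Geometric morphisms out of an arrow category\<close>

locale arrow_transf = arrow_category B + G: ftor D B G + G': ftor D B G'
  for B :: "('u,'u) cat" and D :: "('u,'u) cat" and G G' +
  fixes \<sigma>
  assumes nt: "nat_trans D B G G' \<sigma>"
begin

lemma sig [simp]: "d \<in> Ob D \<Longrightarrow> \<sigma> d \<in> Ar B" "d \<in> Ob D \<Longrightarrow> src B (\<sigma> d) = fob G d" "d \<in> Ob D \<Longrightarrow> tgt B (\<sigma> d) = fob G' d"
  using nt by (auto simp: nat_trans_def hom_iff)

lemma sig_nat: "f \<in> Ar D \<Longrightarrow> \<sigma> (tgt D f) \<cdot>\<^bsub>B\<^esub> far G f = far G' f \<cdot>\<^bsub>B\<^esub> \<sigma> (src D f)"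
  using nt by (auto simp: nat_trans_def)

definition pairing :: "('u,'u,'u,'u) ftr" where
  "pairing = \<lparr>fob = (\<lambda>d \<in> Ob D. \<sigma> d),
     far = (\<lambda>f \<in> Ar D. sq (\<sigma> (src D f)) (\<sigma> (tgt D f)) (far G f) (far G' f))\<rparr>"

lemma pairing_sel [simp]: "d \<in> Ob D \<Longrightarrow> fob pairing d = \<sigma> d"
  "f \<in> Ar D \<Longrightarrow> far pairing f = sq (\<sigma> (src D f)) (\<sigma> (tgt D f)) (far G f) (far G' f)"
  by (auto simp: pairing_def)

lemma pairing_Ar [simp]: "f \<in> Ar D \<Longrightarrow> sq (\<sigma> (src D f)) (\<sigma> (tgt D f)) (far G f) (far G' f) \<in> Ar T"
  by (auto simp: hom_iff sig_nat)

sublocale pairing: ftor D T pairing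
proof (rule ftorI[OF G.C.category_axioms T.category_axioms functorI[OF G.C.category_axioms]])
  fix x assume x: "x \<in> Ob D"
  then show "far pairing (idn D x) = idn T (fob pairing x)"
    by (simp add: arrow_cat_def)
next
  fix f g x y z assume "f \<in> hom D x y" "g \<in> hom D y z"
  then show "far pairing (g \<cdot>\<^bsub>D\<^esub> f) = far pairing g \<cdot>\<^bsub>T\<^esub> far pairing f"
    by (auto simp: hom_iff arrow_cat_def G.far_cmp G'.far_cmp)
qed (auto simp: hom_iff sig_nat, auto simp: pairing_def)

text \<open>The two sides of a map into \<open>\<sigma> L\<close> come separately from the limits of
  \<open>G\<close> and of \<open>G'\<close>. That they form a square is an equation between maps
  into the limit at \<open>G' L\<close>, so it can be checked on the components.\<close>

lemma pairing_left_exact: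
  assumes lex: "left_exact D B G" "left_exact D B G'"
  shows "left_exact D T pairing"
  unfolding left_exact_def
proof (intro allI impI, elim conjE)
  fix J :: "(nat,nat) cat" and K L c
  assume fin: "finite_category J" and K: "is_functor J D K" and lim: "is_limit J D K L c"
  then have J: "category J" by (simp add: finite_category_def)
  interpret K: ftor J D K by (rule ftorI[OF J G.C.category_axioms K])
  have L: "L \<in> Ob D" and c: "\<And>j. j \<in> Ob J \<Longrightarrow> c j \<in> Ar D \<and> src D (c j) = L \<and> tgt D (c j) = fob K j"
    using lim by (auto simp: is_limit_def is_cone_def hom_iff)
  have l0: "is_limit J B (cmp_ftr J G K) (fob G L) (\<lambda>j. far G (c j))" and l1: "is_limit J B (cmp_ftr J G' K) (fob G' L) (\<lambda>j. far G' (c j))"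
    using lex fin K lim unfolding left_exact_def by blast+
  have cn: "\<sigma> (fob K j) \<cdot>\<^bsub>B\<^esub> far G (c j) = far G' (c j) \<cdot>\<^bsub>B\<^esub> \<sigma> L" if "j \<in> Ob J" for j using sig_nat[of "c j"] c[OF that] by simp
  show "is_limit J T (cmp_ftr J pairing K) (fob pairing L) (\<lambda>j. far pairing (c j))"
    unfolding is_limit_def
  proof (intro conjI allI impI)
    show "is_cone J T (cmp_ftr J pairing K) (fob pairing L) (\<lambda>j. far pairing (c j))"
      unfolding is_cone_def
    proof (intro conjI ballI)
      fix f assume f: "f \<in> Ar J"
      have "far K f \<cdot>\<^bsub>D\<^esub> c (src J f) = c (tgt J f)" using lim f by (auto simp: is_limit_def is_cone_def)
      then show "far (cmp_ftr J pairing K) f \<cdot>\<^bsub>T\<^esub> far pairing (c (src J f)) = far pairing (c (tgt J f))"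
        using pairing.far_cmp[of "c (src J f)" "far K f"] f c[of "src J f"] by (simp add: cmp_far)
    next
      fix j assume j: "j \<in> Ob J"
      then show "far pairing (c j) \<in> hom T (fob pairing L) (fob (cmp_ftr J pairing K) j)"
        using c[OF j] pairing.far_Ar[of "c j"] by (simp add: cmp_fob hom_iff del: T_sel(4)) (use L c[OF j] sig_nat[of "c j"] in \<open>auto simp: hom_iff\<close>)
    qed (use L in simp)
    fix v d assume cone: "is_cone J T (cmp_ftr J pairing K) v d"
    then have v: "v \<in> Ar B" and d: "\<And>j. j \<in> Ob J \<Longrightarrow> d j \<in> Ar T \<and> src T (d j) = v \<and> tgt T (d j) = \<sigma> (fob K j)"
      and df: "\<And>f. f \<in> Ar J \<Longrightarrow> far pairing (far K f) \<cdot>\<^bsub>T\<^esub> d (src J f) = d (tgt J f)"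
      by (auto simp: is_cone_def cmp_fob cmp_far hom_iff simp del: pairing_sel(2))
    have d': "sq_dom (d j) \<in> hom B (src B v) (fob G (fob K j))" "sq_cod (d j) \<in> hom B (tgt B v) (fob G' (fob K j))"
       "sq_cod (d j) \<cdot>\<^bsub>B\<^esub> v = \<sigma> (fob K j) \<cdot>\<^bsub>B\<^esub> sq_dom (d j)" if j: "j \<in> Ob J" for j
      using T_Ar[of "d j"] d[OF j] j by (auto simp: hom_iff)
    have df': "far G (far K f) \<cdot>\<^bsub>B\<^esub> sq_dom (d (src J f)) = sq_dom (d (tgt J f))" "far G' (far K f) \<cdot>\<^bsub>B\<^esub> sq_cod (d (src J f)) = sq_cod (d (tgt J f))"
      if f: "f \<in> Ar J" for f
      using arg_cong[OF df[OF f], of sq_dom] arg_cong[OF df[OF f], of sq_cod] f by simp_all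
    have c0: "is_cone J B (cmp_ftr J G K) (src B v) (\<lambda>j. sq_dom (d j))" and c1: "is_cone J B (cmp_ftr J G' K) (tgt B v) (\<lambda>j. sq_cod (d j))"
      using v d' df' by (auto simp: is_cone_def cmp_fob cmp_far)
    have e0: "\<exists>!h. h \<in> hom B (src B v) (fob G L) \<and> (\<forall>j\<in>Ob J. far G (c j) \<cdot>\<^bsub>B\<^esub> h = sq_dom (d j))" using l0 c0 unfolding is_limit_def by blast
    have e1: "\<exists>!h. h \<in> hom B (tgt B v) (fob G' L) \<and> (\<forall>j\<in>Ob J. far G' (c j) \<cdot>\<^bsub>B\<^esub> h = sq_cod (d j))" using l1 c1 unfolding is_limit_def by blast
    obtain h0 where h0: "h0 \<in> hom B (src B v) (fob G L)" "\<And>j. j \<in> Ob J \<Longrightarrow> far G (c j) \<cdot>\<^bsub>B\<^esub> h0 = sq_dom (d j)" using e0 by blast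
    obtain h1 where h1: "h1 \<in> hom B (tgt B v) (fob G' L)" "\<And>j. j \<in> Ob J \<Longrightarrow> far G' (c j) \<cdot>\<^bsub>B\<^esub> h1 = sq_cod (d j)" using e1 by blast
    have "h1 \<cdot>\<^bsub>B\<^esub> v = \<sigma> L \<cdot>\<^bsub>B\<^esub> h0"
    proof -
      let ?d = "\<lambda>j. sq_cod (d j) \<cdot>\<^bsub>B\<^esub> v"
      have "is_cone J B (cmp_ftr J G' K) (src B v) ?d"
        unfolding is_cone_def
      proof (intro conjI ballI)
        fix f assume f: "f \<in> Ar J"
        show "far (cmp_ftr J G' K) f \<cdot>\<^bsub>B\<^esub> (sq_cod (d (src J f)) \<cdot>\<^bsub>B\<^esub> v) = sq_cod (d (tgt J f)) \<cdot>\<^bsub>B\<^esub> v"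
          using B.reassoc[OF df'(2)[OF f], of v] f v d'(2)[of "src J f"] by (simp add: cmp_far hom_iff)
      qed (use v d'(2) in \<open>auto simp: cmp_fob hom_iff\<close>)
      then have ex1: "\<exists>!h. h \<in> hom B (src B v) (fob G' L) \<and> (\<forall>j\<in>Ob J. far G' (c j) \<cdot>\<^bsub>B\<^esub> h = ?d j)"
        using l1 unfolding is_limit_def by blast
      have "far G' (c j) \<cdot>\<^bsub>B\<^esub> (h1 \<cdot>\<^bsub>B\<^esub> v) = ?d j" "far G' (c j) \<cdot>\<^bsub>B\<^esub> (\<sigma> L \<cdot>\<^bsub>B\<^esub> h0) = ?d j" if j: "j \<in> Ob J" for j
        using B.reassoc[OF h1(2)[OF j], of v] B.reassoc[OF cn[OF j, symmetric], of h0] h0(1) h0(2)[OF j] h1(1) v c[OF j] L j d'(3)[OF j]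
        by (simp_all add: hom_iff B.assoc)
      moreover have "h1 \<cdot>\<^bsub>B\<^esub> v \<in> hom B (src B v) (fob G' L)" "\<sigma> L \<cdot>\<^bsub>B\<^esub> h0 \<in> hom B (src B v) (fob G' L)"
        using h0 h1 v L by (auto simp: hom_iff)
      ultimately show ?thesis using ex1 by blast
    qed
    then have h: "sq v (\<sigma> L) h0 h1 \<in> hom T v (\<sigma> L)" using h0 h1 v L by (simp add: hom_iff)
    show "\<exists>!h. h \<in> hom T v (fob pairing L) \<and> (\<forall>j\<in>Ob J. far pairing (c j) \<cdot>\<^bsub>T\<^esub> h = d j)"
    proof (rule ex1I[of _ "sq v (\<sigma> L) h0 h1"], intro conjI ballI)
      fix j assume j: "j \<in> Ob J"
      have pc: "far pairing (c j) \<in> hom T (\<sigma> L) (\<sigma> (fob K j))"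
        using pairing.far_Ar[of "c j"] pairing.src_far[of "c j"] pairing.tgt_far[of "c j"] c[OF j] L j by (simp add: hom_iff del: pairing_sel(2))
      show "far pairing (c j) \<cdot>\<^bsub>T\<^esub> sq v (\<sigma> L) h0 h1 = d j"
      proof (rule sq_ext)
        have "far pairing (c j) \<cdot>\<^bsub>T\<^esub> sq v (\<sigma> L) h0 h1 \<in> hom T v (\<sigma> (fob K j))" by (rule T.cmp_hom[OF h pc])
        then show "far pairing (c j) \<cdot>\<^bsub>T\<^esub> sq v (\<sigma> L) h0 h1 \<in> Ar T" "src T (far pairing (c j) \<cdot>\<^bsub>T\<^esub> sq v (\<sigma> L) h0 h1) = src T (d j)"
          "tgt T (far pairing (c j) \<cdot>\<^bsub>T\<^esub> sq v (\<sigma> L) h0 h1) = tgt T (d j)" using d[OF j] by (auto simp: hom_iff)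
      qed (use d[OF j] h0(2)[OF j] h1(2)[OF j] c[OF j] in auto)
    next
      fix k assume k: "k \<in> hom T v (fob pairing L) \<and> (\<forall>j\<in>Ob J. far pairing (c j) \<cdot>\<^bsub>T\<^esub> k = d j)"
      then have k': "k \<in> Ar T" "src T k = v" "tgt T k = \<sigma> L" using L by (auto simp: hom_iff)
      note KK = T_Ar[OF k'(1), unfolded k']
      have kd: "far G (c j) \<cdot>\<^bsub>B\<^esub> sq_dom k = sq_dom (d j)" "far G' (c j) \<cdot>\<^bsub>B\<^esub> sq_cod k = sq_cod (d j)" if j: "j \<in> Ob J" for j
      proof -
        have "far pairing (c j) \<cdot>\<^bsub>T\<^esub> k = d j" using k j by blast
        from arg_cong[OF this, of sq_dom] arg_cong[OF this, of sq_cod]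
        show "far G (c j) \<cdot>\<^bsub>B\<^esub> sq_dom k = sq_dom (d j)" "far G' (c j) \<cdot>\<^bsub>B\<^esub> sq_cod k = sq_cod (d j)" using c[OF j] by simp_all
      qed
      have "sq_dom k \<in> hom B (src B v) (fob G L)" "sq_cod k \<in> hom B (tgt B v) (fob G' L)" using KK(3-8) L by (simp_all add: hom_iff)
      then have "sq_dom k = h0" "sq_cod k = h1"
        by - (rule ex1_eqI[OF e0], simp_all add: kd h0, rule ex1_eqI[OF e1], simp_all add: kd h1)
      then show "k = sq v (\<sigma> L) h0 h1" using KK(10) by simp
    qed (use h L in simp)
  qed
qed

text \<open>A square from \<open>\<sigma> x\<close> to \<open>v\<close> transposes to maps from
  \<open>x\<close> into \<open>R0\<close> and \<open>R1\<close>, the right adjoint of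
  \<open>G\<close> at the domain of \<open>v\<close> and that of \<open>G'\<close> at its codomain.
  The two have to agree in \<open>R2\<close>, the right adjoint of \<open>G\<close> at the codomain,
  reached by the image \<open>gv\<close> of \<open>v\<close> and by the mate \<open>\<mu>\<close> of
  \<open>\<sigma>\<close>. So the value at \<open>v\<close> is the pullback of \<open>gv\<close> and
  \<open>\<mu>\<close>.\<close>

lemma pairing_couniversal:
  assumes hp: "has_pullbacks D"
    and cu: "\<And>b. b \<in> Ob B \<Longrightarrow> \<exists>R e. couniversal D B G b R e" and cu': "\<And>b. b \<in> Ob B \<Longrightarrow> \<exists>R e. couniversal D B G' b R e"
    and v: "v \<in> Ob T"
  shows "\<exists>R e. couniversal D T pairing v R e"
proof -
  have vA: "v \<in> Ar B" using v by simp
  obtain R0 e0 where C0: "couniversal D B G (src B v) R0 e0" using cu[of "src B v"] vA by auto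
  obtain R2 e2 where C2: "couniversal D B G (tgt B v) R2 e2" using cu[of "tgt B v"] vA by auto
  obtain R1 e1 where C1: "couniversal D B G' (tgt B v) R1 e1" using cu'[of "tgt B v"] vA by auto
  have R0: "R0 \<in> Ob D" "e0 \<in> Ar B" "src B e0 = fob G R0" "tgt B e0 = src B v" using C0 by (auto simp: couniversal_def hom_iff)
  have R1: "R1 \<in> Ob D" "e1 \<in> Ar B" "src B e1 = fob G' R1" "tgt B e1 = tgt B v" using C1 by (auto simp: couniversal_def hom_iff)
  have R2: "R2 \<in> Ob D" "e2 \<in> Ar B" "src B e2 = fob G R2" "tgt B e2 = tgt B v" using C2 by (auto simp: couniversal_def hom_iff)
  obtain gv where gv: "gv \<in> Ar D" "src D gv = R0" "tgt D gv = R2" "e2 \<cdot>\<^bsub>B\<^esub> far G gv = v \<cdot>\<^bsub>B\<^esub> e0"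
    using couniversal_lift[OF C2 R0(1), of "v \<cdot>\<^bsub>B\<^esub> e0"] R0 vA by (auto simp: hom_iff)
  obtain \<mu> where mu: "\<mu> \<in> Ar D" "src D \<mu> = R1" "tgt D \<mu> = R2" "e2 \<cdot>\<^bsub>B\<^esub> far G \<mu> = e1 \<cdot>\<^bsub>B\<^esub> \<sigma> R1"
    using couniversal_lift[OF C2 R1(1), of "e1 \<cdot>\<^bsub>B\<^esub> \<sigma> R1"] R1 vA by (auto simp: hom_iff)
  obtain p0 p1 where pb: "is_pullback D gv \<mu> p0 p1" using hp gv mu unfolding has_pullbacks_def by metis
  note P = pullbackD[OF pb]
  let ?R = "src D p0"
  have p: "p0 \<in> Ar D" "tgt D p0 = R0" "p1 \<in> Ar D" "src D p1 = ?R" "tgt D p1 = R1" "gv \<cdot>\<^bsub>D\<^esub> p0 = \<mu> \<cdot>\<^bsub>D\<^esub> p1" using P gv mu by auto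
  have f0: "e2 \<cdot>\<^bsub>B\<^esub> far G (gv \<cdot>\<^bsub>D\<^esub> k) = v \<cdot>\<^bsub>B\<^esub> (e0 \<cdot>\<^bsub>B\<^esub> far G k)" if "k \<in> Ar D" "tgt D k = R0" for k
    using B.reassoc[OF gv(4), of "far G k"] that gv R0 R2 vA by (simp add: G.far_cmp B.assoc)
  have f1: "e2 \<cdot>\<^bsub>B\<^esub> far G (\<mu> \<cdot>\<^bsub>D\<^esub> k) = (e1 \<cdot>\<^bsub>B\<^esub> far G' k) \<cdot>\<^bsub>B\<^esub> \<sigma> (src D k)" if "k \<in> Ar D" "tgt D k = R1" for k
    using B.reassoc[OF mu(4), of "far G k"] that mu R1 R2 sig_nat[of k] by (simp add: G.far_cmp B.assoc)
  let ?e = "sq (\<sigma> ?R) v (e0 \<cdot>\<^bsub>B\<^esub> far G p0) (e1 \<cdot>\<^bsub>B\<^esub> far G' p1)"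
  have e: "?e \<in> Ar T" using p R0 R1 vA f0[of p0] f1[of p1] by (auto simp: hom_iff)
  have eh: "?e \<in> hom T (fob pairing ?R) v" using e p by (simp add: hom_iff del: T_sel(4))
  have "couniversal D T pairing v ?R ?e"
    unfolding couniversal_def
  proof (intro conjI ballI)
    fix x m assume x: "x \<in> Ob D" and "m \<in> hom T (fob pairing x) v"
    then have m: "m \<in> Ar T" "src T m = \<sigma> x" "tgt T m = v" by (auto simp: hom_iff)
    note M = T_Ar[OF m(1), unfolded m]
    obtain k0 where k0: "k0 \<in> Ar D" "src D k0 = x" "tgt D k0 = R0" "e0 \<cdot>\<^bsub>B\<^esub> far G k0 = sq_dom m"
      using couniversal_lift[OF C0 x, of "sq_dom m"] M x by (auto simp: hom_iff)
    obtain k1 where k1: "k1 \<in> Ar D" "src D k1 = x" "tgt D k1 = R1" "e1 \<cdot>\<^bsub>B\<^esub> far G' k1 = sq_cod m"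
      using couniversal_lift[OF C1 x, of "sq_cod m"] M x by (auto simp: hom_iff)
    have "gv \<cdot>\<^bsub>D\<^esub> k0 = \<mu> \<cdot>\<^bsub>D\<^esub> k1"
      by (rule G.couniversal_ext[OF C2, of _ x]) (use k0 k1 gv mu f0[of k0] f1[of k1] M in \<open>auto simp: hom_iff\<close>)
    then obtain k where k: "k \<in> Ar D" "src D k = x" "tgt D k = ?R" "p0 \<cdot>\<^bsub>D\<^esub> k = k0" "p1 \<cdot>\<^bsub>D\<^esub> k = k1"
      using pullback_factor[OF pb, of k0 x k1] k0 k1 gv mu by (auto simp: hom_iff)
    have dc: "sq_dom (?e \<cdot>\<^bsub>T\<^esub> far pairing l) = e0 \<cdot>\<^bsub>B\<^esub> far G (p0 \<cdot>\<^bsub>D\<^esub> l)" "sq_cod (?e \<cdot>\<^bsub>T\<^esub> far pairing l) = e1 \<cdot>\<^bsub>B\<^esub> far G' (p1 \<cdot>\<^bsub>D\<^esub> l)"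
      if "l \<in> Ar D" "tgt D l = ?R" for l
      using that p R0 R1 by (simp_all add: G.far_cmp G'.far_cmp B.assoc)
    show "\<exists>!k. k \<in> hom D x ?R \<and> ?e \<cdot>\<^bsub>T\<^esub> far pairing k = m"
    proof (rule ex1I[of _ k], intro conjI)
      have "?e \<cdot>\<^bsub>T\<^esub> far pairing k \<in> hom T (fob pairing x) v"
        by (rule T.cmp_hom[OF _ eh]) (use functor_hom[OF pairing.F, of k x ?R] k in \<open>simp add: hom_iff del: T_sel(4) pairing_sel(2)\<close>)
      then show "?e \<cdot>\<^bsub>T\<^esub> far pairing k = m"
        using dc[of k] k k0 k1 m x by - (rule sq_ext, auto simp: hom_iff simp del: T_sel(4-) pairing_sel(2))
      fix l assume l: "l \<in> hom D x ?R \<and> ?e \<cdot>\<^bsub>T\<^esub> far pairing l = m"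
      then have l': "l \<in> Ar D" "src D l = x" "tgt D l = ?R" by (auto simp: hom_iff)
      have "e0 \<cdot>\<^bsub>B\<^esub> far G (p0 \<cdot>\<^bsub>D\<^esub> l) = e0 \<cdot>\<^bsub>B\<^esub> far G k0" "e1 \<cdot>\<^bsub>B\<^esub> far G' (p1 \<cdot>\<^bsub>D\<^esub> l) = e1 \<cdot>\<^bsub>B\<^esub> far G' k1"
        using dc[of l] l l' k0 k1 by auto
      then have "p0 \<cdot>\<^bsub>D\<^esub> l = k0" "p1 \<cdot>\<^bsub>D\<^esub> l = k1"
        using G.couniversal_ext[OF C0, of "p0 \<cdot>\<^bsub>D\<^esub> l" x k0] G'.couniversal_ext[OF C1, of "p1 \<cdot>\<^bsub>D\<^esub> l" x k1] k0 k1 l' p by (auto simp: hom_iff)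
      then show "l = k" using G.C.pullback_ext[OF pb, of l x k] l' k by (auto simp: hom_iff)
    qed (use k in \<open>auto simp: hom_iff\<close>)
  qed (use p in simp, rule eh)
  then show ?thesis by blast
qed

end

section \<open>The product of a site with a two-element order\<close>

lemma (in site) psh_ext:
  assumes P: "presheaf C P" and Q: "presheaf C Q" and s: "\<And>c. c \<in> Ob C \<Longrightarrow> sec P c = sec Q c"
    and r: "\<And>f a. f \<in> Ar C \<Longrightarrow> a \<in> sec P (tgt C f) \<Longrightarrow> res P f a = res Q f a"
  shows "P = Q"
proof -
  have "sec P = sec Q" by (rule extensionalityI[of _ "Ob C"]) (use P Q s in \<open>auto simp: presheaf_def\<close>)
  moreover have "res P = res Q"
  proof (rule extensionalityI[of _ "Ar C"])
    fix f assume f: "f \<in> Ar C"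
    have p: "res P f \<in> sec P (tgt C f) \<rightarrow>\<^sub>E sec P (src C f)" using P f unfolding presheaf_def by blast
    have "res Q f \<in> sec Q (tgt C f) \<rightarrow>\<^sub>E sec Q (src C f)" using Q f unfolding presheaf_def by blast
    then have "res Q f \<in> sec P (tgt C f) \<rightarrow>\<^sub>E sec P (src C f)" using s[OF tgt_Ob[OF f]] s[OF src_Ob[OF f]] by simp
    with p show "res P f = res Q f" using r[OF f] by (rule PiE_ext)
  qed (use P Q in \<open>auto simp: presheaf_def\<close>)
  ultimately show ?thesis by (cases P; cases Q) simp
qed

context site
begin

text \<open>Along any \<open>h\<close> in \<open>R\<close> the larger sieve pulls back to the
  maximal one, so transitivity applies.\<close>

lemma cover_superset:
  assumes c: "c \<in> Ob C" and R: "R \<in> J c" and R': "sieve C c R'" "R \<subseteq> R'"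
  shows "R' \<in> J c"
proof -
  have "pull_sieve C h R' \<in> J (src C h)" if h: "h \<in> R" for h
  proof -
    note hh = coverD[OF R c h]
    have "pull_sieve C h R' = {f \<in> Ar C. tgt C f = src C h}" using hh(3) R' by (auto simp: pull_sieve_def)
    then show ?thesis using top hh(1) unfolding grothendieck_topology_def by auto
  qed
  then show ?thesis using top c R R' unfolding grothendieck_topology_def by blast
qed

lemma cover_trans: "c \<in> Ob C \<Longrightarrow> R \<in> J c \<Longrightarrow> sieve C c R' \<Longrightarrow> (\<And>h. h \<in> R \<Longrightarrow> pull_sieve C h R' \<in> J (src C h)) \<Longrightarrow> R' \<in> J c"
  using top unfolding grothendieck_topology_def by blast

text \<open>The product of the site with the poset of truth values, with the topology of the first factor.\<close>

definition bc :: "bool \<Rightarrow> 'u" where "bc = (SOME e. inj e)"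

lemma inj_bc: "inj bc"
proof -
  have "finite (UNIV :: bool set)" by simp
  then obtain e :: "bool \<Rightarrow> 'u" where "inj_on e UNIV"
    using card_of_less_encode[OF card_of_finite_less[OF inacc]] by metis
  then show ?thesis unfolding bc_def by (rule someI[of inj])
qed

definition ob :: "'u \<Rightarrow> bool \<Rightarrow> 'u" where "ob c k = pair_code (c, bc k)"
definition obc :: "'u \<Rightarrow> 'u" where "obc x = fst (pair_decode x)"
definition obk :: "'u \<Rightarrow> bool" where "obk x = inv bc (snd (pair_decode x))"
definition ar :: "'u \<Rightarrow> bool \<Rightarrow> bool \<Rightarrow> 'u" where "ar f k k' = pair_code (f, pair_code (bc k, bc k'))"
definition arf :: "'u \<Rightarrow> 'u" where "arf a = fst (pair_decode a)"
definition ars :: "'u \<Rightarrow> bool" where "ars a = inv bc (fst (pair_decode (snd (pair_decode a))))"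
definition art :: "'u \<Rightarrow> bool" where "art a = inv bc (snd (pair_decode (snd (pair_decode a))))"

lemma ob_ar [simp]: "obc (ob c k) = c" "obk (ob c k) = k" "arf (ar f k k') = f" "ars (ar f k k') = k" "art (ar f k k') = k'"
  using inj_bc by (auto simp: obc_def obk_def ob_def arf_def ars_def art_def ar_def)

lemma ob_ar_eq [simp]: "ob c k = ob c' k' \<longleftrightarrow> c = c' \<and> k = k'" "ar f k l = ar f' k' l' \<longleftrightarrow> f = f' \<and> k = k' \<and> l = l'"
proof -
  have "c = c' \<and> k = k'" if "ob c k = ob c' k'"
    using arg_cong[OF that, of obc] arg_cong[OF that, of obk] by simp
  then show "ob c k = ob c' k' \<longleftrightarrow> c = c' \<and> k = k'" by blast
  have "f = f' \<and> k = k' \<and> l = l'" if "ar f k l = ar f' k' l'"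
    using arg_cong[OF that, of arf] arg_cong[OF that, of ars] arg_cong[OF that, of art] by simp
  then show "ar f k l = ar f' k' l' \<longleftrightarrow> f = f' \<and> k = k' \<and> l = l'" by blast
qed

text \<open>Arrows between different levels go from True to False. A presheaf therefore restricts
  from its False level to its True level, which makes False the domain of the map it encodes and
  True the codomain.\<close>

definition two :: "('u,'u) cat" where
  "two = \<lparr>Ob = {ob c k | c k. c \<in> Ob C}, Ar = {ar f k k' | f k k'. f \<in> Ar C \<and> (k' \<longrightarrow> k)},
     src = (\<lambda>a. ob (src C (arf a)) (ars a)), tgt = (\<lambda>a. ob (tgt C (arf a)) (art a)),
     idn = (\<lambda>x. ar (idn C (obc x)) (obk x) (obk x)), cmp = (\<lambda>b a. ar (arf b \<cdot>\<^bsub>C\<^esub> arf a) (ars a) (art b))\<rparr>"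

lemma two_sel [simp]:
  "ob c k \<in> Ob two \<longleftrightarrow> c \<in> Ob C" "ar f k k' \<in> Ar two \<longleftrightarrow> f \<in> Ar C \<and> (k' \<longrightarrow> k)"
  "src two (ar f k k') = ob (src C f) k" "tgt two (ar f k k') = ob (tgt C f) k'"
  "idn two (ob c k) = ar (idn C c) k k" "ar g l l' \<cdot>\<^bsub>two\<^esub> ar f k k' = ar (g \<cdot>\<^bsub>C\<^esub> f) k l'"
  by (auto simp: two_def)

lemma two_ObE: "x \<in> Ob two \<Longrightarrow> (\<And>c k. x = ob c k \<Longrightarrow> c \<in> Ob C \<Longrightarrow> thesis) \<Longrightarrow> thesis"
  and two_ArE: "a \<in> Ar two \<Longrightarrow> (\<And>f k k'. a = ar f k k' \<Longrightarrow> f \<in> Ar C \<Longrightarrow> (k' \<longrightarrow> k) \<Longrightarrow> thesis) \<Longrightarrow> thesis"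
  by (auto simp: two_def)

lemma category_two: "category two"
proof
  fix f g h w x y z
  { assume "f \<in> Ar two" then show "src two f \<in> Ob two" "tgt two f \<in> Ob two" by (auto elim!: two_ArE) }
  { assume "x \<in> Ob two" then show "idn two x \<in> hom two x x" by (auto elim!: two_ObE simp: hom_iff) }
  { assume "f \<in> hom two x y"
    then show "idn two y \<cdot>\<^bsub>two\<^esub> f = f" "f \<cdot>\<^bsub>two\<^esub> idn two x = f" by (auto elim!: two_ArE simp: hom_iff) }
  { assume "f \<in> hom two x y" "g \<in> hom two y z"
    then show "g \<cdot>\<^bsub>two\<^esub> f \<in> hom two x z" by (auto elim!: two_ArE simp: hom_iff) }
  { assume "f \<in> hom two w x" "g \<in> hom two x y" "h \<in> hom two y z"
    then show "h \<cdot>\<^bsub>two\<^esub> g \<cdot>\<^bsub>two\<^esub> f = h \<cdot>\<^bsub>two\<^esub> (g \<cdot>\<^bsub>two\<^esub> f)" by (auto elim!: two_ArE simp: hom_iff assoc) }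
qed

definition level :: "bool \<Rightarrow> 'u set \<Rightarrow> 'u set" where "level k S = {f \<in> Ar C. ar f k k \<in> S}"

text \<open>Covering is decided by the arrows that stay at the level of \<open>x\<close>. Their
  composites with arrows from the other level lie in the sieve too, so the other level is covered
  along with it.\<close>

definition J2 :: "'u \<Rightarrow> 'u set set" where
  "J2 x = {S. sieve two x S \<and> level (obk x) S \<in> J (obc x)}"

lemma sieve_twoD:
  assumes "sieve two (ob c k) S" "ar f l l' \<in> S"
  shows "f \<in> Ar C" "l' \<longrightarrow> l" "tgt C f = c" "l' = k" "g \<in> Ar C \<Longrightarrow> tgt C g = src C f \<Longrightarrow> (l \<longrightarrow> m) \<Longrightarrow> ar (f \<cdot>\<^bsub>C\<^esub> g) m k \<in> S"
proof -
  show 1: "f \<in> Ar C" "l' \<longrightarrow> l" "tgt C f = c" "l' = k" using assms unfolding sieve_def by (auto elim!: two_ArE)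
  assume g: "g \<in> Ar C" "tgt C g = src C f" "l \<longrightarrow> m"
  have "a \<cdot>\<^bsub>two\<^esub> b \<in> S" if "a \<in> S" "b \<in> Ar two" "tgt two b = src two a" for a b
    using assms(1) that unfolding sieve_def by blast
  from this[OF assms(2), of "ar g m l"] have "ar f l l' \<cdot>\<^bsub>two\<^esub> ar g m l \<in> S" using g by simp
  then show "ar (f \<cdot>\<^bsub>C\<^esub> g) m k \<in> S" using 1 by simp
qed

lemma level_sieve: "sieve two (ob c k) S \<Longrightarrow> sieve C c (level k S)"
  unfolding sieve_def[of C] level_def using sieve_twoD by auto

lemma topology_two: "grothendieck_topology two J2"
  unfolding grothendieck_topology_def
proof (intro conjI ballI allI impI, goal_cases)
  case (1 x S) then show ?case by (simp add: J2_def)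
next
  case (2 x)
  then obtain c k where x: "x = ob c k" "c \<in> Ob C" by (rule two_ObE)
  have "level k {f \<in> Ar two. tgt two f = x} = {f \<in> Ar C. tgt C f = c}" by (auto simp: level_def x)
  moreover have "{f \<in> Ar C. tgt C f = c} \<in> J c" using top x unfolding grothendieck_topology_def by blast
  moreover have "sieve two x {f \<in> Ar two. tgt two f = x}"
    using category.cmp_Ar[OF category_two] category.tgt_cmp[OF category_two] by (auto simp: sieve_def)
  ultimately show ?case by (simp add: J2_def x)
next
  case (3 h S)
  then obtain f m k where h: "h = ar f m k" "f \<in> Ar C" "k \<longrightarrow> m" by (auto elim: two_ArE)
  have S: "sieve two (ob (tgt C f) k) S" "level k S \<in> J (tgt C f)" using 3 by (auto simp: J2_def h)
  have sv: "sieve two (ob (src C f) m) (pull_sieve two h S)"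
    unfolding sieve_def pull_sieve_def
  proof (intro conjI ballI impI)
    fix a b assume "a \<in> {g \<in> Ar two. tgt two g = src two h \<and> h \<cdot>\<^bsub>two\<^esub> g \<in> S}" "b \<in> Ar two" "tgt two b = src two a"
    then obtain g l g' l' where a: "a = ar g l m" "g \<in> Ar C" "tgt C g = src C f" "ar (f \<cdot>\<^bsub>C\<^esub> g) l k \<in> S" "m \<longrightarrow> l"
      and b: "b = ar g' l' l" "g' \<in> Ar C" "tgt C g' = src C g" "l \<longrightarrow> l'" by (auto elim!: two_ArE simp: h)
    have "ar (f \<cdot>\<^bsub>C\<^esub> g \<cdot>\<^bsub>C\<^esub> g') l' k \<in> S" using sieve_twoD(5)[OF S(1) a(4), of g' l'] a b h by simp
    then show "a \<cdot>\<^bsub>two\<^esub> b \<in> {g \<in> Ar two. tgt two g = src two h \<and> h \<cdot>\<^bsub>two\<^esub> g \<in> S}" using a b h by (auto simp: assoc)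
  qed (auto simp: h)
  \<comment> \<open>In general only an inclusion holds: \<open>S\<close> may contain arrows from
    level \<open>m\<close> that do not factor through the arrows of \<open>S\<close> at level
    \<open>k\<close>.\<close>
  have "pull_sieve C f (level k S) \<subseteq> level m (pull_sieve two h S)"
  proof
    fix g assume "g \<in> pull_sieve C f (level k S)"
    then have g: "g \<in> Ar C" "tgt C g = src C f" "ar (f \<cdot>\<^bsub>C\<^esub> g) k k \<in> S" by (auto simp: pull_sieve_def level_def)
    have "ar (f \<cdot>\<^bsub>C\<^esub> g) m k \<in> S" using sieve_twoD(5)[OF S(1) g(3), of "idn C (src C g)" m] g h by simp
    then show "g \<in> level m (pull_sieve two h S)" using g by (simp add: level_def pull_sieve_def h)
  qed
  then have "level m (pull_sieve two h S) \<in> J (src C f)"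
    using cover_superset[OF _ cover_pull[OF _ S(2) h(2)] level_sieve[OF sv]] h by simp
  then show ?case using sv by (simp add: J2_def h)
next
  case (4 x S R)
  then obtain c k where x: "x = ob c k" "c \<in> Ob C" by (auto elim: two_ObE)
  have S: "sieve two (ob c k) S" "level k S \<in> J c" and R: "sieve two (ob c k) R" "\<And>h. h \<in> S \<Longrightarrow> pull_sieve two h R \<in> J2 (src two h)"
    using 4 by (auto simp: J2_def x)
  have "level k R \<in> J c"
  proof (rule cover_trans[OF x(2) S(2) level_sieve[OF R(1)]])
    fix h assume "h \<in> level k S"
    then have h: "h \<in> Ar C" "ar h k k \<in> S" by (auto simp: level_def)
    have "level k (pull_sieve two (ar h k k) R) = pull_sieve C h (level k R)"
      using h by (auto simp: level_def pull_sieve_def)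
    then show "pull_sieve C h (level k R) \<in> J (src C h)" using R(2)[OF h(2)] by (simp add: J2_def)
  qed
  then show ?case using R(1) by (simp add: J2_def x)
qed

lemma site_two: "site two J2"
proof (rule site.intro[OF category_two site_axioms.intro[OF inacc]])
  have "Ob two = (\<lambda>(c,k). ob c k) ` (Ob C \<times> UNIV)" by (auto simp: two_def)
  moreover have "|Ob C \<times> (UNIV :: bool set)| <o |UNIV :: 'u set|"
    by (rule card_of_Times_less[OF inacc small_Ob[unfolded small_def] card_of_finite_less[OF inacc]]) simp
  ultimately show "small (Ob two)" unfolding small_def by (metis card_of_image_less)
  have "Ar two \<subseteq> (\<lambda>(f,k,k'). ar f k k') ` (Ar C \<times> UNIV)"
    by (auto elim!: two_ArE intro!: image_eqI[of _ _ "(f,k,k')" for f k k'])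
  moreover have "|Ar C \<times> (UNIV :: (bool \<times> bool) set)| <o |UNIV :: 'u set|"
    by (rule card_of_Times_less[OF inacc small_Ar[unfolded small_def] card_of_finite_less[OF inacc]]) simp
  ultimately show "small (Ar two)" unfolding small_def by (metis card_of_image_less card_of_subset_less)
qed (rule topology_two)

end

locale glueing = site C J for C :: "('u,'u) cat" and J
begin

sublocale two: site two J2 by (rule site_two)

lemma J2D: "S \<in> J2 (ob c k) \<Longrightarrow> sieve two (ob c k) S \<and> level k S \<in> J c"
  by (simp add: J2_def)

subsection \<open>Sheaves on the product site\<close>

text \<open>The restriction between levels over an identity. The second case is only meant for
  \<open>k'\<close> False and \<open>k\<close> True.\<close>

definition trn :: "'u sheaf_map \<Rightarrow> bool \<Rightarrow> bool \<Rightarrow> 'u \<Rightarrow> 'u \<Rightarrow> 'u" where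
  "trn m k' k c x = (if k' = k then x else ap m c x)"

text \<open>A map of sheaves as a single sheaf on the product site: \<open>P False\<close> and \<open>P True\<close> are its two levels, and \<open>m\<close> gives the restrictions from the first to the second.\<close>

definition glued :: "(bool \<Rightarrow> 'u psh) \<Rightarrow> 'u sheaf_map \<Rightarrow> 'u psh" where
  "glued P m = two.mk_psh (\<lambda>x. sec (P (obk x)) (obc x))
     (\<lambda>a x. res (P (ars a)) (arf a) (trn m (art a) (ars a) (tgt C (arf a)) x))"

definition glued_map :: "(bool \<Rightarrow> 'u psh) \<Rightarrow> 'u sheaf_map \<Rightarrow>
    (bool \<Rightarrow> 'u psh) \<Rightarrow> 'u sheaf_map \<Rightarrow>
    (bool \<Rightarrow> 'u sheaf_map) \<Rightarrow> 'u sheaf_map" where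
  "glued_map P m P' m' \<eta> = two.mk_map (glued P m) (glued P' m') (\<lambda>x. ap (\<eta> (obk x)) (obc x))"

lemma glued_sel [simp]:
  "c \<in> Ob C \<Longrightarrow> sec (glued P m) (ob c k) = sec (P k) c"
  "f \<in> Ar C \<Longrightarrow> (k' \<longrightarrow> k) \<Longrightarrow> a \<in> sec (P k') (tgt C f) \<Longrightarrow> res (glued P m) (ar f k k') a = res (P k) f (trn m k' k (tgt C f) a)"
  by (auto simp: glued_def)

lemma ap_glued_map [simp]: "c \<in> Ob C \<Longrightarrow> x \<in> sec (P k) c \<Longrightarrow> ap (glued_map P m P' m' \<eta>) (ob c k) x = ap (\<eta> k) c x"
  by (simp add: glued_map_def)

context
  fixes P m assumes m: "m \<in> hom H (P False) (P True)"
begin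

lemma PS: "sheaf C J (P k)" using hom_sheaf[OF m] by (cases k) auto

lemma trn_in: "c \<in> Ob C \<Longrightarrow> x \<in> sec (P k') c \<Longrightarrow> (k' \<longrightarrow> k) \<Longrightarrow> trn m k' k c x \<in> sec (P k) c"
  using ap_in[OF m, of c x] by (cases k; cases k') (auto simp: trn_def)

lemma trn_nat: "f \<in> Ar C \<Longrightarrow> x \<in> sec (P k') (tgt C f) \<Longrightarrow> (k' \<longrightarrow> k) \<Longrightarrow>
   trn m k' k (src C f) (res (P k') f x) = res (P k) f (trn m k' k (tgt C f) x)"
  using ap_nat[OF m, of f x] by (cases k; cases k') (auto simp: trn_def)

lemma trn_trn: "(k'' \<longrightarrow> k') \<Longrightarrow> (k' \<longrightarrow> k) \<Longrightarrow> trn m k' k c (trn m k'' k' c x) = trn m k'' k c x"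
  by (auto simp: trn_def)

lemma trn_same [simp]: "trn m k k c x = x" by (simp add: trn_def)

lemma glued_presheaf: "presheaf two (glued P m)"
  unfolding glued_def
proof (rule two.mk_psh_presheaf, goal_cases)
  case (1 x) then show ?case using sheafD(1)[OF PS] by (auto elim: two_ObE)
next
  case (2 a x) then show ?case using sheafD(2)[OF PS] trn_in by (auto elim!: two_ArE)
next
  case (3 c x) then show ?case using sheafD(3)[OF PS] by (auto elim!: two_ObE)
next
  case (4 a b x)
  then obtain f k k' g l where e: "a = ar f k k'" "f \<in> Ar C" "k' \<longrightarrow> k" "b = ar g l k" "g \<in> Ar C" "k \<longrightarrow> l" "tgt C g = src C f"
    "x \<in> sec (P k') (tgt C f)" by (auto elim!: two_ArE)
  have t: "trn m k' k (tgt C f) x \<in> sec (P k) (tgt C f)" using e by (intro trn_in) auto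
  have "res (P l) (f \<cdot>\<^bsub>C\<^esub> g) (trn m k' l (tgt C f) x) = res (P l) g (res (P l) f (trn m k l (tgt C f) (trn m k' k (tgt C f) x)))"
    using e sheafD(4)[OF PS, of f g "trn m k' l (tgt C f) x" l] trn_in[of "tgt C f" x k' l] by (simp add: trn_trn)
  also have "\<dots> = res (P l) g (trn m k l (src C f) (res (P k) f (trn m k' k (tgt C f) x)))"
    using trn_nat[OF e(2) t e(6)] by simp
  finally show ?case using e by simp
qed

text \<open>The amalgamation is found at the level of \<open>x\<close> alone. For an arrow
  \<open>f\<close> from the other level the required equation is checked locally, on the cover
  pulled back along \<open>f\<close>, where the matching condition reduces it to the level already
  treated.\<close>

lemma glued_sheaf: "sheaf two J2 (glued P m)"
proof (rule two.sheafI[OF glued_presheaf])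
  fix x S a b assume "x \<in> Ob two" and S: "S \<in> J2 x" and ab: "a \<in> sec (glued P m) x" "b \<in> sec (glued P m) x"
    and e: "\<And>f. f \<in> S \<Longrightarrow> res (glued P m) f a = res (glued P m) f b"
  then obtain c k where x: "x = ob c k" "c \<in> Ob C" by (auto elim: two_ObE)
  note S' = J2D[OF S[unfolded x]]
  have ab': "a \<in> sec (P k) c" "b \<in> sec (P k) c" using ab x by auto
  show "a = b"
  proof (rule sheaf_separated[OF PS x(2) conjunct2[OF S'] ab'])
    fix f assume "f \<in> level k S"
    then have f: "f \<in> Ar C" "ar f k k \<in> S" by (auto simp: level_def)
    have "tgt C f = c" using sieve_twoD(3)[OF conjunct1[OF S'] f(2)] .
    then show "res (P k) f a = res (P k) f b" using e[OF f(2)] f ab' by simp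
  qed
next
  fix x S y assume "x \<in> Ob two" and S: "S \<in> J2 x" and y: "\<And>a. a \<in> S \<Longrightarrow> y a \<in> sec (glued P m) (src two a)"
    and ym: "\<And>a b. a \<in> S \<Longrightarrow> b \<in> Ar two \<Longrightarrow> tgt two b = src two a \<Longrightarrow> y (a \<cdot>\<^bsub>two\<^esub> b) = res (glued P m) b (y a)"
  then obtain c k where x: "x = ob c k" "c \<in> Ob C" by (auto elim: two_ObE)
  note S' = J2D[OF S[unfolded x]]
  note R = conjunct2[OF S'] and sD = sieve_twoD[OF conjunct1[OF S']]
  have y': "y (ar f l k) \<in> sec (P l) (src C f)" if "ar f l k \<in> S" for f l
    using y[OF that] sD(1)[OF that] by simp
  have ym': "y (ar (f \<cdot>\<^bsub>C\<^esub> g) l' k) = res (P l') g (trn m l l' (src C f) (y (ar f l k)))"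
    if "ar f l k \<in> S" "g \<in> Ar C" "tgt C g = src C f" "l \<longrightarrow> l'" for f g l l'
    using ym[OF that(1), of "ar g l' l"] that y'[OF that(1)] by simp
  have "\<exists>!a. a \<in> sec (P k) c \<and> (\<forall>f \<in> level k S. res (P k) f a = y (ar f k k))"
  proof (rule sheaf_glue[OF PS x(2) R])
    fix f assume "f \<in> level k S" then show "y (ar f k k) \<in> sec (P k) (src C f)" using y' by (simp add: level_def)
  next
    fix f g assume "f \<in> level k S" "g \<in> Ar C" "tgt C g = src C f"
    then show "y (ar (f \<cdot>\<^bsub>C\<^esub> g) k k) = res (P k) g (y (ar f k k))" using ym'[of f k g k] by (simp add: level_def)
  qed
  then obtain a where a: "a \<in> sec (P k) c" "\<And>f. f \<in> level k S \<Longrightarrow> res (P k) f a = y (ar f k k)" by blast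
  have "res (glued P m) h a = y h" if h: "h \<in> S" for h
  proof -
    have "h \<in> Ar two" using conjunct1[OF S'] h by (auto simp: sieve_def)
    then obtain f l l' where "h = ar f l l'" by (rule two_ArE)
    then have f: "h = ar f l k" "f \<in> Ar C" "k \<longrightarrow> l" "tgt C f = c" "ar f l k \<in> S" using sD(1-4)[of f l l'] h by auto
    have pf: "pull_sieve C f (level k S) \<in> J (src C f)" by (rule cover_pull[OF x(2) R f(2,4)])
    have t: "trn m k l c a \<in> sec (P l) c" by (rule trn_in[OF x(2) a(1) f(3)])
    have "res (P l) f (trn m k l c a) = y (ar f l k)"
    proof (rule sheaf_separated[OF PS _ pf])
      show "res (P l) f (trn m k l c a) \<in> sec (P l) (src C f)" using sheafD(2)[OF PS f(2)] t f by simp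
      show "y (ar f l k) \<in> sec (P l) (src C f)" using y' f by simp
      fix g assume "g \<in> pull_sieve C f (level k S)"
      then have g: "g \<in> Ar C" "tgt C g = src C f" "f \<cdot>\<^bsub>C\<^esub> g \<in> level k S" by (auto simp: pull_sieve_def)
      have fgS: "ar (f \<cdot>\<^bsub>C\<^esub> g) k k \<in> S" using g by (simp add: level_def)
      note yk = y'[OF fgS]
      have "res (P l) g (res (P l) f (trn m k l c a)) = res (P l) (f \<cdot>\<^bsub>C\<^esub> g) (trn m k l c a)"
        using sheafD(4)[OF PS f(2) g(1,2)] t f by simp
      also have "\<dots> = trn m k l (src C g) (res (P k) (f \<cdot>\<^bsub>C\<^esub> g) a)"
        using trn_nat[of "f \<cdot>\<^bsub>C\<^esub> g" a k l] f g a by simp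
      also have "\<dots> = trn m k l (src C g) (y (ar (f \<cdot>\<^bsub>C\<^esub> g) k k))" using a(2)[OF g(3)] by simp
      also have "\<dots> = y (ar (f \<cdot>\<^bsub>C\<^esub> g \<cdot>\<^bsub>C\<^esub> idn C (src C g)) l k)"
        using ym'[OF fgS, of "idn C (src C g)" l] f g yk trn_in[of "src C g" "y (ar (f \<cdot>\<^bsub>C\<^esub> g) k k)" k l] sheafD(3)[OF PS] by simp
      also have "\<dots> = res (P l) g (y (ar f l k))" using ym'[OF f(5) g(1,2), of l] f g by simp
      finally show "res (P l) g (res (P l) f (trn m k l c a)) = res (P l) g (y (ar f l k))" .
    qed (use f in simp)
    then show ?thesis using f a by simp
  qed
  then show "\<exists>a\<in>sec (glued P m) x. \<forall>f\<in>S. res (glued P m) f a = y f" using a x by auto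
qed

end

lemma glued_map_hom:
  assumes m: "m \<in> hom H (P False) (P True)" and m': "m' \<in> hom H (P' False) (P' True)"
    and \<eta>: "\<And>k. \<eta> k \<in> hom H (P k) (P' k)" and sq: "\<eta> True \<cdot>\<^bsub>H\<^esub> m = m' \<cdot>\<^bsub>H\<^esub> \<eta> False"
  shows "glued_map P m P' m' \<eta> \<in> hom two.H (glued P m) (glued P' m')"
  unfolding glued_map_def
proof (rule two.mk_map_hom[OF glued_sheaf[of m P, OF m] glued_sheaf[of m' P', OF m']], goal_cases)
  case (1 x a) then show ?case using ap_in[OF \<eta>] by (auto elim!: two_ObE)
next
  case (2 h a)
  then obtain f k k' where f: "h = ar f k k'" "f \<in> Ar C" "k' \<longrightarrow> k" "a \<in> sec (P k') (tgt C f)" by (auto elim!: two_ArE)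
  have c: "tgt C f \<in> Ob C" using f by simp
  note t = trn_in[of m P, OF m c f(4,3)]
  have "ap (\<eta> True) (tgt C f) (ap m (tgt C f) z) = ap m' (tgt C f) (ap (\<eta> False) (tgt C f) z)" if "z \<in> sec (P False) (tgt C f)" for z
    using ap_cmp[OF m \<eta>[of True] c that] ap_cmp[OF \<eta>[of False] m' c that] sq by simp
  then have "ap (\<eta> k) (tgt C f) (trn m k' k (tgt C f) a) = trn m' k' k (tgt C f) (ap (\<eta> k') (tgt C f) a)"
    using f by (cases k; cases k') (auto simp: trn_def)
  then show ?case
    using f ap_nat[OF \<eta> f(2) t] ap_in[OF \<eta> c f(4)] by simp
qed

lemma glued_map_cmp:
  assumes m: "m \<in> hom H (P False) (P True)" and m': "m' \<in> hom H (P' False) (P' True)" and m'': "m'' \<in> hom H (P'' False) (P'' True)"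
    and \<eta>: "\<And>k. \<eta> k \<in> hom H (P k) (P' k)" and sq: "\<eta> True \<cdot>\<^bsub>H\<^esub> m = m' \<cdot>\<^bsub>H\<^esub> \<eta> False"
    and \<theta>: "\<And>k. \<theta> k \<in> hom H (P' k) (P'' k)" and sq': "\<theta> True \<cdot>\<^bsub>H\<^esub> m' = m'' \<cdot>\<^bsub>H\<^esub> \<theta> False"
  shows "glued_map P' m' P'' m'' \<theta> \<cdot>\<^bsub>two.H\<^esub> glued_map P m P' m' \<eta> = glued_map P m P'' m'' (\<lambda>k. \<theta> k \<cdot>\<^bsub>H\<^esub> \<eta> k)"
proof -
  note a = glued_map_hom[of m P m' P' \<eta>, OF m m' \<eta> sq] and b = glued_map_hom[of m' P' m'' P'' \<theta>, OF m' m'' \<theta> sq']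
  have sq'': "(\<theta> True \<cdot>\<^bsub>H\<^esub> \<eta> True) \<cdot>\<^bsub>H\<^esub> m = m'' \<cdot>\<^bsub>H\<^esub> (\<theta> False \<cdot>\<^bsub>H\<^esub> \<eta> False)"
    using m m' m'' \<eta>[of True] \<eta>[of False] \<theta>[of True] \<theta>[of False] sq H.reassoc[OF sq', of "\<eta> False"]
    by (simp add: hom_iff H.assoc)
  have c: "glued_map P m P'' m'' (\<lambda>k. \<theta> k \<cdot>\<^bsub>H\<^esub> \<eta> k) \<in> hom two.H (glued P m) (glued P'' m'')"
    by (rule glued_map_hom[of m P m'' P'', OF m m'' H.cmp_hom[OF \<eta> \<theta>] sq''])
  show ?thesis
  proof (rule two.ap_ext[OF two.H.cmp_hom[OF a b] c])
    fix x z assume "x \<in> Ob two" and z0: "z \<in> sec (glued P m) x"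
    then obtain d k where x: "x = ob d k" "d \<in> Ob C" by (auto elim: two_ObE)
    then have z: "z \<in> sec (P k) d" using z0 by simp
    have "ap (glued_map P' m' P'' m'' \<theta> \<cdot>\<^bsub>two.H\<^esub> glued_map P m P' m' \<eta>) x z = ap (\<theta> k) d (ap (\<eta> k) d z)"
      using two.ap_cmp[OF a b, of x z] x z z0 ap_in[OF \<eta> x(2) z] by simp
    then show "ap (glued_map P' m' P'' m'' \<theta> \<cdot>\<^bsub>two.H\<^esub> glued_map P m P' m' \<eta>) x z = ap (glued_map P m P'' m'' (\<lambda>k. \<theta> k \<cdot>\<^bsub>H\<^esub> \<eta> k)) x z"
      using x z ap_cmp[OF \<eta> \<theta> x(2) z] by simp
  qed
qed

lemma glued_map_idn:
  assumes m: "m \<in> hom H (P False) (P True)"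
  shows "glued_map P m P m (\<lambda>k. idn H (P k)) = idn two.H (glued P m)"
proof -
  have i: "idn H (P k) \<in> hom H (P k) (P k)" for k using H.idn_hom PS[of m P, OF m] by simp
  have a: "glued_map P m P m (\<lambda>k. idn H (P k)) \<in> hom two.H (glued P m) (glued P m)"
    by (rule glued_map_hom[OF m m i]) (use m in \<open>simp add: hom_iff\<close>)
  have b: "idn two.H (glued P m) \<in> hom two.H (glued P m) (glued P m)" using two.H.idn_hom glued_sheaf[of m P, OF m] by simp
  show ?thesis
  proof (rule two.ap_ext[OF a b])
    fix x z assume "x \<in> Ob two" and z: "z \<in> sec (glued P m) x"
    then obtain d k where x: "x = ob d k" "d \<in> Ob C" by (auto elim: two_ObE)
    then show "ap (glued_map P m P m (\<lambda>k. idn H (P k))) x z = ap (idn two.H (glued P m)) x z"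
      using z by (simp add: Sh_idn two.Sh_idn)
  qed
qed

text \<open>Reading \<open>\<mu>\<close> level by level gives the two sides of a square. Its
  commutativity is naturality of \<open>\<mu>\<close> at the arrow from True to False over the
  identity of each \<open>c\<close>.\<close>

lemma glued_map_full:
  assumes m: "m \<in> hom H (P False) (P True)" and m': "m' \<in> hom H (P' False) (P' True)"
    and \<mu>: "\<mu> \<in> hom two.H (glued P m) (glued P' m')"
  shows "\<exists>\<eta>. (\<forall>k. \<eta> k \<in> hom H (P k) (P' k)) \<and> \<eta> True \<cdot>\<^bsub>H\<^esub> m = m' \<cdot>\<^bsub>H\<^esub> \<eta> False \<and> glued_map P m P' m' \<eta> = \<mu>"
proof -
  define \<eta> where "\<eta> k = mk_map (P k) (P' k) (\<lambda>c. ap \<mu> (ob c k))" for k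
  have in': "ap \<mu> (ob c k) x \<in> sec (P' k) c" if "c \<in> Ob C" "x \<in> sec (P k) c" for c k x
    using two.ap_in[OF \<mu>, of "ob c k" x] that by simp
  have \<eta>: "\<eta> k \<in> hom H (P k) (P' k)" for k
    unfolding \<eta>_def
  proof (rule mk_map_hom[OF PS[of m P, OF m] PS[of m' P', OF m']])
    fix f a assume f: "f \<in> Ar C" "a \<in> sec (P k) (tgt C f)"
    then show "ap \<mu> (ob (src C f) k) (res (P k) f a) = res (P' k) f (ap \<mu> (ob (tgt C f) k) a)"
      using two.ap_nat[OF \<mu>, of "ar f k k" a] in'[of "tgt C f" a k] by (simp add: trn_def)
  qed (use in' in auto)
  have ape: "ap (\<eta> k) c x = ap \<mu> (ob c k) x" if "c \<in> Ob C" "x \<in> sec (P k) c" for k c x using that by (simp add: \<eta>_def)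
  have sq: "\<eta> True \<cdot>\<^bsub>H\<^esub> m = m' \<cdot>\<^bsub>H\<^esub> \<eta> False"
  proof (rule ap_ext[OF H.cmp_hom[OF m \<eta>] H.cmp_hom[OF \<eta> m']])
    fix c x assume c: "c \<in> Ob C" "x \<in> sec (P False) c"
    note mx = ap_in[OF m c]
    have "ap \<mu> (ob c True) (res (glued P m) (ar (idn C c) True False) x) = res (glued P' m') (ar (idn C c) True False) (ap \<mu> (ob c False) x)"
      using two.ap_nat[OF \<mu>, of "ar (idn C c) True False" x] c by simp
    then have "ap \<mu> (ob c True) (ap m c x) = ap m' c (ap \<mu> (ob c False) x)"
      using c in'[OF c] sheafD(3)[OF PS[of m P True, OF m] c(1) mx] sheafD(3)[OF PS[of m' P' True, OF m'] c(1) ap_in[OF m' c(1) in'[OF c]]]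
      by (simp add: trn_def)
    then show "ap (\<eta> True \<cdot>\<^bsub>H\<^esub> m) c x = ap (m' \<cdot>\<^bsub>H\<^esub> \<eta> False) c x"
      using ap_cmp[OF m \<eta> c] ap_cmp[OF \<eta> m' c] ape c mx by simp
  qed
  have "glued_map P m P' m' \<eta> = \<mu>"
  proof (rule two.ap_ext[OF glued_map_hom[of m P m' P' \<eta>, OF m m' \<eta> sq] \<mu>])
    fix x z assume "x \<in> Ob two" and z: "z \<in> sec (glued P m) x"
    then obtain d k where x: "x = ob d k" "d \<in> Ob C" by (auto elim: two_ObE)
    then show "ap (glued_map P m P' m' \<eta>) x z = ap \<mu> x z" using z ape by simp
  qed
  then show ?thesis using \<eta> sq by blast
qed

lemma glued_map_faithful:
  assumes \<eta>: "\<And>k. \<eta> k \<in> hom H (P k) (P' k)" and \<theta>: "\<And>k. \<theta> k \<in> hom H (P k) (P' k)"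
    and e: "glued_map P m P' m' \<eta> = glued_map P m P' m' \<theta>"
  shows "\<eta> = \<theta>"
proof (rule ext)
  fix k show "\<eta> k = \<theta> k"
    by (rule ap_ext[OF \<eta> \<theta>]) (use ap_glued_map[of _ _ P k m P' m' \<eta>] ap_glued_map[of _ _ P k m P' m' \<theta>] e in auto)
qed

text \<open>The two levels of \<open>Q\<close> are sheaves, and \<open>m\<close> is restriction
  along the arrows between the levels over identities. Because presheaves are extensional records,
  \<open>Q\<close> is recovered as an equality and not just up to isomorphism.\<close>

lemma glued_surj:
  assumes Q: "sheaf two J2 Q"
  shows "\<exists>P m. m \<in> hom H (P False) (P True) \<and> glued P m = Q"
proof -
  note QD = two.sheafD[OF Q]
  define P where "P k = mk_psh (\<lambda>c. sec Q (ob c k)) (\<lambda>f. res Q (ar f k k))" for k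
  have secP: "sec (P k) c = sec Q (ob c k)" if "c \<in> Ob C" for k c using that by (simp add: P_def)
  have resP: "res (P k) f a = res Q (ar f k k) a" if "f \<in> Ar C" "a \<in> sec Q (ob (tgt C f) k)" for k f a using that by (simp add: P_def)
  have r_in: "res Q (ar f k k') a \<in> sec Q (ob (src C f) k)" if "f \<in> Ar C" "k' \<longrightarrow> k" "a \<in> sec Q (ob (tgt C f) k')" for f k k' a
    using QD(2)[of "ar f k k'" a] that by simp
  have r_id: "res Q (ar (idn C c) k k) a = a" if "c \<in> Ob C" "a \<in> sec Q (ob c k)" for c k a
    using QD(3)[of "ob c k" a] that by simp
  have r_cmp: "res Q (ar (f \<cdot>\<^bsub>C\<^esub> g) l k') a = res Q (ar g l k) (res Q (ar f k k') a)"
    if "f \<in> Ar C" "g \<in> Ar C" "tgt C g = src C f" "k' \<longrightarrow> k" "k \<longrightarrow> l" "a \<in> sec Q (ob (tgt C f) k')" for f g k k' l a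
    using QD(4)[of "ar f k k'" "ar g l k" a] that by simp
  have P0: "presheaf C (P k)" for k
    unfolding P_def by (rule mk_psh_presheaf) (use QD(1) r_in r_id r_cmp in auto)
  \<comment> \<open>The sieve generated by \<open>R\<close> at level \<open>k\<close>, through which
    the sheaf condition of \<open>Q\<close> is applied to a cover of the original site.\<close>
  have gen: "\<exists>S \<in> J2 (ob c k). level k S = R \<and> (\<forall>a \<in> S. \<exists>f l. a = ar f l k \<and> f \<in> R \<and> (k \<longrightarrow> l))"
    if c: "c \<in> Ob C" and R: "R \<in> J c" for c R k
  proof -
    note RD = coverD[OF R c]
    let ?S = "{ar f l k | f l. f \<in> R \<and> (k \<longrightarrow> l)}"
    have "sieve two (ob c k) ?S"
      unfolding sieve_def
    proof (intro conjI ballI impI)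
      show "?S \<subseteq> {f \<in> Ar two. tgt two f = ob c k}" using RD by auto
      fix a b assume "a \<in> ?S" "b \<in> Ar two" "tgt two b = src two a"
      then obtain f l g l' where "a = ar f l k" "f \<in> R" "k \<longrightarrow> l" "b = ar g l' l" "g \<in> Ar C" "l \<longrightarrow> l'" "tgt C g = src C f"
        by (auto elim!: two_ArE)
      then show "a \<cdot>\<^bsub>two\<^esub> b \<in> ?S" using RD(3) by auto
    qed
    moreover have "level k ?S = R" using RD(1) by (auto simp: level_def)
    ultimately show ?thesis using R by (intro bexI[of _ ?S]) (auto simp: J2_def)
  qed
  have PS': "sheaf C J (P k)" for k
  proof (rule sheafI[OF P0])
    fix c R a b assume c: "c \<in> Ob C" and R: "R \<in> J c" and ab: "a \<in> sec (P k) c" "b \<in> sec (P k) c"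
      and e: "\<And>f. f \<in> R \<Longrightarrow> res (P k) f a = res (P k) f b"
    note RD = coverD[OF R c]
    obtain S where S: "S \<in> J2 (ob c k)" "\<And>a. a \<in> S \<Longrightarrow> \<exists>f l. a = ar f l k \<and> f \<in> R \<and> (k \<longrightarrow> l)"
      using gen[OF c R, of k] by (elim bexE conjE) auto
    have ab': "a \<in> sec Q (ob c k)" "b \<in> sec Q (ob c k)" using ab c by (simp_all add: secP)
    show "a = b"
    proof (rule two.sheaf_separated[OF Q _ S(1) ab'])
      fix h assume "h \<in> S"
      then obtain f l where f: "h = ar f l k" "f \<in> R" "k \<longrightarrow> l" using S(2) by blast
      have "res Q (ar f k k) a = res Q (ar f k k) b" using e[OF f(2)] RD(1,2)[OF f(2)] ab' by (simp add: resP)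
      moreover have "res Q h z = res Q (ar (idn C (src C f)) l k) (res Q (ar f k k) z)" if "z \<in> sec Q (ob c k)" for z
        using r_cmp[of f "idn C (src C f)" k k l z] f RD(1,2)[OF f(2)] that by simp
      ultimately show "res Q h a = res Q h b" using ab' by simp
    qed (use c in simp)
  next
    fix c R y assume c: "c \<in> Ob C" and R: "R \<in> J c" and y0: "\<And>f. f \<in> R \<Longrightarrow> y f \<in> sec (P k) (src C f)"
      and ym0: "\<And>f g. f \<in> R \<Longrightarrow> g \<in> Ar C \<Longrightarrow> tgt C g = src C f \<Longrightarrow> y (f \<cdot>\<^bsub>C\<^esub> g) = res (P k) g (y f)"
    note RD = coverD[OF R c]
    have y: "y f \<in> sec Q (ob (src C f) k)" if "f \<in> R" for f using y0[OF that] RD(1)[OF that] by (simp add: secP)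
    have ym: "y (f \<cdot>\<^bsub>C\<^esub> g) = res Q (ar g k k) (y f)" if "f \<in> R" "g \<in> Ar C" "tgt C g = src C f" for f g
      using ym0[OF that] y[OF that(1)] that by (simp add: resP)
    obtain S where S: "S \<in> J2 (ob c k)" "level k S = R" "\<And>a. a \<in> S \<Longrightarrow> \<exists>f l. a = ar f l k \<and> f \<in> R \<and> (k \<longrightarrow> l)"
      using gen[OF c R, of k] by (elim bexE conjE) auto
    \<comment> \<open>The matching family \<open>y\<close> lives at level \<open>k\<close>; on an
      arrow from another level its value is forced to be the restriction between the levels.\<close>
    define Y where "Y a = res Q (ar (idn C (src C (arf a))) (ars a) k) (y (arf a))" for a
    have "\<exists>!a. a \<in> sec Q (ob c k) \<and> (\<forall>h \<in> S. res Q h a = Y h)"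
    proof (rule two.sheaf_glue[OF Q _ S(1)])
      fix h assume "h \<in> S"
      then obtain f l where f: "h = ar f l k" "f \<in> R" "k \<longrightarrow> l" using S(3) by blast
      show "Y h \<in> sec Q (src two h)" using r_in[of "idn C (src C f)" k l "y f"] y[OF f(2)] f RD(1)[OF f(2)] by (simp add: Y_def)
      fix b assume b: "b \<in> Ar two" "tgt two b = src two h"
      then obtain g l' where g: "b = ar g l' l" "g \<in> Ar C" "l \<longrightarrow> l'" "tgt C g = src C f" using f by (auto elim!: two_ArE)
      note f' = RD(1)[OF f(2)] and yf = y[OF f(2)]
      have "Y (h \<cdot>\<^bsub>two\<^esub> b) = res Q (ar (idn C (src C g)) l' k) (res Q (ar g k k) (y f))"
        using f g f' ym[OF f(2) g(2,4)] by (simp add: Y_def)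
      also have "\<dots> = res Q (ar (g \<cdot>\<^bsub>C\<^esub> idn C (src C g)) l' k) (y f)"
        using r_cmp[of g "idn C (src C g)" k k l' "y f"] f g f' yf by simp
      also have "\<dots> = res Q (ar (idn C (src C f) \<cdot>\<^bsub>C\<^esub> g) l' k) (y f)" using g f' by simp
      also have "\<dots> = res Q (ar g l' l) (res Q (ar (idn C (src C f)) l k) (y f))"
        using r_cmp[of "idn C (src C f)" g k l l' "y f"] f g f' yf by simp
      finally show "Y (h \<cdot>\<^bsub>two\<^esub> b) = res Q b (Y h)" using f g by (simp add: Y_def)
    qed (use c in simp)
    then obtain a where a: "a \<in> sec Q (ob c k)" "\<And>h. h \<in> S \<Longrightarrow> res Q h a = Y h" by blast
    have "res (P k) f a = y f" if f: "f \<in> R" for f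
    proof -
      have "ar f k k \<in> S" using f S(2) by (auto simp: level_def)
      then show ?thesis using a(2)[of "ar f k k"] a(1) RD(1,2)[OF f] r_id[OF _ y[OF f]] by (simp add: resP Y_def)
    qed
    then show "\<exists>a\<in>sec (P k) c. \<forall>f\<in>R. res (P k) f a = y f" using a c by (auto simp: secP)
  qed
  define m where "m = mk_map (P False) (P True) (\<lambda>c. res Q (ar (idn C c) True False))"
  have m: "m \<in> hom H (P False) (P True)"
    unfolding m_def
  proof (rule mk_map_hom[OF PS' PS'])
    fix c a assume "c \<in> Ob C" "a \<in> sec (P False) c"
    then show "res Q (ar (idn C c) True False) a \<in> sec (P True) c" using r_in[of "idn C c" False True a] by (simp add: secP)
  next
    fix f a assume f: "f \<in> Ar C" and "a \<in> sec (P False) (tgt C f)"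
    then have a: "a \<in> sec Q (ob (tgt C f) False)" by (simp add: secP)
    then show "res Q (ar (idn C (src C f)) True False) (res (P False) f a) = res (P True) f (res Q (ar (idn C (tgt C f)) True False) a)"
      using f r_in[of "idn C (tgt C f)" False True a]
        r_cmp[of f "idn C (src C f)" False False True a] r_cmp[of "idn C (tgt C f)" f False True True a] by (simp add: resP)
  qed
  have "glued P m = Q"
  proof (rule two.psh_ext)
    show "presheaf two (glued P m)" by (rule glued_presheaf[of m P, OF m])
    show "presheaf two Q" by (rule two.sheaf_presheaf[OF Q])
    fix x assume "x \<in> Ob two" then show "sec (glued P m) x = sec Q x" by (auto elim!: two_ObE simp: secP)
  next
    fix h a assume "h \<in> Ar two" and a: "a \<in> sec (glued P m) (tgt two h)"
    then obtain f k k' where f: "h = ar f k k'" "f \<in> Ar C" "k' \<longrightarrow> k" by (auto elim: two_ArE)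
    have aP: "a \<in> sec (P k') (tgt C f)" and aQ: "a \<in> sec Q (ob (tgt C f) k')" using a f by (simp_all add: secP)
    have t: "trn m k' k (tgt C f) a = res Q (ar (idn C (tgt C f)) k k') a"
    proof (cases "k' = k")
      case True then show ?thesis using r_id[OF _ aQ] f by (simp add: trn_def)
    next
      case False then have "k' = False" "k = True" using f(3) by auto
      then show ?thesis using aP f by (simp add: trn_def m_def)
    qed
    show "res (glued P m) h a = res Q h a"
      using f aP aQ t r_in[of "idn C (tgt C f)" k' k a] r_cmp[of "idn C (tgt C f)" f k' k k a] by (simp add: resP)
  qed
  then show ?thesis using m by blast
qed

end

subsection \<open>The arrow category of a Grothendieck topos is a Grothendieck topos\<close>

locale arrow_topos = glueing C J + F: ftor B "Sh C J" F
  for C :: "('u,'u) cat" and J and B :: "('u,'u) cat" and F +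
  assumes ff: "fully_faithful B (Sh C J) F" and eso: "ess_surj B (Sh C J) F"
begin

sublocale arrow_category B
  by unfold_locales (rule inf)

definition ends :: "'u \<Rightarrow> bool \<Rightarrow> 'u psh" where
  "ends v k = fob F (if k then tgt B v else src B v)"

definition legs :: "'u \<Rightarrow> bool \<Rightarrow> 'u sheaf_map" where
  "legs s k = far F (if k then sq_cod s else sq_dom s)"

definition arrow_sheaf :: "('u, 'u, 'u psh, 'u sheaf_map) ftr" where
  "arrow_sheaf = \<lparr>fob = (\<lambda>v \<in> Ar B. glued (ends v) (far F v)),
     far = (\<lambda>s \<in> Ar T. glued_map (ends (src T s)) (far F (src T s)) (ends (tgt T s)) (far F (tgt T s)) (legs s))\<rparr>"

lemma arrow_sheaf_sel [simp]: "v \<in> Ar B \<Longrightarrow> fob arrow_sheaf v = glued (ends v) (far F v)"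
  "s \<in> Ar T \<Longrightarrow> far arrow_sheaf s = glued_map (ends (src T s)) (far F (src T s)) (ends (tgt T s)) (far F (tgt T s)) (legs s)"
  by (auto simp: arrow_sheaf_def)

lemma ends_hom: "v \<in> Ar B \<Longrightarrow> far F v \<in> hom (Sh C J) (ends v False) (ends v True)"
  by (simp add: ends_def hom_iff)

lemma legs_hom: "s \<in> Ar T \<Longrightarrow> legs s k \<in> hom (Sh C J) (ends (src T s) k) (ends (tgt T s) k)"
  using T_Ar[of s] by (simp add: legs_def ends_def hom_iff)

lemma legs_sq: "s \<in> Ar T \<Longrightarrow> legs s True \<cdot>\<^bsub>Sh C J\<^esub> far F (src T s) = far F (tgt T s) \<cdot>\<^bsub>Sh C J\<^esub> legs s False"
  using T_Ar[of s] F.far_cmp[of "src T s" "sq_cod s"] F.far_cmp[of "sq_dom s" "tgt T s"] by (simp add: legs_def)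

lemma arrow_sheaf_functor: "ftor T (Sh two J2) arrow_sheaf"
proof (rule ftorI[OF T.category_axioms two.H.category_axioms functorI[OF T.category_axioms]])
  fix v assume "v \<in> Ob T" then have v: "v \<in> Ar B" by simp
  show "fob arrow_sheaf v \<in> Ob (Sh two J2)" using glued_sheaf[of "far F v" "ends v", OF ends_hom[OF v]] v by simp
  have l: "legs (idn T v) = (\<lambda>k. idn (Sh C J) (ends v k))" using v by (auto simp: legs_def ends_def)
  have i: "idn T v \<in> Ar T" "src T (idn T v) = v" "tgt T (idn T v) = v" using v T.idn_Ar[of v] T.src_idn[of v] T.tgt_idn[of v] by auto
  show "far arrow_sheaf (idn T v) = idn (Sh two J2) (fob arrow_sheaf v)"
    using glued_map_idn[of "far F v" "ends v", OF ends_hom[OF v]] i v by (simp add: l)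
next
  fix s v w assume "s \<in> hom T v w"
  then have s: "s \<in> Ar T" "src T s = v" "tgt T s = w" by (auto simp: hom_iff)
  have vw: "v \<in> Ar B" "w \<in> Ar B" using T_Ar[OF s(1)] s by auto
  show "far arrow_sheaf s \<in> hom (Sh two J2) (fob arrow_sheaf v) (fob arrow_sheaf w)"
    using glued_map_hom[of "far F v" "ends v" "far F w" "ends w" "legs s", OF ends_hom[OF vw(1)] ends_hom[OF vw(2)]]
      legs_hom[OF s(1)] legs_sq[OF s(1)] s vw by simp
  fix r x assume "r \<in> hom T w x"
  then have r: "r \<in> Ar T" "src T r = w" "tgt T r = x" by (auto simp: hom_iff)
  have x: "x \<in> Ar B" using T_Ar[OF r(1)] r by auto
  have rs: "r \<cdot>\<^bsub>T\<^esub> s \<in> Ar T" "src T (r \<cdot>\<^bsub>T\<^esub> s) = v" "tgt T (r \<cdot>\<^bsub>T\<^esub> s) = x" using r s by auto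
  have l: "legs (r \<cdot>\<^bsub>T\<^esub> s) = (\<lambda>k. legs r k \<cdot>\<^bsub>Sh C J\<^esub> legs s k)"
    using T_Ar[OF s(1)] T_Ar[OF r(1)] r s by (auto simp: legs_def F.far_cmp)
  show "far arrow_sheaf (r \<cdot>\<^bsub>T\<^esub> s) = far arrow_sheaf r \<cdot>\<^bsub>Sh two J2\<^esub> far arrow_sheaf s"
    using glued_map_cmp[of "far F v" "ends v" "far F w" "ends w" "far F x" "ends x" "legs s" "legs r",
        OF ends_hom[OF vw(1)] ends_hom[OF vw(2)] ends_hom[OF x]]
      legs_hom[OF s(1)] legs_sq[OF s(1)] legs_hom[OF r(1)] legs_sq[OF r(1)] r s rs by (simp add: l)
qed (auto simp: arrow_sheaf_def)

lemma arrow_sheaf_ff: "fully_faithful T (Sh two J2) arrow_sheaf"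
  unfolding fully_faithful_def bij_betw_def
proof (intro ballI conjI inj_onI equalityI subsetI)
  fix v w s r assume s0: "s \<in> hom T v w" and r0: "r \<in> hom T v w" and e: "far arrow_sheaf s = far arrow_sheaf r"
  have s: "s \<in> Ar T" "src T s = v" "tgt T s = w" and r: "r \<in> Ar T" "src T r = v" "tgt T r = w" using s0 r0 by (auto simp: hom_iff)
  have "legs s = legs r"
    using glued_map_faithful[of "legs s" "ends v" "ends w" "legs r" "far F v" "far F w"] legs_hom[OF s(1)] legs_hom[OF r(1)] e s r by simp
  then have "legs s True = legs r True" "legs s False = legs r False" by auto
  then have e': "far F (sq_cod s) = far F (sq_cod r)" "far F (sq_dom s) = far F (sq_dom r)" by (auto simp: legs_def)
  note S = T_Ar[OF s(1), unfolded s(2,3)] and R = T_Ar[OF r(1), unfolded r(2,3)]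
  have "sq_cod s = sq_cod r" by (rule F.ff_eq[OF ff eso _ _ _ _ e'(1)]) (simp_all only: S R)
  moreover have "sq_dom s = sq_dom r" by (rule F.ff_eq[OF ff eso _ _ _ _ e'(2)]) (simp_all only: S R)
  ultimately show "s = r" using sq_ext[OF s(1) r(1)] by (simp only: s r)
next
  fix v w \<mu> assume "v \<in> Ob T" "w \<in> Ob T" and \<mu>: "\<mu> \<in> hom (Sh two J2) (fob arrow_sheaf v) (fob arrow_sheaf w)"
  then have vw: "v \<in> Ar B" "w \<in> Ar B" by auto
  obtain \<eta> where \<eta>: "\<And>k. \<eta> k \<in> hom (Sh C J) (ends v k) (ends w k)" "\<eta> True \<cdot>\<^bsub>Sh C J\<^esub> far F v = far F w \<cdot>\<^bsub>Sh C J\<^esub> \<eta> False"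
    "glued_map (ends v) (far F v) (ends w) (far F w) \<eta> = \<mu>"
    using glued_map_full[of "far F v" "ends v" "far F w" "ends w" \<mu>, OF ends_hom[OF vw(1)] ends_hom[OF vw(2)]] \<mu> vw by auto
  obtain a where a: "a \<in> Ar B" "src B a = src B v" "tgt B a = src B w" "far F a = \<eta> False"
    using F.ff_full[OF ff eso, of "src B v" "src B w" "\<eta> False"] \<eta>(1)[of False] vw by (auto simp: ends_def hom_iff)
  obtain b where b: "b \<in> Ar B" "src B b = tgt B v" "tgt B b = tgt B w" "far F b = \<eta> True"
    using F.ff_full[OF ff eso, of "tgt B v" "tgt B w" "\<eta> True"] \<eta>(1)[of True] vw by (auto simp: ends_def hom_iff)
  have "far F (b \<cdot>\<^bsub>B\<^esub> v) = far F (w \<cdot>\<^bsub>B\<^esub> a)" using a b vw \<eta>(2) by (simp add: F.far_cmp)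
  then have "b \<cdot>\<^bsub>B\<^esub> v = w \<cdot>\<^bsub>B\<^esub> a" using F.ff_eq[OF ff eso, of "b \<cdot>\<^bsub>B\<^esub> v" "w \<cdot>\<^bsub>B\<^esub> a"] a b vw by simp
  then have s: "sq v w a b \<in> hom T v w" using a b vw by (intro sq_hom) (auto simp: hom_iff)
  have "legs (sq v w a b) = \<eta>" by (rule ext) (auto simp: legs_def a b)
  then have "far arrow_sheaf (sq v w a b) = \<mu>" using s \<eta>(3) by (simp add: hom_iff del: T_sel(4))
  then show "\<mu> \<in> far arrow_sheaf ` hom T v w" using s by blast
qed (auto dest: functor_hom[OF ftor.F[OF arrow_sheaf_functor]])

text \<open>Each level of \<open>Q\<close> is isomorphic to an object coming from \<open>B\<close>.
  Conjugating \<open>m\<close> with these isomorphisms gives an arrow of \<open>B\<close>, and the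
  isomorphisms commute with the maps by construction, so they glue.\<close>

lemma arrow_sheaf_eso: "ess_surj T (Sh two J2) arrow_sheaf"
  unfolding ess_surj_def
proof
  fix Q assume "Q \<in> Ob (Sh two J2)"
  then obtain P m where m: "m \<in> hom (Sh C J) (P False) (P True)" and Q: "glued P m = Q" using glued_surj[of Q] by auto
  have "\<exists>b i j. b \<in> Ob B \<and> i \<in> hom (Sh C J) (fob F b) (P k) \<and> j \<in> hom (Sh C J) (P k) (fob F b) \<and>
     j \<cdot>\<^bsub>Sh C J\<^esub> i = idn (Sh C J) (fob F b) \<and> i \<cdot>\<^bsub>Sh C J\<^esub> j = idn (Sh C J) (P k)" for k
  proof -
    have "P k \<in> Ob (Sh C J)" using PS[of m P k, OF m] by simp
    from F.eso_obtain[OF ff eso this] show ?thesis by (metis hom_iff)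
  qed
  then obtain b i j where b: "\<And>k. b k \<in> Ob B" and i: "\<And>k. i k \<in> hom (Sh C J) (fob F (b k)) (P k)"
    and j: "\<And>k. j k \<in> hom (Sh C J) (P k) (fob F (b k))" and ji: "\<And>k. j k \<cdot>\<^bsub>Sh C J\<^esub> i k = idn (Sh C J) (fob F (b k))"
    and ij: "\<And>k. i k \<cdot>\<^bsub>Sh C J\<^esub> j k = idn (Sh C J) (P k)" by metis
  let ?n = "j True \<cdot>\<^bsub>Sh C J\<^esub> (m \<cdot>\<^bsub>Sh C J\<^esub> i False)"
  have n: "?n \<in> hom (Sh C J) (fob F (b False)) (fob F (b True))" by (rule H.cmp_hom[OF H.cmp_hom[OF i m] j])
  obtain v where v: "v \<in> Ar B" "src B v = b False" "tgt B v = b True" "far F v = ?n"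
    using F.ff_full[OF ff eso b b, of ?n] n by (auto simp: hom_iff)
  have en: "ends v = (\<lambda>k. fob F (b k))" by (auto simp: ends_def v)
  note nF = ends_hom[OF v(1), unfolded en]
  have I: "i k \<in> hom (Sh C J) (ends v k) (P k)" and Jj: "j k \<in> hom (Sh C J) (P k) (ends v k)" for k using i j by (simp_all add: en)
  have sqi: "i True \<cdot>\<^bsub>Sh C J\<^esub> far F v = m \<cdot>\<^bsub>Sh C J\<^esub> i False"
    using H.reassoc[OF ij[of True], of "m \<cdot>\<^bsub>Sh C J\<^esub> i False"] i[of False] i[of True] j[of True] m by (simp add: v hom_iff)
  have sqj: "j True \<cdot>\<^bsub>Sh C J\<^esub> m = far F v \<cdot>\<^bsub>Sh C J\<^esub> j False"
    using i[of False] j[of True] j[of False] m by (simp add: v hom_iff H.assoc ij)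
  let ?i = "glued_map (ends v) (far F v) P m i" and ?j = "glued_map P m (ends v) (far F v) j"
  have hi: "?i \<in> hom (Sh two J2) (fob arrow_sheaf v) Q"
    using glued_map_hom[of "far F v" "ends v" m P i, OF ends_hom[OF v(1)] m I sqi] v Q by simp
  have hj: "?j \<in> hom (Sh two J2) Q (fob arrow_sheaf v)"
    using glued_map_hom[of m P "far F v" "ends v" j, OF m ends_hom[OF v(1)] Jj sqj] v Q by simp
  have "?j \<cdot>\<^bsub>Sh two J2\<^esub> ?i = idn (Sh two J2) (fob arrow_sheaf v)"
    using glued_map_cmp[of "far F v" "ends v" m P "far F v" "ends v" i j, OF ends_hom[OF v(1)] m ends_hom[OF v(1)] I sqi Jj sqj]
      glued_map_idn[of "far F v" "ends v", OF ends_hom[OF v(1)]] v by (simp add: ji en)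
  moreover have "?i \<cdot>\<^bsub>Sh two J2\<^esub> ?j = idn (Sh two J2) Q"
    using glued_map_cmp[of m P "far F v" "ends v" m P j i, OF m ends_hom[OF v(1)] m Jj sqj I sqi]
      glued_map_idn[of m P, OF m] Q by (simp add: ij)
  ultimately show "\<exists>c\<in>Ob T. \<exists>i\<in>hom (Sh two J2) (fob arrow_sheaf c) Q. is_iso (Sh two J2) i"
    using isoI[OF hi hj] hi v(1) by (intro bexI[of _ v] bexI[of _ ?i]) simp_all
qed

lemma arrow_cat_topos:
  assumes sm: "\<And>x y. x \<in> Ob B \<Longrightarrow> y \<in> Ob B \<Longrightarrow> small (hom B x y)"
  shows "grothendieck_topos (arrow_cat B)"
  unfolding grothendieck_topos_def
proof (intro conjI ballI)
  fix v w assume "v \<in> Ob T" "w \<in> Ob T"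
  then have vw: "v \<in> Ar B" "w \<in> Ar B" by auto
  have "|hom B (src B v) (src B w) \<times> hom B (tgt B v) (tgt B w)| <o |UNIV :: 'u set|"
    using sm vw by (intro card_of_Times_less[OF inacc]) (auto simp: small_def)
  then have "|(\<lambda>(a,b). sq v w a b) ` (hom B (src B v) (src B w) \<times> hom B (tgt B v) (tgt B w))| <o |UNIV :: 'u set|"
    by (rule card_of_image_less)
  moreover have "hom T v w \<subseteq> (\<lambda>(a,b). sq v w a b) ` (hom B (src B v) (src B w) \<times> hom B (tgt B v) (tgt B w))"
  proof
    fix s assume "s \<in> hom T v w"
    then have s: "s \<in> Ar T" "src T s = v" "tgt T s = w" by (auto simp: hom_iff)
    note S = T_Ar[OF s(1), unfolded s]
    show "s \<in> (\<lambda>(a,b). sq v w a b) ` (hom B (src B v) (src B w) \<times> hom B (tgt B v) (tgt B w))"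
      using S by (intro image_eqI[of _ _ "(sq_dom s, sq_cod s)"]) (auto simp: hom_iff)
  qed
  ultimately show "small (hom T v w)" unfolding small_def by (metis card_of_subset_less)
next
  have "small_category two" using category_two two.small_Ob two.small_Ar by (simp add: small_category_def)
  moreover have "equivalent_cats T (Sh two J2)"
    unfolding equivalent_cats_def using equivalenceI[OF arrow_sheaf_functor arrow_sheaf_ff arrow_sheaf_eso] by blast
  ultimately show "\<exists>(C :: ('u,'u) cat) J. small_category C \<and> grothendieck_topology C J \<and> equivalent_cats T (Sh C J)"
    using topology_two by blast
qed (rule T.category_axioms)

end

lemma topos_category: "grothendieck_topos B \<Longrightarrow> category B"
  by (simp add: grothendieck_topos_def)

lemma topos_site:
  assumes inacc: "inaccessible TYPE('u)" and B: "grothendieck_topos (B :: ('u,'u) cat)"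
  obtains C :: "('u,'u) cat" and J F where "site C J" "ftor B (Sh C J) F" "fully_faithful B (Sh C J) F" "ess_surj B (Sh C J) F"
proof -
  obtain C :: "('u,'u) cat" and J F where C: "small_category C" "grothendieck_topology C J" and F: "is_equivalence B (Sh C J) F"
    using B unfolding grothendieck_topos_def equivalent_cats_def by blast
  have s: "site C J" using C inacc by (simp add: site_def site_axioms_def small_category_def)
  interpret site C J by (rule s)
  have f: "is_functor B H F" using F by (simp add: is_equivalence_def)
  show ?thesis
    by (rule that[OF s ftorI[OF topos_category[OF B] H.category_axioms f]
          equivalence_fully_faithful[OF topos_category[OF B] H.category_axioms F] equivalence_ess_surj[OF F]])
qed

lemma topos_limits:
  assumes inacc: "inaccessible TYPE('u)" and B: "grothendieck_topos (B :: ('u,'u) cat)"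
  shows "\<exists>t. terminal_in B t" "\<exists>i. initial_in B i" "has_pullbacks B"
proof -
  obtain C :: "('u,'u) cat" and J F where s: "site C J" and F: "ftor B (Sh C J) F" "fully_faithful B (Sh C J) F" "ess_surj B (Sh C J) F"
    using topos_site[OF inacc B] .
  interpret site C J by (rule s)
  interpret F: ftor B H F by (rule F(1))
  show "\<exists>t. terminal_in B t" using Sh_has_terminal F.equivalence_has_terminal[OF F(2,3)] by blast
  show "\<exists>i. initial_in B i" using Sh_has_initial F.equivalence_has_initial[OF F(2,3)] by blast
  show "has_pullbacks B" by (rule F.equivalence_has_pullbacks[OF F(2,3) Sh_has_pullbacks])
qed

lemma topos_arrow_cat:
  assumes inacc: "inaccessible TYPE('u)" and B: "grothendieck_topos (B :: ('u,'u) cat)"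
  shows "grothendieck_topos (arrow_cat B)"
proof -
  obtain C :: "('u,'u) cat" and J F where s: "site C J" and F: "ftor B (Sh C J) F" "fully_faithful B (Sh C J) F" "ess_surj B (Sh C J) F"
    using topos_site[OF inacc B] .
  interpret site C J by (rule s)
  interpret F: ftor B H F by (rule F(1))
  interpret arrow_topos C J B F by unfold_locales (rule F)+
  show ?thesis by (rule arrow_cat_topos) (use B in \<open>auto simp: grothendieck_topos_def\<close>)
qed

subsection \<open>Two-cells between geometric morphisms\<close>

lemma nat_trans_inverse:
  assumes "category C" "category D" and F: "is_functor C D F" and G: "is_functor C D G"
    and n: "nat_trans C D F G \<eta>" and i: "\<And>x. x \<in> Ob C \<Longrightarrow> is_iso D (\<eta> x)"
  shows "\<exists>\<theta>. nat_trans C D G F \<theta> \<and> (\<forall>x \<in> Ob C. \<theta> x \<cdot>\<^bsub>D\<^esub> \<eta> x = idn D (fob F x) \<and> \<eta> x \<cdot>\<^bsub>D\<^esub> \<theta> x = idn D (fob G x))"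
proof -
  interpret C: category C by fact
  interpret F: ftor C D F by (rule ftorI[OF assms(1-3)])
  interpret G: ftor C D G by (rule ftorI[OF assms(1,2,4)])
  note e = F.natD[OF n]
  have "\<exists>j. j \<in> hom D (fob G x) (fob F x) \<and> j \<cdot>\<^bsub>D\<^esub> \<eta> x = idn D (fob F x) \<and> \<eta> x \<cdot>\<^bsub>D\<^esub> j = idn D (fob G x)" if x: "x \<in> Ob C" for x
    using isoE[OF i[OF x] nt_hom[OF n x]] by metis
  then obtain \<theta> where "\<And>x. x \<in> Ob C \<Longrightarrow> \<theta> x \<in> hom D (fob G x) (fob F x) \<and> \<theta> x \<cdot>\<^bsub>D\<^esub> \<eta> x = idn D (fob F x) \<and> \<eta> x \<cdot>\<^bsub>D\<^esub> \<theta> x = idn D (fob G x)"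
    by metis
  then have t: "\<theta> x \<in> Ar D" "src D (\<theta> x) = fob G x" "tgt D (\<theta> x) = fob F x" "\<theta> x \<cdot>\<^bsub>D\<^esub> \<eta> x = idn D (fob F x)" "\<eta> x \<cdot>\<^bsub>D\<^esub> \<theta> x = idn D (fob G x)"
    if "x \<in> Ob C" for x using that by (auto simp: hom_iff)
  have nat: "\<theta> (tgt C f) \<cdot>\<^bsub>D\<^esub> far G f = far F f \<cdot>\<^bsub>D\<^esub> \<theta> (src C f)" if f: "f \<in> Ar C" for f
  proof (rule F.D.iso_mono[OF i[of "tgt C f"]])
    have "\<eta> (tgt C f) \<cdot>\<^bsub>D\<^esub> (far F f \<cdot>\<^bsub>D\<^esub> \<theta> (src C f)) = (far G f \<cdot>\<^bsub>D\<^esub> \<eta> (src C f)) \<cdot>\<^bsub>D\<^esub> \<theta> (src C f)"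
      using F.D.reassoc[OF e(1)[OF f], of "\<theta> (src C f)"] f t[of "src C f"] e(2-4)[of "tgt C f"] by simp
    also have "\<dots> = far G f" using f t[of "src C f"] e(2-4)[of "src C f"] by (simp add: F.D.assoc)
    also have "\<dots> = \<eta> (tgt C f) \<cdot>\<^bsub>D\<^esub> (\<theta> (tgt C f) \<cdot>\<^bsub>D\<^esub> far G f)"
      using F.D.reassoc[OF t(5)[of "tgt C f"], of "far G f"] f t[of "tgt C f"] e(2-4)[of "tgt C f"] by simp
    finally show "\<eta> (tgt C f) \<cdot>\<^bsub>D\<^esub> (\<theta> (tgt C f) \<cdot>\<^bsub>D\<^esub> far G f) = \<eta> (tgt C f) \<cdot>\<^bsub>D\<^esub> (far F f \<cdot>\<^bsub>D\<^esub> \<theta> (src C f))" by simp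
  qed (use f t e in simp_all)
  have "nat_trans C D G F (restrict \<theta> (Ob C))" unfolding nat_trans_def using t nat by (auto simp: hom_iff)
  then show ?thesis using t by (intro exI[of _ "restrict \<theta> (Ob C)"]) simp
qed

lemma gtop_isoI:
  assumes "category E" "category F" and g: "geometric_morphism E F f" "geometric_morphism E F g"
    and n: "nat_trans F E (inv_im f) (inv_im g) \<phi>" and i: "\<And>x. x \<in> Ob F \<Longrightarrow> is_iso E (\<phi> x)"
  shows "is_iso (Hom gtop E F) (f, g, \<phi>)"
proof -
  obtain \<theta> where t: "nat_trans F E (inv_im g) (inv_im f) \<theta>" "\<forall>x \<in> Ob F. \<theta> x \<cdot>\<^bsub>E\<^esub> \<phi> x = idn E (fob (inv_im f) x) \<and> \<phi> x \<cdot>\<^bsub>E\<^esub> \<theta> x = idn E (fob (inv_im g) x)"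
    using nat_trans_inverse[OF assms(2,1) geom_dest(1)[OF g(1)] geom_dest(1)[OF g(2)] n i] by blast
  show ?thesis
    by (rule isoI[of _ _ f g "(g, f, \<theta>)"]) (use g n t in \<open>simp_all add: hom_gtop gtop_sel cong: restrict_cong\<close>)
qed

lemma gtop_isoD:
  assumes i: "is_iso (Hom gtop E F) (f, g, \<phi>)" and x: "x \<in> Ob F"
  shows "is_iso E (\<phi> x)"
proof -
  have "(f, g, \<phi>) \<in> hom (Hom gtop E F) f g" using i by (auto simp: is_iso_def hom_iff gtop_def)
  from isoE[OF i this] obtain s where "s \<in> hom (Hom gtop E F) g f" "s \<cdot>\<^bsub>Hom gtop E F\<^esub> (f, g, \<phi>) = idn (Hom gtop E F) f"
    "(f, g, \<phi>) \<cdot>\<^bsub>Hom gtop E F\<^esub> s = idn (Hom gtop E F) g" .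
  then obtain \<theta> where t: "nat_trans F E (inv_im g) (inv_im f) \<theta>"
     "(\<lambda>x\<in>Ob F. \<theta> x \<cdot>\<^bsub>E\<^esub> \<phi> x) = (\<lambda>x\<in>Ob F. idn E (fob (inv_im f) x))" "(\<lambda>x\<in>Ob F. \<phi> x \<cdot>\<^bsub>E\<^esub> \<theta> x) = (\<lambda>x\<in>Ob F. idn E (fob (inv_im g) x))"
    by (auto simp: hom_gtop gtop_sel)
  have p: "nat_trans F E (inv_im f) (inv_im g) \<phi>" using \<open>(f, g, \<phi>) \<in> hom _ _ _\<close> by (simp add: hom_gtop)
  show ?thesis using isoI[OF nt_hom[OF p x] nt_hom[OF t(1) x]] fun_cong[OF t(2), of x] fun_cong[OF t(3), of x] x by simp
qed

lemma gtop_lwhisker: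
  assumes "category A" "category B" "category C" and g: "geometric_morphism B C g" and f: "geometric_morphism A B f" "geometric_morphism A B f'"
    and n: "nat_trans B A (inv_im f) (inv_im f') \<sigma>"
  shows "lwhisker gtop A B C g (f, f', \<sigma>) = (cmp_geom A B C g f, cmp_geom A B C g f', \<lambda>c \<in> Ob C. \<sigma> (fob (inv_im g) c))"
proof -
  interpret A: category A by fact
  interpret G: ftor C B "inv_im g" by (rule ftorI[OF assms(3,2) geom_dest(1)[OF g]])
  interpret F: ftor B A "inv_im f" by (rule ftorI[OF assms(2,1) geom_dest(1)[OF f(1)]])
  show ?thesis unfolding lwhisker_def gtop_sel using F.natD(2-4)[OF n] by (auto simp: restrict_def fun_eq_iff)
qed

lemma gtop_rwhisker:
  assumes "category A" "category B" "category C" and g: "geometric_morphism B C g" "geometric_morphism B C g'" and f: "geometric_morphism A B f"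
    and n: "nat_trans C B (inv_im g) (inv_im g') \<sigma>"
  shows "rwhisker gtop A B C (g, g', \<sigma>) f = (cmp_geom A B C g f, cmp_geom A B C g' f, \<lambda>c \<in> Ob C. far (inv_im f) (\<sigma> c))"
proof -
  interpret A: category A by fact
  interpret G: ftor C B "inv_im g" by (rule ftorI[OF assms(3,2) geom_dest(1)[OF g(1)]])
  interpret G': ftor C B "inv_im g'" by (rule ftorI[OF assms(3,2) geom_dest(1)[OF g(2)]])
  interpret F: ftor B A "inv_im f" by (rule ftorI[OF assms(2,1) geom_dest(1)[OF f(1)]])
  show ?thesis unfolding rwhisker_def gtop_sel using G.natD(2-4)[OF n] by (auto simp: restrict_def fun_eq_iff)
qed

subsection \<open>The arrow category is a tensor\<close>

text \<open>A 2-cell \<open>\<alpha>\<close> is the same as the functor \<open>pairing\<close> into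
  the arrow category, and a 2-cell between 1-cells out of \<open>T\<close> is a natural family of
  squares, given by its two sides. The universal 2-cell has the arrow \<open>v\<close> itself as
  component at \<open>v\<close>.\<close>

lemma gtop_arrow_tensor:
  assumes inacc: "inaccessible TYPE('u)" and B: "grothendieck_topos (B :: ('u,'u) cat)"
    and i0: "geometric_morphism B (arrow_cat B) i0" "inv_im i0 = dom_ftr B"
    and i1: "geometric_morphism B (arrow_cat B) i1" "inv_im i1 = cod_ftr B"
  shows "arrow_tensor gtop B (arrow_cat B) i0 i1 (i0, i1, \<lambda>v \<in> Ar B. v)"
proof -
  interpret arrow_category B
    by (rule arrow_category.intro[OF topos_category[OF B] arrow_category_axioms.intro[OF inaccessible_infinite[OF inacc]]])
  let ?\<tau> = "(i0, i1, \<lambda>v \<in> Ar B. v)"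
  note cB = B.category_axioms and cT = T.category_axioms
  have nt: "nat_trans T B (inv_im i0) (inv_im i1) (\<lambda>v \<in> Ar B. v)"
    unfolding i0(2) i1(2) nat_trans_def using T_Ar by (auto simp: hom_iff)
  have lw: "lwhisker gtop B T D a ?\<tau> = (cmp_geom B T D a i0, cmp_geom B T D a i1, \<lambda>d \<in> Ob D. fob (inv_im a) d)"
    if D: "category D" and a: "geometric_morphism T D a" for D a
  proof -
    have "fob (inv_im a) d \<in> Ar B" if "d \<in> Ob D" for d using functor_Ob[OF geom_dest(1)[OF a] that] by simp
    then show ?thesis unfolding gtop_lwhisker[OF cB cT D a i0(1) i1(1) nt] by (auto simp: restrict_def fun_eq_iff)
  qed
  show ?thesis
    unfolding arrow_tensor_def
  proof (intro conjI ballI allI impI)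
    show "T \<in> Obj gtop" using topos_arrow_cat[OF inacc B] by (simp add: gtop_sel)
    show "i0 \<in> Ob (Hom gtop B T)" "i1 \<in> Ob (Hom gtop B T)" using i0 i1 by (auto simp: gtop_sel)
    show "?\<tau> \<in> hom (Hom gtop B T) i0 i1" using i0 i1 nt by (simp add: hom_gtop)
  next
    fix D :: "('u,'u) cat" and g g' \<alpha>
    assume D: "D \<in> Obj gtop" and \<alpha>: "\<alpha> \<in> hom (Hom gtop B D) g g'"
    then have tD: "grothendieck_topos D" by (simp add: gtop_sel)
    note cD = topos_category[OF tD]
    obtain \<sigma> where s: "\<alpha> = (g, g', \<sigma>)" and g: "geometric_morphism B D g" "geometric_morphism B D g'"
      and ns: "nat_trans D B (inv_im g) (inv_im g') \<sigma>" using \<alpha> by (auto simp: hom_gtop)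
    interpret G: ftor D B "inv_im g" by (rule ftorI[OF cD cB geom_dest(1)[OF g(1)]])
    interpret G': ftor D B "inv_im g'" by (rule ftorI[OF cD cB geom_dest(1)[OF g(2)]])
    interpret arrow_transf B D "inv_im g" "inv_im g'" \<sigma> by unfold_locales (rule ns)
    have "\<exists>R e. couniversal D T pairing v R e" if "v \<in> Ob T" for v
      by (rule pairing_couniversal[OF topos_limits(3)[OF inacc tD] _ _ that])
        (use geom_couniversal[OF cB cD g(1)] geom_couniversal[OF cB cD g(2)] in blast)+
    then obtain a where a: "geometric_morphism T D a" "inv_im a = pairing"
      using geom_of_couniversal[OF pairing.ftor_axioms pairing_left_exact[OF geom_dest(7)[OF g(1)] geom_dest(7)[OF g(2)]]] by blast
    have e0: "cmp_ftr D (dom_ftr B) pairing = inv_im g"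
      by (rule functor_eq[OF cmp_functor[OF cD pairing.F dom.F] G.F]) (auto simp: cmp_fob cmp_far simp del: T_sel(4))
    have e1: "cmp_ftr D (cod_ftr B) pairing = inv_im g'"
      by (rule functor_eq[OF cmp_functor[OF cD pairing.F cod.F] G'.F]) (auto simp: cmp_fob cmp_far simp del: T_sel(4))
    \<comment> \<open>The inverse images agree strictly by \<open>e0\<close> and \<open>e1\<close>,
      but the direct images chosen for \<open>a\<close> are only isomorphic to the given ones. Hence
      the 1-cells differ, and the comparisons are isomorphisms with identity components.\<close>
    let ?k0 = "(g, cmp_geom B T D a i0, \<lambda>d \<in> Ob D. idn B (fob (inv_im g) d))"
    let ?k1 = "(g', cmp_geom B T D a i1, \<lambda>d \<in> Ob D. idn B (fob (inv_im g') d))"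
    have c: "geometric_morphism B D (cmp_geom B T D a i0)" "geometric_morphism B D (cmp_geom B T D a i1)"
      "inv_im (cmp_geom B T D a i0) = inv_im g" "inv_im (cmp_geom B T D a i1) = inv_im g'"
      using cmp_geom[OF cB cT cD i0(1) a(1)] cmp_geom[OF cB cT cD i1(1) a(1)] by (simp_all add: inv_cmp_geom i0 i1 a e0 e1)
    show "\<exists>a\<in>Ob (Hom gtop T D). \<exists>\<kappa>0\<in>hom (Hom gtop B D) g (cmp1 gtop B T D a i0). \<exists>\<kappa>1\<in>hom (Hom gtop B D) g' (cmp1 gtop B T D a i1).
        is_iso (Hom gtop B D) \<kappa>0 \<and> is_iso (Hom gtop B D) \<kappa>1 \<and>
        lwhisker gtop B T D a ?\<tau> \<cdot>\<^bsub>Hom gtop B D\<^esub> \<kappa>0 = \<kappa>1 \<cdot>\<^bsub>Hom gtop B D\<^esub> \<alpha>"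
    proof (intro bexI conjI)
      show "is_iso (Hom gtop B D) ?k0"
        by (rule gtop_isoI[OF cB cD g(1) c(1)]) (use nt_id[OF cD cB G.F] iso_idn[OF cB] in \<open>auto simp: c\<close>)
      show "is_iso (Hom gtop B D) ?k1"
        by (rule gtop_isoI[OF cB cD g(2) c(2)]) (use nt_id[OF cD cB G'.F] iso_idn[OF cB] in \<open>auto simp: c\<close>)
      show "lwhisker gtop B T D a ?\<tau> \<cdot>\<^bsub>Hom gtop B D\<^esub> ?k0 = ?k1 \<cdot>\<^bsub>Hom gtop B D\<^esub> \<alpha>"
        unfolding lw[OF cD a(1)] s gtop_sel by (auto simp: a restrict_def fun_eq_iff)
      show "?k0 \<in> hom (Hom gtop B D) g (cmp1 gtop B T D a i0)" "?k1 \<in> hom (Hom gtop B D) g' (cmp1 gtop B T D a i1)"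
        using nt_id[OF cD cB G.F] nt_id[OF cD cB G'.F] g c by (auto simp: hom_gtop gtop_sel(3))
      show "a \<in> Ob (Hom gtop T D)" using a by (simp add: gtop_sel)
    qed
  next
    fix D :: "('u,'u) cat" and a b \<sigma>0 \<sigma>1
    assume D: "D \<in> Obj gtop" and a0: "a \<in> Ob (Hom gtop T D)" and b0: "b \<in> Ob (Hom gtop T D)"
      and s0: "\<sigma>0 \<in> hom (Hom gtop B D) (cmp1 gtop B T D a i0) (cmp1 gtop B T D b i0)"
      and s1: "\<sigma>1 \<in> hom (Hom gtop B D) (cmp1 gtop B T D a i1) (cmp1 gtop B T D b i1)"
      and eq: "lwhisker gtop B T D b ?\<tau> \<cdot>\<^bsub>Hom gtop B D\<^esub> \<sigma>0 = \<sigma>1 \<cdot>\<^bsub>Hom gtop B D\<^esub> lwhisker gtop B T D a ?\<tau>"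
    have cD: "category D" using D topos_category by (auto simp: gtop_sel)
    have a: "geometric_morphism T D a" and b: "geometric_morphism T D b" using a0 b0 by (auto simp: gtop_sel)
    interpret a: ftor D T "inv_im a" by (rule ftorI[OF cD cT geom_dest(1)[OF a]])
    interpret b: ftor D T "inv_im b" by (rule ftorI[OF cD cT geom_dest(1)[OF b]])
    have aO: "fob (inv_im a) d \<in> Ar B" and bO: "fob (inv_im b) d \<in> Ar B" if "d \<in> Ob D" for d
      using a.fob_Ob[OF that] b.fob_Ob[OF that] by simp_all
    obtain m0 m1 where m: "\<sigma>0 = (cmp_geom B T D a i0, cmp_geom B T D b i0, m0)" "\<sigma>1 = (cmp_geom B T D a i1, cmp_geom B T D b i1, m1)"
      and n0: "nat_trans D B (cmp_ftr D (dom_ftr B) (inv_im a)) (cmp_ftr D (dom_ftr B) (inv_im b)) m0"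
      and n1: "nat_trans D B (cmp_ftr D (cod_ftr B) (inv_im a)) (cmp_ftr D (cod_ftr B) (inv_im b)) m1"
      using s0 s1 by (auto simp: hom_gtop gtop_sel(3) inv_cmp_geom i0 i1)
    have h0: "m0 d \<in> hom B (src B (fob (inv_im a) d)) (src B (fob (inv_im b) d))" if d: "d \<in> Ob D" for d
      using nt_hom[OF n0 d] aO[OF d] bO[OF d] d by (simp add: cmp_fob)
    have h1: "m1 d \<in> hom B (tgt B (fob (inv_im a) d)) (tgt B (fob (inv_im b) d))" if d: "d \<in> Ob D" for d
      using nt_hom[OF n1 d] aO[OF d] bO[OF d] d by (simp add: cmp_fob)
    have sqr: "m1 d \<cdot>\<^bsub>B\<^esub> fob (inv_im a) d = fob (inv_im b) d \<cdot>\<^bsub>B\<^esub> m0 d" if d: "d \<in> Ob D" for d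
      using fun_cong[of _ _ d, OF conjunct2[OF conjunct2[OF eq[unfolded lw[OF cD a] lw[OF cD b] m gtop_sel prod.inject]]]] d by simp
    define s where "s = (\<lambda>d \<in> Ob D. sq (fob (inv_im a) d) (fob (inv_im b) d) (m0 d) (m1 d))"
    have sh: "s d \<in> hom T (fob (inv_im a) d) (fob (inv_im b) d)" and sdc: "sq_dom (s d) = m0 d" "sq_cod (s d) = m1 d" if d: "d \<in> Ob D" for d
      using sq_hom[OF aO[OF d] bO[OF d] h0[OF d] h1[OF d] sqr[OF d]] d by (simp_all add: s_def)
    have sn: "nat_trans D T (inv_im a) (inv_im b) s"
      unfolding nat_trans_def
    proof (intro conjI ballI)
      fix f assume f: "f \<in> Ar D"
      have fa: "far (inv_im a) f \<in> hom T (fob (inv_im a) (src D f)) (fob (inv_im a) (tgt D f))"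
        and fb: "far (inv_im b) f \<in> hom T (fob (inv_im b) (src D f)) (fob (inv_im b) (tgt D f))" using f by (simp_all add: hom_iff)
      have S: "src D f \<in> Ob D" "tgt D f \<in> Ob D" using f by auto
      note l = T.cmp_hom[OF fa sh[OF S(2)]] and r = T.cmp_hom[OF sh[OF S(1)] fb]
      have d0: "m0 (tgt D f) \<cdot>\<^bsub>B\<^esub> sq_dom (far (inv_im a) f) = sq_dom (far (inv_im b) f) \<cdot>\<^bsub>B\<^esub> m0 (src D f)"
        and d1: "m1 (tgt D f) \<cdot>\<^bsub>B\<^esub> sq_cod (far (inv_im a) f) = sq_cod (far (inv_im b) f) \<cdot>\<^bsub>B\<^esub> m1 (src D f)"
        using n0 n1 f by (auto simp: nat_trans_def cmp_far)
      show "s (tgt D f) \<cdot>\<^bsub>T\<^esub> far (inv_im a) f = far (inv_im b) f \<cdot>\<^bsub>T\<^esub> s (src D f)"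
        by (rule sq_ext) (use l r d0 d1 in \<open>simp_all add: hom_iff sdc S del: T_sel(4)\<close>)
    qed (use sh in \<open>auto simp: s_def\<close>)
    have rw0: "rwhisker gtop B T D (a, b, u) i0 = (cmp_geom B T D a i0, cmp_geom B T D b i0, \<lambda>d \<in> Ob D. sq_dom (u d))"
      and rw1: "rwhisker gtop B T D (a, b, u) i1 = (cmp_geom B T D a i1, cmp_geom B T D b i1, \<lambda>d \<in> Ob D. sq_cod (u d))"
      if u: "nat_trans D T (inv_im a) (inv_im b) u" for u
    proof -
      have "u d \<in> Ar T" if "d \<in> Ob D" for d using nt_hom[OF u that] by (simp add: hom_iff)
      then show "rwhisker gtop B T D (a, b, u) i0 = (cmp_geom B T D a i0, cmp_geom B T D b i0, \<lambda>d \<in> Ob D. sq_dom (u d))"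
        "rwhisker gtop B T D (a, b, u) i1 = (cmp_geom B T D a i1, cmp_geom B T D b i1, \<lambda>d \<in> Ob D. sq_cod (u d))"
        unfolding gtop_rwhisker[OF cB cT cD a b i0(1) u] gtop_rwhisker[OF cB cT cD a b i1(1) u] i0 i1
        by (auto simp: restrict_def fun_eq_iff)
    qed
    have ext: "m0 \<in> extensional (Ob D)" "m1 \<in> extensional (Ob D)" using n0 n1 by (auto simp: nat_trans_def)
    show "\<exists>!\<sigma>. \<sigma> \<in> hom (Hom gtop T D) a b \<and> rwhisker gtop B T D \<sigma> i0 = \<sigma>0 \<and> rwhisker gtop B T D \<sigma> i1 = \<sigma>1"
    proof (rule ex1I[of _ "(a, b, s)"])
      have "(\<lambda>d \<in> Ob D. sq_dom (s d)) = m0" "(\<lambda>d \<in> Ob D. sq_cod (s d)) = m1"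
        by (rule extensionalityI[of _ "Ob D"]; use ext sdc in simp)+
      then show "(a, b, s) \<in> hom (Hom gtop T D) a b \<and> rwhisker gtop B T D (a, b, s) i0 = \<sigma>0 \<and> rwhisker gtop B T D (a, b, s) i1 = \<sigma>1"
        using a b sn rw0[OF sn] rw1[OF sn] by (simp add: hom_gtop m)
      fix \<sigma> assume r: "\<sigma> \<in> hom (Hom gtop T D) a b \<and> rwhisker gtop B T D \<sigma> i0 = \<sigma>0 \<and> rwhisker gtop B T D \<sigma> i1 = \<sigma>1"
      then obtain u where u: "\<sigma> = (a, b, u)" "nat_trans D T (inv_im a) (inv_im b) u" by (auto simp: hom_gtop)
      have q: "(\<lambda>d \<in> Ob D. sq_dom (u d)) = m0" "(\<lambda>d \<in> Ob D. sq_cod (u d)) = m1" using r rw0[OF u(2)] rw1[OF u(2)] by (auto simp: u m)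
      have "u = s"
      proof (rule nt_eq[OF sn])
        fix d assume d: "d \<in> Ob D"
        show "u d = s d"
          using sh[OF d] nt_hom[OF u(2) d] fun_cong[OF q(1), of d] fun_cong[OF q(2), of d] sdc[OF d] d
          by - (rule sq_ext, simp_all add: hom_iff del: T_sel(4))
      qed (use u in \<open>simp add: nat_trans_def\<close>)
      then show "\<sigma> = (a, b, s)" using u by simp
    qed
  qed
qed

text \<open>Left adjoints of the two functors give left exactness and right adjoints give direct
  images. The initial object enters on the side of codomains, the terminal object on the side of
  domains.\<close>

lemma gtop_arrow_ends:
  assumes inacc: "inaccessible TYPE('u)" and B: "grothendieck_topos (B :: ('u,'u) cat)"
  obtains i0 i1 where "geometric_morphism B (arrow_cat B) i0" "inv_im i0 = dom_ftr B"
    "geometric_morphism B (arrow_cat B) i1" "inv_im i1 = cod_ftr B"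
proof -
  interpret arrow_category B
    by (rule arrow_category.intro[OF topos_category[OF B] arrow_category_axioms.intro[OF inaccessible_infinite[OF inacc]]])
  obtain t i where t: "terminal_in B t" and i: "initial_in B i" using topos_limits[OF inacc B] by blast
  show ?thesis
    using geom_of_couniversal[OF dom.ftor_axioms dom_left_exact dom_couniversal[OF t]]
      geom_of_couniversal[OF cod.ftor_axioms cod_left_exact[OF i] cod_couniversal] that by blast
qed

section \<open>1-cells of the pseudoslice into the etale object\<close>

locale etale_object = etale E X p q for E :: "('u,'u) cat" and X p q +
  assumes inacc: "inaccessible TYPE('u)" and topos: "grothendieck_topos E"
begin

sublocale two_category "gtop :: (('u,'u) cat, _, _) twocat"
  by (rule two_category_gtop)

lemma geom_p: "geometric_morphism S E p"
  using et by (simp add: is_etale_def)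

abbreviation "cells T a \<equiv> Hom (pseudoslice gtop E) (T, a) (S, p)"
abbreviation "im x \<equiv> inv_im (fst x)"
abbreviation "sect T x \<psi> \<equiv> etale_point.section E X p q T (im x) \<psi>"

text \<open>A 1-cell of the pseudoslice carries a transformation \<open>\<phi>\<close> from
  \<open>inv_im a\<close>, whereas an \<open>etale_point\<close> is described by one in the opposite
  direction. So \<open>\<psi>\<close> is recorded as the inverse of \<open>\<phi>\<close>.\<close>

definition point_of :: "('u,'u) cat \<Rightarrow> 'u geom \<Rightarrow> 'u geom \<times> 'u geom \<times> 'u geom \<times> ('u \<Rightarrow> 'u) \<Rightarrow> ('u \<Rightarrow> 'u) \<Rightarrow> bool" where
  "point_of T a x \<psi> \<longleftrightarrow> etale_point E X p q T (inv_im a) (im x) \<psi> \<and>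
     (\<exists>\<phi>. x = (fst x, a, cmp_geom T S E p (fst x), \<phi>) \<and> geometric_morphism T S (fst x) \<and>
       nat_trans E T (inv_im a) (cmp_ftr E (im x) \<pi>) \<phi> \<and>
       (\<forall>D \<in> Ob E. \<psi> D \<cdot>\<^bsub>T\<^esub> \<phi> D = idn T (fob (inv_im a) D) \<and> \<phi> D \<cdot>\<^bsub>T\<^esub> \<psi> D = idn T (fob (im x) (fob \<pi> D))))"

context
  fixes T a
  assumes T: "category T" and a: "geometric_morphism T E a"
begin

lemma A_ftor: "ftor E T (inv_im a)"
  by (rule ftorI[OF category_axioms T geom_dest(1)[OF a]])

lemma etale_pointI:
  assumes h: "geometric_morphism T S h" and n: "nat_trans E T (cmp_ftr E (inv_im h) \<pi>) (inv_im a) \<psi>"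
    and i: "\<And>D. D \<in> Ob E \<Longrightarrow> is_iso T (\<psi> D)"
  shows "etale_point E X p q T (inv_im a) (inv_im h) \<psi>"
proof -
  interpret A: ftor E T "inv_im a" by (rule A_ftor)
  interpret H: ftor S T "inv_im h" by (rule ftorI[OF S.category_axioms T geom_dest(1)[OF h]])
  show ?thesis by unfold_locales (use geom_dest(7)[OF h] n i in auto)
qed

lemma cell_point:
  assumes x: "x \<in> Ob (cells T a)"
  shows "\<exists>\<psi>. point_of T a x \<psi>"
proof -
  obtain h \<alpha> where xe: "x = (h, \<alpha>)" by (cases x)
  then have h: "geometric_morphism T S h" and al: "\<alpha> \<in> hom (Hom gtop T E) a (cmp_geom T S E p h)" "is_iso (Hom gtop T E) \<alpha>"
    using x by (auto simp: PS_Ob gtop_sel)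
  obtain \<phi> where \<phi>: "\<alpha> = (a, cmp_geom T S E p h, \<phi>)" "nat_trans E T (inv_im a) (cmp_ftr E (inv_im h) \<pi>) \<phi>"
    using al(1) by (auto simp: hom_gtop inv_cmp_geom)
  interpret H: ftor S T "inv_im h" by (rule ftorI[OF S.category_axioms T geom_dest(1)[OF h]])
  have HP: "is_functor E T (cmp_ftr E (inv_im h) \<pi>)" by (rule cmp_functor[OF category_axioms P.F H.F])
  obtain \<psi> where ps: "nat_trans E T (cmp_ftr E (inv_im h) \<pi>) (inv_im a) \<psi>"
    "\<forall>D \<in> Ob E. \<psi> D \<cdot>\<^bsub>T\<^esub> \<phi> D = idn T (fob (inv_im a) D) \<and> \<phi> D \<cdot>\<^bsub>T\<^esub> \<psi> D = idn T (fob (cmp_ftr E (inv_im h) \<pi>) D)"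
    using nat_trans_inverse[OF category_axioms T geom_dest(1)[OF a] HP \<phi>(2)] gtop_isoD[of T E a _ \<phi>] al(2)[unfolded \<phi>(1)] by blast
  have "is_iso T (\<psi> D)" if "D \<in> Ob E" for D
    using isoI[OF nt_hom[OF ps(1) that] nt_hom[OF \<phi>(2) that]] ps(2) that by blast
  from etale_pointI[OF h ps(1) this] show ?thesis
    unfolding point_of_def using h \<phi> ps(2) by (intro exI[of _ \<psi>]) (auto simp: xe cmp_fob)
qed

lemma point_cell:
  assumes pt: "point_of T a x \<psi>"
  shows "x \<in> Ob (cells T a)"
proof -
  obtain \<phi> where x: "x = (fst x, a, cmp_geom T S E p (fst x), \<phi>)" and h: "geometric_morphism T S (fst x)"
    and n: "nat_trans E T (inv_im a) (cmp_ftr E (im x) \<pi>) \<phi>"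
    and i: "\<forall>D \<in> Ob E. \<psi> D \<cdot>\<^bsub>T\<^esub> \<phi> D = idn T (fob (inv_im a) D) \<and> \<phi> D \<cdot>\<^bsub>T\<^esub> \<psi> D = idn T (fob (im x) (fob \<pi> D))"
    and pt': "etale_point E X p q T (inv_im a) (im x) \<psi>" using pt unfolding point_of_def by blast
  interpret etale_point E X p q T "inv_im a" "im x" \<psi> by (rule pt')
  have c: "geometric_morphism T E (cmp_geom T S E p (fst x))"
    by (rule cmp_geom[OF T S.category_axioms category_axioms h geom_p])
  have "is_iso T (\<phi> D)" if D: "D \<in> Ob E" for D
    by (rule isoI[OF nt_hom[OF n D], of "\<psi> D"]) (use D i nt_hom[OF psi D] in \<open>auto simp: cmp_fob\<close>)
  then have "is_iso (Hom gtop T E) (a, cmp_geom T S E p (fst x), \<phi>)"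
    by (intro gtop_isoI[OF T category_axioms a c]) (simp_all add: inv_cmp_geom n)
  then have "(fst x, (a, cmp_geom T S E p (fst x), \<phi>)) \<in> Ob (cells T a)"
    unfolding PS_Ob using h n a c by (simp add: gtop_sel hom_gtop inv_cmp_geom)
  then show ?thesis using x by simp
qed

text \<open>The triangle of a 2-cell is stated with \<open>\<phi>\<close>, the condition on
  transformations of points with its inverse. Cancelling the inverse pairs turns one equation into
  the other.\<close>

lemma cells_hom:
  assumes x: "point_of T a x \<psi>" and y: "point_of T a y \<chi>"
  shows "s \<in> hom (cells T a) x y \<longleftrightarrow> (\<exists>\<sigma>. s = (x, y, fst x, fst y, \<sigma>) \<and> nat_trans S T (im x) (im y) \<sigma> \<and>
    (\<forall>D \<in> Ob E. \<chi> D \<cdot>\<^bsub>T\<^esub> \<sigma> (fob \<pi> D) = \<psi> D))"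
proof -
  obtain \<phi> where xe: "x = (fst x, a, cmp_geom T S E p (fst x), \<phi>)" and h: "geometric_morphism T S (fst x)"
    and n: "nat_trans E T (inv_im a) (cmp_ftr E (im x) \<pi>) \<phi>"
    and i: "\<And>D. D \<in> Ob E \<Longrightarrow> \<psi> D \<cdot>\<^bsub>T\<^esub> \<phi> D = idn T (fob (inv_im a) D) \<and> \<phi> D \<cdot>\<^bsub>T\<^esub> \<psi> D = idn T (fob (im x) (fob \<pi> D))"
    and pt: "etale_point E X p q T (inv_im a) (im x) \<psi>" using x unfolding point_of_def by blast
  obtain \<phi>' where ye: "y = (fst y, a, cmp_geom T S E p (fst y), \<phi>')" and h': "geometric_morphism T S (fst y)"
    and n': "nat_trans E T (inv_im a) (cmp_ftr E (im y) \<pi>) \<phi>'"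
    and i': "\<And>D. D \<in> Ob E \<Longrightarrow> \<chi> D \<cdot>\<^bsub>T\<^esub> \<phi>' D = idn T (fob (inv_im a) D) \<and> \<phi>' D \<cdot>\<^bsub>T\<^esub> \<chi> D = idn T (fob (im y) (fob \<pi> D))"
    and pt': "etale_point E X p q T (inv_im a) (im y) \<chi>" using y unfolding point_of_def by blast
  interpret X: etale_point E X p q T "inv_im a" "im x" \<psi> by (rule pt)
  interpret Y: etale_point E X p q T "inv_im a" "im y" \<chi> by (rule pt')
  note sx = X.psi_sel and sy = Y.psi_sel
  have ph: "\<phi> D \<in> Ar T" "src T (\<phi> D) = fob (inv_im a) D" "tgt T (\<phi> D) = fob (im x) (fob \<pi> D)"
     "\<phi>' D \<in> Ar T" "src T (\<phi>' D) = fob (inv_im a) D" "tgt T (\<phi>' D) = fob (im y) (fob \<pi> D)" if "D \<in> Ob E" for D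
    using nt_hom[OF n that] nt_hom[OF n' that] that by (auto simp: hom_iff cmp_fob)
  have x2: "snd x = (a, cmp_geom T S E p (fst x), \<phi>)" and y2: "snd y = (a, cmp_geom T S E p (fst y), \<phi>')"
    using arg_cong[OF xe, of snd] arg_cong[OF ye, of snd] by simp_all
  have ext: "\<phi>' \<in> extensional (Ob E)" using n' by (simp add: nat_trans_def)
  have key: "lwhisker gtop T S E p (fst x, fst y, \<sigma>) \<cdot>\<^bsub>Hom gtop T E\<^esub> snd x = snd y \<longleftrightarrow> (\<forall>D \<in> Ob E. \<chi> D \<cdot>\<^bsub>T\<^esub> \<sigma> (fob \<pi> D) = \<psi> D)"
    if s: "nat_trans S T (im x) (im y) \<sigma>" for \<sigma>
  proof -
    have so: "\<sigma> (fob \<pi> D) \<in> Ar T" "src T (\<sigma> (fob \<pi> D)) = fob (im x) (fob \<pi> D)" "tgt T (\<sigma> (fob \<pi> D)) = fob (im y) (fob \<pi> D)" if "D \<in> Ob E" for D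
      using nt_hom[OF s, of "fob \<pi> D"] that by (auto simp: hom_iff)
    have "lwhisker gtop T S E p (fst x, fst y, \<sigma>) \<cdot>\<^bsub>Hom gtop T E\<^esub> snd x = snd y \<longleftrightarrow> (\<lambda>D \<in> Ob E. \<sigma> (fob \<pi> D) \<cdot>\<^bsub>T\<^esub> \<phi> D) = \<phi>'"
      unfolding gtop_lwhisker[OF T S.category_axioms category_axioms geom_p h h' s] x2 y2 gtop_sel
      by (simp cong: restrict_cong)
    also have "\<dots> \<longleftrightarrow> (\<forall>D \<in> Ob E. \<sigma> (fob \<pi> D) \<cdot>\<^bsub>T\<^esub> \<phi> D = \<phi>' D)"
    proof (intro iffI ballI)
      fix D assume "(\<lambda>D \<in> Ob E. \<sigma> (fob \<pi> D) \<cdot>\<^bsub>T\<^esub> \<phi> D) = \<phi>'" and D: "D \<in> Ob E"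
      then have "(\<lambda>D \<in> Ob E. \<sigma> (fob \<pi> D) \<cdot>\<^bsub>T\<^esub> \<phi> D) D = \<phi>' D" by (simp only:)
      then show "\<sigma> (fob \<pi> D) \<cdot>\<^bsub>T\<^esub> \<phi> D = \<phi>' D" by (simp only: restrict_apply D if_True)
    qed (rule extensionalityI[of _ "Ob E"], use ext in auto)
    also have "\<dots> \<longleftrightarrow> (\<forall>D \<in> Ob E. \<chi> D \<cdot>\<^bsub>T\<^esub> \<sigma> (fob \<pi> D) = \<psi> D)"
    proof (rule ball_cong[OF refl])
      fix D assume D: "D \<in> Ob E"
      note f = so[OF D] ph[OF D] sx[OF D] sy[OF D] i[OF D] i'[OF D]
      show "\<sigma> (fob \<pi> D) \<cdot>\<^bsub>T\<^esub> \<phi> D = \<phi>' D \<longleftrightarrow> \<chi> D \<cdot>\<^bsub>T\<^esub> \<sigma> (fob \<pi> D) = \<psi> D"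
      proof
        assume e: "\<sigma> (fob \<pi> D) \<cdot>\<^bsub>T\<^esub> \<phi> D = \<phi>' D"
        have "\<sigma> (fob \<pi> D) = \<phi>' D \<cdot>\<^bsub>T\<^esub> \<psi> D" using X.H.D.reassoc[OF e, of "\<psi> D"] f D by simp
        then show "\<chi> D \<cdot>\<^bsub>T\<^esub> \<sigma> (fob \<pi> D) = \<psi> D" using X.H.D.reassoc[OF conjunct1[OF i'[OF D]], of "\<psi> D"] f D by simp
      next
        assume e: "\<chi> D \<cdot>\<^bsub>T\<^esub> \<sigma> (fob \<pi> D) = \<psi> D"
        have "\<chi> D \<cdot>\<^bsub>T\<^esub> (\<sigma> (fob \<pi> D) \<cdot>\<^bsub>T\<^esub> \<phi> D) = idn T (fob (inv_im a) D)" using X.H.D.reassoc[OF e, of "\<phi> D"] f D by simp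
        then show "\<sigma> (fob \<pi> D) \<cdot>\<^bsub>T\<^esub> \<phi> D = \<phi>' D"
          using X.H.D.reassoc[OF conjunct2[OF i'[OF D]], of "\<sigma> (fob \<pi> D) \<cdot>\<^bsub>T\<^esub> \<phi> D"] f D by simp
      qed
    qed
    finally show ?thesis .
  qed
  show ?thesis
    unfolding PS_hom using point_cell[OF x] point_cell[OF y] key h h' by (auto simp: hom_gtop)
qed

text \<open>The component of a 2-cell at the identity of \<open>X\<close> is such a \<open>v\<close>
  by \<open>point_arrow_fib\<close>, and \<open>point_arrow_exists\<close> extends \<open>v\<close>
  to a 2-cell. Existence of 2-cells is thereby reduced to an equation of sections.\<close>

lemma cells_linked:
  assumes x: "point_of T a x \<psi>" and y: "point_of T a y \<chi>"
  shows "hom (cells T a) x y \<noteq> {} \<longleftrightarrow>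
    (\<exists>v \<in> hom T (fob (im x) (idn E X)) (fob (im y) (idn E X)). sect T y \<chi> \<cdot>\<^bsub>T\<^esub> v = sect T x \<psi>)"
proof -
  have pt: "etale_point E X p q T (inv_im a) (im x) \<psi>" and pt': "etale_point E X p q T (inv_im a) (im y) \<chi>"
    using x y unfolding point_of_def by blast+
  interpret X: etale_point E X p q T "inv_im a" "im x" \<psi> by (rule pt)
  interpret Y: etale_point E X p q T "inv_im a" "im y" \<chi> by (rule pt')
  show ?thesis
  proof
    assume "hom (cells T a) x y \<noteq> {}"
    then obtain \<sigma> where s: "nat_trans S T (im x) (im y) \<sigma>" "\<And>D. D \<in> Ob E \<Longrightarrow> \<chi> D \<cdot>\<^bsub>T\<^esub> \<sigma> (fob \<pi> D) = \<psi> D"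
      unfolding ex_in_conv[symmetric] cells_hom[OF x y] by blast
    have "Y.section \<cdot>\<^bsub>T\<^esub> \<sigma> (idn E X) = X.section"
      unfolding X.section_def Y.section_def by (rule X.point_arrow_fib[OF pt' s]) auto
    then show "\<exists>v \<in> hom T (fob (im x) (idn E X)) (fob (im y) (idn E X)). sect T y \<chi> \<cdot>\<^bsub>T\<^esub> v = sect T x \<psi>"
      using nt_hom[OF s(1), of "idn E X"] by (intro bexI[of _ "\<sigma> (idn E X)"]) auto
  next
    assume "\<exists>v \<in> hom T (fob (im x) (idn E X)) (fob (im y) (idn E X)). sect T y \<chi> \<cdot>\<^bsub>T\<^esub> v = sect T x \<psi>"
    then obtain \<sigma> where "nat_trans S T (im x) (im y) \<sigma>" "\<forall>D \<in> Ob E. \<chi> D \<cdot>\<^bsub>T\<^esub> \<sigma> (fob \<pi> D) = \<psi> D"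
      using X.point_arrow_exists[OF pt'] by blast
    then show "hom (cells T a) x y \<noteq> {}" unfolding ex_in_conv[symmetric] cells_hom[OF x y] by blast
  qed
qed

text \<open>Uniqueness is \<open>point_arrow_unique\<close>. The map \<open>v\<close> that links two
  points runs between terminal objects, so it is invertible and the equation of sections can be read
  backwards.\<close>

lemma cells_setoidal: "setoidal (cells T a)"
  unfolding setoidal_def
proof (intro conjI allI impI)
  fix x y s r assume s: "s \<in> hom (cells T a) x y" and r: "r \<in> hom (cells T a) x y"
  then have "x \<in> Ob (cells T a)" "y \<in> Ob (cells T a)" by (auto simp: PS_hom)
  then obtain \<psi> \<chi> where x: "point_of T a x \<psi>" and y: "point_of T a y \<chi>" using cell_point by metis
  have pt: "etale_point E X p q T (inv_im a) (im x) \<psi>" and pt': "etale_point E X p q T (inv_im a) (im y) \<chi>"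
    using x y unfolding point_of_def by blast+
  show "s = r" using s r etale_point.point_arrow_unique[OF pt pt'] unfolding cells_hom[OF x y] by blast
next
  fix x y assume l: "hom (cells T a) x y \<noteq> {}"
  then have "x \<in> Ob (cells T a)" "y \<in> Ob (cells T a)" by (auto simp: PS_hom)
  then obtain \<psi> \<chi> where x: "point_of T a x \<psi>" and y: "point_of T a y \<chi>" using cell_point by metis
  have pt: "etale_point E X p q T (inv_im a) (im x) \<psi>" and pt': "etale_point E X p q T (inv_im a) (im y) \<chi>"
    using x y unfolding point_of_def by blast+
  interpret X: etale_point E X p q T "inv_im a" "im x" \<psi> by (rule pt)
  interpret Y: etale_point E X p q T "inv_im a" "im y" \<chi> by (rule pt')
  obtain v where v: "v \<in> hom T (fob (im x) (idn E X)) (fob (im y) (idn E X))" "Y.section \<cdot>\<^bsub>T\<^esub> v = X.section"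
    using l unfolding cells_linked[OF x y] by blast
  obtain w where w: "w \<in> hom T (fob (im y) (idn E X)) (fob (im x) (idn E X))" "v \<cdot>\<^bsub>T\<^esub> w = idn T (fob (im y) (idn E X))"
    using isoE[OF terminal_in_iso[OF T X.terminal_unit Y.terminal_unit v(1)] v(1)] by blast
  have "X.section \<cdot>\<^bsub>T\<^esub> w = Y.section \<cdot>\<^bsub>T\<^esub> (v \<cdot>\<^bsub>T\<^esub> w)"
    using v w(1) Y.section_hom X.H.D.assoc[of w v Y.section] by (simp add: hom_iff)
  also have "\<dots> = Y.section" using w(2) Y.section_hom by (simp add: hom_iff)
  finally show "hom (cells T a) y x \<noteq> {}" unfolding cells_linked[OF y x] using w(1) by blast
qed

text \<open>The inverse image is \<open>fibre\<close>, for pullbacks along \<open>s\<close> chosen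
  in the topos \<open>T\<close>.\<close>

lemma point_exists:
  assumes tT: "grothendieck_topos T" and t: "terminal_in T t" and s: "s \<in> hom T t (fob (inv_im a) X)"
  shows "\<exists>x \<psi> v. point_of T a x \<psi> \<and> v \<in> hom T (fob (im x) (idn E X)) t \<and> sect T x \<psi> = s \<cdot>\<^bsub>T\<^esub> v"
proof -
  interpret A: ftor E T "inv_im a" by (rule A_ftor)
  have "\<exists>r w. is_pullback T (far (inv_im a) y) s r w" if y: "y \<in> Ar E" "tgt E y = X" for y
    using topos_limits(3)[OF inacc tT] y s unfolding has_pullbacks_def by (auto simp: hom_iff)
  then obtain r w where pb: "\<And>y. y \<in> Ar E \<Longrightarrow> tgt E y = X \<Longrightarrow> is_pullback T (far (inv_im a) y) s (r y) (w y)" by metis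
  interpret etale_section E X p q T "inv_im a" t s r w
    by unfold_locales (use geom_dest(7)[OF a] t s pb in auto)
  obtain C :: "('u,'u) cat" and J \<Phi> where st: "site C J" and Phi: "ftor T (Sh C J) \<Phi>"
    and ff: "fully_faithful T (Sh C J) \<Phi>" and eso: "ess_surj T (Sh C J) \<Phi>" using topos_site[OF inacc tT] .
  interpret Z: site C J by (rule st)
  interpret Phi: ftor T "Sh C J" \<Phi> by (rule Phi)
  have Phi_s: "far \<Phi> s \<in> hom (Sh C J) (fob \<Phi> t) (fob \<Phi> (fob (inv_im a) X))" by (rule functor_hom[OF Phi.F s])
  \<comment> \<open>The dependent product along \<open>s\<close> is taken in a category of sheaves
    equivalent to \<open>T\<close>.\<close>
  have cu: "\<exists>R e. couniversal S T fibre b R e" if b: "b \<in> Ob T" for b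
  proof (rule fibre_couniversal[OF Phi ff eso _ topos_limits(3)[OF inacc topos] _ b])
    show "\<exists>R e. couniversal E T (inv_im a) c R e" if "c \<in> Ob T" for c
      using geom_couniversal[OF T category_axioms a that] by blast
    show "\<exists>z p u ev. point_Pi (Sh C J) (far \<Phi> s) b z p u ev" if "b \<in> Ob (Sh C J)" for b
      using Z.Sh_point_Pi[OF Phi.equivalence_preserves_terminal[OF ff eso t] Phi_s, of b] that by simp
  qed
  obtain h where h: "geometric_morphism T S h" "inv_im h = fibre"
    using geom_of_couniversal[OF fibre.ftor_axioms fibre_left_exact cu] by blast
  obtain one where one: "terminal_in E one" using topos_limits(1)[OF inacc topos] by blast
  note fp = fibre_point[OF one]
  interpret pt: etale_point E X p q T "inv_im a" fibre fibre_iso by (rule fp(1))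
  obtain \<phi> where f: "nat_trans E T (inv_im a) (cmp_ftr E fibre \<pi>) \<phi>"
    "\<forall>D\<in>Ob E. \<phi> D \<cdot>\<^bsub>T\<^esub> fibre_iso D = idn T (fob (cmp_ftr E fibre \<pi>) D) \<and> fibre_iso D \<cdot>\<^bsub>T\<^esub> \<phi> D = idn T (fob (inv_im a) D)"
    using nat_trans_inverse[OF category_axioms T cmp_functor[OF category_axioms P.F fibre.F] A.F pt.psi pt.psi_iso] by blast
  let ?x = "(h, a, cmp_geom T S E p h, \<phi>)"
  have "point_of T a ?x fibre_iso"
    unfolding point_of_def using fp(1) f h by (auto simp: cmp_fob)
  moreover have "w (idn E X) \<in> hom T (fob (im ?x) (idn E X)) t" by (simp add: hom_iff h)
  moreover have "sect T ?x fibre_iso = s \<cdot>\<^bsub>T\<^esub> w (idn E X)" using fp(2) by (simp add: h)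
  ultimately show ?thesis by blast
qed

end

text \<open>Restricting along \<open>i\<close> applies the inverse image of \<open>i\<close> to all
  data of the point, and so to its generic section. Composition in \<open>gtop\<close> is strictly
  associative, which gives the restricted cell the exact form required by
  \<open>point_of\<close>.\<close>

lemma point_restrict:
  assumes T: "category T" and a: "geometric_morphism T E a"
    and B: "category B" and i: "geometric_morphism B T i" and x: "point_of T a x \<psi>"
  defines "b \<equiv> cmp_geom B T E a i"
  defines "y \<equiv> cmp1 (PS E) (B, b) (T, a) (S, p) x (i, idn (Hom gtop B E) b)"
  shows "point_of B b y (\<lambda>D \<in> Ob E. far (inv_im i) (\<psi> D))"
    and "im y = cmp_ftr S (inv_im i) (im x)"
    and "sect B y (\<lambda>D \<in> Ob E. far (inv_im i) (\<psi> D)) = far (inv_im i) (sect T x \<psi>)"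
proof -
  obtain \<phi> where xe: "x = (fst x, a, cmp_geom T S E p (fst x), \<phi>)" and h: "geometric_morphism T S (fst x)"
    and n: "nat_trans E T (inv_im a) (cmp_ftr E (im x) \<pi>) \<phi>"
    and e: "\<And>D. D \<in> Ob E \<Longrightarrow> \<psi> D \<cdot>\<^bsub>T\<^esub> \<phi> D = idn T (fob (inv_im a) D) \<and> \<phi> D \<cdot>\<^bsub>T\<^esub> \<psi> D = idn T (fob (im x) (fob \<pi> D))"
    and pt: "etale_point E X p q T (inv_im a) (im x) \<psi>" using x unfolding point_of_def by blast
  interpret X: etale_point E X p q T "inv_im a" "im x" \<psi> by (rule pt)
  interpret I: ftor T B "inv_im i" by (rule ftorI[OF T B geom_dest(1)[OF i]])
  let ?k = "cmp_geom B T S (fst x) i" and ?f = "\<lambda>D \<in> Ob E. far (inv_im i) (\<phi> D)" and ?g = "\<lambda>D \<in> Ob E. far (inv_im i) (\<psi> D)"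
  have k: "geometric_morphism B S ?k" by (rule cmp_geom[OF B T S.category_axioms i h])
  have b: "geometric_morphism B E b" unfolding b_def by (rule cmp_geom[OF B T category_axioms i a])
  have ph: "geometric_morphism T E (cmp_geom T S E p (fst x))" by (rule cmp_geom[OF T S.category_axioms category_axioms h geom_p])
  have imk: "inv_im ?k = cmp_ftr S (inv_im i) (im x)" and imb: "inv_im b = cmp_ftr E (inv_im i) (inv_im a)"
    by (simp_all add: inv_cmp_geom b_def)
  have f: "\<phi> D \<in> Ar T" "src T (\<phi> D) = fob (inv_im a) D" "tgt T (\<phi> D) = fob (im x) (fob \<pi> D)" if "D \<in> Ob E" for D
    using nt_hom[OF n that] that by (auto simp: hom_iff cmp_fob)
  have fn: "\<phi> (tgt E m) \<cdot>\<^bsub>T\<^esub> far (inv_im a) m = far (im x) (far \<pi> m) \<cdot>\<^bsub>T\<^esub> \<phi> (src E m)" if "m \<in> Ar E" for m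
    using n that by (auto simp: nat_trans_def cmp_far)
  have rw: "rwhisker gtop B T E (snd x) i = (b, cmp_geom B S E p ?k, ?f)"
  proof -
    have n': "nat_trans E T (inv_im a) (inv_im (cmp_geom T S E p (fst x))) \<phi>" using n by (simp add: inv_cmp_geom)
    have "snd x = (a, cmp_geom T S E p (fst x), \<phi>)" using arg_cong[OF xe, of snd] by simp
    then show ?thesis
      using gtop_rwhisker[OF B T category_axioms a ph i n'] cmp_geom_assoc[OF B T S.category_axioms category_axioms i h geom_p]
      by (simp add: b_def)
  qed
  have y: "y = (?k, b, cmp_geom B S E p ?k, ?f)"
  proof -
    have "y = (?k, rwhisker gtop B T E (snd x) i \<cdot>\<^bsub>Hom gtop B E\<^esub> idn (Hom gtop B E) b)"
      unfolding y_def by (subst surjective_pairing[of x], subst PS_sel(3)) (simp add: gtop_sel(3))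
    also have "rwhisker gtop B T E (snd x) i \<cdot>\<^bsub>Hom gtop B E\<^esub> idn (Hom gtop B E) b = (b, cmp_geom B S E p ?k, ?f)"
      unfolding rw gtop_sel imb using f by (auto simp: cmp_fob restrict_def fun_eq_iff)
    finally show ?thesis .
  qed
  have nf: "nat_trans E B (inv_im b) (cmp_ftr E (inv_im ?k) \<pi>) ?f"
    unfolding nat_trans_def imb imk
    using f fn I.far_cmp by (auto simp: hom_iff cmp_fob cmp_far I.far_cmp[symmetric])
  have ng: "nat_trans E B (cmp_ftr E (inv_im ?k) \<pi>) (inv_im b) ?g"
    unfolding nat_trans_def imb imk
    using X.psi_nat I.far_cmp by (auto simp: hom_iff cmp_fob cmp_far I.far_cmp[symmetric])
  have gi: "is_iso B (?g D)" if "D \<in> Ob E" for D using I.far_iso[OF X.psi_iso[OF that]] that by simp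
  have pk: "etale_point E X p q B (inv_im b) (inv_im ?k) ?g" by (rule etale_pointI[OF B b k ng gi])
  have inv: "far (inv_im i) (\<psi> D) \<cdot>\<^bsub>B\<^esub> far (inv_im i) (\<phi> D) = idn B (fob (inv_im i) (fob (inv_im a) D))"
    "far (inv_im i) (\<phi> D) \<cdot>\<^bsub>B\<^esub> far (inv_im i) (\<psi> D) = idn B (fob (inv_im i) (fob (im x) (fob \<pi> D)))" if D: "D \<in> Ob E" for D
    using e[OF D] f[OF D] D I.far_cmp[of "\<phi> D" "\<psi> D"] I.far_cmp[of "\<psi> D" "\<phi> D"] by simp_all
  show "point_of B b y ?g" unfolding point_of_def y using pk k nf inv by (auto simp: imb imk cmp_fob)
  show "im y = cmp_ftr S (inv_im i) (im x)" by (simp add: y imk)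
  interpret Y: etale_point E X p q B "inv_im b" "inv_im ?k" ?g by (rule pk)
  show "sect B y ?g = far (inv_im i) (sect T x \<psi>)"
    unfolding y fst_conv Y.section_def X.section_def Y.fib_def X.fib_def
    using I.far_cmp[of "far (im x) (graph (idn E X))" "\<psi> X"] by (simp add: imk cmp_far)
qed

text \<open>Links are equations of generic sections by \<open>cells_linked\<close>, and restriction
  along \<open>i0\<close> takes the section, a square, to its domain component by
  \<open>point_restrict\<close>. What remains is to extend a domain component to a square out of a
  terminal object of the arrow category, and to compare two such squares.\<close>

lemma arrow_orthogonal:
  assumes B: "grothendieck_topos B" and i0: "geometric_morphism B (arrow_cat B) i0" "inv_im i0 = dom_ftr B"
    and a: "geometric_morphism (arrow_cat B) E a"
  defines "b \<equiv> cmp_geom B (arrow_cat B) E a i0"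
  shows "orthogonal (PS E) (B, b) (arrow_cat B, a) (i0, idn (Hom gtop B E) b) (S, p)"
proof -
  interpret T: arrow_category B
    by (rule arrow_category.intro[OF topos_category[OF B] arrow_category_axioms.intro[OF inf]])
  let ?T = "arrow_cat B" and ?j = "(i0, idn (Hom gtop B E) b)"
  note cB = T.B.category_axioms and cT = T.T.category_axioms
  have tT: "grothendieck_topos ?T" by (rule topos_arrow_cat[OF inacc B])
  have b: "geometric_morphism B E b" unfolding b_def by (rule cmp_geom[OF cB cT category_axioms i0(1) a])
  note restr = point_restrict[OF cT a cB i0(1), folded b_def, unfolded i0(2)]
  obtain i where i: "initial_in B i" using topos_limits(2)[OF inacc B] by blast
  have dom_t: "terminal_in B (src B t)" and cod_t: "terminal_in B (tgt B t)" if "terminal_in ?T t" for t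
  proof -
    have "t \<in> Ar B" using that by (simp add: terminal_in_def)
    then show "terminal_in B (src B t)" "terminal_in B (tgt B t)"
      using left_exact_terminal[OF T.dom.ftor_axioms T.dom_left_exact that] left_exact_terminal[OF T.cod.ftor_axioms T.cod_left_exact[OF i] that] by simp_all
  qed
  have t_iso: "is_iso B t" if t: "terminal_in ?T t" for t
    by (rule terminal_in_iso[OF cB dom_t[OF t] cod_t[OF t]]) (use t in \<open>simp add: terminal_in_def hom_iff\<close>)
  interpret A: ftor E ?T "inv_im a" by (rule A_ftor[OF cT a])
  have AX: "fob (inv_im a) X \<in> Ar B" using A.fob_Ob[OF X] by simp
  have bX: "fob (inv_im b) X = src B (fob (inv_im a) X)" using AX by (simp add: b_def inv_cmp_geom i0 cmp_fob)
  show ?thesis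
    unfolding orthogonal_def
  proof (intro conjI ballI impI)
    fix x assume "x \<in> Ob (cells B b)"
    then obtain \<chi> where x: "point_of B b x \<chi>" using cell_point[OF cB b] by blast
    then interpret x: etale_point E X p q B "inv_im b" "im x" \<chi> unfolding point_of_def by blast
    let ?H = "fob (im x) (idn E X)"
    have sx: "x.section \<in> Ar B" "src B x.section = ?H" "tgt B x.section = src B (fob (inv_im a) X)"
      using x.section_hom by (auto simp: hom_iff bX)
    obtain t where t: "terminal_in ?T t" using topos_limits(1)[OF inacc tT] by blast
    have tA: "t \<in> Ar B" using t by (simp add: terminal_in_def)
    obtain u where u: "u \<in> Ar B" "src B u = src B t" "tgt B u = ?H"
      using terminal_in_ex[OF x.terminal_unit, of "src B t"] tA by (auto simp: hom_iff)
    obtain w where w: "w \<in> Ar B" "src B w = tgt B t" "tgt B w = src B t" "w \<cdot>\<^bsub>B\<^esub> t = idn B (src B t)"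
      using isoE[OF t_iso[OF t], of "src B t" "tgt B t"] tA by (auto simp: hom_iff)
    let ?d = "x.section \<cdot>\<^bsub>B\<^esub> u"
    have d: "?d \<in> Ar B" "src B ?d = src B t" "tgt B ?d = src B (fob (inv_im a) X)" using sx u by auto
    \<comment> \<open>\<open>w\<close> inverts \<open>t\<close>, so this is the codomain component
      forced by \<open>?d\<close>.\<close>
    let ?c = "fob (inv_im a) X \<cdot>\<^bsub>B\<^esub> (?d \<cdot>\<^bsub>B\<^esub> w)"
    let ?s = "sq t (fob (inv_im a) X) ?d ?c"
    have "?c \<cdot>\<^bsub>B\<^esub> t = fob (inv_im a) X \<cdot>\<^bsub>B\<^esub> ?d" using d w tA AX by (simp add: T.B.assoc)
    then have s: "?s \<in> hom ?T t (fob (inv_im a) X)" using d w tA AX by (intro T.sq_hom) (auto simp: hom_iff)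
    obtain y \<psi> v where y: "point_of ?T a y \<psi>" and v: "v \<in> hom ?T (fob (im y) (idn E X)) t" and sy: "sect ?T y \<psi> = ?s \<cdot>\<^bsub>?T\<^esub> v"
      using point_exists[OF cT a tT t s] by blast
    let ?y = "cmp1 (PS E) (B, b) (?T, a) (S, p) y ?j"
    note r = restr[OF y]
    have Y: "fob (im y) (idn E X) \<in> Ar B" using v by (auto simp: hom_iff dest: T.T.src_Ob)
    note V = T.T_Ar[of v] and v' = v[unfolded hom_iff]
    have "hom (cells B b) ?y x \<noteq> {}"
      unfolding cells_linked[OF cB b r(1) x]
    proof (rule bexI[of _ "u \<cdot>\<^bsub>B\<^esub> sq_dom v"])
      have "sq_dom (?s \<cdot>\<^bsub>?T\<^esub> v) = ?d \<cdot>\<^bsub>B\<^esub> sq_dom v" by simp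
      then have "sect B ?y (\<lambda>D\<in>Ob E. far (dom_ftr B) (\<psi> D)) = ?d \<cdot>\<^bsub>B\<^esub> sq_dom v"
        unfolding r(3) sy using T.T.cmp_hom[OF v s] by (simp add: hom_iff del: T.T_sel(4))
      then show "x.section \<cdot>\<^bsub>B\<^esub> (u \<cdot>\<^bsub>B\<^esub> sq_dom v) = sect B ?y (\<lambda>D\<in>Ob E. far (dom_ftr B) (\<psi> D))"
        using V v' sx u by (simp add: T.B.assoc)
      show "u \<cdot>\<^bsub>B\<^esub> sq_dom v \<in> hom B (fob (im ?y) (idn E X)) ?H"
        unfolding r(2) using V v' u Y by (simp add: hom_iff cmp_fob)
    qed
    then show "\<exists>y\<in>Ob (cells ?T a). hom (cells B b) (cmp1 (PS E) (B, b) (?T, a) (S, p) y ?j) x \<noteq> {}"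
      using point_cell[OF cT a y] by blast
  next
    fix y z assume "y \<in> Ob (cells ?T a)" "z \<in> Ob (cells ?T a)"
      and l: "hom (cells B b) (cmp1 (PS E) (B, b) (?T, a) (S, p) y ?j) (cmp1 (PS E) (B, b) (?T, a) (S, p) z ?j) \<noteq> {}"
    then obtain \<psi> \<chi> where y: "point_of ?T a y \<psi>" and z: "point_of ?T a z \<chi>" using cell_point[OF cT a] by blast
    from y interpret y: etale_point E X p q ?T "inv_im a" "im y" \<psi> unfolding point_of_def by blast
    from z interpret z: etale_point E X p q ?T "inv_im a" "im z" \<chi> unfolding point_of_def by blast
    let ?Y = "fob (im y) (idn E X)" and ?Z = "fob (im z) (idn E X)"
    note ty = y.terminal_unit and tz = z.terminal_unit
    have YZ: "?Y \<in> Ar B" "?Z \<in> Ar B" using ty tz by (simp_all add: terminal_in_def)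
    note sy = y.section_hom[unfolded hom_iff] and sz = z.section_hom[unfolded hom_iff]
    obtain v where v: "v \<in> hom B (src B ?Y) (src B ?Z)" and e: "sq_dom z.section \<cdot>\<^bsub>B\<^esub> v = sq_dom y.section"
      using l sy sz YZ unfolding cells_linked[OF cB b restr(1)[OF y] restr(1)[OF z]] restr(3)[OF y] restr(3)[OF z]
      unfolding restr(2)[OF y] restr(2)[OF z] by (auto simp: cmp_fob simp del: T.T_sel(4))
    obtain k where k: "k \<in> hom ?T ?Y ?Z" using terminal_in_ex[OF tz, of ?Y] YZ by auto
    note K = T.T_Ar[of k] and k' = k[unfolded hom_iff] and SY = T.T_Ar[of y.section] and SZ = T.T_Ar[of z.section]
    have zk: "z.section \<cdot>\<^bsub>?T\<^esub> k \<in> hom ?T ?Y (fob (inv_im a) X)" by (rule T.T.cmp_hom[OF k z.section_hom])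
    have "sq_dom k = v"
      by (rule terminal_in_unique[OF dom_t[OF tz], of "src B ?Y"]) (use K k' v YZ in \<open>auto simp: hom_iff\<close>)
    then have d: "sq_dom (z.section \<cdot>\<^bsub>?T\<^esub> k) = sq_dom y.section" using e by simp
    note ZK = T.T_Ar[of "z.section \<cdot>\<^bsub>?T\<^esub> k"] and zk' = zk[unfolded hom_iff]
    \<comment> \<open>Equal domain components make the squares agree after the arrow
      \<open>?Y\<close>, which is terminal in the arrow category, hence invertible, and can be
      cancelled.\<close>
    have ec: "sq_cod (z.section \<cdot>\<^bsub>?T\<^esub> k) \<cdot>\<^bsub>B\<^esub> ?Y = sq_cod y.section \<cdot>\<^bsub>B\<^esub> ?Y"
      using ZK(9) SY(9) zk' sy d by simp
    have c: "sq_cod (z.section \<cdot>\<^bsub>?T\<^esub> k) = sq_cod y.section"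
      by (rule T.B.iso_epi[OF t_iso[OF ty] _ _ _ _ ec]) (use ZK(1-8) SY(1-8) zk' sy in simp_all)
    have "z.section \<cdot>\<^bsub>?T\<^esub> k = y.section"
      by (rule T.sq_ext) (use zk' sy d c in simp_all)
    then show "hom (cells ?T a) y z \<noteq> {}" unfolding cells_linked[OF cT a y z] using k by blast
  qed
qed

lemma etale_locally_setoidal: "locally_setoidal (PS E) (S, p)"
  unfolding locally_setoidal_def
proof
  fix G assume "G \<in> Obj (PS E)"
  then obtain T a where "G = (T, a)" "grothendieck_topos T" "geometric_morphism T E a"
    by (cases G) (auto simp: PS_Obj gtop_sel)
  then show "setoidal (Hom (PS E) G (S, p))" using cells_setoidal[OF topos_category] by blast
qed

end

theorem proposition4p3p2:
  fixes C E :: "('u,'u) cat" and f :: "'u geom"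
  assumes "inaccessible TYPE('u)"
    and "grothendieck_topos C" and "grothendieck_topos E"
    and "geometric_morphism C E f"
    and "pro_etale C E f"
  shows "discrete_opfibration gtop C E f"
proof -
  note inacc = assms(1)
  interpret G: two_category "gtop :: (('u,'u) cat, _, _) twocat" by (rule two_category_gtop)
  let ?P = "pseudoslice gtop E"
  have CE: "C \<in> Obj gtop" "E \<in> Obj gtop" "f \<in> Ob (Hom gtop C E)" using assms by (simp_all add: gtop_sel)
  \<comment> \<open>Bilimits and equivalences are those of the pseudoslice, so the general lemmas
    are used for it as a 2-category of its own, while tensors are formed in
    \<open>gtop\<close>.\<close>
  interpret P: two_category ?P by (rule G.two_category_pseudoslice[OF CE(2)])
  obtain I :: "('u,'u) cat" and D F L c where I: "small_category I" and D: "is_functor I E D" and F: "etale_diagram E I D F"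
    and L: "is_bilimit I ?P F L c" and eq: "equivalent_objs ?P (C, f) L"
    using assms(5) unfolding pro_etale_def by blast
  obtain l n where c: "c = (l, n)" by (cases c)
  obtain p q where pF: "pseudofunctor I ?P F"
    and pq: "\<And>i. i \<in> Ob I \<Longrightarrow> pob F i = (slice E (fob D i), p i) \<and> is_etale E (fob D i) (p i) (q i)"
    using F unfolding etale_diagram_def by blast
  have Ic: "category I" using I by (simp add: small_category_def)
  have et: "etale_object E (fob D i) (p i) (q i)" if i: "i \<in> Ob I" for i
    using pq[OF i] functor_Ob[OF D i] topos_category[OF assms(3)] inaccessible_infinite[OF inacc] inacc assms(3)
    by (simp add: etale_object_def etale_object_axioms_def etale_def etale_axioms_def slice_category_def slice_category_axioms_def)
  have st: "locally_setoidal ?P (pob F i)" if i: "i \<in> Ob I" for i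
    using etale_object.etale_locally_setoidal[OF et[OF i]] pq[OF i] by simp
  obtain u v \<eta> \<epsilon> where eqv: "(C, f) \<in> Obj ?P" "L \<in> Obj ?P" "u \<in> Ob (Hom ?P (C, f) L)" "v \<in> Ob (Hom ?P L (C, f))"
    "\<eta> \<in> hom (Hom ?P (C, f) (C, f)) (id1 ?P (C, f)) (cmp1 ?P (C, f) L (C, f) v u)" "is_iso (Hom ?P (C, f) (C, f)) \<eta>"
    "\<epsilon> \<in> hom (Hom ?P L L) (cmp1 ?P L (C, f) L u v) (id1 ?P L)" "is_iso (Hom ?P L L) \<epsilon>"
    using eq L CE unfolding equivalent_objs_def is_bilimit_def by (auto simp: G.PS_Obj)
  note bil = Ic pF st L[unfolded c]
  show ?thesis
  proof (rule G.discrete_opfibration_of_orthogonal[OF CE])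
    show "locally_setoidal ?P (C, f)"
      by (rule P.equiv_locally_setoidal[OF eqv P.bilimit_locally_setoidal[OF bil]])
    fix B :: "('u,'u) cat" assume B: "B \<in> Obj gtop"
    then have tB: "grothendieck_topos B" by (simp add: gtop_sel)
    let ?T = "arrow_cat B"
    have T: "?T \<in> Obj gtop" using topos_arrow_cat[OF inacc tB] by (simp add: gtop_sel)
    obtain i0 i1 where i: "geometric_morphism B ?T i0" "inv_im i0 = dom_ftr B" "geometric_morphism B ?T i1" "inv_im i1 = cod_ftr B"
      using gtop_arrow_ends[OF inacc tB] .
    have i0: "i0 \<in> Ob (Hom gtop B ?T)" using i by (simp add: gtop_sel)
    have "orthogonal ?P (B, cmp1 gtop B ?T E a i0) (?T, a) (i0, idn (Hom gtop B E) (cmp1 gtop B ?T E a i0)) (C, f)"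
      if a: "a \<in> Ob (Hom gtop ?T E)" for a
    proof -
      \<comment> \<open>To speak of orthogonality in the pseudoslice, \<open>i0\<close> is made a
        1-cell into \<open>(?T, a)\<close> from the restriction of \<open>a\<close>, with the
        identity as its triangle.\<close>
      let ?b = "cmp1 gtop B ?T E a i0"
      have b: "?b \<in> Ob (Hom gtop B E)" by (rule G.cmp1_Hom[OF B T CE(2) i0 a])
      have o: "(B, ?b) \<in> Obj ?P" "(?T, a) \<in> Obj ?P" using B T a b by (simp_all add: G.PS_Obj)
      have j: "(i0, idn (Hom gtop B E) ?b) \<in> Ob (Hom ?P (B, ?b) (?T, a))"
        using i0 G.idH[OF B CE(2) b] iso_idn[OF G.Hom_category[OF B CE(2)] b] by (simp add: G.PS_Ob)
      have "orthogonal ?P (B, ?b) (?T, a) (i0, idn (Hom gtop B E) ?b) (pob F k)" if k: "k \<in> Ob I" for k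
        using etale_object.arrow_orthogonal[OF et[OF k] tB i(1,2), of a] a pq[OF k] by (simp add: gtop_sel)
      then show ?thesis by (intro P.equiv_orthogonal[OF eqv o j] P.bilimit_orthogonal[OF bil o j])
    qed
    then show "\<exists>T i0 i1 \<tau>. arrow_tensor gtop B T i0 i1 \<tau> \<and>
        (\<forall>a\<in>Ob (Hom gtop T E). orthogonal ?P (B, cmp1 gtop B T E a i0) (T, a) (i0, idn (Hom gtop B E) (cmp1 gtop B T E a i0)) (C, f))"
      using gtop_arrow_tensor[OF inacc tB i] by blast
  qed
qed

end
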